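(* Let $\varrho\in(1,\infty)$, $u_0\in L^\infty(\Omega)$ and $\overline u:=\overline{u_0}\ne0$. If the zero-mean Poincaré inequality $$\|v-\overline v\|_{2;\nu}\le M_P\,\|\nabla v\|_{2;\mu}\qquad\forall v\in W^{1,2}(\Omega;\nu,\mu)$$ holds for some $M_P>0$ and $u$ is the energy solution of the Neumann problem (N) with initial datum $u_0$, then $u(\cdot,t)$ converges at least exponentially to its mean value. More precisely: $$\|u(t)-\overline u\|_{\varrho;\nu}\le e^{-C|\overline u|^{m-1}t}\,\|u_0-\overline u\|_{\varrho;\nu}\qquad\text{for a.e. }t>0,$$ where (for fixed $\Omega,\rho_\nu,\rho_\mu$) $C>0$ is a constant depending on $\varrho$, $m$ and $R>0$, the latter being any number such that $$\frac{\|u_0-\overline u\|_\infty}{|\overline u|}\le R .$$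
   Context: Throughout $m>1$ is fixed, and for $q>0$, $x\in\mathbb{R}$ one sets $x^q:=|x|^q\operatorname{sign}(x)$. $\Omega\subseteq\mathbb{R}^N$ is a domain ($\Omega=\mathbb{R}^N$ allowed). Positive weights $\rho_\nu,\rho_\mu$ on $\Omega$ are given with $\rho_\nu\in C^{3,\alpha}_{loc}(\Omega)$, $\rho_\mu\in C^{2,\alpha}_{loc}(\Omega)$ for some $\alpha\in(0,1)$ and $\rho_\nu^{-1},\rho_\mu^{-1}\in L^\infty_{loc}(\Omega)$. $\mathrm{d}\nu=\rho_\nu\,\mathrm{d}\mathbf{x}$, $\mathrm{d}\mu=\rho_\mu\,\mathrm{d}\mathbf{x}$, and it is assumed that $\nu(\Omega)<\infty$. $\|\cdot\|_{p;\nu}$, $\|\cdot\|_{p;\mu}$ are the norms of $L^p(\Omega;\nu)$, $L^p(\Omega;\mu)$, $\|\cdot\|_\infty$ is the norm of $L^\infty(\Omega)$, and $\overline f=\nu(\Omega)^{-1}\int_\Omega f\,\mathrm{d}\nu$ (the mean value of $u(t)$ is preserved in time). $W^{1,2}(\Omega;\nu,\mu)$ is the space of all $v\in W^{1,1}_{loc}(\Omega)$ with $\|v\|_{2;\nu}^2+\|\nabla v\|_{2;\mu}^2<\infty$. Neumann problem (N): $\rho_\nu u_t=\operatorname{div}(\rho_\mu\nabla(u^m))$ in $\Omega\times(0,\infty)$, $\rho_\mu\,\partial(u^m)/\partial\mathbf{n}=0$ on $\partial\Omega\times(0,\infty)$, $u(\cdot,0)=u_0$ in $\Omega$. Weak solution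 of (N) with initial datum $u_0\in L^2(\Omega;\nu)$: a function $u$ with $u\in L^2((0,T);L^2(\Omega;\nu))$, $\nabla(u^m)\in L^2((0,T);[L^2(\Omega;\mu)]^N)$ for all $T>0$, and (for every $T>0$) $\int_0^T\!\int_\Omega u\,\eta_t\,\mathrm{d}\nu\,\mathrm{d}t=-\int_\Omega u_0\,\eta(\cdot,0)\,\mathrm{d}\nu+\int_0^T\!\int_\Omega\nabla(u^m)\cdot\nabla\eta\,\mathrm{d}\mu\,\mathrm{d}t$ for all $\eta\in W^{1,2}((0,T);L^2(\Omega;\nu))$ with $\nabla\eta\in L^2((0,T);[L^2(\Omega;\mu)]^N)$ and $\eta(T)=0$. Energy solution: a weak solution with $u\in L^{m+1}((0,T);L^{m+1}(\Omega;\nu))$ for all $T>0$; under the present assumptions it exists and is unique for every $u_0\in L^1(\Omega;\nu)\cap L^{m+1}(\Omega;\nu)$, in particular for every $u_0\in L^\infty(\Omega)$. *)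

theory Defs
  imports "HOL-Analysis.Analysis" "HOL-Probability.Essential_Supremum"
begin

text \<open>
  Conventions. Functions on the domain \<open>\<Omega>\<close> are total functions of which only the values on \<open>\<Omega>\<close>
  matter. Elements of \<open>L\<^sup>p\<close> spaces are given by Borel representatives (every Lebesgue class has
  one), and a function of time and space is written \<open>u t x\<close>.
\<close>

definition spow :: "real \<Rightarrow> real \<Rightarrow> real" where
  "spow q x = \<bar>x\<bar> powr q * sgn x"

text \<open>All partial derivatives up to order \<open>k\<close> exist, and those of order \<open>k\<close> satisfy \<open>P\<close>. In the
  instances below \<open>P\<close> implies continuity on \<open>\<Omega>\<close>, so that asking for total rather than merely partial
  differentiability is the usual notion.\<close>

primrec diff_class ::
    "(('a::euclidean_space \<Rightarrow> real) \<Rightarrow> bool) \<Rightarrow> 'a set \<Rightarrow> nat \<Rightarrow> ('a \<Rightarrow> real) \<Rightarrow> bool" where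
  "diff_class P \<Omega> 0 f \<longleftrightarrow> P f"
| "diff_class P \<Omega> (Suc k) f \<longleftrightarrow>
     (\<forall>x\<in>\<Omega>. f differentiable (at x)) \<and>
     (\<forall>b\<in>Basis. diff_class P \<Omega> k (\<lambda>x. frechet_derivative f (at x) b))"

definition locally_hoelder :: "real \<Rightarrow> 'a::euclidean_space set \<Rightarrow> ('a \<Rightarrow> real) \<Rightarrow> bool" where
  "locally_hoelder \<alpha> \<Omega> f \<longleftrightarrow>
     (\<forall>K. compact K \<and> K \<subseteq> \<Omega> \<longrightarrow>
       (\<exists>L. \<forall>x\<in>K. \<forall>y\<in>K. \<bar>f x - f y\<bar> \<le> L * dist x y powr \<alpha>))"

definition C_hoelder_loc ::
    "nat \<Rightarrow> real \<Rightarrow> 'a::euclidean_space set \<Rightarrow> ('a \<Rightarrow> real) \<Rightarrow> bool" where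
  "C_hoelder_loc k \<alpha> \<Omega> = diff_class (locally_hoelder \<alpha> \<Omega>) \<Omega> k"

definition C_c_infinity :: "'a::euclidean_space set \<Rightarrow> ('a \<Rightarrow> real) \<Rightarrow> bool" where
  "C_c_infinity \<Omega> \<phi> \<longleftrightarrow>
     (\<forall>k. diff_class (continuous_on UNIV) UNIV k \<phi>) \<and>
     (\<exists>K. compact K \<and> K \<subseteq> \<Omega> \<and> (\<forall>x. x \<notin> K \<longrightarrow> \<phi> x = 0))"

definition in_Lp :: "real \<Rightarrow> 'b measure \<Rightarrow> ('b \<Rightarrow> 'c::euclidean_space) \<Rightarrow> bool" where
  "in_Lp p M f \<longleftrightarrow> f \<in> borel_measurable M \<and> integrable M (\<lambda>x. norm (f x) powr p)"

text \<open>Only meaningful for functions satisfying \<open>in_Lp p M\<close>: the Bochner integral is \<open>0\<close> otherwise.\<close>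

definition Lp_norm :: "real \<Rightarrow> 'b measure \<Rightarrow> ('b \<Rightarrow> 'c::euclidean_space) \<Rightarrow> real" where
  "Lp_norm p M f = (LINT x|M. norm (f x) powr p) powr (1 / p)"

definition in_Linf :: "'b measure \<Rightarrow> ('b \<Rightarrow> real) \<Rightarrow> bool" where
  "in_Linf M f \<longleftrightarrow> f \<in> borel_measurable M \<and> esssup M (\<lambda>x. ereal \<bar>f x\<bar>) < \<infinity>"

definition Linf_norm :: "'b measure \<Rightarrow> ('b \<Rightarrow> real) \<Rightarrow> real" where
  "Linf_norm M f = real_of_ereal (esssup M (\<lambda>x. ereal \<bar>f x\<bar>))"

definition mean_value :: "'b measure \<Rightarrow> ('b \<Rightarrow> real) \<Rightarrow> real" where
  "mean_value M f = (LINT x|M. f x) / measure M (space M)"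

text \<open>\<open>L\<^sup>p((0,T); L\<^sup>p(M))\<close>, identified with \<open>L\<^sup>p\<close> of the product measure.\<close>

definition in_LpLp ::
    "real \<Rightarrow> real \<Rightarrow> 'b measure \<Rightarrow> (real \<Rightarrow> 'b \<Rightarrow> 'c::euclidean_space) \<Rightarrow> bool" where
  "in_LpLp p T M u \<longleftrightarrow>
     in_Lp p (restrict_space lborel {0<..<T} \<Otimes>\<^sub>M M) (\<lambda>(t, x). u t x)"

definition weighted :: "'a::euclidean_space set \<Rightarrow> ('a \<Rightarrow> real) \<Rightarrow> 'a measure" where
  "weighted \<Omega> \<rho> = density (restrict_space lborel \<Omega>) (\<lambda>x. ennreal (\<rho> x))"

definition in_Linf_loc :: "'a::euclidean_space set \<Rightarrow> ('a \<Rightarrow> real) \<Rightarrow> bool" where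
  "in_Linf_loc \<Omega> f \<longleftrightarrow>
     (\<forall>K. compact K \<and> K \<subseteq> \<Omega> \<longrightarrow> in_Linf (restrict_space lborel K) f)"

definition admissible_weights ::
    "'a::euclidean_space set \<Rightarrow> ('a \<Rightarrow> real) \<Rightarrow> ('a \<Rightarrow> real) \<Rightarrow> bool" where
  "admissible_weights \<Omega> \<rho>\<^sub>\<nu> \<rho>\<^sub>\<mu> \<longleftrightarrow>
     (\<forall>x\<in>\<Omega>. 0 < \<rho>\<^sub>\<nu> x \<and> 0 < \<rho>\<^sub>\<mu> x) \<and>
     (\<exists>\<alpha>\<in>{0<..<1}. C_hoelder_loc 3 \<alpha> \<Omega> \<rho>\<^sub>\<nu> \<and> C_hoelder_loc 2 \<alpha> \<Omega> \<rho>\<^sub>\<mu>) \<and>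
     in_Linf_loc \<Omega> (\<lambda>x. 1 / \<rho>\<^sub>\<nu> x) \<and> in_Linf_loc \<Omega> (\<lambda>x. 1 / \<rho>\<^sub>\<mu> x)"

definition locally_integrable ::
    "'a::euclidean_space set \<Rightarrow> ('a \<Rightarrow> 'c::euclidean_space) \<Rightarrow> bool" where
  "locally_integrable \<Omega> f \<longleftrightarrow> (\<forall>K. compact K \<and> K \<subseteq> \<Omega> \<longrightarrow> set_integrable lborel K f)"

text \<open>\<open>v\<close> is in \<open>W\<^sup>1\<^sup>,\<^sup>1\<^sub>l\<^sub>o\<^sub>c(\<Omega>)\<close> iff it has a weak gradient in this sense.\<close>

definition has_weak_gradient ::
    "'a::euclidean_space set \<Rightarrow> ('a \<Rightarrow> real) \<Rightarrow> ('a \<Rightarrow> 'a) \<Rightarrow> bool" where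
  "has_weak_gradient \<Omega> v g \<longleftrightarrow>
     locally_integrable \<Omega> v \<and> locally_integrable \<Omega> g \<and>
     (\<forall>\<phi>. C_c_infinity \<Omega> \<phi> \<longrightarrow>
       (\<forall>b\<in>Basis. (LINT x:\<Omega>|lborel. v x * frechet_derivative \<phi> (at x) b) =
                  - (LINT x:\<Omega>|lborel. (g x \<bullet> b) * \<phi> x)))"

definition in_W12 ::
    "'a::euclidean_space set \<Rightarrow> ('a \<Rightarrow> real) \<Rightarrow> ('a \<Rightarrow> real) \<Rightarrow> ('a \<Rightarrow> real) \<Rightarrow> bool" where
  "in_W12 \<Omega> \<rho>\<^sub>\<nu> \<rho>\<^sub>\<mu> v \<longleftrightarrow>
     in_Lp 2 (weighted \<Omega> \<rho>\<^sub>\<nu>) v \<and>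
     (\<exists>g. has_weak_gradient \<Omega> v g \<and> in_Lp 2 (weighted \<Omega> \<rho>\<^sub>\<mu>) g)"

definition zero_mean_poincare ::
    "'a::euclidean_space set \<Rightarrow> ('a \<Rightarrow> real) \<Rightarrow> ('a \<Rightarrow> real) \<Rightarrow> real \<Rightarrow> bool" where
  "zero_mean_poincare \<Omega> \<rho>\<^sub>\<nu> \<rho>\<^sub>\<mu> M\<^sub>P \<longleftrightarrow>
     (\<forall>v g. in_W12 \<Omega> \<rho>\<^sub>\<nu> \<rho>\<^sub>\<mu> v \<and> has_weak_gradient \<Omega> v g \<longrightarrow>
       Lp_norm 2 (weighted \<Omega> \<rho>\<^sub>\<nu>) (\<lambda>x. v x - mean_value (weighted \<Omega> \<rho>\<^sub>\<nu>) v)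
         \<le> M\<^sub>P * Lp_norm 2 (weighted \<Omega> \<rho>\<^sub>\<mu>) g)"

text \<open>\<open>\<eta>\<close> is in \<open>W\<^sup>1\<^sup>,\<^sup>2((0,T); L\<^sup>2(M))\<close> with weak time derivative \<open>\<eta>'\<close>. The function \<open>\<eta>\<close> is taken to be
  the representative that is continuous from \<open>[0,T]\<close> to \<open>L\<^sup>2(M)\<close>, so that \<open>\<eta> 0\<close> and \<open>\<eta> T\<close> are its
  values at the end points. The identity of \<open>L\<^sup>2(M)\<close>-valued integrals that defines \<open>\<eta>'\<close> is
  written as an identity for almost every \<open>x\<close>.\<close>

definition in_W12_time ::
    "real \<Rightarrow> 'b measure \<Rightarrow> (real \<Rightarrow> 'b \<Rightarrow> real) \<Rightarrow> (real \<Rightarrow> 'b \<Rightarrow> real) \<Rightarrow> bool" where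
  "in_W12_time T M \<eta> \<eta>' \<longleftrightarrow>
     in_LpLp 2 T M \<eta> \<and> in_LpLp 2 T M \<eta>' \<and>
     (\<forall>\<phi>. C_c_infinity {0<..<T} \<phi> \<longrightarrow>
       (AE x in M. (LINT t:{0<..<T}|lborel. deriv \<phi> t * \<eta> t x) =
                   - (LINT t:{0<..<T}|lborel. \<phi> t * \<eta>' t x))) \<and>
     (\<forall>s\<in>{0..T}. in_Lp 2 M (\<eta> s) \<and>
       ((\<lambda>t. Lp_norm 2 M (\<lambda>x. \<eta> t x - \<eta> s x)) \<longlongrightarrow> 0) (at s within {0..T}))"

text \<open>In the following definition, \<open>G\<close> is the spatial gradient of \<open>u\<^sup>m\<close>, and \<open>\<eta>'\<close> and \<open>\<zeta>\<close> are the
  time derivative and the spatial gradient of the test function \<open>\<eta>\<close>; they are unique up to null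
  sets.\<close>

definition weak_solution_N ::
    "real \<Rightarrow> 'a::euclidean_space set \<Rightarrow> ('a \<Rightarrow> real) \<Rightarrow> ('a \<Rightarrow> real) \<Rightarrow>
     ('a \<Rightarrow> real) \<Rightarrow> (real \<Rightarrow> 'a \<Rightarrow> real) \<Rightarrow> bool" where
  "weak_solution_N m \<Omega> \<rho>\<^sub>\<nu> \<rho>\<^sub>\<mu> u\<^sub>0 u \<longleftrightarrow>
     in_Lp 2 (weighted \<Omega> \<rho>\<^sub>\<nu>) u\<^sub>0 \<and>
     (\<exists>G. (AE t in lborel. 0 < t \<longrightarrow> has_weak_gradient \<Omega> (\<lambda>x. spow m (u t x)) (G t)) \<and>
       (\<forall>T>0.
         in_LpLp 2 T (weighted \<Omega> \<rho>\<^sub>\<nu>) u \<and> in_LpLp 2 T (weighted \<Omega> \<rho>\<^sub>\<mu>) G \<and>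
         (\<forall>\<eta> \<eta>' \<zeta>.
            in_W12_time T (weighted \<Omega> \<rho>\<^sub>\<nu>) \<eta> \<eta>' \<and>
            (AE t in lborel. t \<in> {0<..<T} \<longrightarrow> has_weak_gradient \<Omega> (\<eta> t) (\<zeta> t)) \<and>
            in_LpLp 2 T (weighted \<Omega> \<rho>\<^sub>\<mu>) \<zeta> \<and>
            (AE x in weighted \<Omega> \<rho>\<^sub>\<nu>. \<eta> T x = 0) \<longrightarrow>
            (LINT t:{0<..<T}|lborel. LINT x|weighted \<Omega> \<rho>\<^sub>\<nu>. u t x * \<eta>' t x) =
              - (LINT x|weighted \<Omega> \<rho>\<^sub>\<nu>. u\<^sub>0 x * \<eta> 0 x)
              + (LINT t:{0<..<T}|lborel. LINT x|weighted \<Omega> \<rho>\<^sub>\<mu>. G t x \<bullet> \<zeta> t x))))"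

definition energy_solution_N ::
    "real \<Rightarrow> 'a::euclidean_space set \<Rightarrow> ('a \<Rightarrow> real) \<Rightarrow> ('a \<Rightarrow> real) \<Rightarrow>
     ('a \<Rightarrow> real) \<Rightarrow> (real \<Rightarrow> 'a \<Rightarrow> real) \<Rightarrow> bool" where
  "energy_solution_N m \<Omega> \<rho>\<^sub>\<nu> \<rho>\<^sub>\<mu> u\<^sub>0 u \<longleftrightarrow>
     weak_solution_N m \<Omega> \<rho>\<^sub>\<nu> \<rho>\<^sub>\<mu> u\<^sub>0 u \<and>
     (\<forall>T>0. in_LpLp (m + 1) T (weighted \<Omega> \<rho>\<^sub>\<nu>) u)"

end

theory Submission
  imports Defs "HOL-Probability.Probability_Measure"
begin

text \<open>The decay comes from one entropy, \<open>E(t) = \<integral> \<bar>u(t) - v\<bar>\<^sup>r d\<nu>\<close> with \<open>v\<close> the mean value, which may be taken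
positive because \<open>-u\<close> solves the same problem. Formally, testing the equation with
\<open>\<psi>(u\<^sup>m) = r (u - v)\<^sup>(\<^sup>r\<^sup>-\<^sup>1\<^sup>)\<close> gives \<open>E' = -D\<close> with the dissipation \<open>D = \<integral> \<psi>'(u\<^sup>m) \<bar>\<nabla>(u\<^sup>m)\<bar>\<^sup>2 d\<mu>\<close>. If
\<open>F'\<^sup>2 \<le> \<psi>'\<close>, then \<open>D\<close> dominates \<open>\<integral> \<bar>\<nabla> F(u\<^sup>m)\<bar>\<^sup>2 d\<mu>\<close>, and the Poincare inequality bounds this from below by
the variance of \<open>F(u\<^sup>m)\<close>, divided by \<open>M\<^sub>P\<^sup>2\<close>. It remains to choose \<open>F\<close> such that this variance controls \<open>E\<close>.

The natural choice, a multiple of \<open>(u - v)\<^sup>(\<^sup>r\<^sup>/\<^sup>2\<^sup>)\<close>, is spoilt by the degeneracy: \<open>u\<close>, as a function of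
\<open>u\<^sup>m\<close>, has infinite slope at \<open>u = 0\<close>. Therefore \<open>z = u - v\<close> is replaced by \<open>y(z)\<close>, where \<open>y\<close> is the
identity on positive numbers and constant below \<open>-v/2\<close>. Then only values \<open>u \<ge> v/2\<close> contribute to the
gradient of \<open>F(u\<^sup>m)\<close>, the slope there is at most \<open>(v/2)\<^sup>1\<^sup>-\<^sup>m\<close>, and \<open>F\<^sup>2\<close> may carry a factor proportional to
\<open>v\<^sup>m\<^sup>-\<^sup>1\<close>, which becomes the rate. Nothing essential is lost: by the maximum principle \<open>\<bar>z\<bar> \<le> R v\<close>, so that
\<open>\<bar>y(z)\<bar>\<close> is comparable with \<open>\<bar>z\<bar>\<close> with a ratio depending on \<open>R\<close> only. The variance of
\<open>y(z)\<^sup>(\<^sup>r\<^sup>/\<^sup>2\<^sup>)\<close> controls its square integral because \<open>z\<close> has mean zero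
(\<open>zero_mean_power_inequality\<close>): a pointwise inequality bounds the squared distance of \<open>y(z)\<^sup>(\<^sup>r\<^sup>/\<^sup>2\<^sup>)\<close> from
any constant below by a multiple of the square of that constant, up to a term linear in \<open>z\<close>, and that term
integrates to zero since mass is conserved.

To make this rigorous for weak solutions, \<open>\<psi>\<close> is first taken smooth and bounded, and the test function is
the average over \<open>[t, t + h]\<close> of \<open>e\<^sup>c\<^sup>t \<psi>(u\<^sup>m)\<close>, cut off after time \<open>\<tau>\<close>. Convexity replaces the chain rule in time:
if \<open>\<Phi>' = \<psi>(s\<^sup>m)\<close>, then \<open>\<Phi>\<close> is convex, and \<open>\<Phi>(u(t)) - \<Phi>(u(t - h)) \<le> \<psi>(u\<^sup>m(t)) (u(t) - u(t - h))\<close>. Letting \<open>h\<close>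
tend to \<open>0\<close> gives \<open>entropy_inequality\<close> for almost every \<open>\<tau>\<close>. The weight \<open>e\<^sup>c\<^sup>t\<close> plays the part of
Gronwall's lemma: once \<open>c E \<le> D\<close>, the inequality itself says \<open>e\<^sup>c\<^sup>\<tau> E(\<tau>) \<le> E(0)\<close>. Constant \<open>\<psi>\<close> give
conservation of mass, and a \<open>\<psi>\<close> that vanishes up to the \<open>m\<close>-th power of the bound gives the maximum principle.

Two analytic facts about weak gradients enter: the chain rule \<open>has_weak_gradient_compose\<close>, proved by
difference quotients, and the interchange of weak gradients with averages in time. Finally the power
entropy and the function \<open>F\<close> are approximated by the smooth bounded ones of \<open>regularised_entropies\<close>, and the
approximation is removed by bounded convergence, using once more that \<open>u\<close> is bounded.\<close>

section \<open>Continuity of translations in the mean\<close>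

text \<open>Truncating \<open>f\<close> in space and in size costs little by dominated convergence; the truncation is an almost
everywhere limit of continuous functions, and these may be clipped to the same bounds without losing the
convergence.\<close>

lemma continuous_approx_L1:
  fixes f :: "'a::euclidean_space \<Rightarrow> real"
  assumes f: "integrable lborel f" and e: "0 < e"
  obtains c :: "'a \<Rightarrow> real" and B where "continuous_on UNIV c" "0 \<le> B" "\<And>x. \<bar>c x\<bar> \<le> B"
    "\<And>x. B < norm x \<Longrightarrow> c x = 0" "(LINT x|lborel. \<bar>f x - c x\<bar>) < e"
proof -
  have fm[measurable]: "f \<in> borel_measurable borel"
    using f by (auto dest: borel_measurable_integrable)
  define clip :: "real \<Rightarrow> real \<Rightarrow> real" where "clip = (\<lambda>r y. max (- r) (min r y))"
  define F where "F n x = (if norm x \<le> real n then clip (real n) (f x) else 0)" for n x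
  have Fm[measurable]: "F n \<in> borel_measurable borel" for n
    unfolding F_def clip_def by measurable
  have Fle: "\<bar>F n x\<bar> \<le> \<bar>f x\<bar>" for n x
    unfolding F_def clip_def by (auto simp: max_def min_def)
  have Flim: "(\<lambda>n. F n x) \<longlonglongrightarrow> f x" for x
  proof (rule tendsto_eventually)
    obtain N where N: "max (norm x) \<bar>f x\<bar> \<le> real N" using real_arch_simple by blast
    show "\<forall>\<^sub>F n in sequentially. F n x = f x"
      using eventually_ge_at_top[of N]
    proof eventually_elim
      case (elim n)
      then have "max (norm x) \<bar>f x\<bar> \<le> real n" using N by (meson of_nat_le_iff order_trans)
      then have "norm x \<le> real n" "\<bar>f x\<bar> \<le> real n" by (simp_all only: max.bounded_iff)
      then show ?case unfolding F_def clip_def by (simp add: abs_le_iff)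
    qed
  qed
  have "(\<lambda>n. LINT x|lborel. \<bar>f x - F n x\<bar>) \<longlonglongrightarrow> (LINT x::'a|lborel. 0)"
  proof (rule integral_dominated_convergence[where w="\<lambda>x. 2 * \<bar>f x\<bar>"])
    show "AE x in lborel. (\<lambda>n. \<bar>f x - F n x\<bar>) \<longlonglongrightarrow> 0"
      using tendsto_rabs_zero[OF LIM_zero[OF Flim]] by (auto simp: abs_minus_commute)
    show "AE x in lborel. norm \<bar>f x - F n x\<bar> \<le> 2 * \<bar>f x\<bar>" for n
      using Fle[of n] by (intro always_eventually allI) (smt (verit) real_norm_def)
  qed (use f in auto)
  then have "\<forall>\<^sub>F n in sequentially. (LINT x|lborel. \<bar>f x - F n x\<bar>) < e/2"
    using e by (intro order_tendstoD(2)) auto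
  then obtain n where n: "(LINT x|lborel. \<bar>f x - F n x\<bar>) < e/2"
    by (auto simp: eventually_sequentially)
  have Fi: "integrable lborel (F n)"
    by (rule Bochner_Integration.integrable_bound[OF f]) (use Fle in auto)
  \<comment> \<open>The continuous approximants need neither be bounded nor have bounded support; clipping and a cutoff
    that equals 1 where \<open>F n\<close> may be nonzero repair this without changing the limit.\<close>
  have "F n measurable_on UNIV"
    by (rule lebesgue_measurable_imp_measurable_on_real) (auto intro: borel_measurable_if_I measurable_completion)
  then obtain N g where N: "negligible N" and gc: "\<And>k::nat. continuous_on UNIV (g k)"
      and glim: "\<And>x. x \<notin> N \<Longrightarrow> (\<lambda>k. g k x) \<longlonglongrightarrow> F n x"
    unfolding measurable_on_def by auto
  define cut :: "'a \<Rightarrow> real" where "cut x = max 0 (min 1 (real n + 1 - norm x))" for x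
  define c where "c k x = clip (real n) (g k x) * cut x" for k x
  have cc: "continuous_on UNIV (c k)" for k
    unfolding c_def clip_def cut_def by (intro continuous_intros gc)
  have cut01: "0 \<le> cut x" "cut x \<le> 1" for x unfolding cut_def by auto
  have cb: "\<bar>c k x\<bar> \<le> real n" for k x
  proof -
    have "\<bar>clip (real n) (g k x)\<bar> \<le> real n" unfolding clip_def by auto
    then show ?thesis unfolding c_def abs_mult using cut01[of x]
      by (metis abs_ge_zero abs_of_nonneg mult.right_neutral mult_mono order_trans zero_le_one of_nat_0_le_iff)
  qed
  have c0: "c k x = 0" if "real n + 1 < norm x" for k x
    using that unfolding c_def cut_def by auto
  have clim: "(\<lambda>k. c k x) \<longlonglongrightarrow> F n x" if "x \<notin> N" for x
  proof -
    have "(\<lambda>k. c k x) \<longlonglongrightarrow> clip (real n) (F n x) * cut x"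
      unfolding c_def clip_def by (intro tendsto_intros glim that)
    moreover have "clip (real n) (F n x) * cut x = F n x"
      unfolding F_def clip_def cut_def by (auto simp: max_def min_def)
    ultimately show ?thesis by simp
  qed
  have AEN: "AE x in lborel. x \<notin> N"
  proof -
    have "N \<in> null_sets lebesgue" using N by (simp add: negligible_iff_null_sets)
    then have "AE x in lebesgue. x \<notin> N" by (rule AE_not_in)
    then show ?thesis by (simp add: AE_completion_iff)
  qed
  have "(\<lambda>k. LINT x|lborel. \<bar>F n x - c k x\<bar>) \<longlonglongrightarrow> (LINT x::'a|lborel. 0)"
  proof (rule integral_dominated_convergence[where w="\<lambda>x. (2 * real n) * indicat_real (cball 0 (real n + 1)) x"])
    show "AE x in lborel. (\<lambda>k. \<bar>F n x - c k x\<bar>) \<longlonglongrightarrow> 0"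
      using AEN by eventually_elim (use tendsto_rabs_zero[OF LIM_zero[OF clim]] in \<open>auto simp: abs_minus_commute\<close>)
    show "AE x in lborel. norm \<bar>F n x - c k x\<bar> \<le> (2 * real n) * indicat_real (cball 0 (real n + 1)) x" for k
    proof (intro always_eventually allI)
      fix x
      have "\<bar>F n x\<bar> \<le> real n" unfolding F_def clip_def by auto
      moreover have "F n x = 0" if "real n + 1 < norm x" using that unfolding F_def by auto
      ultimately show "norm \<bar>F n x - c k x\<bar> \<le> (2 * real n) * indicat_real (cball 0 (real n + 1)) x"
        using cb[of k x] c0[of x k] by (cases "real n + 1 < norm x") auto
    qed
    show "integrable lborel (\<lambda>x. (2 * real n) * indicat_real (cball (0::'a) (real n + 1)) x)"
      using emeasure_bounded_finite[OF bounded_cball[of "0::'a" "real n + 1"]] by (auto intro!: integrable_mult_right)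
    show "(\<lambda>x. \<bar>F n x - c k x\<bar>) \<in> borel_measurable lborel" for k
      using borel_measurable_continuous_onI[OF cc[of k]] by measurable
  qed auto
  then have "\<forall>\<^sub>F k in sequentially. (LINT x|lborel. \<bar>F n x - c k x\<bar>) < e/2"
    using e by (intro order_tendstoD(2)) auto
  then obtain k where k: "(LINT x|lborel. \<bar>F n x - c k x\<bar>) < e/2"
    by (auto simp: eventually_sequentially)
  have ci: "integrable lborel (c k)"
  proof (rule Bochner_Integration.integrable_bound[where f="\<lambda>x. real n * indicat_real (cball (0::'a) (real n + 1)) x"])
    show "integrable lborel (\<lambda>x. real n * indicat_real (cball (0::'a) (real n + 1)) x)"
      using emeasure_bounded_finite[OF bounded_cball[of "0::'a" "real n + 1"]] by (auto intro!: integrable_mult_right)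
    show "AE x in lborel. norm (c k x) \<le> norm (real n * indicat_real (cball (0::'a) (real n + 1)) x)"
      using cb[of k] c0[of _ k] by (intro always_eventually allI) (auto simp: indicator_def not_le)
  qed (use borel_measurable_continuous_onI[OF cc[of k]] in auto)
  have "(LINT x|lborel. \<bar>f x - c k x\<bar>) \<le> (LINT x|lborel. \<bar>f x - F n x\<bar> + \<bar>F n x - c k x\<bar>)"
    by (intro integral_mono integrable_abs Bochner_Integration.integrable_add Bochner_Integration.integrable_diff f Fi ci) auto
  also have "\<dots> = (LINT x|lborel. \<bar>f x - F n x\<bar>) + (LINT x|lborel. \<bar>F n x - c k x\<bar>)"
    by (intro Bochner_Integration.integral_add integrable_abs Bochner_Integration.integrable_diff f Fi ci)
  also have "\<dots> < e" using n k by simp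
  finally have fin: "(LINT x|lborel. \<bar>f x - c k x\<bar>) < e" .
  show ?thesis
    by (rule that[of "c k" "real n + 1"]) (use cc cb c0 fin in \<open>auto intro: order_trans[OF cb]\<close>)
qed

lemma integrable_translate:
  fixes f :: "'a::euclidean_space \<Rightarrow> real"
  assumes "integrable lborel f" shows "integrable lborel (\<lambda>x. f (x + t))"
proof -
  have "integrable (distr lborel borel (\<lambda>x. t + x)) f"
    using assms by (simp add: lborel_distr_plus)
  then have "integrable lborel (\<lambda>x. f (t + x))"
    by (subst (asm) integrable_distr_eq) (use assms in auto)
  then show ?thesis by (simp add: add.commute)
qed

lemma integral_translate:
  fixes f :: "'a::euclidean_space \<Rightarrow> real"
  assumes "f \<in> borel_measurable borel"
  shows "(LINT x|lborel. f (x + t)) = (LINT x|lborel. f x)"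
proof -
  have "(LINT x|lborel. f x) = (LINT x|distr lborel borel (\<lambda>x. t + x). f x)"
    by (simp add: lborel_distr_plus)
  also have "\<dots> = (LINT x|lborel. f (t + x))"
    by (rule integral_distr) (use assms in auto)
  finally show ?thesis by (simp add: add.commute)
qed

text \<open>For a continuous function of bounded support this is dominated convergence; the general case follows by
approximation, because translations preserve the \<open>L\<^sup>1\<close> norm.\<close>

lemma translation_continuous_L1:
  fixes f :: "'a::euclidean_space \<Rightarrow> real"
  assumes f: "integrable lborel f" and h: "h \<longlonglongrightarrow> 0"
  shows "(\<lambda>k. LINT x|lborel. \<bar>f (x + h k) - f x\<bar>) \<longlonglongrightarrow> 0"
proof (rule LIMSEQ_I)
  fix e :: real assume e: "0 < e"
  obtain c B where cc: "continuous_on UNIV c" and B: "0 \<le> B" and cb: "\<And>x. \<bar>c x\<bar> \<le> B"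
    and c0: "\<And>x. B < norm x \<Longrightarrow> c x = 0" and fc: "(LINT x|lborel. \<bar>f x - c x\<bar>) < e/3"
    using continuous_approx_L1[OF f, of "e/3"] e by auto
  have cm[measurable]: "c \<in> borel_measurable borel" using borel_measurable_continuous_onI[OF cc] .
  have fm[measurable]: "f \<in> borel_measurable borel"
    using f by (auto dest: borel_measurable_integrable)
  have bi: "integrable lborel (\<lambda>x::'a. K * indicat_real (cball 0 r) x)" for K r
    using emeasure_bounded_finite[OF bounded_cball[of "0::'a" r]] by (auto intro!: integrable_mult_right)
  have ci: "integrable lborel c"
    by (rule Bochner_Integration.integrable_bound[OF bi[of B B]])
       (use cb c0 B in \<open>auto simp: indicator_def not_le\<close>)
  have ev1: "\<forall>\<^sub>F k in sequentially. norm (h k) < 1"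
    using tendsto_norm_zero[OF h] by (rule order_tendstoD) simp
  then obtain K where K: "\<And>k. k \<ge> K \<Longrightarrow> norm (h k) < 1" by (auto simp: eventually_sequentially)
  have "(\<lambda>k. LINT x|lborel. \<bar>c (x + h (k + K)) - c x\<bar>) \<longlonglongrightarrow> (LINT x::'a|lborel. 0)"
  proof (rule integral_dominated_convergence[OF _ _ bi[of "2*B" "B+1"]])
    show "AE x in lborel. (\<lambda>k. \<bar>c (x + h (k + K)) - c x\<bar>) \<longlonglongrightarrow> 0"
    proof (intro always_eventually allI)
      fix x
      have "isCont c x" using cc by (simp add: continuous_on_eq_continuous_at)
      moreover have "(\<lambda>k. x + h (k + K)) \<longlonglongrightarrow> x + 0"
        by (intro tendsto_intros LIMSEQ_ignore_initial_segment h)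
      ultimately have "(\<lambda>k. c (x + h (k + K))) \<longlonglongrightarrow> c x"
        using isCont_tendsto_compose[of x c] by simp
      from tendsto_rabs_zero[OF LIM_zero[OF this]]
      show "(\<lambda>k. \<bar>c (x + h (k + K)) - c x\<bar>) \<longlonglongrightarrow> 0" .
    qed
    show "AE x in lborel. norm \<bar>c (x + h (k + K)) - c x\<bar> \<le> 2 * B * indicat_real (cball 0 (B + 1)) x" for k
    proof (intro always_eventually allI)
      fix x
      have "norm (h (k+K)) < 1" using K by simp
      then have "B < norm (x + h (k+K))" "B < norm x" if "B + 1 < norm x"
        using that norm_diff_ineq[of x "h (k+K)"] by auto
      then show "norm \<bar>c (x + h (k + K)) - c x\<bar> \<le> 2 * B * indicat_real (cball 0 (B + 1)) x"
        using cb[of x] cb[of "x + h (k+K)"] c0[of x] c0[of "x + h (k+K)"]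
        by (cases "B + 1 < norm x") auto
    qed
  qed auto
  then have "(\<lambda>k. LINT x|lborel. \<bar>c (x + h k) - c x\<bar>) \<longlonglongrightarrow> 0"
    by (simp add: LIMSEQ_ignore_initial_segment[of _ 0 K] LIMSEQ_offset[where k=K])
  then obtain N where N: "\<And>k. k \<ge> N \<Longrightarrow> (LINT x|lborel. \<bar>c (x + h k) - c x\<bar>) < e/3"
    using e order_tendstoD(2)[of _ 0 sequentially "e/3"] by (auto simp: eventually_sequentially)
  show "\<exists>no. \<forall>n\<ge>no. norm ((LINT x|lborel. \<bar>f (x + h n) - f x\<bar>) - 0) < e"
  proof (intro exI allI impI)
    fix k assume k: "k \<ge> N"
    have i1: "integrable lborel (\<lambda>x. \<bar>f x - c x\<bar>)" using f ci by auto
    have i2: "integrable lborel (\<lambda>x. \<bar>f (x + h k) - c (x + h k)\<bar>)"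
      using integrable_translate[OF i1, of "h k"] by simp
    have i3: "integrable lborel (\<lambda>x. \<bar>c (x + h k) - c x\<bar>)"
      using integrable_translate[OF ci, of "h k"] ci by auto
    have i0: "integrable lborel (\<lambda>x. \<bar>f (x + h k) - f x\<bar>)"
      using integrable_translate[OF f, of "h k"] f by auto
    have "(LINT x|lborel. \<bar>f (x + h k) - f x\<bar>) \<le>
      (LINT x|lborel. \<bar>f (x + h k) - c (x + h k)\<bar> + \<bar>c (x + h k) - c x\<bar> + \<bar>f x - c x\<bar>)"
      by (rule integral_mono) (use i0 i1 i2 i3 in \<open>auto\<close>)
    also have "\<dots> = (LINT x|lborel. \<bar>f (x + h k) - c (x + h k)\<bar>) + (LINT x|lborel. \<bar>c (x + h k) - c x\<bar>) + (LINT x|lborel. \<bar>f x - c x\<bar>)"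
      using i1 i2 i3 by simp
    also have "(LINT x|lborel. \<bar>f (x + h k) - c (x + h k)\<bar>) = (LINT x|lborel. \<bar>f x - c x\<bar>)"
      by (rule integral_translate[of "\<lambda>x. \<bar>f x - c x\<bar>"]) measurable
    finally have "(LINT x|lborel. \<bar>f (x + h k) - f x\<bar>) < e" using fc N[OF k] by linarith
    moreover have "0 \<le> (LINT x|lborel. \<bar>f (x + h k) - f x\<bar>)" by (rule integral_nonneg_AE) auto
    ultimately show "norm ((LINT x|lborel. \<bar>f (x + h k) - f x\<bar>) - 0) < e" by simp
  qed
qed

section \<open>Averages over intervals and shifts in time\<close>

text \<open>The average of \<open>f\<close> over \<open>[t, t + h]\<close> is the expectation of \<open>f (t + h * s)\<close> under this measure. In this form
the domain of integration does not depend on \<open>t\<close> and \<open>h\<close>, so that averages commute with other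
integrals by the Fubini theorem for a product with a fixed probability measure.\<close>

definition unit_unif :: "real measure" where
  "unit_unif = uniform_measure lborel {0..1}"

lemma sets_unit_unif [simp, measurable_cong]: "sets unit_unif = sets borel"
  by (simp add: unit_unif_def)

lemma space_unit_unif [simp]: "space unit_unif = UNIV"
  by (simp add: unit_unif_def)

lemma prob_space_unit_unif: "prob_space unit_unif"
  unfolding unit_unif_def by (rule prob_space_uniform_measure) auto

interpretation unit_unif: prob_space unit_unif
  by (rule prob_space_unit_unif)

lemma AE_unit_unif: "AE s in unit_unif. 0 \<le> s \<and> s \<le> 1"
  unfolding unit_unif_def by (subst AE_uniform_measure) auto

lemma unit_unif_eq_density: "unit_unif = density lborel (\<lambda>s. ennreal (indicator {0..1} s))"
  unfolding unit_unif_def uniform_measure_def by (simp add: ennreal_indicator divide_ennreal_def)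

lemma integral_unit_unif:
  fixes f :: "real \<Rightarrow> 'b::euclidean_space"
  assumes [measurable]: "f \<in> borel_measurable borel"
  shows "(LINT s|unit_unif. f s) = (LINT s:{0..1}|lborel. f s)"
  unfolding unit_unif_eq_density set_lebesgue_integral_def
  by (subst integral_density) auto

lemma AE_unit_unif_affine:
  assumes P: "AE s in lborel. P s" and h: "0 < h"
  shows "AE s in unit_unif. P (t + h * s)"
proof -
  have "AE s in lborel. P (t + h * s)"
  proof -
    have "AE s in distr lborel borel (\<lambda>s. t + h * s). P s"
    proof -
      have "lborel = density (distr lborel borel (\<lambda>x. t + h * x)) (\<lambda>_. ennreal \<bar>h\<bar>)"
        using h by (intro lborel_real_affine) auto
      from this have "AE x in density (distr lborel borel (\<lambda>x. t + h * x)) (\<lambda>_. ennreal \<bar>h\<bar>). P x"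
        by (rule ssubst[where P="\<lambda>M. AE x in M. P x", OF sym]) (rule P)
      then show ?thesis using h by (subst (asm) AE_density) auto
    qed
    then show ?thesis by (rule AE_distrD[rotated]) simp
  qed
  then show ?thesis unfolding unit_unif_def by (subst AE_uniform_measure) auto
qed

definition tshift :: "real \<Rightarrow> real \<times> 'b \<Rightarrow> real \<times> 'b" where
  "tshift a z = (fst z + a, snd z)"

lemma measurable_tshift [measurable]: "tshift a \<in> lborel \<Otimes>\<^sub>M M \<rightarrow>\<^sub>M lborel \<Otimes>\<^sub>M M"
  unfolding tshift_def by measurable

lemma distr_tshift:
  assumes "sigma_finite_measure M"
  shows "distr (lborel \<Otimes>\<^sub>M M) (lborel \<Otimes>\<^sub>M M) (tshift a) = lborel \<Otimes>\<^sub>M M"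
proof -
  have e1: "distr lborel lborel (\<lambda>t::real. t + a) = lborel"
    using lborel_distr_plus[of a] by (simp add: add.commute cong: distr_cong)
  have e2: "distr M M (\<lambda>x. x) = M" by (rule distr_id2) simp
  have "distr lborel lborel (\<lambda>t::real. t + a) \<Otimes>\<^sub>M distr M M (\<lambda>x. x)
     = distr (lborel \<Otimes>\<^sub>M M) (lborel \<Otimes>\<^sub>M M) (\<lambda>(x, y). (x + a, y))"
    by (rule pair_measure_distr) (use assms e2 in auto)
  then show ?thesis unfolding e1 e2 by (simp add: tshift_def[abs_def] case_prod_beta')
qed

lemma integrable_tshift:
  fixes F :: "real \<times> 'b \<Rightarrow> real"
  assumes "sigma_finite_measure M" "integrable (lborel \<Otimes>\<^sub>M M) F"
  shows "integrable (lborel \<Otimes>\<^sub>M M) (\<lambda>z. F (tshift a z))"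
proof -
  have "integrable (distr (lborel \<Otimes>\<^sub>M M) (lborel \<Otimes>\<^sub>M M) (tshift a)) F"
    using assms by (simp add: distr_tshift)
  then show ?thesis by (subst (asm) integrable_distr_eq) (use assms in auto)
qed

lemma integral_tshift:
  fixes F :: "real \<times> 'b \<Rightarrow> real"
  assumes "sigma_finite_measure M" "F \<in> borel_measurable (lborel \<Otimes>\<^sub>M M)"
  shows "(LINT z|(lborel \<Otimes>\<^sub>M M). F (tshift a z)) = (LINT z|(lborel \<Otimes>\<^sub>M M). F z)"
proof -
  have "(LINT z|(lborel \<Otimes>\<^sub>M M). F z) = (LINT z|(distr (lborel \<Otimes>\<^sub>M M) (lborel \<Otimes>\<^sub>M M) (tshift a)). F z)"
    using assms by (simp add: distr_tshift)
  also have "\<dots> = (LINT z|(lborel \<Otimes>\<^sub>M M). F (tshift a z))"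
    by (rule integral_distr) (use assms in auto)
  finally show ?thesis by simp
qed

text \<open>Continuity of translations is applied on each line \<open>x = const\<close>; twice the \<open>L\<^sup>1\<close> norm on the line
dominates.\<close>

lemma tshift_continuous_L1:
  fixes F :: "real \<times> 'b \<Rightarrow> real"
  assumes M: "sigma_finite_measure M" and F: "integrable (lborel \<Otimes>\<^sub>M M) F" and s: "s \<longlonglongrightarrow> 0"
  shows "(\<lambda>k. LINT z|(lborel \<Otimes>\<^sub>M M). \<bar>F (tshift (s k) z) - F z\<bar>) \<longlonglongrightarrow> 0"
proof -
  interpret M: sigma_finite_measure M by fact
  interpret pair_sigma_finite "lborel :: real measure" M ..
  have [measurable]: "F \<in> borel_measurable (lborel \<Otimes>\<^sub>M M)" using F by auto
  have D: "integrable (lborel \<Otimes>\<^sub>M M) (\<lambda>z. \<bar>F (tshift (s k) z) - F z\<bar>)" for k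
    using integrable_tshift[OF M F] F by auto
  have eq: "(LINT z|(lborel \<Otimes>\<^sub>M M). \<bar>F (tshift (s k) z) - F z\<bar>)
     = (LINT x|M. LINT t|lborel. \<bar>F (t + s k, x) - F (t, x)\<bar>)" for k
    using integral_snd[of "\<lambda>t x. \<bar>F (t + s k, x) - F (t, x)\<bar>"] D[of k]
    by (simp add: tshift_def case_prod_beta')
  have AEi: "AE x in M. integrable lborel (\<lambda>t. F (t, x))"
    using AE_integrable_snd[of "\<lambda>t x. F (t, x)"] F by simp
  have "integrable M (\<lambda>x. LINT t|lborel. \<bar>F (t, x)\<bar>)"
    using integrable_snd[of "\<lambda>t x. \<bar>F (t, x)\<bar>"] integrable_abs[OF F] by (simp add: case_prod_beta')
  then have w: "integrable M (\<lambda>x. 2 * (LINT t|lborel. \<bar>F (t, x)\<bar>))" by simp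
  have "(\<lambda>k. LINT x|M. LINT t|lborel. \<bar>F (t + s k, x) - F (t, x)\<bar>) \<longlonglongrightarrow> (LINT x|M. 0)"
  proof (rule integral_dominated_convergence[OF _ _ w])
    show "AE x in M. (\<lambda>k. LINT t|lborel. \<bar>F (t + s k, x) - F (t, x)\<bar>) \<longlonglongrightarrow> 0"
      using AEi by eventually_elim (rule translation_continuous_L1[OF _ s])
    show "AE x in M. norm (LINT t|lborel. \<bar>F (t + s k, x) - F (t, x)\<bar>) \<le> 2 * (LINT t|lborel. \<bar>F (t, x)\<bar>)" for k
      using AEi AE_space
    proof eventually_elim
      case (elim x)
      then have [measurable]: "x \<in> space M" by simp
      have i: "integrable lborel (\<lambda>t. F (t + s k, x))" using integrable_translate[OF elim(1)] .
      have "(LINT t|lborel. \<bar>F (t + s k, x) - F (t, x)\<bar>) \<le> (LINT t|lborel. \<bar>F (t + s k, x)\<bar> + \<bar>F (t, x)\<bar>)"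
        by (rule integral_mono) (use elim i in auto)
      also have "\<dots> = (LINT t|lborel. \<bar>F (t + s k, x)\<bar>) + (LINT t|lborel. \<bar>F (t, x)\<bar>)"
        using elim i by simp
      also have "(LINT t|lborel. \<bar>F (t + s k, x)\<bar>) = (LINT t|lborel. \<bar>F (t, x)\<bar>)"
        by (rule integral_translate[of "\<lambda>t. \<bar>F (t, x)\<bar>"]) (use elim in auto)
      finally show ?case by simp
    qed
  qed auto
  then show ?thesis by (simp add: eq)
qed

text \<open>The map \<open>a \<mapsto> a * \<bar>a\<bar>\<close> carries \<open>L\<^sup>2\<close> functions to \<open>L\<^sup>1\<close> functions and commutes with translations, so
this inequality turns continuity of translations in \<open>L\<^sup>1\<close> into continuity in \<open>L\<^sup>2\<close>.\<close>

lemma diff_square_le_signed_squares: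
  fixes a b :: real shows "(a - b)\<^sup>2 \<le> 2 * \<bar>a * \<bar>a\<bar> - b * \<bar>b\<bar>\<bar>"
proof -
  consider "a \<ge> 0" "b \<ge> 0" | "a \<ge> 0" "b \<le> 0" | "a \<le> 0" "b \<ge> 0" | "a \<le> 0" "b \<le> 0" by linarith
  then show ?thesis
  proof cases
    case 1
    have "(a-b)\<^sup>2 = \<bar>a-b\<bar> * \<bar>a-b\<bar>" by (simp add: power2_eq_square)
    also have "\<dots> \<le> \<bar>a-b\<bar> * (a+b)" using 1 by (intro mult_left_mono) auto
    also have "\<dots> = \<bar>(a-b)*(a+b)\<bar>" using 1 by (simp add: abs_mult)
    also have "\<dots> = \<bar>a * \<bar>a\<bar> - b * \<bar>b\<bar>\<bar>" using 1 by (simp add: algebra_simps)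
    finally have "(a-b)\<^sup>2 \<le> \<bar>a * \<bar>a\<bar> - b * \<bar>b\<bar>\<bar>" .
    then show ?thesis by (rule order_trans) simp
  next
    case 2
    have "0 \<le> (a+b)\<^sup>2" by simp
    then have "(a-b)\<^sup>2 \<le> 2 * (a*a+b*b)" by (simp add: power2_eq_square algebra_simps)
    then show ?thesis using 2 by simp
  next
    case 3
    have "0 \<le> (a+b)\<^sup>2" by simp
    then have "(a-b)\<^sup>2 \<le> 2 * (a*a+b*b)" by (simp add: power2_eq_square algebra_simps)
    also have "\<dots> \<le> 2 * \<bar>-(a*a) - b*b\<bar>" by simp
    finally show ?thesis using 3 by simp
  next
    case 4
    have "(a-b)\<^sup>2 = \<bar>a-b\<bar> * \<bar>a-b\<bar>" by (simp add: power2_eq_square)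
    also have "\<dots> \<le> \<bar>a-b\<bar> * (-(a+b))" using 4 by (intro mult_left_mono) auto
    also have "\<dots> = \<bar>(a-b)*(a+b)\<bar>" using 4 by (simp add: abs_mult)
    also have "\<dots> = \<bar>a * \<bar>a\<bar> - b * \<bar>b\<bar>\<bar>" using 4 by (simp add: algebra_simps abs_minus_commute)
    finally have "(a-b)\<^sup>2 \<le> \<bar>a * \<bar>a\<bar> - b * \<bar>b\<bar>\<bar>" .
    then show ?thesis by (rule order_trans) simp
  qed
qed

lemma abs_mult_le_half_squares: "\<bar>a * b\<bar> \<le> a\<^sup>2 / 2 + b\<^sup>2 / (2::real)"
proof -
  have "0 \<le> (\<bar>a\<bar> - \<bar>b\<bar>)\<^sup>2" by simp
  then show ?thesis by (simp add: power2_diff abs_mult)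
qed

lemma tshift_continuous_L2:
  fixes g :: "real \<times> 'b \<Rightarrow> real"
  assumes M: "sigma_finite_measure M" and gm[measurable]: "g \<in> borel_measurable (lborel \<Otimes>\<^sub>M M)"
    and g: "integrable (lborel \<Otimes>\<^sub>M M) (\<lambda>z. (g z)\<^sup>2)" and s: "s \<longlonglongrightarrow> 0"
  shows "(\<lambda>k. LINT z|(lborel \<Otimes>\<^sub>M M). (g (tshift (s k) z) - g z)\<^sup>2) \<longlonglongrightarrow> 0"
proof -
  define F where "F z = g z * \<bar>g z\<bar>" for z
  have Fm[measurable]: "F \<in> borel_measurable (lborel \<Otimes>\<^sub>M M)" unfolding F_def by measurable
  have F: "integrable (lborel \<Otimes>\<^sub>M M) F"
    by (rule Bochner_Integration.integrable_bound[OF g]) (auto simp: F_def abs_mult power2_eq_square)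
  have lim: "(\<lambda>k. 2 * (LINT z|(lborel \<Otimes>\<^sub>M M). \<bar>F (tshift (s k) z) - F z\<bar>)) \<longlonglongrightarrow> 0"
    using tendsto_mult_right_zero[OF tshift_continuous_L1[OF M F s]] .
  have D: "integrable (lborel \<Otimes>\<^sub>M M) (\<lambda>z. 2 * \<bar>F (tshift (s k) z) - F z\<bar>)" for k
    using integrable_tshift[OF M F] F by auto
  have pt: "(g (tshift (s k) z) - g z)\<^sup>2 \<le> 2 * \<bar>F (tshift (s k) z) - F z\<bar>" for k z
    unfolding F_def by (rule diff_square_le_signed_squares)
  have i: "integrable (lborel \<Otimes>\<^sub>M M) (\<lambda>z. (g (tshift (s k) z) - g z)\<^sup>2)" for k
    by (rule Bochner_Integration.integrable_bound[OF D[of k]]) (use pt in auto)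
  show ?thesis
  proof (rule tendsto_sandwich[OF _ _ tendsto_const lim])
    show "\<forall>\<^sub>F k in sequentially. 0 \<le> (LINT z|(lborel \<Otimes>\<^sub>M M). (g (tshift (s k) z) - g z)\<^sup>2)"
      by (intro always_eventually allI integral_nonneg_AE) auto
    show "\<forall>\<^sub>F k in sequentially. (LINT z|(lborel \<Otimes>\<^sub>M M). (g (tshift (s k) z) - g z)\<^sup>2)
        \<le> 2 * (LINT z|(lborel \<Otimes>\<^sub>M M). \<bar>F (tshift (s k) z) - F z\<bar>)"
    proof (intro always_eventually allI)
      fix k
      have "(LINT z|(lborel \<Otimes>\<^sub>M M). (g (tshift (s k) z) - g z)\<^sup>2) \<le> (LINT z|(lborel \<Otimes>\<^sub>M M). 2 * \<bar>F (tshift (s k) z) - F z\<bar>)"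
        by (rule integral_mono[OF i D]) (rule pt)
      then show "(LINT z|(lborel \<Otimes>\<^sub>M M). (g (tshift (s k) z) - g z)\<^sup>2)
        \<le> 2 * (LINT z|(lborel \<Otimes>\<^sub>M M). \<bar>F (tshift (s k) z) - F z\<bar>)" by simp
    qed
  qed
qed

lemma integrable_mult_L2:
  fixes f g :: "'b \<Rightarrow> real"
  assumes [measurable]: "f \<in> borel_measurable N" "g \<in> borel_measurable N"
    and "integrable N (\<lambda>z. (f z)\<^sup>2)" "integrable N (\<lambda>z. (g z)\<^sup>2)"
  shows "integrable N (\<lambda>z. f z * g z)"
proof (rule Bochner_Integration.integrable_bound[where f="\<lambda>z. (f z)\<^sup>2/2 + (g z)\<^sup>2/2"])
  show "integrable N (\<lambda>z. (f z)\<^sup>2/2 + (g z)\<^sup>2/2)" using assms by auto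
  show "AE z in N. norm (f z * g z) \<le> norm ((f z)\<^sup>2/2 + (g z)\<^sup>2/2)"
    using abs_mult_le_half_squares by (intro always_eventually allI) auto
qed simp

text \<open>Young's inequality; choosing \<open>d\<close> small makes the first factor harmless when the second one tends to zero
in \<open>L\<^sup>2\<close>.\<close>

lemma abs_integral_mult_le:
  fixes f g :: "'b \<Rightarrow> real"
  assumes [measurable]: "f \<in> borel_measurable N" "g \<in> borel_measurable N"
    and f: "integrable N (\<lambda>z. (f z)\<^sup>2)" and g: "integrable N (\<lambda>z. (g z)\<^sup>2)" and d: "0 < d"
  shows "\<bar>LINT z|N. f z * g z\<bar> \<le> d * (LINT z|N. (f z)\<^sup>2) + (LINT z|N. (g z)\<^sup>2) / d"
proof -
  have "\<bar>LINT z|N. f z * g z\<bar> \<le> (LINT z|N. \<bar>f z * g z\<bar>)" by (rule integral_abs_bound)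
  also have "\<dots> \<le> (LINT z|N. d * (f z)\<^sup>2 + (g z)\<^sup>2 / d)"
  proof (rule integral_mono)
    show "integrable N (\<lambda>z. \<bar>f z * g z\<bar>)" using integrable_mult_L2[OF _ _ f g] by simp
    show "integrable N (\<lambda>z. d * (f z)\<^sup>2 + (g z)\<^sup>2 / d)" using f g by simp
    fix z
    have "\<bar>(sqrt d * f z) * (g z / sqrt d)\<bar> \<le> (sqrt d * f z)\<^sup>2/2 + (g z / sqrt d)\<^sup>2/2"
      by (rule abs_mult_le_half_squares)
    also have "\<dots> = d * (f z)\<^sup>2/2 + (g z)\<^sup>2/d/2" using d by (simp add: power_mult_distrib power_divide)
    also have "\<dots> \<le> d * (f z)\<^sup>2 + (g z)\<^sup>2/d"
    proof -
      have "0 \<le> d * (f z)\<^sup>2" "0 \<le> (g z)\<^sup>2/d" using d by auto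
      moreover have "x / 2 + y / 2 \<le> x + y" if "0 \<le> x" "0 \<le> y" for x y :: real using that by simp
      ultimately show ?thesis by blast
    qed
    finally show "\<bar>f z * g z\<bar> \<le> d * (f z)\<^sup>2 + (g z)\<^sup>2 / d" using d by simp
  qed
  also have "\<dots> = d * (LINT z|N. (f z)\<^sup>2) + (LINT z|N. (g z)\<^sup>2) / d" using f g by simp
  finally show ?thesis .
qed

lemma tshift_correlation_continuous:
  fixes f g :: "real \<times> 'b \<Rightarrow> real"
  assumes M: "sigma_finite_measure M"
    and [measurable]: "f \<in> borel_measurable (lborel \<Otimes>\<^sub>M M)" "g \<in> borel_measurable (lborel \<Otimes>\<^sub>M M)"
    and f: "integrable (lborel \<Otimes>\<^sub>M M) (\<lambda>z. (f z)\<^sup>2)"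
    and g: "integrable (lborel \<Otimes>\<^sub>M M) (\<lambda>z. (g z)\<^sup>2)" and s: "s \<longlonglongrightarrow> 0"
  shows "(\<lambda>k. LINT z|(lborel \<Otimes>\<^sub>M M). f z * g (tshift (s k) z)) \<longlonglongrightarrow> (LINT z|(lborel \<Otimes>\<^sub>M M). f z * g z)"
proof (rule LIMSEQ_I)
  fix e :: real assume e: "0 < e"
  let ?P = "lborel \<Otimes>\<^sub>M M"
  define A where "A = (LINT z|?P. (f z)\<^sup>2)"
  have A: "0 \<le> A" unfolding A_def by (rule integral_nonneg_AE) auto
  define d where "d = e / (2 * (A + 1))"
  have d: "0 < d" using e A by (simp add: d_def)
  have dA: "d * A < e / 2 + 0"
  proof -
    have "d * A < d * (A + 1)" using d by simp
    also have "\<dots> = e / 2" using A by (simp add: d_def field_simps)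
    finally show ?thesis by simp
  qed
  have gs: "integrable ?P (\<lambda>z. (g (tshift a z))\<^sup>2)" for a
    using integrable_tshift[OF M g] .
  have D: "integrable ?P (\<lambda>z. (g (tshift a z) - g z)\<^sup>2)" for a
  proof (rule Bochner_Integration.integrable_bound[where f="\<lambda>z. 2 * (g (tshift a z))\<^sup>2 + 2 * (g z)\<^sup>2"])
    show "AE z in ?P. norm ((g (tshift a z) - g z)\<^sup>2) \<le> norm (2 * (g (tshift a z))\<^sup>2 + 2 * (g z)\<^sup>2)"
    proof (intro always_eventually allI)
      fix z
      have "0 \<le> (g (tshift a z) + g z)\<^sup>2" by simp
      then have "(g (tshift a z) - g z)\<^sup>2 \<le> 2 * (g (tshift a z))\<^sup>2 + 2 * (g z)\<^sup>2"
        unfolding power2_sum power2_diff by linarith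
      then show "norm ((g (tshift a z) - g z)\<^sup>2) \<le> norm (2 * (g (tshift a z))\<^sup>2 + 2 * (g z)\<^sup>2)"
        by simp
    qed
  qed (use gs g in auto)
  have "\<forall>\<^sub>F k in sequentially. (LINT z|?P. (g (tshift (s k) z) - g z)\<^sup>2) < d * (e/2)"
    using tshift_continuous_L2[OF M _ g s] d e by (intro order_tendstoD(2)) auto
  then obtain N where N: "\<And>k. k \<ge> N \<Longrightarrow> (LINT z|?P. (g (tshift (s k) z) - g z)\<^sup>2) < d * (e/2)"
    by (auto simp: eventually_sequentially)
  show "\<exists>no. \<forall>n\<ge>no. norm ((LINT z|?P. f z * g (tshift (s n) z)) - (LINT z|?P. f z * g z)) < e"
  proof (intro exI allI impI)
    fix k assume "k \<ge> N"
    have "(LINT z|?P. f z * g (tshift (s k) z)) - (LINT z|?P. f z * g z)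
      = (LINT z|?P. f z * g (tshift (s k) z) - f z * g z)"
      by (rule Bochner_Integration.integral_diff[symmetric]) (intro integrable_mult_L2 f g gs; measurable)+
    also have "\<dots> = (LINT z|?P. f z * (g (tshift (s k) z) - g z))"
      by (simp add: right_diff_distrib)
    also have "\<bar>\<dots>\<bar> \<le> d * A + (LINT z|?P. (g (tshift (s k) z) - g z)\<^sup>2) / d"
      unfolding A_def by (rule abs_integral_mult_le[OF _ _ f D d]) measurable
    also have "\<dots> < e/2 + e/2"
      using dA N[OF \<open>k \<ge> N\<close>] d by (intro add_strict_mono) (auto simp: field_simps)
    finally show "norm ((LINT z|?P. f z * g (tshift (s k) z)) - (LINT z|?P. f z * g z)) < e" by simp
  qed
qed

lemma integrable_pair_tshift:
  fixes F :: "real \<times> 'b \<Rightarrow> real"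
  assumes M: "sigma_finite_measure M" and F: "integrable (lborel \<Otimes>\<^sub>M M) F"
  shows "integrable (unit_unif \<Otimes>\<^sub>M (lborel \<Otimes>\<^sub>M M)) (\<lambda>(s, z). F (tshift (h * s) z))"
proof -
  interpret M: sigma_finite_measure M by fact
  interpret P: pair_sigma_finite "lborel :: real measure" M ..
  interpret Q: pair_sigma_finite unit_unif "(lborel :: real measure) \<Otimes>\<^sub>M M" ..
  have [measurable]: "F \<in> borel_measurable (lborel \<Otimes>\<^sub>M M)" using F by auto
  have m[measurable]: "(\<lambda>(s, z). F (tshift (h * s) z)) \<in> borel_measurable (unit_unif \<Otimes>\<^sub>M (lborel \<Otimes>\<^sub>M M))"
    unfolding tshift_def by measurable
  show ?thesis
  proof (rule Q.Fubini_integrable[OF m])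
    have "(LINT z|(lborel \<Otimes>\<^sub>M M). norm (F (tshift a z))) = (LINT z|(lborel \<Otimes>\<^sub>M M). norm (F z))" for a
      by (rule integral_tshift[OF M]) measurable
    then show "integrable unit_unif (\<lambda>x. LINT y|(lborel \<Otimes>\<^sub>M M). norm (case (x, y) of (s, z) \<Rightarrow> F (tshift (h * s) z)))"
      by simp
    show "AE x in unit_unif. integrable (lborel \<Otimes>\<^sub>M M) (\<lambda>y. case (x, y) of (s, z) \<Rightarrow> F (tshift (h * s) z))"
      using integrable_tshift[OF M F] by simp
  qed
qed

lemma integrable_pair_tshift_mult:
  fixes f g :: "real \<times> 'b \<Rightarrow> real"
  assumes M: "sigma_finite_measure M"
    and fm[measurable]: "f \<in> borel_measurable (lborel \<Otimes>\<^sub>M M)" and gm[measurable]: "g \<in> borel_measurable (lborel \<Otimes>\<^sub>M M)"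
    and f: "integrable (lborel \<Otimes>\<^sub>M M) (\<lambda>z. (f z)\<^sup>2)"
    and g: "integrable (lborel \<Otimes>\<^sub>M M) (\<lambda>z. (g z)\<^sup>2)"
  shows "integrable (unit_unif \<Otimes>\<^sub>M (lborel \<Otimes>\<^sub>M M)) (\<lambda>(s, z). f z * g (tshift (h * s) z))"
proof -
  have [measurable]: "(\<lambda>w. g (tshift (h * fst w) (snd w))) \<in> borel_measurable (unit_unif \<Otimes>\<^sub>M (lborel \<Otimes>\<^sub>M M))"
    unfolding tshift_def by measurable
  have 1: "integrable (unit_unif \<Otimes>\<^sub>M (lborel \<Otimes>\<^sub>M M)) (\<lambda>w. (f (snd w))\<^sup>2)"
    using integrable_pair_tshift[OF M f, of 0] by (simp add: tshift_def case_prod_beta')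
  have 2: "integrable (unit_unif \<Otimes>\<^sub>M (lborel \<Otimes>\<^sub>M M)) (\<lambda>w. (g (tshift (h * fst w) (snd w)))\<^sup>2)"
    using integrable_pair_tshift[OF M g, of h] by (simp add: case_prod_beta')
  show ?thesis
    unfolding case_prod_beta' by (rule integrable_mult_L2[OF _ _ 1 2]) measurable
qed

text \<open>This is the limit of the gradient term in the weak formulation: \<open>f\<close> is the gradient of \<open>u\<^sup>m\<close>, and the
average of the shifts of \<open>g\<close> is the gradient of the test function.\<close>

lemma tshift_averaged_correlation:
  fixes f g :: "real \<times> 'b \<Rightarrow> real"
  assumes M: "sigma_finite_measure M"
    and fm[measurable]: "f \<in> borel_measurable (lborel \<Otimes>\<^sub>M M)" and gm[measurable]: "g \<in> borel_measurable (lborel \<Otimes>\<^sub>M M)"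
    and f: "integrable (lborel \<Otimes>\<^sub>M M) (\<lambda>z. (f z)\<^sup>2)"
    and g: "integrable (lborel \<Otimes>\<^sub>M M) (\<lambda>z. (g z)\<^sup>2)" and h: "h \<longlonglongrightarrow> 0"
  shows "(\<lambda>k. LINT s|unit_unif. LINT z|(lborel \<Otimes>\<^sub>M M). f z * g (tshift (h k * s) z)) \<longlonglongrightarrow> (LINT z|(lborel \<Otimes>\<^sub>M M). f z * g z)"
proof -
  interpret M: sigma_finite_measure M by fact
  interpret P: pair_sigma_finite "lborel :: real measure" M ..
  interpret Q: pair_sigma_finite unit_unif "(lborel :: real measure) \<Otimes>\<^sub>M M" ..
  let ?P = "lborel \<Otimes>\<^sub>M M"
  define B where "B = (LINT z|?P. (f z)\<^sup>2) + (LINT z|?P. (g z)\<^sup>2)"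
  have m: "(\<lambda>s. LINT z|?P. f z * g (tshift (h k * s) z)) \<in> borel_measurable unit_unif" for k
    unfolding tshift_def by measurable
  have "(\<lambda>k. LINT s|unit_unif. LINT z|?P. f z * g (tshift (h k * s) z)) \<longlonglongrightarrow> (LINT s|unit_unif. LINT z|?P. f z * g z)"
  proof (rule integral_dominated_convergence[where w="\<lambda>_. B"])
    show "AE s in unit_unif. (\<lambda>k. LINT z|?P. f z * g (tshift (h k * s) z)) \<longlonglongrightarrow> (LINT z|?P. f z * g z)"
      by (intro always_eventually allI tshift_correlation_continuous[OF M fm gm f g]
          tendsto_mult_left_zero h)
    show "AE s in unit_unif. norm (LINT z|?P. f z * g (tshift (h k * s) z)) \<le> B" for k
    proof (intro always_eventually allI)
      fix s
      have "\<bar>LINT z|?P. f z * g (tshift (h k * s) z)\<bar> \<le> 1 * (LINT z|?P. (f z)\<^sup>2) + (LINT z|?P. (g (tshift (h k * s) z))\<^sup>2) / 1"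
        by (rule abs_integral_mult_le[OF _ _ f integrable_tshift[OF M g]]) measurable
      also have "(LINT z|?P. (g (tshift (h k * s) z))\<^sup>2) = (LINT z|?P. (g z)\<^sup>2)"
        by (rule integral_tshift[OF M, of "\<lambda>z. (g z)\<^sup>2"]) measurable
      finally show "norm (LINT z|?P. f z * g (tshift (h k * s) z)) \<le> B" by (simp add: B_def)
    qed
  qed (use m in auto)
  then show ?thesis using unit_unif.prob_space by simp
qed

lemma integrable_pair_directional:
  fixes f :: "'a::euclidean_space \<Rightarrow> real"
  assumes f: "integrable lborel f"
  shows "integrable (unit_unif \<Otimes>\<^sub>M lborel) (\<lambda>(s, x). f (x + (h * s) *\<^sub>R d))"
proof -
  interpret Q: pair_sigma_finite unit_unif "lborel :: 'a measure" ..
  have [measurable]: "f \<in> borel_measurable borel" using f by auto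
  have m[measurable]: "(\<lambda>(s, x). f (x + (h * s) *\<^sub>R d)) \<in> borel_measurable (unit_unif \<Otimes>\<^sub>M lborel)"
    by measurable
  show ?thesis
  proof (rule Q.Fubini_integrable[OF m])
    have "(LINT x|lborel. norm (f (x + a))) = (LINT x|lborel. norm (f x))" for a
      by (rule integral_translate[of "\<lambda>x. norm (f x)"]) measurable
    then show "integrable unit_unif (\<lambda>s. LINT x|lborel. norm (case (s, x) of (s, x) \<Rightarrow> f (x + (h * s) *\<^sub>R d)))"
      by simp
    show "AE s in unit_unif. integrable lborel (\<lambda>x. case (s, x) of (s, x) \<Rightarrow> f (x + (h * s) *\<^sub>R d))"
      using integrable_translate[OF f] by simp
  qed
qed

text \<open>Averages along short segments converge in the mean, since the translations under the average do so.\<close>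

lemma directional_average_L1:
  fixes f :: "'a::euclidean_space \<Rightarrow> real"
  assumes f: "integrable lborel f" and h: "h \<longlonglongrightarrow> 0"
  shows "(\<lambda>k. LINT x|lborel. \<bar>(LINT s|unit_unif. f (x + (h k * s) *\<^sub>R d)) - f x\<bar>) \<longlonglongrightarrow> 0"
    and "integrable lborel (\<lambda>x. LINT s|unit_unif. f (x + (a * s) *\<^sub>R d))"
proof -
  interpret Q: pair_sigma_finite unit_unif "lborel :: 'a measure" ..
  have [measurable]: "f \<in> borel_measurable borel" using f by auto
  have I: "integrable (unit_unif \<Otimes>\<^sub>M lborel) (\<lambda>(s, x). f (x + (a * s) *\<^sub>R d))" for a
    by (rule integrable_pair_directional[OF f])
  have I0: "integrable (unit_unif \<Otimes>\<^sub>M lborel) (\<lambda>(s, x). f x)"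
    using I[of 0] by simp
  have ID: "integrable (unit_unif \<Otimes>\<^sub>M lborel) (\<lambda>(s, x). \<bar>f (x + (a * s) *\<^sub>R d) - f x\<bar>)" for a
    using Bochner_Integration.integrable_diff[OF I I0, THEN integrable_abs] by (simp add: case_prod_beta')
  show i: "integrable lborel (\<lambda>x. LINT s|unit_unif. f (x + (a * s) *\<^sub>R d))" for a
    using Q.integrable_snd[OF I[of a]] .
  have AEi: "AE x in lborel. integrable unit_unif (\<lambda>s. f (x + (a * s) *\<^sub>R d))" for a
    using Q.AE_integrable_snd[OF I[of a]] .
  have le: "(LINT x|lborel. \<bar>(LINT s|unit_unif. f (x + (a * s) *\<^sub>R d)) - f x\<bar>)
      \<le> (LINT s|unit_unif. LINT x|lborel. \<bar>f (x + (a * s) *\<^sub>R d) - f x\<bar>)" for a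
  proof -
    have "(LINT x|lborel. \<bar>(LINT s|unit_unif. f (x + (a * s) *\<^sub>R d)) - f x\<bar>)
      \<le> (LINT x|lborel. LINT s|unit_unif. \<bar>f (x + (a * s) *\<^sub>R d) - f x\<bar>)"
    proof (rule integral_mono_AE)
      show "integrable lborel (\<lambda>x. \<bar>(LINT s|unit_unif. f (x + (a * s) *\<^sub>R d)) - f x\<bar>)"
        using i[of a] f by auto
      show "integrable lborel (\<lambda>x. LINT s|unit_unif. \<bar>f (x + (a * s) *\<^sub>R d) - f x\<bar>)"
        using Q.integrable_snd[OF ID[of a]] .
      show "AE x in lborel. \<bar>(LINT s|unit_unif. f (x + (a * s) *\<^sub>R d)) - f x\<bar> \<le> (LINT s|unit_unif. \<bar>f (x + (a * s) *\<^sub>R d) - f x\<bar>)"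
        using AEi[of a]
      proof eventually_elim
        case (elim x)
        have "(LINT s|unit_unif. f (x + (a * s) *\<^sub>R d)) - f x = (LINT s|unit_unif. f (x + (a * s) *\<^sub>R d) - f x)"
          using elim unit_unif.prob_space by simp
        also have "\<bar>\<dots>\<bar> \<le> (LINT s|unit_unif. \<bar>f (x + (a * s) *\<^sub>R d) - f x\<bar>)" by (rule integral_abs_bound)
        finally show ?case .
      qed
    qed
    also have "\<dots> = (LINT s|unit_unif. LINT x|lborel. \<bar>f (x + (a * s) *\<^sub>R d) - f x\<bar>)"
      by (rule Q.Fubini_integral[OF ID])
    finally show ?thesis .
  qed
  have "(\<lambda>k. LINT s|unit_unif. LINT x|lborel. \<bar>f (x + (h k * s) *\<^sub>R d) - f x\<bar>) \<longlonglongrightarrow> (LINT s|unit_unif. 0)"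
  proof (rule integral_dominated_convergence[where w="\<lambda>_. 2 * (LINT x|lborel. \<bar>f x\<bar>)"])
    show "AE s in unit_unif. (\<lambda>k. LINT x|lborel. \<bar>f (x + (h k * s) *\<^sub>R d) - f x\<bar>) \<longlonglongrightarrow> 0"
    proof (intro always_eventually allI translation_continuous_L1 f)
      fix s
      have "(\<lambda>k. (h k * s) *\<^sub>R d) \<longlonglongrightarrow> (0 * s) *\<^sub>R d" by (intro tendsto_intros h)
      then show "(\<lambda>k. (h k * s) *\<^sub>R d) \<longlonglongrightarrow> 0" by simp
    qed
    show "AE s in unit_unif. norm (LINT x|lborel. \<bar>f (x + (h k * s) *\<^sub>R d) - f x\<bar>) \<le> 2 * (LINT x|lborel. \<bar>f x\<bar>)" for k
    proof (intro always_eventually allI)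
      fix s
      let ?b = "(h k * s) *\<^sub>R d"
      have "(LINT x|lborel. \<bar>f (x + ?b) - f x\<bar>) \<le> (LINT x|lborel. \<bar>f (x + ?b)\<bar> + \<bar>f x\<bar>)"
        by (rule integral_mono) (use f integrable_translate[OF f, of ?b] in auto)
      also have "\<dots> = (LINT x|lborel. \<bar>f (x + ?b)\<bar>) + (LINT x|lborel. \<bar>f x\<bar>)"
        using f integrable_translate[OF f, of ?b] by simp
      also have "(LINT x|lborel. \<bar>f (x + ?b)\<bar>) = (LINT x|lborel. \<bar>f x\<bar>)"
        by (rule integral_translate[of "\<lambda>x. \<bar>f x\<bar>"]) measurable
      finally show "norm (LINT x|lborel. \<bar>f (x + ?b) - f x\<bar>) \<le> 2 * (LINT x|lborel. \<bar>f x\<bar>)" by simp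
    qed
    show "(\<lambda>s. LINT x|lborel. \<bar>f (x + (h k * s) *\<^sub>R d) - f x\<bar>) \<in> borel_measurable unit_unif" for k
      by measurable
  qed auto
  then have lim: "(\<lambda>k. LINT s|unit_unif. LINT x|lborel. \<bar>f (x + (h k * s) *\<^sub>R d) - f x\<bar>) \<longlonglongrightarrow> 0" by simp
  show "(\<lambda>k. LINT x|lborel. \<bar>(LINT s|unit_unif. f (x + (h k * s) *\<^sub>R d)) - f x\<bar>) \<longlonglongrightarrow> 0"
    by (rule tendsto_sandwich[OF _ _ tendsto_const lim]) (use le in \<open>auto intro!: always_eventually\<close>)
qed

section \<open>Smooth bump functions\<close>

definition smooth1 :: "(real \<Rightarrow> real) \<Rightarrow> bool" where
  "smooth1 f \<longleftrightarrow> (\<forall>k x. (deriv ^^ k) f differentiable (at x))"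

text \<open>A family of functions that contains a derivative of each of its members consists of smooth functions.\<close>

lemma smooth1_coinduct:
  assumes "f \<in> S" and S: "\<And>g. g \<in> S \<Longrightarrow> \<exists>g'\<in>S. \<forall>x. (g has_real_derivative g' x) (at x)"
  shows "smooth1 f"
proof -
  have der: "deriv g \<in> S \<and> (\<forall>x. g differentiable (at x))" if g: "g \<in> S" for g
  proof -
    obtain g' where g': "g' \<in> S" "\<And>x. (g has_real_derivative g' x) (at x)" using S[OF g] by auto
    then have "deriv g = g'" by (intro ext DERIV_imp_deriv) auto
    then show ?thesis using g' by (auto simp: real_differentiable_def)
  qed
  have "(deriv ^^ k) f \<in> S" for k by (induction k) (use assms(1) der in auto)
  then show ?thesis unfolding smooth1_def using der by blast
qed

lemma smooth1_deriv: "smooth1 f \<Longrightarrow> smooth1 (deriv f)"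
  unfolding smooth1_def by (metis comp_apply funpow_Suc_right)

lemma smooth1_DERIV: "smooth1 f \<Longrightarrow> (f has_real_derivative deriv f x) (at x)"
proof -
  assume "smooth1 f"
  then have "(deriv ^^ 0) f differentiable (at x)" unfolding smooth1_def by blast
  then show ?thesis by (simp add: DERIV_deriv_iff_real_differentiable)
qed

text \<open>This serves at points where two formulas for a function meet.\<close>

lemma DERIV_zero_if_quadratic_bound:
  fixes f :: "real \<Rightarrow> real"
  assumes "\<And>x. \<bar>f x\<bar> \<le> B * (x - a)\<^sup>2"
  shows "(f has_real_derivative 0) (at a)"
proof -
  have fa: "f a = 0" using assms[of a] by simp
  have "((\<lambda>h. (f (a + h) - f a) / h) \<longlongrightarrow> 0) (at 0)"
  proof (rule Lim_null_comparison)
    show "\<forall>\<^sub>F h in at 0. norm ((f (a + h) - f a) / h) \<le> B * \<bar>h\<bar>"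
    proof (intro always_eventually allI)
      fix h :: real
      show "norm ((f (a + h) - f a) / h) \<le> B * \<bar>h\<bar>"
      proof (cases "h = 0")
        case False
        have "\<bar>f (a + h)\<bar> \<le> B * h\<^sup>2" using assms[of "a + h"] by simp
        then have "\<bar>f (a + h)\<bar> / \<bar>h\<bar> \<le> B * h\<^sup>2 / \<bar>h\<bar>" by (intro divide_right_mono) auto
        also have "\<dots> = B * \<bar>h\<bar>" using False by (simp add: power2_eq_square abs_if)
        finally show ?thesis by (simp add: fa abs_divide)
      qed simp
    qed
    have "((\<lambda>h. B * \<bar>h\<bar>) \<longlongrightarrow> B * \<bar>0\<bar>) (at 0)" by (intro tendsto_intros)
    then show "((\<lambda>h. B * \<bar>h\<bar>) \<longlongrightarrow> 0) (at 0)" by simp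
  qed
  then show ?thesis by (simp add: DERIV_def)
qed

text \<open>With \<open>q = (x - l) * (u - x)\<close>, these are the functions \<open>p * q powi (- k) * exp (- c / q)\<close> extended by zero.
For fixed \<open>l\<close>, \<open>u\<close>, \<open>c\<close> they form a family closed under differentiation which contains the standard
bump (\<open>p = 1\<close>, \<open>k = 0\<close>).\<close>

definition bump_jet :: "real \<Rightarrow> real \<Rightarrow> real \<Rightarrow> real poly \<Rightarrow> nat \<Rightarrow> real \<Rightarrow> real" where
  "bump_jet l u c p k x = (if l < x \<and> x < u
     then poly p x * (1 / ((x - l) * (u - x))) ^ k * exp (- c / ((x - l) * (u - x))) else 0)"

lemma exp_ge_term: "0 \<le> x \<Longrightarrow> x ^ n / fact n \<le> exp (x::real)"
proof -
  assume x: "0 \<le> x"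
  have s: "(\<lambda>n. x ^ n / fact n) sums exp x"
    using exp_converges[of x] by (simp add: divide_inverse mult.commute scaleR_conv_of_real)
  have "(\<Sum>i\<in>{n}. x ^ i / fact i) \<le> (\<Sum>i. x ^ i / fact i)"
    by (rule sum_le_suminf) (use x s in \<open>auto intro: sums_summable\<close>)
  also have "\<dots> = exp x" using s by (rule sums_unique[symmetric])
  finally have "(\<Sum>i\<in>{n}. x ^ i / fact i) \<le> exp x" .
  then show ?thesis by simp
qed

text \<open>One term of the exponential series of \<open>c / q\<close>, the one of order \<open>k + 2\<close>, beats \<open>(1 / q) ^ k\<close> and leaves a
factor \<open>q\<^sup>2\<close>.\<close>

lemma exp_neg_recip_le:
  fixes c q :: real assumes c: "0 < c" and q: "0 < q"
  shows "(1 / q) ^ k * exp (- c / q) \<le> fact (k + 2) / c ^ (k + 2) * q\<^sup>2"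
proof -
  have "(c / q) ^ (k + 2) / fact (k + 2) \<le> exp (c / q)"
    by (rule exp_ge_term) (use assms in auto)
  then have "(c / q) ^ (k + 2) / fact (k + 2) * exp (- c / q) \<le> exp (c / q) * exp (- c / q)"
    by (rule mult_right_mono) simp
  also have "\<dots> = 1" by (simp flip: exp_add)
  finally have "(c / q) ^ (k + 2) / fact (k + 2) * exp (- c / q) \<le> 1" .
  then have "fact (k + 2) / c ^ (k + 2) * q\<^sup>2 * ((c / q) ^ (k + 2) / fact (k + 2) * exp (- c / q))
      \<le> fact (k + 2) / c ^ (k + 2) * q\<^sup>2 * 1"
    by (rule mult_left_mono) (use c in auto)
  also have "fact (k + 2) / c ^ (k + 2) * q\<^sup>2 * ((c / q) ^ (k + 2) / fact (k + 2) * exp (- c / q))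
      = (1 / q) ^ k * exp (- c / q)"
  proof -
    have 1: "(c / q) ^ (k + 2) = c ^ (k + 2) * (1 / q) ^ k * (1 / q)\<^sup>2"
      by (simp add: power_divide power_add power2_eq_square)
    have 2: "F / C * x * (C * R * y / F * E) = x * y * (R * E)" if "F \<noteq> 0" "C \<noteq> 0" for F C x y R E :: real
      using that by simp
    have 3: "q\<^sup>2 * (1 / q)\<^sup>2 = 1" using q by (simp add: power_divide)
    show ?thesis unfolding 1 by (subst 2) (use c 3 in auto)
  qed
  finally show ?thesis by simp
qed

text \<open>Hence the derivative exists and vanishes outside the open interval \<open>(l, u)\<close>, its end points included.\<close>

lemma bump_jet_quadratic_bound:
  assumes c: "0 < c" and a: "a \<le> l \<or> u \<le> a"
  obtains B where "\<And>x. \<bar>bump_jet l u c p k x\<bar> \<le> B * (x - a)\<^sup>2"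
proof -
  have "compact (poly p ` {l..u})"
    by (intro compact_continuous_image continuous_intros) auto
  then obtain P where P: "\<And>x. x \<in> {l..u} \<Longrightarrow> \<bar>poly p x\<bar> \<le> P" 
    by (metis compact_imp_bounded bounded_iff image_eqI real_norm_def)
  define A where "A = fact (k + 2) / c ^ (k + 2)"
  have A: "0 \<le> A" unfolding A_def using c by simp
  have "\<bar>bump_jet l u c p k x\<bar> \<le> (\<bar>P\<bar> * A * (u - l)\<^sup>2) * (x - a)\<^sup>2" for x
  proof (cases "l < x \<and> x < u")
    case True
    define q where "q = (x - l) * (u - x)"
    have q: "0 < q" using True by (simp add: q_def)
    have "q \<le> (u - l) * \<bar>x - a\<bar>"
    proof (cases "a \<le> l")
      case True': True
      have "(x - l) * (u - x) \<le> \<bar>x - a\<bar> * (u - l)"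
        by (rule mult_mono) (use True True' in auto)
      then show ?thesis by (simp add: q_def mult.commute)
    next
      case False
      then have "u \<le> a" using a by simp
      then have "(x - l) * (u - x) \<le> (u - l) * \<bar>x - a\<bar>"
        by (intro mult_mono) (use True in auto)
      then show ?thesis by (simp add: q_def)
    qed
    then have "q\<^sup>2 \<le> ((u - l) * \<bar>x - a\<bar>)\<^sup>2" using q by (intro power_mono) auto
    then have q2: "q\<^sup>2 \<le> (u - l)\<^sup>2 * (x - a)\<^sup>2" by (simp add: power_mult_distrib)
    have "\<bar>bump_jet l u c p k x\<bar> = \<bar>poly p x\<bar> * ((1 / q) ^ k * exp (- c / q))"
      using True q by (simp add: bump_jet_def q_def[symmetric] abs_mult power_abs)
    also have "\<dots> \<le> \<bar>P\<bar> * (A * q\<^sup>2)"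
    proof (rule mult_mono)
      show "(1 / q) ^ k * exp (- c / q) \<le> A * q\<^sup>2" unfolding A_def by (rule exp_neg_recip_le[OF c q])
    qed (use P[of x] True q in auto)
    also have "\<dots> \<le> \<bar>P\<bar> * (A * ((u - l)\<^sup>2 * (x - a)\<^sup>2))"
      using q2 A by (intro mult_left_mono) auto
    finally show ?thesis by (simp add: mult_ac)
  next
    case False
    then have "bump_jet l u c p k x = 0" by (auto simp: bump_jet_def)
    then show ?thesis using A by simp
  qed
  then show ?thesis using that by blast
qed

lemma bump_jet_has_derivative:
  fixes l u c :: real
  assumes c: "0 < c"
  defines "Q \<equiv> [:- l, 1:] * [:u, - 1:]"
  shows "(bump_jet l u c p k has_real_derivative
    bump_jet l u c (pderiv p * Q\<^sup>2 - smult (real k) (p * pderiv Q * Q) + smult c (p * pderiv Q)) (k + 2) x) (at x)"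
proof (cases "l < x \<and> x < u")
  case True
  have Qx: "poly Q y = (y - l) * (u - y)" for y by (simp add: Q_def algebra_simps)
  define q where "q = poly Q x"
  define q' where "q' = poly (pderiv Q) x"
  have q: "0 < q" using True by (simp add: q_def Qx)
  have DQ: "(poly Q has_real_derivative q') (at x)" unfolding q'_def by (rule poly_DERIV)
  have DR: "((\<lambda>y. 1 / poly Q y) has_real_derivative - q' * (1 / q)\<^sup>2) (at x)"
    using q by (auto intro!: derivative_eq_intros DQ simp: q_def[symmetric] q'_def[symmetric] power2_eq_square)
  have DE: "((\<lambda>y. exp (- c / poly Q y)) has_real_derivative exp (- c / q) * (c * q' * (1 / q)\<^sup>2)) (at x)"
    using q by (auto intro!: derivative_eq_intros DQ simp: q_def[symmetric] q'_def[symmetric] power2_eq_square)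
  have D: "((\<lambda>y. poly p y * (1 / poly Q y) ^ k * exp (- c / poly Q y)) has_real_derivative
      (poly (pderiv p) x * (1 / q) ^ k + poly p x * (real k * (1 / q) ^ (k - 1) * (- q' * (1 / q)\<^sup>2))) * exp (- c / q)
      + poly p x * (1 / q) ^ k * (exp (- c / q) * (c * q' * (1 / q)\<^sup>2))) (at x)"
    by (rule DERIV_cong, rule DERIV_mult[OF DERIV_mult[OF poly_DERIV DERIV_power[OF DR]] DE])
      (simp add: q_def algebra_simps)
  have rq: "(1 / q)\<^sup>2 * q\<^sup>2 = 1" "(1/q) * q = 1" using q by (auto simp: power_divide)
  have kk: "real k * (1 / q) ^ (k - 1) * (1 / q) = real k * (1/q)^k" by (cases k) auto
  have e: "(poly (pderiv p) x * (1 / q) ^ k + poly p x * (real k * (1 / q) ^ (k - 1) * (- q' * (1 / q)\<^sup>2))) * exp (- c / q)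
      + poly p x * (1 / q) ^ k * (exp (- c / q) * (c * q' * (1 / q)\<^sup>2))
    = (poly (pderiv p) x * q\<^sup>2 - real k * (poly p x * q' * q) + c * (poly p x * q')) * (1/q)^(k+2) * exp (- c / q)"
  proof -
    have 1: "poly p x * (real k * (1 / q) ^ (k - 1) * (- q' * (1 / q)\<^sup>2)) = - (real k * (poly p x * q' * q)) * (1/q)^(k+2)"
    proof -
      have "poly p x * (real k * (1 / q) ^ (k - 1) * (- q' * (1 / q)\<^sup>2))
        = - (poly p x * q' * (1/q)) * (real k * (1 / q) ^ (k - 1) * (1 / q))"
        by (simp add: power2_eq_square)
      also have "\<dots> = - (poly p x * q' * (1/q)) * (real k * (1/q)^k)" unfolding kk ..
      also have "\<dots> = - (real k * (poly p x * q' * q)) * (1/q)^(k+2)"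
        using q by (simp add: power_add power2_eq_square)
      finally show ?thesis .
    qed
    have 2: "poly (pderiv p) x * (1 / q) ^ k = poly (pderiv p) x * q\<^sup>2 * (1/q)^(k+2)"
      using q by (simp add: power_add power_divide power2_eq_square)
    show ?thesis unfolding 1 2 by (simp add: power_add power2_eq_square algebra_simps)
  qed
  have "(bump_jet l u c p k has_real_derivative
      (poly (pderiv p) x * (1 / q) ^ k + poly p x * (real k * (1 / q) ^ (k - 1) * (- q' * (1 / q)\<^sup>2))) * exp (- c / q)
      + poly p x * (1 / q) ^ k * (exp (- c / q) * (c * q' * (1 / q)\<^sup>2))) (at x)"
  proof (rule has_field_derivative_transform_within_open[OF D, of "{l<..<u}"])
    fix y assume "y \<in> {l<..<u}"
    then show "poly p y * (1 / poly Q y) ^ k * exp (- c / poly Q y) = bump_jet l u c p k y"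
      by (simp add: bump_jet_def Qx)
  qed (use True in auto)
  then show ?thesis unfolding e using True
    by (simp add: bump_jet_def q_def Qx[symmetric] q'_def)
next
  case False
  then have "x \<le> l \<or> u \<le> x" by auto
  then obtain B where "\<And>y. \<bar>bump_jet l u c p k y\<bar> \<le> B * (y - x)\<^sup>2"
    using bump_jet_quadratic_bound[OF c, of x l u p k] by blast
  then have "(bump_jet l u c p k has_real_derivative 0) (at x)"
    by (rule DERIV_zero_if_quadratic_bound)
  then show ?thesis using False by (auto simp: bump_jet_def)
qed

lemma smooth1_bump_jet: "0 < c \<Longrightarrow> smooth1 (bump_jet l u c p k)"
  by (rule smooth1_coinduct[where S="{bump_jet l u c p k |p k. True}"])
     (use bump_jet_has_derivative in blast)+

definition tensor :: "('a::euclidean_space \<Rightarrow> real \<Rightarrow> real) \<Rightarrow> 'a \<Rightarrow> real" where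
  "tensor p x = (\<Prod>b\<in>Basis. p b (x \<bullet> b))"

lemma tensor_has_derivative:
  assumes "\<And>b. b \<in> Basis \<Longrightarrow> smooth1 (p b)"
  shows "(tensor p has_derivative (\<lambda>h. \<Sum>b\<in>Basis. (h \<bullet> b) * tensor (p(b := deriv (p b))) x)) (at x)"
proof -
  have "((\<lambda>x. \<Prod>b\<in>Basis. p b (x \<bullet> b)) has_derivative
     (\<lambda>h. \<Sum>b\<in>Basis. (deriv (p b) (x \<bullet> b) * (h \<bullet> b)) * (\<Prod>b'\<in>Basis - {b}. p b' (x \<bullet> b')))) (at x)"
  proof (rule has_derivative_prod)
    fix b :: 'a assume b: "b \<in> Basis"
    have "(p b has_derivative (*) (deriv (p b) (x \<bullet> b))) (at (x \<bullet> b))"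
      using smooth1_DERIV[OF assms[OF b]] by (simp add: has_field_derivative_def)
    moreover have "((\<lambda>x. x \<bullet> b) has_derivative (\<lambda>h. h \<bullet> b)) (at x)"
      by (intro derivative_eq_intros) auto
    ultimately show "((\<lambda>x. p b (x \<bullet> b)) has_derivative (\<lambda>h. deriv (p b) (x \<bullet> b) * (h \<bullet> b))) (at x)"
      using has_derivative_compose[of "\<lambda>x. x \<bullet> b" "\<lambda>h. h \<bullet> b" x UNIV "p b" "(*) (deriv (p b) (x \<bullet> b))"] by simp
  qed
  moreover have "(deriv (p b) (x \<bullet> b) * (h \<bullet> b)) * (\<Prod>b'\<in>Basis - {b}. p b' (x \<bullet> b')) = (h \<bullet> b) * tensor (p(b := deriv (p b))) x"
    if "b \<in> Basis" for b h
  proof -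
    have "tensor (p(b := deriv (p b))) x = deriv (p b) (x \<bullet> b) * (\<Prod>b'\<in>Basis - {b}. (p(b := deriv (p b))) b' (x \<bullet> b'))"
      unfolding tensor_def by (subst prod.remove[OF finite_Basis that]) simp
    also have "(\<Prod>b'\<in>Basis - {b}. (p(b := deriv (p b))) b' (x \<bullet> b')) = (\<Prod>b'\<in>Basis - {b}. p b' (x \<bullet> b'))"
      by (rule prod.cong) auto
    finally have e: "tensor (p(b := deriv (p b))) x = deriv (p b) (x \<bullet> b) * (\<Prod>b'\<in>Basis - {b}. p b' (x \<bullet> b'))" .
    show ?thesis unfolding e by (simp only: mult_ac)
  qed
  moreover have "tensor p = (\<lambda>x. \<Prod>b\<in>Basis. p b (x \<bullet> b))" by (intro ext) (simp add: tensor_def)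
  ultimately show ?thesis by simp
qed

lemma frechet_tensor:
  assumes "\<And>b. b \<in> Basis \<Longrightarrow> smooth1 (p b)" and b: "b \<in> Basis"
  shows "frechet_derivative (tensor p) (at x) b = tensor (p(b := deriv (p b))) x"
proof -
  have "frechet_derivative (tensor p) (at x) b = (\<Sum>b'\<in>Basis. (b \<bullet> b') * tensor (p(b' := deriv (p b'))) x)"
    by (simp flip: frechet_derivative_at[OF tensor_has_derivative[of p x, OF assms(1)]])
  also have "\<dots> = (\<Sum>b'\<in>Basis. if b' = b then tensor (p(b' := deriv (p b'))) x else 0)"
    by (rule sum.cong) (use b in \<open>auto simp: inner_Basis\<close>)
  finally show ?thesis using b by simp
qed

text \<open>Each partial derivative of a product of functions of one coordinate is again such a product, with one
factor differentiated.\<close>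

lemma tensor_diff_class:
  assumes "\<And>b. b \<in> Basis \<Longrightarrow> smooth1 (p b)"
  shows "diff_class (continuous_on UNIV) UNIV k (tensor p)"
  using assms
proof (induction k arbitrary: p)
  case 0
  then have "tensor p differentiable (at x)" for x
    using tensor_has_derivative[of p x] unfolding differentiable_def by blast
  then show ?case by (simp add: continuous_on_eq_continuous_at differentiable_imp_continuous_within)
next
  case (Suc k)
  have "tensor p differentiable (at x)" for x
    using tensor_has_derivative[of p x] Suc.prems unfolding differentiable_def by blast
  moreover have "diff_class (continuous_on UNIV) UNIV k (\<lambda>x. frechet_derivative (tensor p) (at x) b)"
    if b: "b \<in> Basis" for b
  proof -
    have "(\<lambda>x. frechet_derivative (tensor p) (at x) b) = tensor (p(b := deriv (p b)))"
      using frechet_tensor[of p b] Suc.prems b by auto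
    moreover have "diff_class (continuous_on UNIV) UNIV k (tensor (p(b := deriv (p b))))"
      by (rule Suc.IH) (use Suc.prems smooth1_deriv in auto)
    ultimately show ?thesis by simp
  qed
  ultimately show ?case by simp
qed

definition bump :: "'a::euclidean_space \<Rightarrow> 'a \<Rightarrow> real \<Rightarrow> 'a \<Rightarrow> real" where
  "bump l u c = tensor (\<lambda>b. bump_jet (l \<bullet> b) (u \<bullet> b) c 1 0)"

lemma bump_translate: "bump l u c (x - a) = bump (l + a) (u + a) c x"
proof -
  have "bump_jet (l \<bullet> b) (u \<bullet> b) c 1 0 ((x - a) \<bullet> b) = bump_jet ((l + a) \<bullet> b) ((u + a) \<bullet> b) c 1 0 (x \<bullet> b)" for b
    by (simp add: bump_jet_def inner_diff_left inner_add_left algebra_simps)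
  then show ?thesis by (simp add: bump_def tensor_def)
qed

lemma bump_outside: assumes "x \<notin> cbox l u" shows "bump l u c x = 0"
proof -
  obtain b where "b \<in> Basis" "\<not> (l \<bullet> b \<le> x \<bullet> b \<and> x \<bullet> b \<le> u \<bullet> b)"
    using assms by (auto simp: mem_box)
  then show ?thesis unfolding bump_def tensor_def
    by (intro prod_zero) (auto simp: bump_jet_def intro!: bexI[of _ b])
qed

lemma bump_C_c_infinity:
  assumes "0 < c" "cbox l u \<subseteq> \<Omega>"
  shows "C_c_infinity \<Omega> (bump l u c)"
  unfolding C_c_infinity_def
proof
  show "\<forall>k. diff_class (continuous_on UNIV) UNIV k (bump l u c)"
    unfolding bump_def using assms by (intro allI tensor_diff_class smooth1_bump_jet)
  show "\<exists>K. compact K \<and> K \<subseteq> \<Omega> \<and> (\<forall>x. x \<notin> K \<longrightarrow> bump l u c x = 0)"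
    using assms bump_outside by (intro exI[of _ "cbox l u"]) auto
qed

lemma bump_bounds: assumes "0 < c" shows "0 \<le> bump l u c x" "bump l u c x \<le> 1"
proof -
  have "0 \<le> bump_jet (l \<bullet> b) (u \<bullet> b) c 1 0 (x \<bullet> b) \<and> bump_jet (l \<bullet> b) (u \<bullet> b) c 1 0 (x \<bullet> b) \<le> 1" for b
    using assms by (auto simp: bump_jet_def)
  then show "0 \<le> bump l u c x" "bump l u c x \<le> 1"
    unfolding bump_def tensor_def by (auto intro: prod_nonneg prod_le_1)
qed

text \<open>On the open box the exponents tend to zero as \<open>c\<close> does, so that bumps test a function as well as
indicators of boxes do.\<close>

lemma bump_tendsto_indicator:
  "(\<lambda>n. bump l u (1 / real (Suc n)) x) \<longlonglongrightarrow> indicator (box l u) x"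
proof -
  have "(\<lambda>n. bump_jet (l \<bullet> b) (u \<bullet> b) (1 / real (Suc n)) 1 0 (x \<bullet> b)) \<longlonglongrightarrow> (if l \<bullet> b < x \<bullet> b \<and> x \<bullet> b < u \<bullet> b then 1 else 0)" for b
  proof (cases "l \<bullet> b < x \<bullet> b \<and> x \<bullet> b < u \<bullet> b")
    case True
    define q where "q = (x \<bullet> b - l \<bullet> b) * (u \<bullet> b - x \<bullet> b)"
    have "(\<lambda>n. exp (- (1 / real (Suc n)) / q)) \<longlonglongrightarrow> exp (- 0 / q)"
      using True by (intro tendsto_intros LIMSEQ_Suc[OF lim_1_over_n]) (auto simp: q_def)
    then show ?thesis using True by (simp add: bump_jet_def q_def)
  next
    case False
    then show ?thesis by (simp only: bump_jet_def False if_False) simp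
  qed
  then have "(\<lambda>n. bump l u (1 / real (Suc n)) x) \<longlonglongrightarrow> (\<Prod>b\<in>Basis. (if l \<bullet> b < x \<bullet> b \<and> x \<bullet> b < u \<bullet> b then 1 else 0))"
    unfolding bump_def tensor_def by (intro tendsto_prod)
  moreover have "(\<Prod>b\<in>Basis. (if l \<bullet> b < x \<bullet> b \<and> x \<bullet> b < u \<bullet> b then 1 else 0)) = indicat_real (box l u) x"
    by (auto simp: indicator_def mem_box prod_zero_iff)
  ultimately show ?thesis by simp
qed

section \<open>Difference quotients of weakly differentiable functions\<close>

lemma C_c_infinity_differentiable: "C_c_infinity \<Omega> \<phi> \<Longrightarrow> \<phi> differentiable (at x)"
  unfolding C_c_infinity_def by (metis diff_class.simps(2) UNIV_I)

lemma C_c_infinity_continuous: "C_c_infinity \<Omega> \<phi> \<Longrightarrow> continuous_on UNIV \<phi>"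
  unfolding C_c_infinity_def by (metis diff_class.simps(1))

lemma C_c_infinity_continuous_partial:
  assumes "C_c_infinity \<Omega> \<phi>" "b \<in> Basis"
  shows "continuous_on UNIV (\<lambda>x. frechet_derivative \<phi> (at x) b)"
proof -
  have "diff_class (continuous_on UNIV) UNIV (Suc 0) \<phi>"
    using assms unfolding C_c_infinity_def by blast
  then show ?thesis using assms(2) by simp
qed

lemma bounded_if_continuous_compact_support:
  fixes f :: "'a::euclidean_space \<Rightarrow> real"
  assumes f: "continuous_on UNIV f" and K: "compact K" and f0: "\<And>x. x \<notin> K \<Longrightarrow> f x = 0"
  shows "\<exists>B\<ge>0. \<forall>x. \<bar>f x\<bar> \<le> B"
proof -
  have "bounded (f ` K)"
    by (intro compact_imp_bounded compact_continuous_image continuous_on_subset[OF f] K) auto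
  then obtain B where "\<forall>x\<in>K. \<bar>f x\<bar> \<le> B" by (auto simp: bounded_iff)
  then show ?thesis using f0 by (intro exI[of _ "\<bar>B\<bar>"]) (metis abs_ge_self abs_ge_zero abs_zero order_trans)
qed

lemma C_c_infinity_support:
  assumes \<phi>: "C_c_infinity \<Omega> \<phi>"
  obtains K where "compact K" "K \<subseteq> \<Omega>" "\<And>x. x \<notin> K \<Longrightarrow> \<phi> x = 0"
    "\<And>x b. x \<notin> K \<Longrightarrow> frechet_derivative \<phi> (at x) b = 0"
proof -
  obtain K where K: "compact K" "K \<subseteq> \<Omega>" "\<And>x. x \<notin> K \<Longrightarrow> \<phi> x = 0"
    using \<phi> unfolding C_c_infinity_def by blast
  have "frechet_derivative \<phi> (at x) b = 0" if x: "x \<notin> K" for x b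
  proof -
    have "((\<lambda>_. 0) has_derivative (\<lambda>_. 0)) (at x)" by simp
    then have "(\<phi> has_derivative (\<lambda>_. 0)) (at x)"
      by (rule has_derivative_transform_within_open[of _ _ _ _ "- K"])
         (use K x in \<open>auto intro: compact_imp_closed\<close>)
    then show ?thesis by (metis frechet_derivative_at)
  qed
  then show ?thesis using K that by blast
qed

lemma C_c_infinity_bounded:
  assumes \<phi>: "C_c_infinity \<Omega> \<phi>" and b: "b \<in> Basis"
  obtains B where "0 \<le> B" "\<And>x. \<bar>\<phi> x\<bar> \<le> B" "\<And>x. \<bar>frechet_derivative \<phi> (at x) b\<bar> \<le> B"
proof -
  obtain K where K: "compact K" "K \<subseteq> \<Omega>" "\<And>x. x \<notin> K \<Longrightarrow> \<phi> x = 0"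
    "\<And>x b. x \<notin> K \<Longrightarrow> frechet_derivative \<phi> (at x) b = 0"
    using C_c_infinity_support[OF \<phi>] by metis
  obtain B1 where B1: "0 \<le> B1" "\<forall>x. \<bar>\<phi> x\<bar> \<le> B1"
    using bounded_if_continuous_compact_support[OF C_c_infinity_continuous[OF \<phi>] K(1) K(3)] by blast
  obtain B2 where B2: "0 \<le> B2" "\<forall>x. \<bar>frechet_derivative \<phi> (at x) b\<bar> \<le> B2"
    using bounded_if_continuous_compact_support[OF C_c_infinity_continuous_partial[OF \<phi> b] K(1) K(4)] by blast
  show ?thesis by (rule that[of "max B1 B2"]) (use B1 B2 in \<open>auto simp: le_max_iff_disj\<close>)
qed

lemma directional_DERIV:
  fixes \<phi> :: "'a::euclidean_space \<Rightarrow> real"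
  assumes d: "\<And>x. \<phi> differentiable (at x)"
  shows "((\<lambda>s. \<phi> (x + (h * s) *\<^sub>R d)) has_real_derivative h * frechet_derivative \<phi> (at (x + (h * s) *\<^sub>R d)) d) (at s)"
proof -
  let ?y = "x + (h * s) *\<^sub>R d"
  have 1: "((\<lambda>s. x + (h * s) *\<^sub>R d) has_derivative (\<lambda>r. (h * r) *\<^sub>R d)) (at s)"
    by (auto intro!: derivative_eq_intros)
  have 2: "(\<phi> has_derivative frechet_derivative \<phi> (at ?y)) (at ?y)"
    using d by (simp add: frechet_derivative_works)
  have "((\<lambda>s. \<phi> (x + (h * s) *\<^sub>R d)) has_derivative (\<lambda>r. frechet_derivative \<phi> (at ?y) ((h * r) *\<^sub>R d))) (at s)"
    by (rule has_derivative_compose[OF 1]) (use 2 in simp)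
  moreover have "frechet_derivative \<phi> (at ?y) ((h * r) *\<^sub>R d) = h * frechet_derivative \<phi> (at ?y) d * r" for r
    using linear_frechet_derivative[OF d, of ?y] by (simp add: linear_cmul)
  ultimately show ?thesis by (simp add: has_field_derivative_def)
qed

lemma directional_FTC:
  fixes \<phi> :: "'a::euclidean_space \<Rightarrow> real"
  assumes d: "\<And>x. \<phi> differentiable (at x)"
    and c: "continuous_on UNIV (\<lambda>x. frechet_derivative \<phi> (at x) d)"
  shows "\<phi> (x + h *\<^sub>R d) - \<phi> x = h * (LINT s|unit_unif. frechet_derivative \<phi> (at (x + (h * s) *\<^sub>R d)) d)"
proof -
  let ?f = "\<lambda>s. frechet_derivative \<phi> (at (x + (h * s) *\<^sub>R d)) d"
  have cf: "continuous_on UNIV ?f"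
    by (rule continuous_on_compose2[OF c]) (auto intro!: continuous_intros)
  then have m: "?f \<in> borel_measurable borel" by (rule borel_measurable_continuous_onI)
  have "(\<integral>s. (h * ?f s) * indicator {0..1} s \<partial>lborel) = \<phi> (x + (h * 1) *\<^sub>R d) - \<phi> (x + (h * 0) *\<^sub>R d)"
  proof (rule integral_FTC_Icc_real)
    show "((\<lambda>s. \<phi> (x + (h * s) *\<^sub>R d)) has_real_derivative h * ?f s) (at s)" for s
      by (rule directional_DERIV[OF d])
    show "isCont (\<lambda>s. h * ?f s) s" for s
      using cf by (auto simp: continuous_on_eq_continuous_at intro!: continuous_intros)
  qed simp
  then show ?thesis
    unfolding integral_unit_unif[OF m] set_lebesgue_integral_def by (simp add: mult_ac)
qed

lemma locally_integrable_indicator: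
  fixes v :: "'a::euclidean_space \<Rightarrow> real"
  assumes "locally_integrable \<Omega> v" "compact K" "K \<subseteq> \<Omega>"
  shows "integrable lborel (\<lambda>x. indicator K x * v x)"
  using assms unfolding locally_integrable_def set_integrable_def by auto

lemma locally_integrable_indicator_inner:
  fixes g :: "'a::euclidean_space \<Rightarrow> 'a"
  assumes "locally_integrable \<Omega> g" "compact K" "K \<subseteq> \<Omega>"
  shows "integrable lborel (\<lambda>x. indicator K x * (g x \<bullet> b))"
proof -
  have "integrable lborel (\<lambda>x. (indicator K x *\<^sub>R g x) \<bullet> b)"
    using assms unfolding locally_integrable_def set_integrable_def by (intro integrable_inner_left) auto
  then show ?thesis by simp
qed

lemma integrable_mult_bounded:
  fixes f g :: "'b \<Rightarrow> real"
  assumes f: "integrable M f" and [measurable]: "g \<in> borel_measurable M" and B: "\<And>x. x \<in> space M \<Longrightarrow> \<bar>g x\<bar> \<le> B"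
  shows "integrable M (\<lambda>x. f x * g x)"
proof (rule Bochner_Integration.integrable_bound[where f="\<lambda>x. B * \<bar>f x\<bar>"])
  show "integrable M (\<lambda>x. B * \<bar>f x\<bar>)" using f by simp
  show "AE x in M. norm (f x * g x) \<le> norm (B * \<bar>f x\<bar>)"
    using AE_space
  proof eventually_elim
    case (elim x)
    have "\<bar>g x\<bar> * \<bar>f x\<bar> \<le> B * \<bar>f x\<bar>" using B[OF elim] by (intro mult_right_mono) auto
    also have "\<dots> \<le> \<bar>B\<bar> * \<bar>f x\<bar>" by (intro mult_right_mono) auto
    finally show ?case by (simp add: abs_mult mult.commute)
  qed
qed (use f in measurable)

text \<open>Translating the bump and restricting the functions to a compact set \<open>K\<close> turns the definition of the weak
gradient into an identity between integrals over the whole space.\<close>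

lemma weak_gradient_bump:
  fixes \<Omega> :: "'a::euclidean_space set"
  assumes W: "has_weak_gradient \<Omega> v g" and K: "compact K" "K \<subseteq> \<Omega>" and b: "b \<in> Basis" and c: "0 < c"
    and sub: "cbox (l + a) (u + a) \<subseteq> K"
  shows "(LINT x|lborel. (indicator K x * v x) * frechet_derivative (bump l u c) (at (x - a)) b)
      = - (LINT x|lborel. (indicator K x * (g x \<bullet> b)) * bump l u c (x - a))"
proof -
  let ?\<phi> = "bump (l + a) (u + a) c"
  have \<phi>: "C_c_infinity \<Omega> ?\<phi>" by (rule bump_C_c_infinity) (use c sub K in auto)
  have d: "bump l u c differentiable (at x)" for x
    by (rule C_c_infinity_differentiable[OF bump_C_c_infinity[OF c, of _ _ UNIV]]) simp
  have \<phi>0: "?\<phi> x = 0" "frechet_derivative ?\<phi> (at x) b = 0" if "x \<notin> K" for x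
  proof -
    show "?\<phi> x = 0" using bump_outside sub that by blast
    have "((\<lambda>_. 0) has_derivative (\<lambda>_. 0)) (at x)" by simp
    then have "(?\<phi> has_derivative (\<lambda>_. 0)) (at x)"
      by (rule has_derivative_transform_within_open[of _ _ _ _ "- K"])
         (use K sub that in \<open>auto intro!: bump_outside[symmetric] bump_outside intro: compact_imp_closed\<close>)
    then show "frechet_derivative ?\<phi> (at x) b = 0" by (metis frechet_derivative_at)
  qed
  have fd: "frechet_derivative (bump l u c) (at (x - a)) b = frechet_derivative ?\<phi> (at x) b" for x
  proof -
    have 1: "((\<lambda>x. x - a) has_derivative (\<lambda>h. h)) (at x)" by (auto intro!: derivative_eq_intros)
    have "(bump l u c has_derivative frechet_derivative (bump l u c) (at (x - a))) (at (x - a))"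
      using d by (simp add: frechet_derivative_works)
    from has_derivative_compose[OF 1, of "bump l u c"] this
    have "((\<lambda>x. bump l u c (x - a)) has_derivative frechet_derivative (bump l u c) (at (x - a))) (at x)"
      by simp
    then have "(?\<phi> has_derivative frechet_derivative (bump l u c) (at (x - a))) (at x)"
      by (simp add: bump_translate)
    then show ?thesis by (metis frechet_derivative_at)
  qed
  have "(LINT x:\<Omega>|lborel. v x * frechet_derivative ?\<phi> (at x) b) = - (LINT x:\<Omega>|lborel. (g x \<bullet> b) * ?\<phi> x)"
    using W \<phi> b unfolding has_weak_gradient_def by blast
  moreover have "(LINT x:\<Omega>|lborel. v x * frechet_derivative ?\<phi> (at x) b)
      = (LINT x|lborel. (indicator K x * v x) * frechet_derivative ?\<phi> (at x) b)"
    unfolding set_lebesgue_integral_def using K(2) \<phi>0(2)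
    by (intro Bochner_Integration.integral_cong) (auto simp: indicator_def)
  moreover have "(LINT x:\<Omega>|lborel. (g x \<bullet> b) * ?\<phi> x) = (LINT x|lborel. (indicator K x * (g x \<bullet> b)) * ?\<phi> x)"
    unfolding set_lebesgue_integral_def using K(2) \<phi>0(1)
    by (intro Bochner_Integration.integral_cong) (auto simp: indicator_def)
  ultimately show ?thesis unfolding fd bump_translate by simp
qed

text \<open>The fundamental theorem of calculus writes \<open>\<phi>(x - h b) - \<phi>(x)\<close> as an average of derivatives of \<open>\<phi>\<close>
along the segment; moving these derivatives to \<open>v\<close> and undoing the translations gives the difference
identity tested with \<open>\<phi>\<close>.\<close>

lemma weak_gradient_difference_tested:
  fixes \<Omega> :: "'a::euclidean_space set"
  assumes W: "has_weak_gradient \<Omega> v g" and K: "compact K" "K \<subseteq> \<Omega>" and b: "b \<in> Basis" and c: "0 < c"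
    and sub: "\<And>s. 0 \<le> s \<Longrightarrow> s \<le> 1 \<Longrightarrow> cbox (l + (h * s) *\<^sub>R b) (u + (h * s) *\<^sub>R b) \<subseteq> K"
  defines "vK \<equiv> \<lambda>x. indicator K x * v x" and "gK \<equiv> \<lambda>x. indicator K x * (g x \<bullet> b)"
  shows "(LINT x|lborel. (vK (x + h *\<^sub>R b) - vK x - h * (LINT s|unit_unif. gK (x + (h * s) *\<^sub>R b))) * bump l u c x) = 0"
proof -
  interpret Q: pair_sigma_finite unit_unif "lborel :: 'a measure" ..
  define \<phi> where "\<phi> = bump l u c"
  have \<phi>: "C_c_infinity UNIV \<phi>" unfolding \<phi>_def by (rule bump_C_c_infinity) (use c in auto)
  have cb: "continuous_on UNIV (\<lambda>x. frechet_derivative \<phi> (at x) b)"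
    by (rule C_c_infinity_continuous_partial[OF \<phi> b])
  obtain B where B: "0 \<le> B" "\<And>x. \<bar>\<phi> x\<bar> \<le> B" "\<And>x. \<bar>frechet_derivative \<phi> (at x) b\<bar> \<le> B"
    using C_c_infinity_bounded[OF \<phi> b] by blast
  have [measurable]: "\<phi> \<in> borel_measurable borel" "(\<lambda>x. frechet_derivative \<phi> (at x) b) \<in> borel_measurable borel"
    using borel_measurable_continuous_onI C_c_infinity_continuous[OF \<phi>] cb by blast+
  have vi: "integrable lborel vK"
    unfolding vK_def using W K by (intro locally_integrable_indicator[of \<Omega>]) (auto simp: has_weak_gradient_def)
  have gi: "integrable lborel gK"
    unfolding gK_def using W K by (intro locally_integrable_indicator_inner[of \<Omega>]) (auto simp: has_weak_gradient_def)
  have [measurable]: "vK \<in> borel_measurable borel" "gK \<in> borel_measurable borel" using vi gi by auto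
  have I1: "(LINT x|lborel. vK (x + h *\<^sub>R b) * \<phi> x) = (LINT x|lborel. vK x * \<phi> (x - h *\<^sub>R b))"
    using integral_translate[of "\<lambda>x. vK x * \<phi> (x - h *\<^sub>R b)" "h *\<^sub>R b"] by simp
  have v1: "integrable lborel (\<lambda>x. vK x * \<phi> (x - a))" for a
    by (rule integrable_mult_bounded[OF vi _ B(2)]) measurable
  have v2: "integrable lborel (\<lambda>x. vK (x + h *\<^sub>R b) * \<phi> x)"
    by (rule integrable_mult_bounded[OF integrable_translate[OF vi] _ B(2)]) measurable
  have vQ: "integrable (unit_unif \<Otimes>\<^sub>M lborel) (\<lambda>(s, x). vK x)"
    using integrable_pair_directional[OF vi, of 0] by simp
  have vQ': "integrable (unit_unif \<Otimes>\<^sub>M lborel) (\<lambda>(s, x). vK x * frechet_derivative \<phi> (at (x - (h * s) *\<^sub>R b)) b)"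
    using integrable_mult_bounded[OF vQ, of "\<lambda>(s, x). frechet_derivative \<phi> (at (x - (h * s) *\<^sub>R b)) b" B] B(3)
    by (simp add: case_prod_beta')
  have gQ: "integrable (unit_unif \<Otimes>\<^sub>M lborel) (\<lambda>(s, x). gK (x + (h * s) *\<^sub>R b) * \<phi> x)"
    using integrable_mult_bounded[OF integrable_pair_directional[OF gi, of h b], of "\<lambda>(s, x). \<phi> x" B] B(2)
    by (simp add: case_prod_beta')
  have FTC: "\<phi> (x - h *\<^sub>R b) - \<phi> x = - h * (LINT s|unit_unif. frechet_derivative \<phi> (at (x - (h * s) *\<^sub>R b)) b)" for x
    using directional_FTC[OF C_c_infinity_differentiable[OF \<phi>] cb, of x "- h"] by simp
  have "(LINT x|lborel. vK (x + h *\<^sub>R b) * \<phi> x) - (LINT x|lborel. vK x * \<phi> x)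
      = (LINT x|lborel. vK x * (\<phi> (x - h *\<^sub>R b) - \<phi> x))"
    using v1[of "h *\<^sub>R b"] v1[of 0] by (simp add: I1 right_diff_distrib)
  also have "\<dots> = - h * (LINT x|lborel. LINT s|unit_unif. vK x * frechet_derivative \<phi> (at (x - (h * s) *\<^sub>R b)) b)"
    unfolding FTC by (simp add: mult.left_commute[of _ "h"])
  also have "(LINT x|lborel. LINT s|unit_unif. vK x * frechet_derivative \<phi> (at (x - (h * s) *\<^sub>R b)) b)
      = (LINT s|unit_unif. LINT x|lborel. vK x * frechet_derivative \<phi> (at (x - (h * s) *\<^sub>R b)) b)"
    by (rule Q.Fubini_integral[OF vQ'])
  also have "\<dots> = (LINT s|unit_unif. - (LINT x|lborel. gK (x + (h * s) *\<^sub>R b) * \<phi> x))"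
  proof (rule integral_cong_AE)
    show "AE s in unit_unif. (LINT x|lborel. vK x * frechet_derivative \<phi> (at (x - (h * s) *\<^sub>R b)) b)
        = - (LINT x|lborel. gK (x + (h * s) *\<^sub>R b) * \<phi> x)"
      using AE_unit_unif
    proof eventually_elim
      case (elim s)
      have "(LINT x|lborel. vK x * frechet_derivative \<phi> (at (x - (h * s) *\<^sub>R b)) b)
        = - (LINT x|lborel. gK x * \<phi> (x - (h * s) *\<^sub>R b))"
        unfolding vK_def gK_def \<phi>_def using elim by (intro weak_gradient_bump[OF W K b c] sub) auto
      also have "(LINT x|lborel. gK x * \<phi> (x - (h * s) *\<^sub>R b)) = (LINT x|lborel. gK (x + (h * s) *\<^sub>R b) * \<phi> x)"
        using integral_translate[of "\<lambda>x. gK x * \<phi> (x - (h * s) *\<^sub>R b)" "(h * s) *\<^sub>R b"] by simp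
      finally show ?case .
    qed
  qed measurable
  also have "\<dots> = - (LINT s|unit_unif. LINT x|lborel. gK (x + (h * s) *\<^sub>R b) * \<phi> x)" by simp
  also have "(LINT s|unit_unif. LINT x|lborel. gK (x + (h * s) *\<^sub>R b) * \<phi> x)
     = (LINT x|lborel. LINT s|unit_unif. gK (x + (h * s) *\<^sub>R b) * \<phi> x)"
    by (rule Q.Fubini_integral[OF gQ, symmetric])
  finally have E: "(LINT x|lborel. vK (x + h *\<^sub>R b) * \<phi> x) - (LINT x|lborel. vK x * \<phi> x)
      = h * (LINT x|lborel. LINT s|unit_unif. gK (x + (h * s) *\<^sub>R b) * \<phi> x)" by simp
  have gi': "integrable lborel (\<lambda>x. LINT s|unit_unif. gK (x + (h * s) *\<^sub>R b) * \<phi> x)"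
    using Q.integrable_snd[OF gQ] .
  have "(LINT x|lborel. (vK (x + h *\<^sub>R b) - vK x - h * (LINT s|unit_unif. gK (x + (h * s) *\<^sub>R b))) * \<phi> x)
     = (LINT x|lborel. vK (x + h *\<^sub>R b) * \<phi> x - vK x * \<phi> x - h * (LINT s|unit_unif. gK (x + (h * s) *\<^sub>R b) * \<phi> x))"
    by (simp add: algebra_simps)
  also have "\<dots> = (LINT x|lborel. vK (x + h *\<^sub>R b) * \<phi> x) - (LINT x|lborel. vK x * \<phi> x)
      - h * (LINT x|lborel. LINT s|unit_unif. gK (x + (h * s) *\<^sub>R b) * \<phi> x)"
    using v2 v1[of 0] gi' by simp
  also have "\<dots> = 0" using E by simp
  finally show ?thesis unfolding \<phi>_def .
qed

text \<open>The fundamental theorem of calculus along a segment for weakly differentiable functions. The tested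
identity extends from bumps to indicators of boxes, and Lebesgue differentiation over small cubes at \<open>x\<close>
yields it almost everywhere. The premise on \<open>e\<close> says that a neighbourhood of the segment stays inside
\<open>K\<close>, where \<open>vK\<close> and \<open>gK\<close> agree with \<open>v\<close> and the partial derivative.\<close>

lemma weak_gradient_difference:
  fixes \<Omega> :: "'a::euclidean_space set"
  assumes W: "has_weak_gradient \<Omega> v g" and K: "compact K" "K \<subseteq> \<Omega>" and b: "b \<in> Basis"
  defines "vK \<equiv> \<lambda>x. indicator K x * v x" and "gK \<equiv> \<lambda>x. indicator K x * (g x \<bullet> b)"
  shows "AE x in lborel. (\<exists>e>0. \<forall>y\<in>cball x e. \<forall>s\<in>{0..1}. y + (h * s) *\<^sub>R b \<in> K) \<longrightarrow>
    vK (x + h *\<^sub>R b) - vK x = h * (LINT s|unit_unif. gK (x + (h * s) *\<^sub>R b))"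
proof -
  define q where "q x = vK (x + h *\<^sub>R b) - vK x - h * (LINT s|unit_unif. gK (x + (h * s) *\<^sub>R b))" for x
  have vi: "integrable lborel vK"
    unfolding vK_def using W K by (intro locally_integrable_indicator[of \<Omega>]) (auto simp: has_weak_gradient_def)
  have gi: "integrable lborel gK"
    unfolding gK_def using W K by (intro locally_integrable_indicator_inner[of \<Omega>]) (auto simp: has_weak_gradient_def)
  have qi: "integrable lborel q"
    unfolding q_def using vi integrable_translate[OF vi] directional_average_L1(2)[OF gi, of "\<lambda>_. 0" h b]
    by (intro Bochner_Integration.integrable_diff integrable_mult_right) auto
  have set_i: "set_integrable lborel A q" if "A \<in> sets borel" for A
    unfolding set_integrable_def using qi that by (intro integrable_mult_indicator) auto
  have box0: "integral (cbox l u) q = 0"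
    if sub: "\<And>s. 0 \<le> s \<Longrightarrow> s \<le> 1 \<Longrightarrow> cbox (l + (h * s) *\<^sub>R b) (u + (h * s) *\<^sub>R b) \<subseteq> K" for l u
  proof -
    have "(\<lambda>n. LINT x|lborel. q x * bump l u (1 / real (Suc n)) x) \<longlonglongrightarrow> (LINT x|lborel. q x * indicator (box l u) x)"
    proof (rule integral_dominated_convergence[where w="\<lambda>x. \<bar>q x\<bar>"])
      show "AE x in lborel. (\<lambda>n. q x * bump l u (1 / real (Suc n)) x) \<longlonglongrightarrow> q x * indicator (box l u) x"
        by (intro always_eventually allI tendsto_intros bump_tendsto_indicator)
      show "AE x in lborel. norm (q x * bump l u (1 / real (Suc n)) x) \<le> \<bar>q x\<bar>" for n
      proof (intro always_eventually allI)
        fix x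
        have "\<bar>bump l u (1 / real (Suc n)) x\<bar> \<le> 1" using bump_bounds[of "1 / real (Suc n)" l u x] by simp
        then have "\<bar>q x\<bar> * \<bar>bump l u (1 / real (Suc n)) x\<bar> \<le> \<bar>q x\<bar> * 1" by (intro mult_left_mono) auto
        then show "norm (q x * bump l u (1 / real (Suc n)) x) \<le> \<bar>q x\<bar>" by (simp add: abs_mult)
      qed
      show "(\<lambda>x. q x * bump l u (1 / real (Suc n)) x) \<in> borel_measurable lborel" for n
      proof -
        have "C_c_infinity UNIV (bump l u (1 / real (Suc n)))" by (rule bump_C_c_infinity) auto
        then have "bump l u (1 / real (Suc n)) \<in> borel_measurable borel"
          by (intro borel_measurable_continuous_onI C_c_infinity_continuous)
        then show ?thesis using qi by measurable
      qed
    qed (use qi in \<open>auto intro!: borel_measurable_times\<close>)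
    moreover have "(LINT x|lborel. q x * bump l u (1 / real (Suc n)) x) = 0" for n
      unfolding q_def vK_def gK_def by (rule weak_gradient_difference_tested[OF W K b _ sub]) auto
    ultimately have "(LINT x|lborel. q x * indicator (box l u) x) = 0"
      using LIMSEQ_unique[of "\<lambda>_. 0::real"] by fastforce
    then have "(LINT x:box l u|lborel. q x) = 0" by (simp add: set_lebesgue_integral_def mult.commute)
    then have "integral (box l u) q = 0"
      using set_borel_integral_eq_integral(2)[OF set_i[of "box l u"]] by simp
    then show ?thesis by (simp add: integral_open_interval)
  qed
  obtain N where N: "negligible N" and Leb: "\<And>x e. \<lbrakk>x \<notin> N; 0 < e\<rbrakk> \<Longrightarrow>
     \<exists>d>0. \<forall>h. 0 < h \<and> h < d \<longrightarrow> norm (integral (cbox x (x + h *\<^sub>R One)) q /\<^sub>R h ^ DIM('a) - q x) < e"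
    using integrable_ccontinuous_explicit[of q] set_borel_integral_eq_integral(1)[OF set_i] by (metis borel_closed closed_cbox)
  have "N \<in> null_sets lebesgue" using N by (simp add: negligible_iff_null_sets)
  then have "AE x in lebesgue. x \<notin> N" by (rule AE_not_in)
  then have "AE x in lborel. x \<notin> N" by (simp add: AE_completion_iff)
  then show ?thesis
  proof eventually_elim
    case (elim x)
    show ?case
    proof
      assume "\<exists>e>0. \<forall>y\<in>cball x e. \<forall>s\<in>{0..1}. y + (h * s) *\<^sub>R b \<in> K"
      then obtain e where e: "e > 0" and sub: "\<And>y s. y \<in> cball x e \<Longrightarrow> s \<in> {0..1} \<Longrightarrow> y + (h * s) *\<^sub>R b \<in> K" by blast
      have "\<bar>q x\<bar> < d" if d: "d > 0" for d
      proof -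
        obtain r where r: "r > 0" and Lr: "\<And>h. 0 < h \<and> h < r \<Longrightarrow> norm (integral (cbox x (x + h *\<^sub>R One)) q /\<^sub>R h ^ DIM('a) - q x) < d"
          using Leb[OF elim d] by blast
        \<comment> \<open>The cube with side \<open>t\<close> and corner \<open>x\<close> must fit into the ball of radius \<open>e\<close>.\<close>
        define t where "t = min (r/2) (e / (norm (One::'a) + 1))"
        have t: "0 < t" "t < r" using r e by (auto simp: t_def min_less_iff_disj add_nonneg_pos)
        have te: "t * norm (One::'a) \<le> e"
        proof -
          have "t * norm (One::'a) \<le> e / (norm (One::'a) + 1) * (norm (One::'a) + 1)"
            by (rule mult_mono) (use e in \<open>auto simp: t_def\<close>)
          also have "\<dots> = e" by (simp add: add_nonneg_eq_0_iff)
          finally show ?thesis .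
        qed
        have "integral (cbox x (x + t *\<^sub>R One)) q = 0"
        proof (rule box0, rule subsetI)
          fix s y assume s: "0 \<le> s" "s \<le> (1::real)" and y: "y \<in> cbox (x + (h * s) *\<^sub>R b) (x + t *\<^sub>R One + (h * s) *\<^sub>R b)"
          let ?z = "y - (h * s) *\<^sub>R b"
          have "norm (?z - x) \<le> norm (t *\<^sub>R (One::'a))"
          proof (rule norm_le_componentwise)
            fix i :: 'a assume i: "i \<in> Basis"
            then have "x \<bullet> i \<le> ?z \<bullet> i \<and> ?z \<bullet> i \<le> x \<bullet> i + t"
              using y by (auto simp: mem_box inner_add_left inner_diff_left algebra_simps dest!: bspec[OF _ i])
            then show "\<bar>(?z - x) \<bullet> i\<bar> \<le> \<bar>(t *\<^sub>R (One::'a)) \<bullet> i\<bar>"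
              using i t by (simp add: inner_diff_left)
          qed
          then have "?z \<in> cball x e" using te t by (simp add: dist_norm norm_minus_commute)
          from sub[OF this, of s] s show "y \<in> K" by simp
        qed
        then show ?thesis using Lr[of t] t by simp
      qed
      then have "\<bar>q x\<bar> \<le> 0" by (meson less_irrefl not_le)
      then show "vK (x + h *\<^sub>R b) - vK x = h * (LINT s|unit_unif. gK (x + (h * s) *\<^sub>R b))"
        by (simp add: q_def)
    qed
  qed
qed

section \<open>The chain rule for weak gradients\<close>

text \<open>This is the difference quotient, extended by the derivative to \<open>z = y\<close>; it converts differences of \<open>v\<close> into differences of
\<open>\<psi> \<circ> v\<close> exactly, with a bounded factor.\<close>

definition chord_slope :: "(real \<Rightarrow> real) \<Rightarrow> (real \<Rightarrow> real) \<Rightarrow> real \<Rightarrow> real \<Rightarrow> real" where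
  "chord_slope \<psi> \<psi>' y z = (if z = y then \<psi>' y else (\<psi> z - \<psi> y) / (z - y))"

lemma chord_slope_mult: "chord_slope \<psi> \<psi>' y z * (z - y) = \<psi> z - \<psi> y"
  by (simp add: chord_slope_def)

lemma lipschitz_of_bounded_derivative:
  fixes \<psi> \<psi>' :: "real \<Rightarrow> real"
  assumes "\<And>y. (\<psi> has_real_derivative \<psi>' y) (at y)" "\<And>y. \<bar>\<psi>' y\<bar> \<le> L"
  shows "\<bar>\<psi> x - \<psi> y\<bar> \<le> L * \<bar>x - y\<bar>"
  using field_differentiable_bound[of UNIV \<psi> \<psi>' L x y] assms by simp

lemma chord_slope_bound:
  assumes "\<And>y. (\<psi> has_real_derivative \<psi>' y) (at y)" "\<And>y. \<bar>\<psi>' y\<bar> \<le> L"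
  shows "\<bar>chord_slope \<psi> \<psi>' y z\<bar> \<le> L"
  using lipschitz_of_bounded_derivative[OF assms, of z y] assms(2)[of y]
  by (auto simp: chord_slope_def abs_divide divide_le_eq)

lemma chord_slope_tendsto:
  assumes D: "(\<psi> has_real_derivative \<psi>' y) (at y)" and z: "z \<longlonglongrightarrow> y"
  shows "(\<lambda>k. chord_slope \<psi> \<psi>' y (z k)) \<longlonglongrightarrow> \<psi>' y"
proof -
  have "((\<lambda>x. (\<psi> x - \<psi> y) / (x - y)) \<longlongrightarrow> \<psi>' y) (at y)"
    using D by (simp add: has_field_derivative_iff)
  then have "(chord_slope \<psi> \<psi>' y \<longlongrightarrow> \<psi>' y) (at y)"
    by (rule Lim_transform_eventually) (auto simp: chord_slope_def eventually_at_filter)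
  then have "isCont (chord_slope \<psi> \<psi>' y) y" by (simp add: isCont_def chord_slope_def)
  from isCont_tendsto_compose[OF this z] show ?thesis by (simp add: chord_slope_def)
qed

lemma locally_integrable_lipschitz_compose:
  fixes v :: "'a::euclidean_space \<Rightarrow> real"
  assumes v: "locally_integrable \<Omega> v" and \<psi>c: "continuous_on UNIV \<psi>" and lip: "\<And>y. \<bar>\<psi> y - \<psi> 0\<bar> \<le> L * \<bar>y\<bar>"
  shows "locally_integrable \<Omega> (\<lambda>x. \<psi> (v x))"
  unfolding locally_integrable_def
proof (intro allI impI)
  fix K assume K: "compact K \<and> K \<subseteq> \<Omega>"
  have vi: "integrable lborel (\<lambda>x. indicator K x * v x)" using locally_integrable_indicator[OF v] K by auto
  then have [measurable]: "(\<lambda>x. indicator K x * v x) \<in> borel_measurable borel" by auto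
  have [measurable]: "\<psi> \<in> borel_measurable borel" by (rule borel_measurable_continuous_onI[OF \<psi>c])
  have Km[measurable]: "K \<in> sets borel" using K by (auto intro: borel_closed compact_imp_closed)
  have eq: "(\<lambda>x. indicator K x *\<^sub>R \<psi> (v x)) = (\<lambda>x. indicator K x * \<psi> (indicator K x * v x))"
    by (auto simp: indicator_def)
  have "integrable lborel (\<lambda>x. indicator K x * \<psi> (indicator K x * v x))"
  proof (rule Bochner_Integration.integrable_bound[where f="\<lambda>x. \<bar>\<psi> 0\<bar> * indicator K x + L * \<bar>indicator K x * v x\<bar>"])
    have "emeasure lborel K < \<infinity>" using K by (intro emeasure_compact_finite) auto
    then show "integrable lborel (\<lambda>x. \<bar>\<psi> 0\<bar> * indicator K x + L * \<bar>indicator K x * v x\<bar>)"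
      using vi by (intro Bochner_Integration.integrable_add integrable_mult_right integrable_abs) auto
    show "AE x in lborel. norm (indicator K x * \<psi> (indicator K x * v x)) \<le> norm (\<bar>\<psi> 0\<bar> * indicator K x + L * \<bar>indicator K x * v x\<bar>)"
    proof (intro always_eventually allI)
      fix x
      show "norm (indicator K x * \<psi> (indicator K x * v x)) \<le> norm (\<bar>\<psi> 0\<bar> * indicator K x + L * \<bar>indicator K x * v x\<bar>)"
        using lip[of "v x"] by (cases "x \<in> K") auto
    qed
  qed measurable
  then show "set_integrable lborel K (\<lambda>x. \<psi> (v x))" unfolding set_integrable_def eq .
qed

lemma locally_integrable_bounded_scale:
  fixes v :: "'a::euclidean_space \<Rightarrow> real" and g :: "'a \<Rightarrow> 'a"
  assumes v: "locally_integrable \<Omega> v" and g: "locally_integrable \<Omega> g"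
    and \<psi>c: "continuous_on UNIV \<psi>" and B: "\<And>y. \<bar>\<psi> y\<bar> \<le> L"
  shows "locally_integrable \<Omega> (\<lambda>x. \<psi> (v x) *\<^sub>R g x)"
  unfolding locally_integrable_def
proof (intro allI impI)
  fix K assume K: "compact K \<and> K \<subseteq> \<Omega>"
  have vi: "integrable lborel (\<lambda>x. indicator K x * v x)" using locally_integrable_indicator[OF v] K by auto
  then have [measurable]: "(\<lambda>x. indicator K x * v x) \<in> borel_measurable borel" by auto
  have gi: "integrable lborel (\<lambda>x. indicator K x *\<^sub>R g x)" using g K unfolding locally_integrable_def set_integrable_def by auto
  then have [measurable]: "(\<lambda>x. indicator K x *\<^sub>R g x) \<in> borel_measurable borel" by auto
  have [measurable]: "\<psi> \<in> borel_measurable borel" by (rule borel_measurable_continuous_onI[OF \<psi>c])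
  have eq: "(\<lambda>x. indicator K x *\<^sub>R (\<psi> (v x) *\<^sub>R g x)) = (\<lambda>x. \<psi> (indicator K x * v x) *\<^sub>R (indicator K x *\<^sub>R g x))"
    by (auto simp: indicator_def)
  have "integrable lborel (\<lambda>x. \<psi> (indicator K x * v x) *\<^sub>R (indicator K x *\<^sub>R g x))"
  proof (rule Bochner_Integration.integrable_bound[where f="\<lambda>x. L *\<^sub>R (indicator K x *\<^sub>R g x)"])
    show "integrable lborel (\<lambda>x. L *\<^sub>R (indicator K x *\<^sub>R g x))" using gi by (intro integrable_scaleR_right) auto
    show "AE x in lborel. norm (\<psi> (indicator K x * v x) *\<^sub>R (indicator K x *\<^sub>R g x)) \<le> norm (L *\<^sub>R (indicator K x *\<^sub>R g x))"
    proof (intro always_eventually allI)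
      fix x
      have "\<bar>\<psi> (indicator K x * v x)\<bar> \<le> \<bar>L\<bar>" using B[of "indicator K x * v x"] by linarith
      then show "norm (\<psi> (indicator K x * v x) *\<^sub>R (indicator K x *\<^sub>R g x)) \<le> norm (L *\<^sub>R (indicator K x *\<^sub>R g x))"
        unfolding norm_scaleR by (intro mult_right_mono) auto
    qed
  qed measurable
  then show "set_integrable lborel K (\<lambda>x. \<psi> (v x) *\<^sub>R g x)" unfolding set_integrable_def eq .
qed

text \<open>Difference quotients of \<open>\<psi> \<circ> v\<close> are the chord slope of \<open>\<psi>\<close> times those of \<open>v\<close>. The latter are
averages of \<open>g\<close> and converge in \<open>L\<^sup>1\<close> to \<open>g\<close> on compact sets; the chord slopes are bounded and, along a subsequence,
converge almost everywhere to \<open>\<psi>'(v)\<close>. On the other side, a discrete integration by parts moves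
the difference quotient to the test function.\<close>

theorem has_weak_gradient_compose:
  fixes \<Omega> :: "'a::euclidean_space set"
  assumes \<Omega>: "open \<Omega>" and W: "has_weak_gradient \<Omega> v g"
    and D: "\<And>y. (\<psi> has_real_derivative \<psi>' y) (at y)" and cont: "continuous_on UNIV \<psi>'" and L: "\<And>y. \<bar>\<psi>' y\<bar> \<le> L"
  shows "has_weak_gradient \<Omega> (\<lambda>x. \<psi> (v x)) (\<lambda>x. \<psi>' (v x) *\<^sub>R g x)"
  unfolding has_weak_gradient_def
proof (intro conjI allI impI ballI)
  have v: "locally_integrable \<Omega> v" and g: "locally_integrable \<Omega> g"
    using W unfolding has_weak_gradient_def by auto
  have \<psi>c: "continuous_on UNIV \<psi>"
    using D by (auto simp: continuous_on_eq_continuous_at intro: DERIV_isCont)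
  have lip: "\<bar>\<psi> y - \<psi> 0\<bar> \<le> L * \<bar>y\<bar>" for y
    using lipschitz_of_bounded_derivative[OF D L, of y 0] by simp
  have L0: "0 \<le> L" using L[of 0] by simp
  show li1: "locally_integrable \<Omega> (\<lambda>x. \<psi> (v x))" by (rule locally_integrable_lipschitz_compose[OF v \<psi>c lip])
  show li2: "locally_integrable \<Omega> (\<lambda>x. \<psi>' (v x) *\<^sub>R g x)" by (rule locally_integrable_bounded_scale[OF v g cont L])
  fix \<phi> :: "'a \<Rightarrow> real" and b :: 'a
  assume \<phi>: "C_c_infinity \<Omega> \<phi>" and b: "b \<in> Basis"
  obtain S where S: "compact S" "S \<subseteq> \<Omega>" "\<And>x. x \<notin> S \<Longrightarrow> \<phi> x = 0"
    "\<And>x b. x \<notin> S \<Longrightarrow> frechet_derivative \<phi> (at x) b = 0"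
    using C_c_infinity_support[OF \<phi>] by metis
  obtain e where e: "e > 0" and eS: "(\<Union>x\<in>S. cball x e) \<subseteq> \<Omega>"
    using compact_subset_open_imp_cball_epsilon_subset[OF S(1) \<Omega> S(2)] by blast
  define K where "K = (\<Union>x\<in>S. cball x e)"
  have K: "compact K" "K \<subseteq> \<Omega>" unfolding K_def using compact_minkowski_sum_cball[OF S(1)] eS by auto
  have SK: "S \<subseteq> K" unfolding K_def using e by force
  have SKb: "x + t *\<^sub>R b \<in> K" if "x \<in> S" "\<bar>t\<bar> \<le> e" for x t
    unfolding K_def using that b by (auto intro!: bexI[of _ x] simp: dist_norm)
  have Km[measurable]: "K \<in> sets borel" using K by (auto intro: borel_closed compact_imp_closed)
  define vK where "vK x = indicator K x * v x" for x
  define gK where "gK x = indicator K x * (g x \<bullet> b)" for x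
  define \<psi>K where "\<psi>K x = indicator K x * \<psi> (v x)" for x
  have vi: "integrable lborel vK" unfolding vK_def by (rule locally_integrable_indicator[OF v K])
  have gi: "integrable lborel gK" unfolding gK_def by (rule locally_integrable_indicator_inner[OF g K])
  have \<psi>i: "integrable lborel \<psi>K" unfolding \<psi>K_def by (rule locally_integrable_indicator[OF li1 K])
  have [measurable]: "vK \<in> borel_measurable borel" "gK \<in> borel_measurable borel" "\<psi>K \<in> borel_measurable borel"
    using vi gi \<psi>i by auto
  have [measurable]: "\<psi> \<in> borel_measurable borel" "\<psi>' \<in> borel_measurable borel"
    using borel_measurable_continuous_onI \<psi>c cont by auto
  have cb: "continuous_on UNIV (\<lambda>x. frechet_derivative \<phi> (at x) b)"
    by (rule C_c_infinity_continuous_partial[OF \<phi> b])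
  obtain B where B: "0 \<le> B" "\<And>x. \<bar>\<phi> x\<bar> \<le> B" "\<And>x. \<bar>frechet_derivative \<phi> (at x) b\<bar> \<le> B"
    using C_c_infinity_bounded[OF \<phi> b] by blast
  have \<phi>m[measurable]: "\<phi> \<in> borel_measurable borel" and \<phi>'m[measurable]: "(\<lambda>x. frechet_derivative \<phi> (at x) b) \<in> borel_measurable borel"
    using borel_measurable_continuous_onI C_c_infinity_continuous[OF \<phi>] cb by blast+
  \<comment> \<open>Steps of length at most \<open>e / 2\<close> keep segments that start within \<open>e / 2\<close> of the support inside \<open>K\<close>.\<close>
  define h where "h k = e / 2 / real (Suc k)" for k
  have h: "h k > 0" "h k \<le> e / 2" for k
    using e by (auto simp: h_def divide_le_eq)
  have hlim: "h \<longlonglongrightarrow> 0"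
    unfolding h_def using tendsto_mult_right_zero[OF LIMSEQ_Suc[OF lim_1_over_n], of "e/2"] by simp
  define q where "q k x = (LINT s|unit_unif. gK (x + (h k * s) *\<^sub>R b))" for k x
  define a where "a k x = chord_slope \<psi> \<psi>' (vK x) (vK (x + h k *\<^sub>R b))" for k x
  have qi: "integrable lborel (q k)" for k
    unfolding q_def by (rule directional_average_L1(2)[OF gi hlim])
  have am[measurable]: "a k \<in> borel_measurable borel" for k
    unfolding a_def chord_slope_def by measurable
  have [measurable]: "q k \<in> borel_measurable borel" for k using qi by auto
  have aL: "\<bar>a k x\<bar> \<le> L" for k x unfolding a_def by (rule chord_slope_bound[OF D L])
  have diff: "AE x in lborel. \<phi> x * (\<psi>K (x + h k *\<^sub>R b) - \<psi>K x) / h k = \<phi> x * a k x * q k x" for k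
    using weak_gradient_difference[OF W K b, of "h k"]
  proof eventually_elim
    case (elim x)
    show ?case
    proof (cases "x \<in> S")
      case True
      have "y + (h k * s) *\<^sub>R b \<in> K" if "y \<in> cball x (e / 2)" "s \<in> {0..1}" for y s
      proof -
        have "\<bar>h k * s\<bar> \<le> e/2 * 1" unfolding abs_mult using h[of k] that by (intro mult_mono) auto
        then have "norm (x - (y + (h k * s) *\<^sub>R b)) \<le> e/2 + e/2"
          using that b norm_triangle_ineq4[of "x - y" "(h k * s) *\<^sub>R b"] by (simp add: dist_norm diff_diff_eq)
        then show ?thesis using True unfolding K_def by (auto simp: dist_norm intro!: bexI[of _ x])
      qed
      then have "vK (x + h k *\<^sub>R b) - vK x = h k * q k x"
        using elim e unfolding vK_def gK_def q_def by (auto intro!: exI[of _ "e/2"])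
      moreover have "\<psi>K (x + h k *\<^sub>R b) - \<psi>K x = \<psi> (vK (x + h k *\<^sub>R b)) - \<psi> (vK x)"
        using True SK SKb[OF True, of "h k"] h[of k] e by (auto simp: \<psi>K_def vK_def)
      ultimately have "\<psi>K (x + h k *\<^sub>R b) - \<psi>K x = a k x * (h k * q k x)"
        using chord_slope_mult[of \<psi> \<psi>' "vK x" "vK (x + h k *\<^sub>R b)"] by (simp add: a_def)
      then show ?thesis using h[of k] by simp
    next
      case False then show ?thesis using S(3) by simp
    qed
  qed
  have \<phi>diff: "\<bar>(\<phi> x - \<phi> (x - h k *\<^sub>R b)) / h k\<bar> \<le> B" for x k
  proof -
    have "\<phi> (x - h k *\<^sub>R b) - \<phi> x = - h k * (LINT s|unit_unif. frechet_derivative \<phi> (at (x + (- h k * s) *\<^sub>R b)) b)"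
      using directional_FTC[OF C_c_infinity_differentiable[OF \<phi>] cb, of x "- h k"] by simp
    then have "(\<phi> x - \<phi> (x - h k *\<^sub>R b)) / h k = (LINT s|unit_unif. frechet_derivative \<phi> (at (x + (- h k * s) *\<^sub>R b)) b)"
      using h[of k] by (simp add: field_simps)
    also have "\<bar>\<dots>\<bar> \<le> (LINT s|unit_unif. \<bar>frechet_derivative \<phi> (at (x + (- h k * s) *\<^sub>R b)) b\<bar>)"
      by (rule integral_abs_bound)
    also have "\<dots> \<le> (LINT s|unit_unif. B)"
    proof (rule integral_mono)
      show "integrable unit_unif (\<lambda>s. \<bar>frechet_derivative \<phi> (at (x + (- h k * s) *\<^sub>R b)) b\<bar>)"
        by (rule unit_unif.integrable_const_bound[of _ B]) (use B(3) in auto)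
    qed (use B(3) in auto)
    finally show ?thesis using unit_unif.prob_space by simp
  qed
  have \<phi>lim: "(\<lambda>k. (\<phi> x - \<phi> (x - h k *\<^sub>R b)) / h k) \<longlonglongrightarrow> frechet_derivative \<phi> (at x) b" for x
  proof -
    have "((\<lambda>s. \<phi> (x + (- 1 * s) *\<^sub>R b)) has_real_derivative - 1 * frechet_derivative \<phi> (at (x + (-1 * 0) *\<^sub>R b)) b) (at 0)"
      by (rule directional_DERIV[OF C_c_infinity_differentiable[OF \<phi>]])
    then have "((\<lambda>s. (\<phi> (x - s *\<^sub>R b) - \<phi> x) / s) \<longlongrightarrow> - frechet_derivative \<phi> (at x) b) (at 0)"
      by (simp add: DERIV_def)
    then have "((\<lambda>k. (\<phi> (x - h k *\<^sub>R b) - \<phi> x) / h k)) \<longlonglongrightarrow> - frechet_derivative \<phi> (at x) b"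
    proof (rule filterlim_compose)
      have "h k \<noteq> 0" for k using h(1)[of k] by simp
      then show "filterlim h (at 0) sequentially" using hlim by (auto simp: filterlim_at)
    qed
    from tendsto_minus[OF this] show ?thesis unfolding minus_divide_left by simp
  qed
  define T where "T k = (LINT x|lborel. \<psi>K x * ((\<phi> x - \<phi> (x - h k *\<^sub>R b)) / h k))" for k
  have T1: "T \<longlonglongrightarrow> (LINT x|lborel. \<psi>K x * frechet_derivative \<phi> (at x) b)"
    unfolding T_def
  proof (rule integral_dominated_convergence[where w="\<lambda>x. \<bar>\<psi>K x\<bar> * B"])
    show "AE x in lborel. (\<lambda>k. \<psi>K x * ((\<phi> x - \<phi> (x - h k *\<^sub>R b)) / h k)) \<longlonglongrightarrow> \<psi>K x * frechet_derivative \<phi> (at x) b"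
      by (intro always_eventually allI tendsto_intros \<phi>lim)
    show "AE x in lborel. norm (\<psi>K x * ((\<phi> x - \<phi> (x - h k *\<^sub>R b)) / h k)) \<le> \<bar>\<psi>K x\<bar> * B" for k
      unfolding real_norm_def abs_mult by (intro always_eventually allI mult_left_mono \<phi>diff) auto
  qed (use \<psi>i in auto)
  have T2: "T k = - (LINT x|lborel. \<phi> x * a k x * q k x)" for k
  proof -
    have s: "(LINT x|lborel. \<psi>K x * \<phi> (x - h k *\<^sub>R b)) = (LINT x|lborel. \<psi>K (x + h k *\<^sub>R b) * \<phi> x)"
      using integral_translate[of "\<lambda>x. \<psi>K x * \<phi> (x - h k *\<^sub>R b)" "h k *\<^sub>R b"] by simp
    have i1: "integrable lborel (\<lambda>x. \<psi>K x * \<phi> (x - c))" for c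
      by (rule integrable_mult_bounded[OF \<psi>i _ B(2)]) measurable
    have i2: "integrable lborel (\<lambda>x. \<psi>K (x + h k *\<^sub>R b) * \<phi> x)"
      by (rule integrable_mult_bounded[OF integrable_translate[OF \<psi>i] _ B(2)]) measurable
    have "T k = (LINT x|lborel. (\<psi>K x * \<phi> (x - 0) - \<psi>K x * \<phi> (x - h k *\<^sub>R b)) / h k)"
      unfolding T_def by (intro Bochner_Integration.integral_cong) (auto simp: right_diff_distrib)
    also have "\<dots> = ((LINT x|lborel. \<psi>K x * \<phi> (x - 0)) - (LINT x|lborel. \<psi>K x * \<phi> (x - h k *\<^sub>R b))) / h k"
      using i1[of 0] i1[of "h k *\<^sub>R b"] by simp
    also have "\<dots> = - (LINT x|lborel. (\<psi>K (x + h k *\<^sub>R b) * \<phi> x - \<psi>K x * \<phi> (x - 0)) / h k)"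
      unfolding s using i1[of 0] i2 h(1)[of k] by (simp add: field_simps)
    also have "(LINT x|lborel. (\<psi>K (x + h k *\<^sub>R b) * \<phi> x - \<psi>K x * \<phi> (x - 0)) / h k) = (LINT x|lborel. \<phi> x * a k x * q k x)"
      by (rule integral_cong_AE, measurable) (use diff[of k] in \<open>eventually_elim, simp add: algebra_simps\<close>)
    finally show ?thesis .
  qed
  \<comment> \<open>Translations of \<open>vK\<close> converge in the mean, hence almost everywhere along a subsequence; this makes the
    chord slopes converge pointwise.\<close>
  have "(\<lambda>k. LINT x|lborel. \<bar>vK (x + h k *\<^sub>R b) - vK x\<bar>) \<longlonglongrightarrow> 0"
  proof (rule translation_continuous_L1[OF vi])
    show "(\<lambda>k. h k *\<^sub>R b) \<longlonglongrightarrow> 0" using tendsto_scaleR[OF hlim tendsto_const[of b]] by simp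
  qed
  then obtain r where r: "strict_mono r" and rAE: "AE x in lborel. (\<lambda>k. vK (x + h (r k) *\<^sub>R b) - vK x) \<longlonglongrightarrow> 0"
    using tendsto_L1_AE_subseq[of lborel "\<lambda>k x. vK (x + h k *\<^sub>R b) - vK x"] vi integrable_translate[OF vi] by auto
  have qlim: "(\<lambda>k. LINT x|lborel. \<bar>q (r k) x - gK x\<bar>) \<longlonglongrightarrow> 0"
    using LIMSEQ_subseq_LIMSEQ[OF directional_average_L1(1)[OF gi hlim, of b] r] by (simp add: q_def o_def)
  have I2: "integrable lborel (\<lambda>x. gK x * (\<phi> x * a k x))" for k
    by (rule integrable_mult_bounded[OF gi, where B="B*L"]) (auto simp: abs_mult intro!: mult_mono B aL L0)
  have lim2: "(\<lambda>k. LINT x|lborel. gK x * (\<phi> x * a (r k) x)) \<longlonglongrightarrow> (LINT x|lborel. gK x * (\<phi> x * \<psi>' (vK x)))"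
  proof (rule integral_dominated_convergence[where w="\<lambda>x. \<bar>gK x\<bar> * (B * L)"])
    show "AE x in lborel. (\<lambda>k. gK x * (\<phi> x * a (r k) x)) \<longlonglongrightarrow> gK x * (\<phi> x * \<psi>' (vK x))"
      using rAE
    proof eventually_elim
      case (elim x)
      have "(\<lambda>k. a (r k) x) \<longlonglongrightarrow> \<psi>' (vK x)"
        unfolding a_def by (rule chord_slope_tendsto[OF D], rule LIM_zero_cancel[OF elim])
      then show ?case by (intro tendsto_intros)
    qed
    show "AE x in lborel. norm (gK x * (\<phi> x * a (r k) x)) \<le> \<bar>gK x\<bar> * (B * L)" for k
      unfolding real_norm_def abs_mult by (intro always_eventually allI mult_left_mono mult_mono B aL L0) auto
  qed (use gi in auto)
  have lim1: "(\<lambda>k. LINT x|lborel. (q (r k) x - gK x) * (\<phi> x * a (r k) x)) \<longlonglongrightarrow> 0"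
  proof (rule Lim_null_comparison)
    show "(\<lambda>k. (LINT x|lborel. \<bar>q (r k) x - gK x\<bar>) * (B * L)) \<longlonglongrightarrow> 0"
      using tendsto_mult_left_zero[OF qlim] .
    show "\<forall>\<^sub>F k in sequentially. norm (LINT x|lborel. (q (r k) x - gK x) * (\<phi> x * a (r k) x)) \<le> (LINT x|lborel. \<bar>q (r k) x - gK x\<bar>) * (B * L)"
    proof (intro always_eventually allI)
      fix k
      have i: "integrable lborel (\<lambda>x. q (r k) x - gK x)" using qi gi by auto
      have "\<bar>LINT x|lborel. (q (r k) x - gK x) * (\<phi> x * a (r k) x)\<bar> \<le> (LINT x|lborel. \<bar>(q (r k) x - gK x) * (\<phi> x * a (r k) x)\<bar>)"
        by (rule integral_abs_bound)
      also have "\<dots> \<le> (LINT x|lborel. \<bar>q (r k) x - gK x\<bar> * (B * L))"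
      proof (rule integral_mono)
        show "integrable lborel (\<lambda>x. \<bar>(q (r k) x - gK x) * (\<phi> x * a (r k) x)\<bar>)"
          by (intro integrable_abs integrable_mult_bounded[OF i, where B="B*L"]) (auto simp: abs_mult intro!: mult_mono B aL L0)
        show "\<bar>(q (r k) x - gK x) * (\<phi> x * a (r k) x)\<bar> \<le> \<bar>q (r k) x - gK x\<bar> * (B * L)" for x
          unfolding abs_mult by (intro mult_left_mono mult_mono B aL L0) auto
      qed (use i in auto)
      finally show "norm (LINT x|lborel. (q (r k) x - gK x) * (\<phi> x * a (r k) x)) \<le> (LINT x|lborel. \<bar>q (r k) x - gK x\<bar>) * (B * L)"
        by simp
    qed
  qed
  \<comment> \<open>The factors \<open>q\<close> converge in \<open>L\<^sup>1\<close> and the factors \<open>a\<close> boundedly almost everywhere, so the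
    product is split accordingly.\<close>
  have "T (r k) = - ((LINT x|lborel. (q (r k) x - gK x) * (\<phi> x * a (r k) x)) + (LINT x|lborel. gK x * (\<phi> x * a (r k) x)))" for k
  proof -
    have i: "integrable lborel (\<lambda>x. q (r k) x - gK x)" using qi gi by auto
    have i': "integrable lborel (\<lambda>x. (q (r k) x - gK x) * (\<phi> x * a (r k) x))"
      by (intro integrable_mult_bounded[OF i, where B="B*L"]) (auto simp: abs_mult intro!: mult_mono B aL L0)
    show ?thesis unfolding T2
      by (subst Bochner_Integration.integral_add[OF i' I2, symmetric]) (simp add: algebra_simps)
  qed
  then have "(\<lambda>k. T (r k)) \<longlonglongrightarrow> - (0 + (LINT x|lborel. gK x * (\<phi> x * \<psi>' (vK x))))"
    by (simp only:) (intro tendsto_intros lim1 lim2)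
  moreover have "(\<lambda>k. T (r k)) \<longlonglongrightarrow> (LINT x|lborel. \<psi>K x * frechet_derivative \<phi> (at x) b)"
    using LIMSEQ_subseq_LIMSEQ[OF T1 r] by (simp add: o_def)
  ultimately have fin: "(LINT x|lborel. \<psi>K x * frechet_derivative \<phi> (at x) b) = - (LINT x|lborel. gK x * (\<phi> x * \<psi>' (vK x)))"
    using LIMSEQ_unique by fastforce
  have "(LINT x:\<Omega>|lborel. \<psi> (v x) * frechet_derivative \<phi> (at x) b) = (LINT x|lborel. \<psi>K x * frechet_derivative \<phi> (at x) b)"
    unfolding set_lebesgue_integral_def using K(2) SK S(4)
    by (intro Bochner_Integration.integral_cong) (auto simp: \<psi>K_def indicator_def)
  also note fin
  also have "(LINT x|lborel. gK x * (\<phi> x * \<psi>' (vK x))) = (LINT x:\<Omega>|lborel. ((\<psi>' (v x) *\<^sub>R g x) \<bullet> b) * \<phi> x)"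
    unfolding set_lebesgue_integral_def using K(2) SK S(3)
    by (intro Bochner_Integration.integral_cong) (auto simp: gK_def vK_def indicator_def)
  finally show "(LINT x:\<Omega>|lborel. \<psi> (v x) * frechet_derivative \<phi> (at x) b) = - (LINT x:\<Omega>|lborel. ((\<psi>' (v x) *\<^sub>R g x) \<bullet> b) * \<phi> x)" .
qed

section \<open>Weighted measures and averaged weak gradients\<close>

lemma space_weighted [simp]: "space (weighted \<Omega> \<rho>) = \<Omega>"
  by (simp add: weighted_def space_restrict_space)

lemma sets_weighted [measurable_cong]: "sets (weighted \<Omega> \<rho>) = sets (restrict_space borel \<Omega>)"
  by (simp add: weighted_def sets_restrict_space)

text \<open>Together, continuity and positivity bound the weights from below on compact sets.\<close>

lemma admissible_weights_continuous:
  assumes "admissible_weights \<Omega> \<rho>\<^sub>\<nu> \<rho>\<^sub>\<mu>"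
  shows "continuous_on \<Omega> \<rho>\<^sub>\<nu>" "continuous_on \<Omega> \<rho>\<^sub>\<mu>" "\<And>x. x \<in> \<Omega> \<Longrightarrow> 0 < \<rho>\<^sub>\<nu> x" "\<And>x. x \<in> \<Omega> \<Longrightarrow> 0 < \<rho>\<^sub>\<mu> x"
proof -
  have "\<forall>x\<in>\<Omega>. \<rho>\<^sub>\<nu> differentiable (at x)" "\<forall>x\<in>\<Omega>. \<rho>\<^sub>\<mu> differentiable (at x)"
    using assms unfolding admissible_weights_def C_hoelder_loc_def by (auto simp: numeral_3_eq_3 numeral_2_eq_2)
  then show "continuous_on \<Omega> \<rho>\<^sub>\<nu>" "continuous_on \<Omega> \<rho>\<^sub>\<mu>"
    by (auto intro!: continuous_at_imp_continuous_on differentiable_imp_continuous_within)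
qed (use assms in \<open>auto simp: admissible_weights_def\<close>)

locale weighted_domain =
  fixes \<Omega> :: "'a::euclidean_space set" and \<rho> :: "'a \<Rightarrow> real"
  assumes open_domain: "open \<Omega>" and weight_continuous: "continuous_on \<Omega> \<rho>" and weight_pos: "\<And>x. x \<in> \<Omega> \<Longrightarrow> 0 < \<rho> x"
begin

lemma domain_sets [measurable]: "\<Omega> \<in> sets borel" using open_domain by auto

lemma weight_measurable [measurable]: "\<rho> \<in> borel_measurable (restrict_space lborel \<Omega>)"
  using borel_measurable_continuous_on_restrict[OF weight_continuous]
  by (simp cong: measurable_cong_sets add: sets_restrict_space)

lemma sigma_finite_weighted: "sigma_finite_measure (weighted \<Omega> \<rho>)"
proof -
  interpret R: sigma_finite_measure "restrict_space lborel \<Omega>"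
    by (rule sigma_finite_measure_restrict_space[OF sigma_finite_lborel]) auto
  show ?thesis unfolding weighted_def
    by (subst R.sigma_finite_iff_density_finite) auto
qed

lemma integrable_weighted_iff:
  fixes f :: "'a \<Rightarrow> 'c::euclidean_space"
  assumes [measurable]: "f \<in> borel_measurable (restrict_space lborel \<Omega>)"
  shows "integrable (weighted \<Omega> \<rho>) f \<longleftrightarrow> integrable (restrict_space lborel \<Omega>) (\<lambda>x. \<rho> x *\<^sub>R f x)"
  unfolding weighted_def
  by (rule integrable_density) (use weight_pos in \<open>auto simp: space_restrict_space less_imp_le\<close>)

lemma AE_weighted_iff: "(AE x in weighted \<Omega> \<rho>. P x) \<longleftrightarrow> (AE x in restrict_space lborel \<Omega>. P x)"
proof -
  have "(AE x in weighted \<Omega> \<rho>. P x) \<longleftrightarrow> (AE x in restrict_space lborel \<Omega>. 0 < ennreal (\<rho> x) \<longrightarrow> P x)"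
    unfolding weighted_def by (rule AE_density) auto
  also have "\<dots> \<longleftrightarrow> (AE x in restrict_space lborel \<Omega>. P x)"
  proof (rule AE_cong)
    fix x assume "x \<in> space (restrict_space lborel \<Omega>)"
    then have "0 < \<rho> x" using weight_pos by (simp add: space_restrict_space)
    then show "(0 < ennreal (\<rho> x) \<longrightarrow> P x) = P x" by simp
  qed
  finally show ?thesis .
qed

lemma weight_lower_bound:
  assumes "compact K" "K \<subseteq> \<Omega>"
  obtains c where "0 < c" "\<And>x. x \<in> K \<Longrightarrow> c \<le> \<rho> x"
proof (cases "K = {}")
  case True then show ?thesis using that[of 1] by auto
next
  case False
  obtain y where "y \<in> K" "\<forall>x\<in>K. \<rho> y \<le> \<rho> x"
    using continuous_attains_inf[OF assms(1) False continuous_on_subset[OF weight_continuous assms(2)]] by blast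
  then show ?thesis using that[of "\<rho> y"] weight_pos assms(2) by auto
qed

end

text \<open>Both sides of the defining identity are linear, so Fubini's theorem carries it over to averages.\<close>

lemma has_weak_gradient_average:
  fixes \<Omega> :: "'a::euclidean_space set" and p :: "real \<Rightarrow> 'a \<Rightarrow> real" and H :: "real \<Rightarrow> 'a \<Rightarrow> 'a"
  defines "R \<equiv> restrict_space lborel \<Omega>"
  assumes \<Omega>: "open \<Omega>" and W: "AE s in unit_unif. has_weak_gradient \<Omega> (p s) (H s)"
    and pm: "(\<lambda>(s, x). p s x) \<in> borel_measurable (unit_unif \<Otimes>\<^sub>M R)"
    and Hm: "(\<lambda>(s, x). H s x) \<in> borel_measurable (unit_unif \<Otimes>\<^sub>M R)"
    and pK: "\<And>K. compact K \<Longrightarrow> K \<subseteq> \<Omega> \<Longrightarrow> integrable (unit_unif \<Otimes>\<^sub>M R) (\<lambda>(s, x). indicator K x * p s x)"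
    and HK: "\<And>K. compact K \<Longrightarrow> K \<subseteq> \<Omega> \<Longrightarrow> integrable (unit_unif \<Otimes>\<^sub>M R) (\<lambda>(s, x). indicator K x *\<^sub>R H s x)"
  shows "has_weak_gradient \<Omega> (\<lambda>x. LINT s|unit_unif. p s x) (\<lambda>x. LINT s|unit_unif. H s x)"
proof -
  have [measurable]: "\<Omega> \<in> sets borel" using \<Omega> by auto
  interpret R: sigma_finite_measure R
    unfolding R_def by (rule sigma_finite_measure_restrict_space[OF sigma_finite_lborel]) auto
  interpret Q: pair_sigma_finite unit_unif R ..
  have toR: "set_lebesgue_integral lborel \<Omega> f = (LINT x|R. f x)" for f :: "'a \<Rightarrow> real"
    unfolding set_lebesgue_integral_def R_def by (subst integral_restrict_space) auto
  have setR: "set_integrable lborel K f" if "integrable R (\<lambda>x. indicator K x *\<^sub>R f x)" "K \<subseteq> \<Omega>" for f :: "'a \<Rightarrow> 'c::euclidean_space" and K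
  proof -
    have "integrable lborel (\<lambda>x. indicator \<Omega> x *\<^sub>R indicator K x *\<^sub>R f x)"
      using that(1) unfolding R_def by (subst (asm) integrable_restrict_space) auto
    moreover have "(\<lambda>x. indicator \<Omega> x *\<^sub>R indicator K x *\<^sub>R f x) = (\<lambda>x. indicator K x *\<^sub>R f x)"
      using that(2) by (auto simp: indicator_def fun_eq_iff)
    ultimately show ?thesis by (simp add: set_integrable_def)
  qed
  have li1: "locally_integrable \<Omega> (\<lambda>x. LINT s|unit_unif. p s x)"
    unfolding locally_integrable_def
  proof (intro allI impI)
    fix K assume K: "compact K \<and> K \<subseteq> \<Omega>"
    have "integrable R (\<lambda>x. LINT s|unit_unif. indicator K x * p s x)"
      using Q.integrable_snd[OF pK] K by auto
    then show "set_integrable lborel K (\<lambda>x. LINT s|unit_unif. p s x)" using K by (intro setR) auto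
  qed
  have li2: "locally_integrable \<Omega> (\<lambda>x. LINT s|unit_unif. H s x)"
    unfolding locally_integrable_def
  proof (intro allI impI)
    fix K assume K: "compact K \<and> K \<subseteq> \<Omega>"
    have "integrable R (\<lambda>x. LINT s|unit_unif. indicator K x *\<^sub>R H s x)"
      using Q.integrable_snd[OF HK] K by auto
    then show "set_integrable lborel K (\<lambda>x. LINT s|unit_unif. H s x)" using K by (intro setR) auto
  qed
  show ?thesis unfolding has_weak_gradient_def
  proof (intro conjI li1 li2 allI impI ballI)
    fix \<phi> :: "'a \<Rightarrow> real" and b :: 'a
    assume \<phi>: "C_c_infinity \<Omega> \<phi>" and b: "b \<in> Basis"
    obtain S where S: "compact S" "S \<subseteq> \<Omega>" "\<And>x. x \<notin> S \<Longrightarrow> \<phi> x = 0"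
      "\<And>x b. x \<notin> S \<Longrightarrow> frechet_derivative \<phi> (at x) b = 0"
      using C_c_infinity_support[OF \<phi>] by metis
    obtain B where B: "0 \<le> B" "\<And>x. \<bar>\<phi> x\<bar> \<le> B" "\<And>x. \<bar>frechet_derivative \<phi> (at x) b\<bar> \<le> B"
      using C_c_infinity_bounded[OF \<phi> b] by blast
    have [measurable]: "\<phi> \<in> borel_measurable borel" "(\<lambda>x. frechet_derivative \<phi> (at x) b) \<in> borel_measurable borel"
      using borel_measurable_continuous_onI C_c_infinity_continuous[OF \<phi>] C_c_infinity_continuous_partial[OF \<phi> b] by blast+
    have [measurable]: "(\<lambda>x. x) \<in> R \<rightarrow>\<^sub>M borel"
      unfolding R_def by (rule measurable_restrict_space1) auto
    have \<phi>R[measurable]: "\<phi> \<in> borel_measurable R" "(\<lambda>x. frechet_derivative \<phi> (at x) b) \<in> borel_measurable R"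
      using measurable_compose[OF \<open>(\<lambda>x. x) \<in> R \<rightarrow>\<^sub>M borel\<close>] by auto
    have iP: "integrable (unit_unif \<Otimes>\<^sub>M R) (\<lambda>(s, x). p s x * frechet_derivative \<phi> (at x) b)"
    proof -
      have "integrable (unit_unif \<Otimes>\<^sub>M R) (\<lambda>z. (case z of (s, x) \<Rightarrow> indicator S x * p s x) * frechet_derivative \<phi> (at (snd z)) b)"
        by (rule integrable_mult_bounded[OF pK[OF S(1,2)], of _ B]) (use B in auto)
      also have "(\<lambda>z. (case z of (s, x) \<Rightarrow> indicator S x * p s x) * frechet_derivative \<phi> (at (snd z)) b)
         = (\<lambda>(s, x). p s x * frechet_derivative \<phi> (at x) b)"
        using S(4) by (auto simp: indicator_def fun_eq_iff)
      finally show ?thesis .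
    qed
    have iHS: "integrable (unit_unif \<Otimes>\<^sub>M R) (\<lambda>z. (case z of (s, x) \<Rightarrow> indicator S x *\<^sub>R H s x) \<bullet> b)"
      using HK[OF S(1,2)] by (intro integrable_inner_left) auto
    have iH: "integrable (unit_unif \<Otimes>\<^sub>M R) (\<lambda>(s, x). (H s x \<bullet> b) * \<phi> x)"
    proof -
      have "integrable (unit_unif \<Otimes>\<^sub>M R) (\<lambda>z. ((case z of (s, x) \<Rightarrow> indicator S x *\<^sub>R H s x) \<bullet> b) * \<phi> (snd z))"
        by (rule integrable_mult_bounded[OF iHS, of _ B]) (use B in auto)
      also have "(\<lambda>z. ((case z of (s, x) \<Rightarrow> indicator S x *\<^sub>R H s x) \<bullet> b) * \<phi> (snd z)) = (\<lambda>(s, x). (H s x \<bullet> b) * \<phi> x)"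
        using S(3) by (auto simp: indicator_def fun_eq_iff)
      finally show ?thesis .
    qed
    have "(LINT x:\<Omega>|lborel. (LINT s|unit_unif. p s x) * frechet_derivative \<phi> (at x) b)
       = (LINT x|R. LINT s|unit_unif. p s x * frechet_derivative \<phi> (at x) b)"
      unfolding toR by simp
    also have "\<dots> = (LINT s|unit_unif. LINT x|R. p s x * frechet_derivative \<phi> (at x) b)"
      by (rule Q.Fubini_integral[OF iP])
    also have "\<dots> = (LINT s|unit_unif. - (LINT x|R. (H s x \<bullet> b) * \<phi> x))"
    proof (rule integral_cong_AE)
      show "AE s in unit_unif. (LINT x|R. p s x * frechet_derivative \<phi> (at x) b) = - (LINT x|R. (H s x \<bullet> b) * \<phi> x)"
        using W
      proof eventually_elim
        case (elim s)
        then have "(LINT x:\<Omega>|lborel. p s x * frechet_derivative \<phi> (at x) b) = - (LINT x:\<Omega>|lborel. (H s x \<bullet> b) * \<phi> x)"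
          using \<phi> b unfolding has_weak_gradient_def by blast
        then show ?case by (simp add: toR)
      qed
    qed (use pm Hm in measurable)
    also have "\<dots> = - (LINT s|unit_unif. LINT x|R. (H s x \<bullet> b) * \<phi> x)" by simp
    also have "(LINT s|unit_unif. LINT x|R. (H s x \<bullet> b) * \<phi> x) = (LINT x|R. LINT s|unit_unif. (H s x \<bullet> b) * \<phi> x)"
      by (rule Q.Fubini_integral[OF iH, symmetric])
    also have "\<dots> = (LINT x|R. ((LINT s|unit_unif. H s x) \<bullet> b) * \<phi> x)"
    proof (rule integral_cong_AE)
      show "AE x in R. (LINT s|unit_unif. (H s x \<bullet> b) * \<phi> x) = ((LINT s|unit_unif. H s x) \<bullet> b) * \<phi> x"
        using Q.AE_integrable_snd[OF HK[OF S(1,2)]]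
      proof eventually_elim
        case (elim x)
        show ?case
        proof (cases "x \<in> S")
          case True
          then have "integrable unit_unif (\<lambda>s. H s x)" using elim by simp
          then show ?thesis by simp
        next
          case False then show ?thesis using S(3) by simp
        qed
      qed
    qed (use Hm in measurable)
    finally show "(LINT x:\<Omega>|lborel. (LINT s|unit_unif. p s x) * frechet_derivative \<phi> (at x) b)
        = - (LINT x:\<Omega>|lborel. ((LINT s|unit_unif. H s x) \<bullet> b) * \<phi> x)"
      unfolding toR .
  qed
qed

section \<open>Averages in time as test functions\<close>

lemma C_c_infinity_real:
  fixes \<phi> :: "real \<Rightarrow> real"
  assumes \<phi>: "C_c_infinity S \<phi>"
  shows "deriv \<phi> t = frechet_derivative \<phi> (at t) 1"
proof -
  have "(\<phi> has_derivative frechet_derivative \<phi> (at t)) (at t)"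
    using C_c_infinity_differentiable[OF \<phi>] by (simp add: frechet_derivative_works)
  moreover have "frechet_derivative \<phi> (at t) = (*) (frechet_derivative \<phi> (at t) 1)"
    using linear_frechet_derivative[OF C_c_infinity_differentiable[OF \<phi>], of t]
    by (metis (no_types, lifting) ext linear_times_of_real mult.commute mult.right_neutral real_scaleR_def linear_cmul)
  ultimately have "(\<phi> has_real_derivative frechet_derivative \<phi> (at t) 1) (at t)"
    by (simp add: has_field_derivative_def)
  then show ?thesis by (rule DERIV_imp_deriv)
qed

lemma average_shift_eq:
  fixes P :: "real \<Rightarrow> real"
  assumes [measurable]: "P \<in> borel_measurable borel" and h: "0 < h"
  shows "(LINT s|unit_unif. P (t + h * s)) = (LINT r|lborel. indicator {t..t+h} r * P r) / h"
proof -
  have "(LINT r|lborel. indicator {t..t+h} r * P r) = \<bar>h\<bar> *\<^sub>R (LINT s|lborel. indicator {t..t+h} (t + h * s) * P (t + h * s))"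
    by (rule lborel_integral_real_affine) (use h in auto)
  also have "(\<lambda>s. indicator {t..t+h} (t + h * s) * P (t + h * s)) = (\<lambda>s. indicator {0..1} s * P (t + h * s))"
    using h by (auto simp: indicator_def fun_eq_iff mult_le_cancel_left1 zero_le_mult_iff)
  finally show ?thesis using h by (simp add: integral_unit_unif set_lebesgue_integral_def)
qed

lemma average_shift_lipschitz:
  fixes P :: "real \<Rightarrow> real"
  assumes Pm[measurable]: "P \<in> borel_measurable borel" and h: "0 < h" and B: "\<And>t. \<bar>P t\<bar> \<le> B"
  shows "\<bar>(LINT s|unit_unif. P (t + h * s)) - (LINT s|unit_unif. P (r + h * s))\<bar> \<le> 2 * B / h * \<bar>t - r\<bar>"
proof -
  have *: "\<bar>(LINT s|unit_unif. P (t + h * s)) - (LINT s|unit_unif. P (r + h * s))\<bar> \<le> 2 * B / h * (t - r)" if rt: "r \<le> t" for t r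
  proof -
    have i: "integrable lborel (\<lambda>x. indicator {a..b} x * P x)" for a b
    proof (rule integrable_mult_bounded[where B=B])
      show "integrable lborel (indicat_real {a..b})" by (intro integrable_real_indicator emeasure_compact_finite) auto
    qed (use B in auto)
    have ind[simp]: "integrable lborel (indicat_real {a..b})" for a b :: real
      by (intro integrable_real_indicator emeasure_compact_finite) auto
    have "\<bar>(LINT x|lborel. indicator {t..t+h} x * P x) - (LINT x|lborel. indicator {r..r+h} x * P x)\<bar>
      = \<bar>LINT x|lborel. indicator {t..t+h} x * P x - indicator {r..r+h} x * P x\<bar>" using i by simp
    also have "\<dots> \<le> (LINT x|lborel. \<bar>indicator {t..t+h} x * P x - indicator {r..r+h} x * P x\<bar>)"
      by (rule integral_abs_bound)
    also have "\<dots> \<le> (LINT x|lborel. B * indicator {r..t} x + B * indicator {r+h..t+h} x)"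
    proof (rule integral_mono)
      show "integrable lborel (\<lambda>x. \<bar>indicator {t..t+h} x * P x - indicator {r..r+h} x * P x\<bar>)" using i by auto
      show "integrable lborel (\<lambda>x. B * indicat_real {r..t} x + B * indicator {r+h..t+h} x)" by auto
      fix x
      have "0 \<le> B" using B[of 0] by simp
      then show "\<bar>indicator {t..t+h} x * P x - indicator {r..r+h} x * P x\<bar> \<le> B * indicat_real {r..t} x + B * indicator {r+h..t+h} x"
        using B[of x] rt by (auto simp: indicator_def)
    qed
    also have "\<dots> = 2 * B * (t - r)" using rt by simp
    finally have "\<bar>(LINT x|lborel. indicator {t..t+h} x * P x) - (LINT x|lborel. indicator {r..r+h} x * P x)\<bar> / h \<le> 2 * B * (t - r) / h"
      using h by (intro divide_right_mono) auto
    then show ?thesis using h by (simp add: average_shift_eq flip: diff_divide_distrib)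
  qed
  show ?thesis
    using *[of r t] *[of t r] by (cases "r \<le> t") (auto simp: abs_minus_commute)
qed

text \<open>By Fubini's theorem and translation the average moves to \<open>\<phi>'\<close>, where the fundamental theorem of calculus
turns it into a difference quotient; a further translation returns this to \<open>P\<close>.\<close>

lemma average_shift_weak_derivative:
  fixes P \<phi> :: "real \<Rightarrow> real"
  assumes Pm[measurable]: "P \<in> borel_measurable borel" and h: "0 < h" and PB: "\<And>t. \<bar>P t\<bar> \<le> B"
    and \<phi>: "C_c_infinity {0<..<T} \<phi>"
  shows "(LINT t:{0<..<T}|lborel. deriv \<phi> t * (LINT s|unit_unif. P (t + h * s)))
    = - (LINT t:{0<..<T}|lborel. \<phi> t * ((P (t + h) - P t) / h))"
proof -
  interpret Q: pair_sigma_finite unit_unif "lborel :: real measure" ..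
  define d where "d t = frechet_derivative \<phi> (at t) 1" for t
  have d: "deriv \<phi> = d" unfolding d_def using C_c_infinity_real[OF \<phi>] by auto
  obtain S where S: "compact S" "S \<subseteq> {0<..<T}" "\<And>x. x \<notin> S \<Longrightarrow> \<phi> x = 0" "\<And>x. x \<notin> S \<Longrightarrow> d x = 0"
    using C_c_infinity_support[OF \<phi>] unfolding d_def by metis
  have out: "\<phi> x = 0 \<and> d x = 0" if "\<not> (0 < x \<and> x < T)" for x
    using S(2) S(3)[of x] S(4)[of x] that by (cases "x \<in> S") auto
  obtain C where C: "0 \<le> C" "\<And>x. \<bar>\<phi> x\<bar> \<le> C" "\<And>x. \<bar>d x\<bar> \<le> C"
    using C_c_infinity_bounded[OF \<phi>, of 1] unfolding d_def by auto
  have dc: "continuous_on UNIV d" unfolding d_def by (rule C_c_infinity_continuous_partial[OF \<phi>]) simp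
  have [measurable]: "\<phi> \<in> borel_measurable borel" "d \<in> borel_measurable borel"
    using borel_measurable_continuous_onI C_c_infinity_continuous[OF \<phi>] dc by blast+
  have Si: "integrable lborel (indicat_real S)"
    using emeasure_compact_finite[OF S(1)] S(1) by (intro integrable_real_indicator) (auto intro: borel_closed compact_imp_closed)
  have \<phi>i: "integrable lborel \<phi>"
  proof -
    have "integrable lborel (\<lambda>x. indicator S x * \<phi> x)"
      by (rule integrable_mult_bounded[OF Si, of \<phi> C]) (use C in auto)
    moreover have "(\<lambda>x. indicator S x * \<phi> x) = \<phi>" using S(3) by (auto simp: indicator_def fun_eq_iff)
    ultimately show ?thesis by simp
  qed
  have di: "integrable lborel d"
  proof -
    have "integrable lborel (\<lambda>x. indicator S x * d x)"
      by (rule integrable_mult_bounded[OF Si, of d C]) (use C in auto)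
    moreover have "(\<lambda>x. indicator S x * d x) = d" using S(4) by (auto simp: indicator_def fun_eq_iff)
    ultimately show ?thesis by simp
  qed
  have i1: "integrable (unit_unif \<Otimes>\<^sub>M lborel) (\<lambda>(s, t). d t * P (t + h * s))"
    using integrable_mult_bounded[OF integrable_pair_directional[OF di, of 0], of "\<lambda>(s, t). P (t + h * s)" B] PB
    by (simp add: case_prod_beta')
  have i2: "integrable (unit_unif \<Otimes>\<^sub>M lborel) (\<lambda>(s, t). d (t - h * s) * P t)"
    using integrable_mult_bounded[OF integrable_pair_directional[OF di, of "- h" 1], of "\<lambda>(s, t). P t" B] PB
    by (simp add: case_prod_beta')
  have FTC: "\<phi> (t - h) - \<phi> t = - h * (LINT s|unit_unif. d (t - h * s))" for t
    using directional_FTC[OF C_c_infinity_differentiable[OF \<phi>] dc[unfolded d_def], of t "- h"] by (simp add: d_def)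
  have \<phi>Pi: "integrable lborel (\<lambda>t. \<phi> (t - c) * P t)" for c
    by (rule integrable_mult_bounded[where B=B]) (use integrable_translate[OF \<phi>i, of "- c"] PB in auto)
  have \<phi>Pi': "integrable lborel (\<lambda>t. \<phi> t * P (t + h))"
    by (rule integrable_mult_bounded[where B=B]) (use \<phi>i PB in auto)
  have "(LINT t:{0<..<T}|lborel. deriv \<phi> t * (LINT s|unit_unif. P (t + h * s)))
     = (LINT t|lborel. LINT s|unit_unif. d t * P (t + h * s))"
    unfolding d set_lebesgue_integral_def
    by (intro Bochner_Integration.integral_cong) (use out in \<open>auto simp: indicator_def\<close>)
  also have "\<dots> = (LINT s|unit_unif. LINT t|lborel. d t * P (t + h * s))"
    by (rule Q.Fubini_integral[OF i1])
  also have "\<dots> = (LINT s|unit_unif. LINT t|lborel. d (t - h * s) * P t)"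
  proof (rule Bochner_Integration.integral_cong[OF refl])
    fix s
    show "(LINT t|lborel. d t * P (t + h * s)) = (LINT t|lborel. d (t - h * s) * P t)"
      using integral_translate[of "\<lambda>t. d (t - h * s) * P t" "h * s"] by simp
  qed
  also have "\<dots> = (LINT t|lborel. LINT s|unit_unif. d (t - h * s) * P t)"
    by (rule Q.Fubini_integral[OF i2, symmetric])
  also have "\<dots> = (LINT t|lborel. (\<phi> (t - 0) * P t - \<phi> (t - h) * P t) / h)"
  proof (rule Bochner_Integration.integral_cong[OF refl])
    fix t
    have "(LINT s|unit_unif. d (t - h * s)) = (\<phi> t - \<phi> (t - h)) / h" using FTC[of t] h by (simp add: field_simps)
    then show "(LINT s|unit_unif. d (t - h * s) * P t) = (\<phi> (t - 0) * P t - \<phi> (t - h) * P t) / h"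
      by (simp add: left_diff_distrib)
  qed
  also have "\<dots> = ((LINT t|lborel. \<phi> t * P t) - (LINT t|lborel. \<phi> (t - h) * P t)) / h"
    using \<phi>Pi[of 0] \<phi>Pi[of h] by simp
  also have "(LINT t|lborel. \<phi> (t - h) * P t) = (LINT t|lborel. \<phi> t * P (t + h))"
    using integral_translate[of "\<lambda>t. \<phi> (t - h) * P t" h] by simp
  also have "((LINT t|lborel. \<phi> t * P t) - (LINT t|lborel. \<phi> t * P (t + h))) / h
      = - (LINT t|lborel. (\<phi> t * P (t + h) - \<phi> t * P t) / h)"
    using \<phi>Pi[of 0] \<phi>Pi' h by (simp add: field_simps)
  also have "(LINT t|lborel. (\<phi> t * P (t + h) - \<phi> t * P t) / h) = (LINT t:{0<..<T}|lborel. \<phi> t * ((P (t + h) - P t) / h))"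
    unfolding set_lebesgue_integral_def
    by (intro Bochner_Integration.integral_cong) (use out in \<open>auto simp: indicator_def right_diff_distrib\<close>)
  finally show ?thesis .
qed

lemma in_Lp_2_iff: "in_Lp 2 M f \<longleftrightarrow> f \<in> borel_measurable M \<and> integrable M (\<lambda>x. (norm (f x))\<^sup>2)"
  unfolding in_Lp_def by simp

lemma in_Lp_2_bounded:
  fixes f :: "'b \<Rightarrow> real"
  assumes "finite_measure M" and [measurable]: "f \<in> borel_measurable M" and "\<And>x. x \<in> space M \<Longrightarrow> \<bar>f x\<bar> \<le> B"
  shows "in_Lp 2 M f"
proof -
  interpret finite_measure M by fact
  have "(norm (f x))\<^sup>2 \<le> B\<^sup>2" if "x \<in> space M" for x
    using assms(3)[OF that] by (intro power_mono) auto
  then show ?thesis unfolding in_Lp_2_iff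
    by (auto intro!: integrable_const_bound[of _ "B\<^sup>2"] AE_I2)
qed

lemma measurable_restrict_time:
  fixes f :: "real \<times> 'b \<Rightarrow> 'c::euclidean_space"
  assumes "f \<in> borel_measurable (lborel \<Otimes>\<^sub>M M)"
  shows "f \<in> borel_measurable (restrict_space lborel S \<Otimes>\<^sub>M M)"
proof -
  have "(\<lambda>t. t) \<in> restrict_space lborel S \<rightarrow>\<^sub>M (lborel :: real measure)"
    by (rule measurable_restrict_space1) auto
  then have "(\<lambda>z. (fst z, snd z)) \<in> restrict_space lborel S \<Otimes>\<^sub>M M \<rightarrow>\<^sub>M lborel \<Otimes>\<^sub>M M"
    by (intro measurable_Pair measurable_compose[OF measurable_fst] measurable_snd)
  from measurable_compose[OF this assms] show ?thesis by simp
qed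

text \<open>Averages of a bounded function are Lipschitz in time uniformly in \<open>x\<close>, which gives the continuity with values in
\<open>L\<^sup>2\<close>; thus they are admissible test functions even though \<open>p\<close> itself has no regularity in time.\<close>

theorem average_shift_in_W12_time:
  fixes p :: "real \<Rightarrow> 'b \<Rightarrow> real"
  assumes M: "finite_measure M" and T: "0 < T" and h: "0 < h"
    and pm[measurable]: "(\<lambda>(t, x). p t x) \<in> borel_measurable (lborel \<Otimes>\<^sub>M M)"
    and pB: "\<And>t x. x \<in> space M \<Longrightarrow> \<bar>p t x\<bar> \<le> B"
  shows "in_W12_time T M (\<lambda>t x. LINT s|unit_unif. p (t + h * s) x) (\<lambda>t x. (p (t + h) x - p t x) / h)"
proof -
  interpret finite_measure M by fact
  have finR: "finite_measure (restrict_space lborel {0<..<T})"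
    by (rule finite_measureI) (use T in \<open>simp add: emeasure_restrict_space space_restrict_space\<close>)
  have fin: "finite_measure (restrict_space lborel {0<..<T} \<Otimes>\<^sub>M M)"
    by (rule finite_measure_pair_measure[OF M finR])
  have pm': "(\<lambda>z. p (fst z) (snd z)) \<in> borel_measurable (lborel \<Otimes>\<^sub>M M)"
    using pm by (simp add: case_prod_beta')
  have [measurable]: "(\<lambda>t. p t x) \<in> borel_measurable borel" if "x \<in> space M" for x
    using measurable_compose[OF measurable_Pair2'[OF that, of "lborel"] pm'] by simp
  define \<eta> where "\<eta> t x = (LINT s|unit_unif. p (t + h * s) x)" for t x
  have \<eta>m: "(\<lambda>(t, x). \<eta> t x) \<in> borel_measurable (lborel \<Otimes>\<^sub>M M)"
  proof -
    have "(\<lambda>((t, x), s). p (t + h * s) x) \<in> borel_measurable ((lborel \<Otimes>\<^sub>M M) \<Otimes>\<^sub>M unit_unif)"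
    proof -
      have "(\<lambda>w. (fst (fst w) + h * snd w, snd (fst w))) \<in> (lborel \<Otimes>\<^sub>M M) \<Otimes>\<^sub>M unit_unif \<rightarrow>\<^sub>M lborel \<Otimes>\<^sub>M M"
        by measurable
      from measurable_compose[OF this pm'] show ?thesis by (simp add: case_prod_beta')
    qed
    then show ?thesis unfolding \<eta>_def case_prod_beta'
      by (intro unit_unif.borel_measurable_lebesgue_integral) (simp add: case_prod_beta')
  qed
  have \<eta>B: "\<bar>\<eta> t x\<bar> \<le> B" if "x \<in> space M" for t x
  proof -
    have "\<bar>\<eta> t x\<bar> \<le> (LINT s|unit_unif. \<bar>p (t + h * s) x\<bar>)" unfolding \<eta>_def by (rule integral_abs_bound)
    also have "\<dots> \<le> (LINT s|unit_unif. B)"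
    proof (rule integral_mono)
      show "integrable unit_unif (\<lambda>s. \<bar>p (t + h * s) x\<bar>)"
        by (rule unit_unif.integrable_const_bound[of _ B]) (use pB that in auto)
    qed (use pB that in auto)
    finally show ?thesis using unit_unif.prob_space by simp
  qed
  have \<eta>s[measurable]: "\<eta> t \<in> borel_measurable M" for t
    using measurable_compose[OF measurable_Pair1'[of t lborel M] \<eta>m] by simp
  have dm: "(\<lambda>(t, x). (p (t + h) x - p t x) / h) \<in> borel_measurable (lborel \<Otimes>\<^sub>M M)"
  proof -
    have "(\<lambda>w. (fst w + h, snd w)) \<in> lborel \<Otimes>\<^sub>M M \<rightarrow>\<^sub>M lborel \<Otimes>\<^sub>M M" by measurable
    from measurable_compose[OF this pm'] pm' show ?thesis by (simp add: case_prod_beta')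
  qed
  have dB: "\<bar>(p (t + h) x - p t x) / h\<bar> \<le> 2 * B / h" if "x \<in> space M" for t x
  proof -
    have "\<bar>p (t + h) x - p t x\<bar> \<le> 2 * B" using pB[OF that, of "t + h"] pB[OF that, of t] by linarith
    then show ?thesis using h by (simp add: abs_divide divide_right_mono)
  qed
  have lip: "\<bar>\<eta> t x - \<eta> r x\<bar> \<le> 2 * B / h * \<bar>t - r\<bar>" if "x \<in> space M" for t r x
    unfolding \<eta>_def by (rule average_shift_lipschitz) (use that h pB in auto)
  show ?thesis unfolding in_W12_time_def in_LpLp_def \<eta>_def[symmetric]
  proof (intro conjI allI impI ballI)
    show "in_Lp 2 (restrict_space lborel {0<..<T} \<Otimes>\<^sub>M M) (\<lambda>(t, x). \<eta> t x)"
      by (rule in_Lp_2_bounded[OF fin measurable_restrict_time[OF \<eta>m], of B]) (auto simp: space_pair_measure \<eta>B)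
    show "in_Lp 2 (restrict_space lborel {0<..<T} \<Otimes>\<^sub>M M) (\<lambda>(t, x). (p (t + h) x - p t x) / h)"
      by (rule in_Lp_2_bounded[OF fin measurable_restrict_time[OF dm], of "2 * B / h"])
         (use dB in \<open>auto simp: space_pair_measure\<close>)
    show "AE x in M. (LINT t:{0<..<T}|lborel. deriv \<phi> t * \<eta> t x) = - (LINT t:{0<..<T}|lborel. \<phi> t * ((p (t + h) x - p t x) / h))"
      if "C_c_infinity {0<..<T} \<phi>" for \<phi>
    proof (rule AE_I2)
      fix x assume "x \<in> space M"
      then show "(LINT t:{0<..<T}|lborel. deriv \<phi> t * \<eta> t x) = - (LINT t:{0<..<T}|lborel. \<phi> t * ((p (t + h) x - p t x) / h))"
        unfolding \<eta>_def using that h pB by (intro average_shift_weak_derivative[where B=B]) auto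
    qed
    show "in_Lp 2 M (\<eta> s)" for s
      by (rule in_Lp_2_bounded[OF M _ \<eta>B]) auto
    show "((\<lambda>t. Lp_norm 2 M (\<lambda>x. \<eta> t x - \<eta> s x)) \<longlongrightarrow> 0) (at s within {0..T})" for s
    proof (rule Lim_null_comparison)
      define C where "C = \<bar>2 * B / h\<bar> * measure M (space M) powr (1/2)"
      show "((\<lambda>t. C * \<bar>t - s\<bar>) \<longlongrightarrow> 0) (at s within {0..T})"
      proof -
        have "((\<lambda>t. C * \<bar>t - s\<bar>) \<longlongrightarrow> C * \<bar>s - s\<bar>) (at s within {0..T})" by (intro tendsto_intros)
        then show ?thesis by simp
      qed
      show "\<forall>\<^sub>F t in at s within {0..T}. norm (Lp_norm 2 M (\<lambda>x. \<eta> t x - \<eta> s x)) \<le> C * \<bar>t - s\<bar>"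
      proof (intro always_eventually allI)
        fix t
        let ?D = "\<bar>2 * B / h\<bar> * \<bar>t - s\<bar>"
        have "(LINT x|M. norm (\<eta> t x - \<eta> s x) powr 2) \<le> (LINT x|M. ?D\<^sup>2)"
        proof (rule integral_mono)
          show "integrable M (\<lambda>x. norm (\<eta> t x - \<eta> s x) powr 2)"
          proof -
            have "in_Lp 2 M (\<lambda>x. \<eta> t x - \<eta> s x)"
            proof (rule in_Lp_2_bounded[OF M, where B="2 * B / h * \<bar>t - s\<bar>"])
            qed (use lip in auto)
            then show ?thesis by (simp add: in_Lp_def)
          qed
          fix x assume "x \<in> space M"
          then have "\<bar>\<eta> t x - \<eta> s x\<bar> \<le> ?D" using lip[of x t s]
            by (smt (verit) abs_ge_self abs_ge_zero mult_right_mono)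
          then have "\<bar>\<eta> t x - \<eta> s x\<bar>\<^sup>2 \<le> ?D\<^sup>2" by (intro power_mono) auto
          then show "norm (\<eta> t x - \<eta> s x) powr 2 \<le> ?D\<^sup>2" by simp
        qed auto
        also have "\<dots> = measure M (space M) * ?D\<^sup>2" by simp
        finally have "(LINT x|M. norm (\<eta> t x - \<eta> s x) powr 2) powr (1/2) \<le> (measure M (space M) * ?D\<^sup>2) powr (1/2)"
          by (intro powr_mono2) (auto intro!: integral_nonneg_AE)
        also have "\<dots> = measure M (space M) powr (1/2) * ?D"
          by (simp add: powr_mult powr_half_sqrt)
        finally show "norm (Lp_norm 2 M (\<lambda>x. \<eta> t x - \<eta> s x)) \<le> C * \<bar>t - s\<bar>"
          by (simp add: Lp_norm_def C_def mult_ac)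
      qed
    qed
  qed
qed

text \<open>Jensen's inequality; it shows that averaging in time preserves square integrability of gradients.\<close>

lemma (in prob_space) norm_expectation_square_le:
  fixes X :: "'a \<Rightarrow> 'c::euclidean_space"
  assumes [measurable]: "X \<in> borel_measurable M" and X: "integrable M (\<lambda>x. (norm (X x))\<^sup>2)"
  shows "(norm (expectation X))\<^sup>2 \<le> expectation (\<lambda>x. (norm (X x))\<^sup>2)" "integrable M X"
proof -
  have i: "integrable M (\<lambda>x. norm (X x))"
  proof (rule Bochner_Integration.integrable_bound[where f="\<lambda>x. 1 + (norm (X x))\<^sup>2"])
    show "AE x in M. norm (norm (X x)) \<le> norm (1 + (norm (X x))\<^sup>2)"
    proof (intro always_eventually allI)
      fix x
      have "0 \<le> (norm (X x) - 1)\<^sup>2" by simp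
      then have "2 * norm (X x) \<le> 1 + (norm (X x))\<^sup>2" by (simp add: power2_diff)
      then show "norm (norm (X x)) \<le> norm (1 + (norm (X x))\<^sup>2)"
        using norm_ge_zero[of "X x"] zero_le_power2[of "norm (X x)"] by (simp only: real_norm_def abs_of_nonneg)
    qed
  qed (use X in auto)
  then show "integrable M X" by (subst (asm) integrable_norm_iff) auto
  define e where "e = expectation (\<lambda>x. norm (X x))"
  have "0 \<le> expectation (\<lambda>x. (norm (X x) - e)\<^sup>2)" by (intro integral_nonneg_AE) auto
  also have "\<dots> = expectation (\<lambda>x. (norm (X x))\<^sup>2 + e\<^sup>2 - 2 * e * norm (X x))"
    by (simp add: power2_diff mult_ac)
  also have "\<dots> = expectation (\<lambda>x. (norm (X x))\<^sup>2) + e\<^sup>2 - 2 * e * e"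
    using X i prob_space by (simp add: e_def)
  finally have "e\<^sup>2 \<le> expectation (\<lambda>x. (norm (X x))\<^sup>2)" by (simp add: power2_eq_square)
  moreover have "norm (expectation X) \<le> e" unfolding e_def by (rule integral_norm_bound)
  then have "(norm (expectation X))\<^sup>2 \<le> e\<^sup>2" by (intro power_mono) auto
  ultimately show "(norm (expectation X))\<^sup>2 \<le> expectation (\<lambda>x. (norm (X x))\<^sup>2)" by linarith
qed

section \<open>Functions on a time slab\<close>

text \<open>Extending functions by zero from the slab \<open>0 < t < T\<close> to all times makes time shifts measure preserving
without boundary terms.\<close>

definition time_cut :: "real \<Rightarrow> (real \<times> 'b \<Rightarrow> 'c::zero) \<Rightarrow> real \<times> 'b \<Rightarrow> 'c" where
  "time_cut T f z = (if 0 < fst z \<and> fst z < T then f z else 0)"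

text \<open>Reading \<open>f\<close> at a fixed time of the slab whenever \<open>t\<close> lies outside makes \<open>f\<close> a function on the whole
product.\<close>

lemma time_cut_measurable:
  fixes f :: "real \<times> 'b \<Rightarrow> 'c::euclidean_space"
  assumes f: "f \<in> borel_measurable (restrict_space lborel {0<..<T} \<Otimes>\<^sub>M M)" and T: "0 < T"
  shows "time_cut T f \<in> borel_measurable (lborel \<Otimes>\<^sub>M M)"
proof -
  define g :: "real \<Rightarrow> real" where "g t = (if 0 < t \<and> t < T then t else T / 2)" for t
  have g: "g \<in> lborel \<rightarrow>\<^sub>M restrict_space lborel {0<..<T}"
  proof (rule measurable_restrict_space2)
    show "g \<in> lborel \<rightarrow>\<^sub>M lborel" unfolding g_def by measurable
  qed (use T in \<open>auto simp: g_def\<close>)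
  have "(\<lambda>z. (g (fst z), snd z)) \<in> lborel \<Otimes>\<^sub>M M \<rightarrow>\<^sub>M restrict_space lborel {0<..<T} \<Otimes>\<^sub>M M"
    by (intro measurable_Pair measurable_compose[OF measurable_fst g] measurable_snd)
  from measurable_compose[OF this f]
  have [measurable]: "(\<lambda>z. f (g (fst z), snd z)) \<in> borel_measurable (lborel \<Otimes>\<^sub>M M)" .
  have "time_cut T f = (\<lambda>z. if 0 < fst z \<and> fst z < T then f (g (fst z), snd z) else 0)"
    by (auto simp: time_cut_def g_def fun_eq_iff)
  then show ?thesis by simp
qed

lemma nn_integral_restrict_time:
  fixes f :: "real \<times> 'b \<Rightarrow> ennreal"
  assumes M: "sigma_finite_measure M" and f[measurable]: "f \<in> borel_measurable (lborel \<Otimes>\<^sub>M M)"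
  shows "(\<integral>\<^sup>+z. f z \<partial>(restrict_space lborel {0<..<T} \<Otimes>\<^sub>M M)) = (\<integral>\<^sup>+z. f z * indicator {0<..<T} (fst z) \<partial>(lborel \<Otimes>\<^sub>M M))"
proof -
  interpret sigma_finite_measure M by fact
  have "(\<integral>\<^sup>+z. f z \<partial>(restrict_space lborel {0<..<T} \<Otimes>\<^sub>M M)) = (\<integral>\<^sup>+t. \<integral>\<^sup>+x. f (t, x) \<partial>M \<partial>(restrict_space lborel {0<..<T}))"
  proof (rule nn_integral_fst[symmetric])
    have "(\<lambda>t. t) \<in> restrict_space lborel {0<..<T} \<rightarrow>\<^sub>M (lborel :: real measure)"
      by (rule measurable_restrict_space1) auto
    then have "(\<lambda>z. (fst z, snd z)) \<in> restrict_space lborel {0<..<T} \<Otimes>\<^sub>M M \<rightarrow>\<^sub>M lborel \<Otimes>\<^sub>M M"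
      by (intro measurable_Pair measurable_compose[OF measurable_fst] measurable_snd)
    from measurable_compose[OF this f] show "f \<in> borel_measurable (restrict_space lborel {0<..<T} \<Otimes>\<^sub>M M)" by simp
  qed
  also have "\<dots> = (\<integral>\<^sup>+t. (\<integral>\<^sup>+x. f (t, x) \<partial>M) * indicator {0<..<T} t \<partial>lborel)"
    by (rule nn_integral_restrict_space) auto
  also have "\<dots> = (\<integral>\<^sup>+t. \<integral>\<^sup>+x. f (t, x) * indicator {0<..<T} (fst (t, x)) \<partial>M \<partial>lborel)"
    by (intro nn_integral_cong, subst nn_integral_multc[symmetric]) (auto simp: space_pair_measure)
  also have "\<dots> = (\<integral>\<^sup>+z. f z * indicator {0<..<T} (fst z) \<partial>(lborel \<Otimes>\<^sub>M M))"
    by (rule nn_integral_fst) measurable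
  finally show ?thesis .
qed

lemma integrable_time_cut:
  fixes f :: "real \<times> 'b \<Rightarrow> real"
  assumes M: "sigma_finite_measure M" and T: "0 < T" and f: "integrable (restrict_space lborel {0<..<T} \<Otimes>\<^sub>M M) f"
  shows "integrable (lborel \<Otimes>\<^sub>M M) (time_cut T f)"
proof (rule integrableI_bounded)
  interpret sigma_finite_measure M by fact
  show m[measurable]: "time_cut T f \<in> borel_measurable (lborel \<Otimes>\<^sub>M M)"
    by (rule time_cut_measurable) (use f T in auto)
  have "(\<integral>\<^sup>+z. ennreal (norm (time_cut T f z)) \<partial>(lborel \<Otimes>\<^sub>M M))
     = (\<integral>\<^sup>+z. ennreal (norm (time_cut T f z)) * indicator {0<..<T} (fst z) \<partial>(lborel \<Otimes>\<^sub>M M))"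
    by (intro nn_integral_cong) (auto simp: time_cut_def indicator_def)
  also have "\<dots> = (\<integral>\<^sup>+z. ennreal (norm (time_cut T f z)) \<partial>(restrict_space lborel {0<..<T} \<Otimes>\<^sub>M M))"
    by (rule nn_integral_restrict_time[OF M, symmetric]) measurable
  also have "\<dots> = (\<integral>\<^sup>+z. ennreal (norm (f z)) \<partial>(restrict_space lborel {0<..<T} \<Otimes>\<^sub>M M))"
    by (intro nn_integral_cong) (auto simp: time_cut_def space_pair_measure space_restrict_space)
  also have "\<dots> < \<infinity>" using f by (simp add: integrable_iff_bounded)
  finally show "(\<integral>\<^sup>+z. ennreal (norm (time_cut T f z)) \<partial>(lborel \<Otimes>\<^sub>M M)) < \<infinity>" .
qed

lemma integrable_restrict_time:
  fixes f :: "real \<times> 'b \<Rightarrow> real"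
  assumes M: "sigma_finite_measure M" and f: "integrable (lborel \<Otimes>\<^sub>M M) f"
  shows "integrable (restrict_space lborel {0<..<T} \<Otimes>\<^sub>M M) f"
proof (rule integrableI_bounded)
  have [measurable]: "f \<in> borel_measurable (lborel \<Otimes>\<^sub>M M)" using f by auto
  show "f \<in> borel_measurable (restrict_space lborel {0<..<T} \<Otimes>\<^sub>M M)" by (rule measurable_restrict_time) measurable
  have "(\<integral>\<^sup>+z. ennreal (norm (f z)) \<partial>(restrict_space lborel {0<..<T} \<Otimes>\<^sub>M M))
     = (\<integral>\<^sup>+z. ennreal (norm (f z)) * indicator {0<..<T} (fst z) \<partial>(lborel \<Otimes>\<^sub>M M))"
    by (rule nn_integral_restrict_time[OF M]) measurable
  also have "\<dots> \<le> (\<integral>\<^sup>+z. ennreal (norm (f z)) \<partial>(lborel \<Otimes>\<^sub>M M))"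
    by (intro nn_integral_mono) (auto simp: indicator_def)
  also have "\<dots> < \<infinity>" using f by (simp add: integrable_iff_bounded)
  finally show "(\<integral>\<^sup>+z. ennreal (norm (f z)) \<partial>(restrict_space lborel {0<..<T} \<Otimes>\<^sub>M M)) < \<infinity>" .
qed

lemma integrable_time_slab:
  assumes M: "finite_measure M"
  shows "integrable (lborel \<Otimes>\<^sub>M M) (time_cut T (\<lambda>_. B :: real))"
proof -
  interpret finite_measure M by fact
  interpret P: pair_sigma_finite "lborel :: real measure" M ..
  have m: "time_cut T (\<lambda>_. B) \<in> borel_measurable ((lborel :: real measure) \<Otimes>\<^sub>M M)"
    unfolding time_cut_def by measurable
  show ?thesis
  proof (rule P.Fubini_integrable[OF m])
    have "(\<lambda>t. LINT x|M. norm (time_cut T (\<lambda>_. B) (t, x))) = (\<lambda>t. indicator {0<..<T} t * (\<bar>B\<bar> * measure M (space M)))"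
      by (auto simp: time_cut_def indicator_def fun_eq_iff)
    moreover have "integrable lborel (\<lambda>t. indicator {0<..<T} t * (\<bar>B\<bar> * measure M (space M)))"
      by (intro integrable_mult_left integrable_real_indicator) (use emeasure_bounded_finite[of "{0<..<T}"] in auto)
    ultimately show "integrable lborel (\<lambda>t. LINT x|M. norm (time_cut T (\<lambda>_. B) (t, x)))" by simp
    show "AE t in lborel. integrable M (\<lambda>x. time_cut T (\<lambda>_. B) (t, x))"
      by (simp add: time_cut_def)
  qed
qed

lemma integrable_unit_unif_affine:
  fixes f :: "real \<Rightarrow> real"
  assumes f: "integrable lborel f" and h: "0 < h"
  shows "integrable unit_unif (\<lambda>s. f (t + h * s))"
proof -
  have [measurable]: "f \<in> borel_measurable borel" using f by auto
  have "integrable lborel (\<lambda>s. f (t + h * s))" by (rule lborel_integrable_real_affine[OF f]) (use h in simp)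
  then have "integrable lborel (\<lambda>s. indicator {0..1} s *\<^sub>R f (t + h * s))" by (intro integrable_mult_indicator) auto
  then show ?thesis unfolding unit_unif_eq_density by (subst integrable_density) auto
qed

lemma integrable_pair_slice:
  fixes F :: "real \<times> 'b \<Rightarrow> real"
  assumes M: "sigma_finite_measure M" and F: "integrable (lborel \<Otimes>\<^sub>M M) F" and h: "0 < h"
  shows "integrable (unit_unif \<Otimes>\<^sub>M M) (\<lambda>(s, x). F (t + h * s, x))"
proof -
  interpret M: sigma_finite_measure M by fact
  interpret P: pair_sigma_finite "lborel :: real measure" M ..
  interpret Q: pair_sigma_finite unit_unif M ..
  have Fm[measurable]: "F \<in> borel_measurable (lborel \<Otimes>\<^sub>M M)" using F by auto
  have m: "(\<lambda>(s, x). F (t + h * s, x)) \<in> borel_measurable (unit_unif \<Otimes>\<^sub>M M)" by measurable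
  show ?thesis
  proof (rule Q.Fubini_integrable[OF m])
    have "integrable lborel (\<lambda>r. LINT x|M. norm (F (r, x)))"
      using P.integrable_fst'[of "\<lambda>z. norm (F z)"] F by simp
    from integrable_unit_unif_affine[OF this h]
    show "integrable unit_unif (\<lambda>s. LINT x|M. norm (case (s, x) of (s, x) \<Rightarrow> F (t + h * s, x)))" by simp
    show "AE s in unit_unif. integrable M (\<lambda>x. case (s, x) of (s, x) \<Rightarrow> F (t + h * s, x))"
      using AE_unit_unif_affine[OF P.AE_integrable_fst'[OF F] h] by simp
  qed
qed

text \<open>On compact sets the weight is bounded below, so integrability with respect to the weighted measure implies
integrability with respect to Lebesgue measure.\<close>

lemma (in weighted_domain) integrable_pair_compact:
  fixes F :: "real \<times> 'a \<Rightarrow> real"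
  assumes F: "integrable (unit_unif \<Otimes>\<^sub>M weighted \<Omega> \<rho>) F" and K: "compact K" "K \<subseteq> \<Omega>"
  shows "integrable (unit_unif \<Otimes>\<^sub>M restrict_space lborel \<Omega>) (\<lambda>z. indicator K (snd z) * F z)"
proof -
  let ?R = "restrict_space lborel \<Omega>" and ?W = "weighted \<Omega> \<rho>"
  interpret W: sigma_finite_measure ?W by (rule sigma_finite_weighted)
  interpret R: sigma_finite_measure ?R
    by (rule sigma_finite_measure_restrict_space[OF sigma_finite_lborel]) auto
  interpret PW: pair_sigma_finite unit_unif ?W ..
  interpret PR: pair_sigma_finite unit_unif ?R ..
  have cong[measurable_cong]: "sets ?W = sets ?R" by (simp add: sets_weighted sets_restrict_space)
  have congP: "sets (unit_unif \<Otimes>\<^sub>M ?W) = sets (unit_unif \<Otimes>\<^sub>M ?R)" by (rule sets_pair_measure_cong) (simp_all add: cong)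
  have FW[measurable]: "F \<in> borel_measurable (unit_unif \<Otimes>\<^sub>M ?W)" using F by auto
  then have FR[measurable]: "F \<in> borel_measurable (unit_unif \<Otimes>\<^sub>M ?R)" by (simp cong: measurable_cong_sets add: congP)
  have KS: "K \<in> sets ?R" using K
    by (subst sets_restrict_space_iff) (auto intro: borel_closed compact_imp_closed)
  then have [measurable]: "indicat_real K \<in> borel_measurable ?R" by simp
  have m: "(\<lambda>z. indicator K (snd z) * F z) \<in> borel_measurable (unit_unif \<Otimes>\<^sub>M ?R)" by measurable
  obtain c where c: "0 < c" "\<And>x. x \<in> K \<Longrightarrow> c \<le> \<rho> x" using weight_lower_bound[OF K] by blast
  have pt: "\<bar>indicator K x * F (s, x)\<bar> \<le> (1 / c) * \<bar>\<rho> x * F (s, x)\<bar>" for s x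
  proof (cases "x \<in> K")
    case True
    have "c * \<bar>F (s, x)\<bar> \<le> \<rho> x * \<bar>F (s, x)\<bar>" using c(2)[OF True] by (intro mult_right_mono) auto
    then show ?thesis using True c(1) c(2)[OF True] by (simp add: field_simps abs_mult)
  next
    case False then show ?thesis using c(1) by simp
  qed
  have sec: "AE s in unit_unif. integrable ?R (\<lambda>x. \<rho> x * F (s, x))"
    using PW.AE_integrable_fst'[OF F]
  proof eventually_elim
    case (elim s)
    have "(\<lambda>x. F (s, x)) \<in> borel_measurable ?R" by measurable
    from integrable_weighted_iff[OF this] elim show ?case by simp
  qed
  have iK: "integrable ?R (\<lambda>x. indicator K x * F (s, x))" if s: "integrable ?R (\<lambda>x. \<rho> x * F (s, x))" for s
  proof (rule Bochner_Integration.integrable_bound)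
    show "integrable ?R (\<lambda>x. (1 / c) * \<bar>\<rho> x * F (s, x)\<bar>)"
      using s by (intro integrable_mult_right integrable_abs) auto
    show "(\<lambda>x. indicator K x * F (s, x)) \<in> borel_measurable ?R" by measurable
    show "AE x in ?R. norm (indicator K x * F (s, x)) \<le> norm ((1 / c) * \<bar>\<rho> x * F (s, x)\<bar>)"
    proof (intro always_eventually allI)
      fix x
      show "norm (indicator K x * F (s, x)) \<le> norm ((1 / c) * \<bar>\<rho> x * F (s, x)\<bar>)"
        using pt[of x s] unfolding real_norm_def by (rule order_trans[OF _ abs_ge_self])
    qed
  qed
  show ?thesis
  proof (rule PR.Fubini_integrable[OF m])
    show "AE s in unit_unif. integrable ?R (\<lambda>x. indicator K (snd (s, x)) * F (s, x))"
      using sec by eventually_elim (simp add: iK)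
    show "integrable unit_unif (\<lambda>s. LINT x|?R. norm (indicator K (snd (s, x)) * F (s, x)))"
    proof (rule Bochner_Integration.integrable_bound)
      show "integrable unit_unif (\<lambda>s. (1 / c) * (LINT x|?W. norm (F (s, x))))"
        using PW.integrable_fst'[of "\<lambda>z. norm (F z)"] F by (intro integrable_mult_right) auto
      show "AE s in unit_unif. norm (LINT x|?R. norm (indicator K (snd (s, x)) * F (s, x))) \<le> norm ((1 / c) * (LINT x|?W. norm (F (s, x))))"
        using sec
      proof eventually_elim
        case (elim s)
        have [measurable]: "(\<lambda>x. F (s, x)) \<in> borel_measurable ?R" by measurable
        have "(LINT x|?R. norm (indicator K (snd (s, x)) * F (s, x))) \<le> (LINT x|?R. (1 / c) * \<bar>\<rho> x * F (s, x)\<bar>)"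
        proof (rule integral_mono)
          show "integrable ?R (\<lambda>x. norm (indicator K (snd (s, x)) * F (s, x)))"
            using iK[OF elim] by simp
          show "integrable ?R (\<lambda>x. (1 / c) * \<bar>\<rho> x * F (s, x)\<bar>)"
            using elim by (intro integrable_mult_right integrable_abs) auto
          show "norm (indicator K (snd (s, x)) * F (s, x)) \<le> (1 / c) * \<bar>\<rho> x * F (s, x)\<bar>" for x
            using pt[of x s] by simp
        qed
        also have "\<dots> = (1 / c) * (LINT x|?R. \<rho> x * norm (F (s, x)))"
          using weight_pos by (subst integral_mult_right_zero) (auto intro!: Bochner_Integration.integral_cong simp: space_restrict_space abs_mult less_imp_le)
        also have "(LINT x|?R. \<rho> x * norm (F (s, x))) = (LINT x|?W. norm (F (s, x)))"
          unfolding weighted_def by (subst integral_density) (use weight_pos in \<open>auto simp: space_restrict_space less_imp_le intro!: AE_I2\<close>)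
        finally have "(LINT x|?R. norm (indicator K (snd (s, x)) * F (s, x))) \<le> (1 / c) * (LINT x|?W. norm (F (s, x)))" .
        moreover have "0 \<le> (LINT x|?R. norm (indicator K (snd (s, x)) * F (s, x)))" by (rule integral_nonneg_AE) auto
        ultimately show ?case unfolding real_norm_def by linarith
      qed
    qed measurable
  qed
qed

lemma borel_measurable_inner_Basis:
  fixes f :: "'b \<Rightarrow> 'c::euclidean_space"
  assumes [measurable]: "f \<in> borel_measurable M"
  shows "(\<lambda>z. f z \<bullet> b) \<in> borel_measurable M"
  by measurable

lemma integrable_inner_square:
  fixes f :: "'b \<Rightarrow> 'c::euclidean_space"
  assumes [measurable]: "f \<in> borel_measurable M" and f: "integrable M (\<lambda>z. (norm (f z))\<^sup>2)" and b: "b \<in> Basis"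
  shows "integrable M (\<lambda>z. (f z \<bullet> b)\<^sup>2)"
proof (rule Bochner_Integration.integrable_bound[OF f])
  show "AE z in M. norm ((f z \<bullet> b)\<^sup>2) \<le> norm ((norm (f z))\<^sup>2)"
  proof (intro always_eventually allI)
    fix z
    have "\<bar>f z \<bullet> b\<bar>\<^sup>2 \<le> (norm (f z))\<^sup>2" using Basis_le_norm[OF b, of "f z"] by (intro power_mono) auto
    then show "norm ((f z \<bullet> b)\<^sup>2) \<le> norm ((norm (f z))\<^sup>2)" by simp
  qed
qed measurable

lemma integrable_pair_tshift_inner:
  fixes f g :: "real \<times> 'b \<Rightarrow> 'c::euclidean_space"
  assumes M: "sigma_finite_measure M"
    and fm: "f \<in> borel_measurable (lborel \<Otimes>\<^sub>M M)" and gm: "g \<in> borel_measurable (lborel \<Otimes>\<^sub>M M)"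
    and f: "integrable (lborel \<Otimes>\<^sub>M M) (\<lambda>z. (norm (f z))\<^sup>2)"
    and g: "integrable (lborel \<Otimes>\<^sub>M M) (\<lambda>z. (norm (g z))\<^sup>2)"
  shows "integrable (unit_unif \<Otimes>\<^sub>M (lborel \<Otimes>\<^sub>M M)) (\<lambda>(s, z). f z \<bullet> g (tshift (h * s) z))"
proof -
  have "integrable (unit_unif \<Otimes>\<^sub>M (lborel \<Otimes>\<^sub>M M)) (\<lambda>w. \<Sum>b\<in>Basis. (case w of (s, z) \<Rightarrow> (f z \<bullet> b) * (g (tshift (h * s) z) \<bullet> b)))"
  proof (rule Bochner_Integration.integrable_sum)
    fix b :: 'c assume b: "b \<in> Basis"
    show "integrable (unit_unif \<Otimes>\<^sub>M (lborel \<Otimes>\<^sub>M M)) (\<lambda>(s, z). (f z \<bullet> b) * (g (tshift (h * s) z) \<bullet> b))"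
      by (rule integrable_pair_tshift_mult[OF M borel_measurable_inner_Basis[OF fm] borel_measurable_inner_Basis[OF gm]
          integrable_inner_square[OF fm f b] integrable_inner_square[OF gm g b]])
  qed
  also have "(\<lambda>w. \<Sum>b\<in>Basis. (case w of (s, z) \<Rightarrow> (f z \<bullet> b) * (g (tshift (h * s) z) \<bullet> b))) = (\<lambda>(s, z). f z \<bullet> g (tshift (h * s) z))"
    by (intro ext) (simp only: case_prod_beta' euclidean_inner[symmetric])
  finally show ?thesis .
qed

lemma tshift_averaged_correlation_inner:
  fixes f g :: "real \<times> 'b \<Rightarrow> 'c::euclidean_space"
  assumes M: "sigma_finite_measure M"
    and fm: "f \<in> borel_measurable (lborel \<Otimes>\<^sub>M M)" and gm: "g \<in> borel_measurable (lborel \<Otimes>\<^sub>M M)"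
    and f: "integrable (lborel \<Otimes>\<^sub>M M) (\<lambda>z. (norm (f z))\<^sup>2)"
    and g: "integrable (lborel \<Otimes>\<^sub>M M) (\<lambda>z. (norm (g z))\<^sup>2)" and h: "h \<longlonglongrightarrow> 0"
  shows "(\<lambda>k. LINT s|unit_unif. LINT z|(lborel \<Otimes>\<^sub>M M). f z \<bullet> g (tshift (h k * s) z)) \<longlonglongrightarrow> (LINT z|(lborel \<Otimes>\<^sub>M M). f z \<bullet> g z)"
proof -
  interpret M: sigma_finite_measure M by fact
  interpret P: pair_sigma_finite "lborel :: real measure" M ..
  interpret Q: pair_sigma_finite unit_unif "(lborel :: real measure) \<Otimes>\<^sub>M M" ..
  let ?P = "lborel \<Otimes>\<^sub>M M"
  have fb: "(\<lambda>z. f z \<bullet> b) \<in> borel_measurable ?P" "(\<lambda>z. g z \<bullet> b) \<in> borel_measurable ?P" for b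
    using fm gm by (auto intro: borel_measurable_inner_Basis)
  have sq: "integrable ?P (\<lambda>z. (f z \<bullet> b)\<^sup>2)" "integrable ?P (\<lambda>z. (g z \<bullet> b)\<^sup>2)" if "b \<in> Basis" for b
    using integrable_inner_square fm gm f g that by blast+
  have I: "integrable (unit_unif \<Otimes>\<^sub>M ?P) (\<lambda>(s, z). (f z \<bullet> b) * (g (tshift (a * s) z) \<bullet> b))" if "b \<in> Basis" for a b
    by (rule integrable_pair_tshift_mult[OF M fb sq[OF that]])
  have eq: "(LINT s|unit_unif. LINT z|?P. f z \<bullet> g (tshift (a * s) z))
     = (\<Sum>b\<in>Basis. LINT s|unit_unif. LINT z|?P. (f z \<bullet> b) * (g (tshift (a * s) z) \<bullet> b))" for a
  proof -
    have "(LINT s|unit_unif. LINT z|?P. f z \<bullet> g (tshift (a * s) z))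
      = (LINT w|(unit_unif \<Otimes>\<^sub>M ?P). (case w of (s, z) \<Rightarrow> f z \<bullet> g (tshift (a * s) z)))"
      using Q.integral_fst[OF integrable_pair_tshift_inner[OF M fm gm f g, of a]] .
    also have "\<dots> = (LINT w|(unit_unif \<Otimes>\<^sub>M ?P). (\<Sum>b\<in>Basis. (case w of (s, z) \<Rightarrow> (f z \<bullet> b) * (g (tshift (a * s) z) \<bullet> b))))"
      by (simp only: case_prod_beta' euclidean_inner[symmetric])
    also have "\<dots> = (\<Sum>b\<in>Basis. LINT w|(unit_unif \<Otimes>\<^sub>M ?P). (case w of (s, z) \<Rightarrow> (f z \<bullet> b) * (g (tshift (a * s) z) \<bullet> b)))"
      by (rule Bochner_Integration.integral_sum[OF I])
    also have "\<dots> = (\<Sum>b\<in>Basis. LINT s|unit_unif. LINT z|?P. (f z \<bullet> b) * (g (tshift (a * s) z) \<bullet> b))"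
      by (intro sum.cong refl Q.integral_fst[OF I, symmetric])
    finally show ?thesis .
  qed
  have "(\<lambda>k. \<Sum>b\<in>Basis. LINT s|unit_unif. LINT z|?P. (f z \<bullet> b) * (g (tshift (h k * s) z) \<bullet> b))
     \<longlonglongrightarrow> (\<Sum>b\<in>Basis. LINT z|?P. (f z \<bullet> b) * (g z \<bullet> b))"
    by (rule tendsto_sum, rule tshift_averaged_correlation[OF M fb sq h])
  moreover have "(\<Sum>b\<in>Basis. LINT z|?P. (f z \<bullet> b) * (g z \<bullet> b)) = (LINT z|?P. f z \<bullet> g z)"
  proof -
    have "(LINT z|?P. f z \<bullet> g z) = (LINT z|?P. (\<Sum>b\<in>Basis. (f z \<bullet> b) * (g z \<bullet> b)))"
      by (simp only: euclidean_inner[symmetric])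
    also have "\<dots> = (\<Sum>b\<in>Basis. LINT z|?P. (f z \<bullet> b) * (g z \<bullet> b))"
      by (rule Bochner_Integration.integral_sum, rule integrable_mult_L2[OF fb sq])
    finally show ?thesis by simp
  qed
  ultimately show ?thesis by (simp add: eq)
qed

section \<open>Testing the equation with functions of the solution\<close>

lemma spow_continuous: "0 < q \<Longrightarrow> continuous_on UNIV (spow q)"
proof -
  assume q: "0 < q"
  have "spow q = (\<lambda>x. (max 0 x) powr q - (max 0 (- x)) powr q)"
    using q by (auto simp: spow_def fun_eq_iff max_def sgn_if)
  moreover have "continuous_on UNIV (\<lambda>x::real. (max 0 x) powr q - (max 0 (- x)) powr q)"
    by (intro continuous_on_diff continuous_on_powr' continuous_on_max continuous_on_const continuous_on_minus continuous_on_id) (use q in auto)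
  ultimately show ?thesis by simp
qed

lemma continuous_compose_measurable:
  fixes f :: "real \<times> 'b \<Rightarrow> real"
  assumes "continuous_on UNIV \<psi>" "f \<in> borel_measurable N"
  shows "(\<lambda>z. \<psi> (f z)) \<in> borel_measurable N"
  using measurable_compose[OF assms(2) borel_measurable_continuous_onI[OF assms(1)]] .

text \<open>A weak solution together with a choice \<open>G\<close> of the spatial gradient of \<open>u\<^sup>m\<close>.\<close>

locale pme_solution = nu: weighted_domain \<Omega> \<rho>\<^sub>\<nu> + mu: weighted_domain \<Omega> \<rho>\<^sub>\<mu>
  for \<Omega> :: "'a::euclidean_space set" and \<rho>\<^sub>\<nu> \<rho>\<^sub>\<mu> :: "'a \<Rightarrow> real" +
  fixes m :: real and u\<^sub>0 :: "'a \<Rightarrow> real" and u :: "real \<Rightarrow> 'a \<Rightarrow> real" and G :: "real \<Rightarrow> 'a \<Rightarrow> 'a"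
  assumes finite_nu: "finite_measure (weighted \<Omega> \<rho>\<^sub>\<nu>)" and m: "1 < m"
    and u0_L2: "in_Lp 2 (weighted \<Omega> \<rho>\<^sub>\<nu>) u\<^sub>0"
    and gradient: "AE t in lborel. 0 < t \<longrightarrow> has_weak_gradient \<Omega> (\<lambda>x. spow m (u t x)) (G t)"
    and u_L2: "\<And>T. 0 < T \<Longrightarrow> in_LpLp 2 T (weighted \<Omega> \<rho>\<^sub>\<nu>) u"
    and G_L2: "\<And>T. 0 < T \<Longrightarrow> in_LpLp 2 T (weighted \<Omega> \<rho>\<^sub>\<mu>) G"
    and weak: "\<And>T \<eta> \<eta>' \<zeta>. 0 < T \<Longrightarrow> in_W12_time T (weighted \<Omega> \<rho>\<^sub>\<nu>) \<eta> \<eta>' \<Longrightarrow>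
            (AE t in lborel. t \<in> {0<..<T} \<longrightarrow> has_weak_gradient \<Omega> (\<eta> t) (\<zeta> t)) \<Longrightarrow>
            in_LpLp 2 T (weighted \<Omega> \<rho>\<^sub>\<mu>) \<zeta> \<Longrightarrow>
            (AE x in weighted \<Omega> \<rho>\<^sub>\<nu>. \<eta> T x = 0) \<Longrightarrow>
            (LINT t:{0<..<T}|lborel. LINT x|weighted \<Omega> \<rho>\<^sub>\<nu>. u t x * \<eta>' t x) =
              - (LINT x|weighted \<Omega> \<rho>\<^sub>\<nu>. u\<^sub>0 x * \<eta> 0 x)
              + (LINT t:{0<..<T}|lborel. LINT x|weighted \<Omega> \<rho>\<^sub>\<mu>. G t x \<bullet> \<zeta> t x)"
begin

abbreviation \<nu> where "\<nu> \<equiv> weighted \<Omega> \<rho>\<^sub>\<nu>"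
abbreviation \<mu> where "\<mu> \<equiv> weighted \<Omega> \<rho>\<^sub>\<mu>"

sublocale fnu: finite_measure \<nu> by (rule finite_nu)
sublocale smu: sigma_finite_measure \<mu> by (rule mu.sigma_finite_weighted)
sublocale Pnu: pair_sigma_finite "lborel :: real measure" \<nu> ..
sublocale Pmu: pair_sigma_finite "lborel :: real measure" \<mu> ..

lemma sets_nu_mu: "sets \<nu> = sets \<mu>" by (simp add: sets_weighted)

lemma sets_time_nu_mu: "sets ((lborel :: real measure) \<Otimes>\<^sub>M \<nu>) = sets ((lborel :: real measure) \<Otimes>\<^sub>M \<mu>)"
  by (rule sets_pair_measure_cong) (simp_all add: sets_nu_mu)

definition uT :: "real \<Rightarrow> real \<times> 'a \<Rightarrow> real" where "uT T = time_cut T (case_prod u)"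
definition GT :: "real \<Rightarrow> real \<times> 'a \<Rightarrow> 'a" where "GT T = time_cut T (case_prod G)"

lemma uT_measurable [measurable]: "0 < T \<Longrightarrow> uT T \<in> borel_measurable (lborel \<Otimes>\<^sub>M \<nu>)"
  unfolding uT_def using u_L2[of T] by (intro time_cut_measurable) (auto simp: in_LpLp_def in_Lp_def case_prod_beta')

lemma GT_measurable [measurable]: "0 < T \<Longrightarrow> GT T \<in> borel_measurable (lborel \<Otimes>\<^sub>M \<mu>)"
  unfolding GT_def using G_L2[of T] by (intro time_cut_measurable) (auto simp: in_LpLp_def in_Lp_def case_prod_beta')

lemma uT_L2: assumes T: "0 < T" shows "integrable (lborel \<Otimes>\<^sub>M \<nu>) (\<lambda>z. (uT T z)\<^sup>2)"
proof -
  have "integrable (restrict_space lborel {0<..<T} \<Otimes>\<^sub>M \<nu>) (\<lambda>z. (case_prod u z)\<^sup>2)"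
    using u_L2[OF T] by (simp add: in_LpLp_def in_Lp_2_iff case_prod_beta')
  from integrable_time_cut[OF nu.sigma_finite_weighted T this]
  have "integrable (lborel \<Otimes>\<^sub>M \<nu>) (time_cut T (\<lambda>z. (case_prod u z)\<^sup>2))" .
  also have "time_cut T (\<lambda>z. (case_prod u z)\<^sup>2) = (\<lambda>z. (uT T z)\<^sup>2)"
    by (auto simp: uT_def time_cut_def fun_eq_iff)
  finally show ?thesis .
qed

lemma GT_L2: assumes T: "0 < T" shows "integrable (lborel \<Otimes>\<^sub>M \<mu>) (\<lambda>z. (norm (GT T z))\<^sup>2)"
proof -
  have "integrable (restrict_space lborel {0<..<T} \<Otimes>\<^sub>M \<mu>) (\<lambda>z. (norm (case_prod G z))\<^sup>2)"
    using G_L2[OF T] by (simp add: in_LpLp_def in_Lp_2_iff case_prod_beta')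
  from integrable_time_cut[OF mu.sigma_finite_weighted T this]
  have "integrable (lborel \<Otimes>\<^sub>M \<mu>) (time_cut T (\<lambda>z. (norm (case_prod G z))\<^sup>2))" .
  also have "time_cut T (\<lambda>z. (norm (case_prod G z))\<^sup>2) = (\<lambda>z. (norm (GT T z))\<^sup>2)"
    by (auto simp: GT_def time_cut_def fun_eq_iff)
  finally show ?thesis .
qed

text \<open>On a slab of finite measure, square integrability of \<open>u\<close> makes every function of linear growth in \<open>u\<close>
integrable.\<close>

lemma slab_integrable:
  assumes T: "0 < T" and [measurable]: "f \<in> borel_measurable (lborel \<Otimes>\<^sub>M \<nu>)"
    and bound: "\<And>z. \<bar>f z\<bar> \<le> A * \<bar>uT T z\<bar> + time_cut T (\<lambda>_. B) z"
  shows "integrable (lborel \<Otimes>\<^sub>M \<nu>) f"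
proof -
  have u1: "integrable (lborel \<Otimes>\<^sub>M \<nu>) (uT T)"
  proof (rule Bochner_Integration.integrable_bound)
    show "integrable (lborel \<Otimes>\<^sub>M \<nu>) (\<lambda>z. time_cut T (\<lambda>_. 1::real) z + (uT T z)\<^sup>2)"
      using integrable_time_slab[OF finite_nu, of T 1] uT_L2[OF T] by auto
    show "AE z in lborel \<Otimes>\<^sub>M \<nu>. norm (uT T z) \<le> norm (time_cut T (\<lambda>_. 1::real) z + (uT T z)\<^sup>2)"
    proof (intro always_eventually allI)
      fix z
      have "\<bar>uT T z * 1\<bar> \<le> (uT T z)\<^sup>2 / 2 + 1\<^sup>2 / 2" by (rule abs_mult_le_half_squares)
      moreover have "0 \<le> (uT T z)\<^sup>2" by simp
      ultimately show "norm (uT T z) \<le> norm (time_cut T (\<lambda>_. 1::real) z + (uT T z)\<^sup>2)"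
        by (cases "0 < fst z \<and> fst z < T") (auto simp: time_cut_def uT_def simp del: zero_le_power2)
    qed
  qed (use T in measurable)
  show ?thesis
  proof (rule Bochner_Integration.integrable_bound)
    show "integrable (lborel \<Otimes>\<^sub>M \<nu>) (\<lambda>z. A * \<bar>uT T z\<bar> + time_cut T (\<lambda>_. B) z)"
      using u1 integrable_time_slab[OF finite_nu, of T B] by auto
    show "AE z in lborel \<Otimes>\<^sub>M \<nu>. norm (f z) \<le> norm (A * \<bar>uT T z\<bar> + time_cut T (\<lambda>_. B) z)"
      using bound by (intro always_eventually allI) (metis abs_ge_self order_trans real_norm_def)
  qed measurable
qed

end

text \<open>A bounded nondecreasing \<open>\<psi>\<close> with bounded derivative is applied to \<open>u\<^sup>m\<close> up to the time \<open>\<tau>\<close>, with the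
exponential weight that will absorb the rate of decay.\<close>

locale pme_test = pme_solution +
  fixes \<psi> \<psi>' :: "real \<Rightarrow> real" and K L c \<tau> :: real
  assumes psi_deriv: "\<And>y. (\<psi> has_real_derivative \<psi>' y) (at y)" and psi'_cont: "continuous_on UNIV \<psi>'"
    and psi'_nonneg: "\<And>y. 0 \<le> \<psi>' y" and psi'_le: "\<And>y. \<psi>' y \<le> L" and psi_bound: "\<And>y. \<bar>\<psi> y\<bar> \<le> K"
    and tau: "0 < \<tau>"
begin

lemma psi_cont: "continuous_on UNIV \<psi>"
  using psi_deriv by (auto simp: continuous_on_eq_continuous_at intro: DERIV_isCont)

lemma psi'_abs_le: "\<bar>\<psi>' y\<bar> \<le> L" using psi'_nonneg psi'_le by simp

lemma K_nonneg: "0 \<le> K" using psi_bound[of 0] by simp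

definition p :: "real \<times> 'a \<Rightarrow> real" where
  "p = time_cut \<tau> (\<lambda>z. exp (c * fst z) * \<psi> (spow m (u (fst z) (snd z))))"

definition H :: "real \<times> 'a \<Rightarrow> 'a" where
  "H = time_cut \<tau> (\<lambda>z. (exp (c * fst z) * \<psi>' (spow m (u (fst z) (snd z)))) *\<^sub>R G (fst z) (snd z))"

lemma spow_m_continuous: "continuous_on UNIV (spow m)" using m by (intro spow_continuous) simp

lemma p_eq: "p = (\<lambda>z. time_cut \<tau> (\<lambda>_. 1) z * (exp (c * fst z) * \<psi> (spow m (uT \<tau> z))))"
  by (auto simp: p_def time_cut_def uT_def fun_eq_iff)

lemma H_eq: "H = (\<lambda>z. (exp (c * fst z) * \<psi>' (spow m (uT \<tau> z))) *\<^sub>R GT \<tau> z)"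
  by (auto simp: H_def time_cut_def uT_def GT_def fun_eq_iff)

lemma time_cut_const_measurable [measurable]: "time_cut T (\<lambda>_. B::real) \<in> borel_measurable ((lborel :: real measure) \<Otimes>\<^sub>M N)"
  unfolding time_cut_def by measurable

lemma uT_comp_measurable:
  fixes f :: "real \<Rightarrow> real"
  assumes "continuous_on UNIV f"
  shows "(\<lambda>z. f (spow m (uT \<tau> z))) \<in> borel_measurable (lborel \<Otimes>\<^sub>M \<nu>)"
  by (rule continuous_compose_measurable[OF continuous_on_compose2[OF assms spow_m_continuous] uT_measurable[OF tau]]) simp

lemma p_measurable [measurable]: "p \<in> borel_measurable (lborel \<Otimes>\<^sub>M \<nu>)"
  using uT_comp_measurable[OF psi_cont] unfolding p_eq by measurable

lemma H_measurable [measurable]: "H \<in> borel_measurable (lborel \<Otimes>\<^sub>M \<mu>)"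
proof -
  have "(\<lambda>z. \<psi>' (spow m (uT \<tau> z))) \<in> borel_measurable (lborel \<Otimes>\<^sub>M \<mu>)"
    using uT_comp_measurable[OF psi'_cont] by (simp cong: measurable_cong_sets add: sets_time_nu_mu)
  then show ?thesis using GT_measurable[OF tau] unfolding H_eq by measurable
qed

definition B where "B = exp (\<bar>c\<bar> * \<tau>) * K"

lemma exp_le: "0 < t \<Longrightarrow> t < \<tau> \<Longrightarrow> exp (c * t) \<le> exp (\<bar>c\<bar> * \<tau>)"
proof -
  assume t: "0 < t" "t < \<tau>"
  have "c * t \<le> \<bar>c\<bar> * t" using t by (intro mult_right_mono) auto
  also have "\<dots> \<le> \<bar>c\<bar> * \<tau>" using t by (intro mult_left_mono) auto
  finally show ?thesis by simp
qed

lemma p_bound: "\<bar>p z\<bar> \<le> B"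
proof (cases "0 < fst z \<and> fst z < \<tau>")
  case True
  then have "\<bar>p z\<bar> = exp (c * fst z) * \<bar>\<psi> (spow m (u (fst z) (snd z)))\<bar>" by (simp add: p_def time_cut_def abs_mult)
  also have "\<dots> \<le> B" unfolding B_def using True exp_le[of "fst z"] psi_bound by (intro mult_mono) auto
  finally show ?thesis .
next
  case False then show ?thesis using K_nonneg by (auto simp: p_def time_cut_def B_def)
qed

lemma p_zero: "\<tau> \<le> t \<Longrightarrow> p (t, x) = 0" by (simp add: p_def time_cut_def)

lemma norm_H_le: "norm (H z) \<le> (exp (\<bar>c\<bar> * \<tau>) * L) * norm (GT \<tau> z)"
proof (cases "0 < fst z \<and> fst z < \<tau>")
  case True
  have L: "0 \<le> L" using psi'_nonneg[of 0] psi'_le[of 0] by linarith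
  have "norm (H z) = (exp (c * fst z) * \<psi>' (spow m (uT \<tau> z))) * norm (GT \<tau> z)"
    using psi'_nonneg by (simp add: H_eq)
  also have "\<dots> \<le> (exp (\<bar>c\<bar> * \<tau>) * L) * norm (GT \<tau> z)"
    using True exp_le[of "fst z"] psi'_le psi'_nonneg L by (intro mult_right_mono mult_mono) auto
  finally show ?thesis .
next
  case False then show ?thesis by (auto simp: H_def GT_def time_cut_def)
qed

lemma H_L2: "integrable (lborel \<Otimes>\<^sub>M \<mu>) (\<lambda>z. (norm (H z))\<^sup>2)"
proof (rule Bochner_Integration.integrable_bound)
  show "integrable (lborel \<Otimes>\<^sub>M \<mu>) (\<lambda>z. (exp (\<bar>c\<bar> * \<tau>) * L)\<^sup>2 * (norm (GT \<tau> z))\<^sup>2)"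
    using GT_L2[OF tau] by (rule integrable_mult_right)
  show "AE z in lborel \<Otimes>\<^sub>M \<mu>. norm ((norm (H z))\<^sup>2) \<le> norm ((exp (\<bar>c\<bar> * \<tau>) * L)\<^sup>2 * (norm (GT \<tau> z))\<^sup>2)"
  proof (intro always_eventually allI)
    fix z
    have "(norm (H z))\<^sup>2 \<le> ((exp (\<bar>c\<bar> * \<tau>) * L) * norm (GT \<tau> z))\<^sup>2"
      by (intro power_mono norm_H_le) auto
    then show "norm ((norm (H z))\<^sup>2) \<le> norm ((exp (\<bar>c\<bar> * \<tau>) * L)\<^sup>2 * (norm (GT \<tau> z))\<^sup>2)"
      by (simp add: power_mult_distrib)
  qed
qed measurable

text \<open>The chain rule, applied to \<open>e\<^sup>c\<^sup>t \<psi>\<close> on almost every time slice; outside the slab both functions vanish.\<close>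

lemma gradient_pH: "AE t in lborel. has_weak_gradient \<Omega> (\<lambda>x. p (t, x)) (\<lambda>x. H (t, x))"
  using gradient
proof eventually_elim
  case (elim t)
  show ?case
  proof (cases "0 < t \<and> t < \<tau>")
    case True
    define \<psi>\<^sub>t where "\<psi>\<^sub>t y = exp (c * t) * \<psi> y" for y
    have "has_weak_gradient \<Omega> (\<lambda>x. \<psi>\<^sub>t (spow m (u t x))) (\<lambda>x. (exp (c * t) * \<psi>' (spow m (u t x))) *\<^sub>R G t x)"
    proof (rule has_weak_gradient_compose[OF nu.open_domain, where L="exp (c * t) * L"])
      show "has_weak_gradient \<Omega> (\<lambda>x. spow m (u t x)) (G t)" using elim True by simp
      show "(\<psi>\<^sub>t has_real_derivative exp (c * t) * \<psi>' y) (at y)" for y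
        unfolding \<psi>\<^sub>t_def using psi_deriv by (intro DERIV_cmult) auto
      show "continuous_on UNIV (\<lambda>y. exp (c * t) * \<psi>' y)" using psi'_cont by (intro continuous_intros)
      show "\<bar>exp (c * t) * \<psi>' y\<bar> \<le> exp (c * t) * L" for y using psi'_abs_le by (simp add: abs_mult)
    qed
    then show ?thesis using True by (simp add: p_def H_def time_cut_def \<psi>\<^sub>t_def)
  next
    case False
    then show ?thesis
      by (auto simp: p_def H_def time_cut_def has_weak_gradient_def locally_integrable_def set_integrable_def)
  qed
qed

definition eta where "eta h t x = (LINT s|unit_unif. p (t + h * s, x))"
definition zeta where "zeta h t x = (LINT s|unit_unif. H (t + h * s, x))"

lemma eta_gradient: assumes h: "0 < h" shows "has_weak_gradient \<Omega> (eta h t) (zeta h t)"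
  unfolding eta_def[abs_def] zeta_def[abs_def]
proof (rule has_weak_gradient_average[OF nu.open_domain])
  let ?R = "restrict_space lborel \<Omega>"
  interpret R: sigma_finite_measure ?R
    by (rule sigma_finite_measure_restrict_space[OF sigma_finite_lborel]) auto
  interpret PR: pair_sigma_finite unit_unif ?R ..
  interpret Pm: pair_sigma_finite unit_unif \<mu> ..
  have sR: "sets ?R = sets \<nu>" "sets ?R = sets \<mu>" by (simp_all add: sets_weighted sets_restrict_space)
  have sUR: "sets (unit_unif \<Otimes>\<^sub>M ?R) = sets (unit_unif \<Otimes>\<^sub>M \<nu>)" "sets (unit_unif \<Otimes>\<^sub>M ?R) = sets (unit_unif \<Otimes>\<^sub>M \<mu>)"
    by (rule sets_pair_measure_cong[OF refl sR(1)], rule sets_pair_measure_cong[OF refl sR(2)])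
  have affm: "(\<lambda>w. (t + h * fst w, snd w)) \<in> unit_unif \<Otimes>\<^sub>M N \<rightarrow>\<^sub>M lborel \<Otimes>\<^sub>M N" for N :: "'a measure"
    by measurable
  show pm: "(\<lambda>(s, x). p (t + h * s, x)) \<in> borel_measurable (unit_unif \<Otimes>\<^sub>M ?R)"
    using measurable_compose[OF affm p_measurable] by (simp add: case_prod_beta' cong: measurable_cong_sets add: sUR(1))
  show Hm: "(\<lambda>(s, x). H (t + h * s, x)) \<in> borel_measurable (unit_unif \<Otimes>\<^sub>M ?R)"
    using measurable_compose[OF affm H_measurable] by (simp add: case_prod_beta' cong: measurable_cong_sets add: sUR(2))
  show "AE s in unit_unif. has_weak_gradient \<Omega> (\<lambda>x. p (t + h * s, x)) (\<lambda>x. H (t + h * s, x))"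
    by (rule AE_unit_unif_affine[OF gradient_pH h])
  fix C assume C: "compact C" "C \<subseteq> \<Omega>"
  have CS: "C \<in> sets ?R" using C
    by (subst sets_restrict_space_iff) (auto intro: borel_closed compact_imp_closed)
  have Cm[measurable]: "indicat_real C \<in> borel_measurable ?R" using CS by simp
  have "emeasure lborel C < \<infinity>" using C by (intro emeasure_compact_finite)
  then have C1: "integrable ?R (indicat_real C)"
    using CS C by (intro integrable_real_indicator) (auto simp: emeasure_restrict_space)
  have C2: "integrable (unit_unif \<Otimes>\<^sub>M ?R) (\<lambda>z. indicat_real C (snd z))"
  proof (rule PR.Fubini_integrable)
    show "(\<lambda>z. indicat_real C (snd z)) \<in> borel_measurable (unit_unif \<Otimes>\<^sub>M ?R)" by measurable
  qed (use C1 in auto)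
  show "integrable (unit_unif \<Otimes>\<^sub>M ?R) (\<lambda>(s, x). indicator C x * p (t + h * s, x))"
    using integrable_mult_bounded[OF C2, of "\<lambda>(s, x). p (t + h * s, x)" B] pm p_bound
    by (simp add: case_prod_beta')
  \<comment> \<open>Square integrability of \<open>H\<close> holds for the weighted measure, whereas the weak gradient refers to
    Lebesgue measure; on the compact set \<open>C\<close> the two are comparable.\<close>
  have "integrable (unit_unif \<Otimes>\<^sub>M \<mu>) (\<lambda>(s, x). (norm (H (t + h * s, x)))\<^sup>2)"
    by (rule integrable_pair_slice[OF mu.sigma_finite_weighted H_L2 h])
  from mu.integrable_pair_compact[OF this C]
  have H2: "integrable (unit_unif \<Otimes>\<^sub>M ?R) (\<lambda>z. indicator C (snd z) * (norm (H (t + h * fst z, snd z)))\<^sup>2)"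
    by (simp add: case_prod_beta')
  show "integrable (unit_unif \<Otimes>\<^sub>M ?R) (\<lambda>(s, x). indicator C x *\<^sub>R H (t + h * s, x))"
  proof (rule Bochner_Integration.integrable_bound)
    show "integrable (unit_unif \<Otimes>\<^sub>M ?R) (\<lambda>z. indicat_real C (snd z) + indicator C (snd z) * (norm (H (t + h * fst z, snd z)))\<^sup>2)"
      using C2 H2 by (rule Bochner_Integration.integrable_add)
    show "(\<lambda>(s, x). indicator C x *\<^sub>R H (t + h * s, x)) \<in> borel_measurable (unit_unif \<Otimes>\<^sub>M ?R)"
      using Hm by (simp add: case_prod_beta')
    show "AE z in unit_unif \<Otimes>\<^sub>M ?R. norm (case z of (s, x) \<Rightarrow> indicator C x *\<^sub>R H (t + h * s, x)) \<le> norm (indicat_real C (snd z) + indicator C (snd z) * (norm (H (t + h * fst z, snd z)))\<^sup>2)"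
    proof (intro always_eventually allI)
      fix z :: "real \<times> 'a"
      let ?n = "norm (H (t + h * fst z, snd z))"
      have "\<bar>?n * 1\<bar> \<le> ?n\<^sup>2 / 2 + 1\<^sup>2 / 2" by (rule abs_mult_le_half_squares)
      then have 1: "?n \<le> ?n\<^sup>2 / 2 + 1 / 2" by simp
      have "0 \<le> ?n\<^sup>2" by (rule zero_le_power2)
      with 1 have "?n \<le> 1 + ?n\<^sup>2" by linarith
      then show "norm (case z of (s, x) \<Rightarrow> indicator C x *\<^sub>R H (t + h * s, x)) \<le> norm (indicat_real C (snd z) + indicator C (snd z) * (norm (H (t + h * fst z, snd z)))\<^sup>2)"
        by (cases "snd z \<in> C") (auto simp: case_prod_beta')
    qed
  qed
qed

lemma zeta_measurable: "(\<lambda>z. zeta h (fst z) (snd z)) \<in> borel_measurable (lborel \<Otimes>\<^sub>M \<mu>)"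
proof -
  have "(\<lambda>w. (fst (fst w) + h * snd w, snd (fst w))) \<in> (lborel \<Otimes>\<^sub>M \<mu>) \<Otimes>\<^sub>M unit_unif \<rightarrow>\<^sub>M lborel \<Otimes>\<^sub>M \<mu>"
    by measurable
  from measurable_compose[OF this H_measurable] show ?thesis unfolding zeta_def
    by (intro unit_unif.borel_measurable_lebesgue_integral) (simp add: case_prod_beta')
qed

lemma AE_zeta:
  shows "AE z in lborel \<Otimes>\<^sub>M \<mu>. integrable unit_unif (\<lambda>s. H (tshift (h * s) z)) \<and>
      (norm (zeta h (fst z) (snd z)))\<^sup>2 \<le> (LINT s|unit_unif. (norm (H (tshift (h * s) z)))\<^sup>2)"
    and zeta_sq_integrable: "integrable (lborel \<Otimes>\<^sub>M \<mu>) (\<lambda>z. (norm (zeta h (fst z) (snd z)))\<^sup>2)"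
proof -
  interpret Q: pair_sigma_finite unit_unif "(lborel :: real measure) \<Otimes>\<^sub>M \<mu>" ..
  have I: "integrable (unit_unif \<Otimes>\<^sub>M (lborel \<Otimes>\<^sub>M \<mu>)) (\<lambda>(s, z). (norm (H (tshift (h * s) z)))\<^sup>2)"
    by (rule integrable_pair_tshift[OF mu.sigma_finite_weighted H_L2])
  have m: "(\<lambda>s. H (tshift (h * s) z)) \<in> borel_measurable unit_unif" if "z \<in> space (lborel \<Otimes>\<^sub>M \<mu>)" for z
  proof -
    have "(\<lambda>s. tshift (h * s) z) \<in> unit_unif \<rightarrow>\<^sub>M lborel \<Otimes>\<^sub>M \<mu>"
      unfolding tshift_def using that by (intro measurable_Pair) (auto simp: space_pair_measure)
    from measurable_compose[OF this H_measurable] show ?thesis .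
  qed
  show 1: "AE z in lborel \<Otimes>\<^sub>M \<mu>. integrable unit_unif (\<lambda>s. H (tshift (h * s) z)) \<and>
      (norm (zeta h (fst z) (snd z)))\<^sup>2 \<le> (LINT s|unit_unif. (norm (H (tshift (h * s) z)))\<^sup>2)"
    using Q.AE_integrable_snd[OF I] AE_space
  proof eventually_elim
    case (elim z)
    have "zeta h (fst z) (snd z) = (LINT s|unit_unif. H (tshift (h * s) z))"
      by (simp add: zeta_def tshift_def)
    then show ?case
      using unit_unif.norm_expectation_square_le[OF m[OF elim(2)] elim(1)] by simp
  qed
  show "integrable (lborel \<Otimes>\<^sub>M \<mu>) (\<lambda>z. (norm (zeta h (fst z) (snd z)))\<^sup>2)"
  proof (rule Bochner_Integration.integrable_bound[OF Q.integrable_snd[OF I]])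
    show "(\<lambda>z. (norm (zeta h (fst z) (snd z)))\<^sup>2) \<in> borel_measurable (lborel \<Otimes>\<^sub>M \<mu>)"
      using zeta_measurable by measurable
    show "AE z in lborel \<Otimes>\<^sub>M \<mu>. norm ((norm (zeta h (fst z) (snd z)))\<^sup>2) \<le> norm (LINT s|unit_unif. (norm (H (tshift (h * s) z)))\<^sup>2)"
      using 1 by eventually_elim (auto intro: order_trans[OF _ abs_ge_self])
  qed
qed

lemma gradient_term:
  "(LINT t:{0<..<\<tau>}|lborel. LINT x|\<mu>. G t x \<bullet> zeta h t x)
    = (LINT s|unit_unif. LINT z|(lborel \<Otimes>\<^sub>M \<mu>). GT \<tau> z \<bullet> H (tshift (h * s) z))"
proof -
  interpret Q: pair_sigma_finite unit_unif "(lborel :: real measure) \<Otimes>\<^sub>M \<mu>" ..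
  have I: "integrable (unit_unif \<Otimes>\<^sub>M (lborel \<Otimes>\<^sub>M \<mu>)) (\<lambda>(s, z). GT \<tau> z \<bullet> H (tshift (h * s) z))"
    by (rule integrable_pair_tshift_inner[OF mu.sigma_finite_weighted GT_measurable[OF tau] H_measurable GT_L2[OF tau] H_L2])
  have AEeq: "AE z in lborel \<Otimes>\<^sub>M \<mu>. (LINT s|unit_unif. GT \<tau> z \<bullet> H (tshift (h * s) z)) = GT \<tau> z \<bullet> zeta h (fst z) (snd z)"
    using AE_zeta(1)[of h]
  proof eventually_elim
    case (elim z)
    have "(LINT s|unit_unif. GT \<tau> z \<bullet> H (tshift (h * s) z)) = GT \<tau> z \<bullet> (LINT s|unit_unif. H (tshift (h * s) z))"
      using elim by (intro integral_inner_right) auto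
    then show ?case by (simp add: zeta_def tshift_def)
  qed
  have zm[measurable]: "(\<lambda>z. zeta h (fst z) (snd z)) \<in> borel_measurable (lborel \<Otimes>\<^sub>M \<mu>)" by (rule zeta_measurable)
  have Gm[measurable]: "GT \<tau> \<in> borel_measurable (lborel \<Otimes>\<^sub>M \<mu>)" by (rule GT_measurable[OF tau])
  have m: "(\<lambda>z. GT \<tau> z \<bullet> zeta h (fst z) (snd z)) \<in> borel_measurable (lborel \<Otimes>\<^sub>M \<mu>)" by measurable
  have i: "integrable (lborel \<Otimes>\<^sub>M \<mu>) (\<lambda>z. GT \<tau> z \<bullet> zeta h (fst z) (snd z))"
    by (rule Bochner_Integration.integrable_cong_AE_imp[OF Q.integrable_snd[OF I] m]) (use AEeq in \<open>eventually_elim, simp\<close>)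
  have "(LINT t:{0<..<\<tau>}|lborel. LINT x|\<mu>. G t x \<bullet> zeta h t x) = (LINT t|lborel. LINT x|\<mu>. GT \<tau> (t, x) \<bullet> zeta h (fst (t, x)) (snd (t, x)))"
    unfolding set_lebesgue_integral_def
    by (intro Bochner_Integration.integral_cong) (auto simp: GT_def time_cut_def indicator_def)
  also have "\<dots> = (LINT z|(lborel \<Otimes>\<^sub>M \<mu>). GT \<tau> z \<bullet> zeta h (fst z) (snd z))"
    by (rule Pmu.integral_fst'[OF i])
  also have "\<dots> = (LINT z|(lborel \<Otimes>\<^sub>M \<mu>). LINT s|unit_unif. GT \<tau> z \<bullet> H (tshift (h * s) z))"
    using AEeq m by (intro integral_cong_AE) (auto intro: borel_measurable_integrable[OF Q.integrable_snd[OF I]])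
  also have "\<dots> = (LINT s|unit_unif. LINT z|(lborel \<Otimes>\<^sub>M \<mu>). GT \<tau> z \<bullet> H (tshift (h * s) z))"
    by (rule Q.Fubini_integral[OF I])
  finally show ?thesis .
qed

text \<open>The function \<open>p\<close> vanishes after time \<open>\<tau>\<close>, so its forward averages \<open>eta h\<close> vanish at \<open>\<tau>\<close>, as the weak
formulation demands of a test function.\<close>

theorem steklov_tested:
  assumes h: "0 < h"
  shows "(LINT t:{0<..<\<tau>}|lborel. LINT x|\<nu>. u t x * ((p (t + h, x) - p (t, x)) / h)) =
      - (LINT x|\<nu>. u\<^sub>0 x * eta h 0 x)
      + (LINT s|unit_unif. LINT z|(lborel \<Otimes>\<^sub>M \<mu>). GT \<tau> z \<bullet> H (tshift (h * s) z))"
  unfolding gradient_term[symmetric]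
proof (rule weak[OF tau])
  have "in_W12_time \<tau> \<nu> (\<lambda>t x. LINT s|unit_unif. p (t + h * s, x)) (\<lambda>t x. (p (t + h, x) - p (t, x)) / h)"
    by (rule average_shift_in_W12_time[where p="\<lambda>t x. p (t, x)" and B=B, OF finite_nu tau h]) (use p_bound in auto)
  then show "in_W12_time \<tau> \<nu> (eta h) (\<lambda>t x. (p (t + h, x) - p (t, x)) / h)"
    unfolding eta_def[abs_def] .
  show "AE t in lborel. t \<in> {0<..<\<tau>} \<longrightarrow> has_weak_gradient \<Omega> (eta h t) (zeta h t)"
    using eta_gradient[OF h] by simp
  show "in_LpLp 2 \<tau> \<mu> (zeta h)"
    unfolding in_LpLp_def in_Lp_2_iff case_prod_beta'
    using measurable_restrict_time[OF zeta_measurable[of h]] integrable_restrict_time[OF mu.sigma_finite_weighted zeta_sq_integrable[of h]]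
    by auto
  show "AE x in \<nu>. eta h \<tau> x = 0"
  proof (rule AE_I2)
    fix x assume x: "x \<in> space \<nu>"
    have "eta h \<tau> x = (LINT s|unit_unif. 0)" unfolding eta_def
    proof (rule integral_cong_AE)
      show "AE s in unit_unif. p (\<tau> + h * s, x) = 0"
        using AE_unit_unif by eventually_elim (use h in \<open>simp add: p_zero\<close>)
      show "(\<lambda>s. p (\<tau> + h * s, x)) \<in> borel_measurable unit_unif"
        using x by measurable
    qed simp
    then show "eta h \<tau> x = 0" by simp
  qed
qed

end

section \<open>The entropy inequality\<close>

lemma spow_strict_mono: assumes q: "0 < q" and "x < y" shows "spow q x < spow q y"
proof -
  consider "0 \<le> x" | "x < 0" "0 \<le> y" | "y < 0" by linarith
  then show ?thesis
  proof cases
    case 1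
    then show ?thesis using assms by (cases "x = 0") (auto simp: spow_def powr_less_mono2)
  next
    case 2
    then have "spow q x < 0" "0 \<le> spow q y" by (auto simp: spow_def sgn_if)
    then show ?thesis by simp
  next
    case 3
    then show ?thesis using assms by (auto simp: spow_def sgn_if powr_less_mono2)
  qed
qed

lemma spow_mono: "0 < q \<Longrightarrow> x \<le> y \<Longrightarrow> spow q x \<le> spow q y"
  using spow_strict_mono[of q x y] by (cases "x = y") auto

text \<open>Convexity enters through this inequality, which replaces the chain rule in time.\<close>

lemma subgradient_inequality:
  fixes \<Phi> \<theta> :: "real \<Rightarrow> real"
  assumes D: "\<And>s. (\<Phi> has_real_derivative \<theta> s) (at s)" and mono: "mono \<theta>"
  shows "\<Phi> a - \<Phi> b \<le> \<theta> a * (a - b)"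
proof -
  consider "a < b" | "a = b" | "b < a" by linarith
  then show ?thesis
  proof cases
    case 1
    obtain z where z: "a < z" "\<Phi> b - \<Phi> a = (b - a) * \<theta> z"
      using MVT2[OF 1, of \<Phi> \<theta>] D by blast
    have "(b - a) * \<theta> a \<le> (b - a) * \<theta> z" using z 1 monoD[OF mono, of a z] by (intro mult_left_mono) auto
    then show ?thesis using z by (simp add: algebra_simps)
  next
    case 3
    obtain z where z: "z < a" "\<Phi> a - \<Phi> b = (a - b) * \<theta> z"
      using MVT2[OF 3, of \<Phi> \<theta>] D by blast
    have "(a - b) * \<theta> z \<le> (a - b) * \<theta> a" using z 3 monoD[OF mono, of z a] by (intro mult_left_mono) auto
    then show ?thesis using z by (simp add: algebra_simps)
  qed simp
qed

lemma average_shift_backward_eq: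
  fixes P :: "real \<Rightarrow> real"
  assumes [measurable]: "P \<in> borel_measurable borel" and h: "0 < h"
  shows "(LINT s|unit_unif. P (t - h * s)) = (LINT r|lborel. indicator {t-h..t} r * P r) / h"
proof -
  have "(LINT r|lborel. indicator {t-h..t} r * P r) = \<bar>- h\<bar> *\<^sub>R (LINT s|lborel. indicator {t-h..t} (t + - h * s) * P (t + - h * s))"
    by (rule lborel_integral_real_affine) (use h in auto)
  also have "(\<lambda>s. indicator {t-h..t} (t + - h * s) * P (t + - h * s)) = (\<lambda>s. indicator {0..1} s * P (t - h * s))"
    using h by (auto simp: indicator_def fun_eq_iff mult_le_cancel_left1 zero_le_mult_iff)
  finally show ?thesis using h by (simp add: integral_unit_unif set_lebesgue_integral_def)
qed

text \<open>The entropy density \<open>\<Phi>\<close> is the antiderivative of \<open>\<psi> \<circ> spow m\<close>, so that testing with \<open>\<psi>(u\<^sup>m)\<close> is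
testing with \<open>\<Phi>'(u)\<close>.\<close>

locale pme_entropy = pme_test +
  fixes \<Phi> :: "real \<Rightarrow> real"
  assumes Phi_deriv: "\<And>s. (\<Phi> has_real_derivative \<psi> (spow m s)) (at s)"
begin

lemma psi_mono: "mono \<psi>"
proof (rule monoI)
  fix x y :: real assume "x \<le> y"
  then show "\<psi> x \<le> \<psi> y"
    by (rule DERIV_nonneg_imp_nondecreasing) (use psi_deriv psi'_nonneg in blast)
qed

lemma Phi_subgradient: "\<Phi> a - \<Phi> b \<le> \<psi> (spow m a) * (a - b)"
  by (rule subgradient_inequality[OF Phi_deriv]) (use psi_mono spow_mono[of m] m in \<open>auto simp: mono_def\<close>)

lemma Phi_growth: "\<bar>\<Phi> s\<bar> \<le> \<bar>\<Phi> 0\<bar> + K * \<bar>s\<bar>"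
  using lipschitz_of_bounded_derivative[OF Phi_deriv psi_bound, of s 0] by simp

lemma Phi_cont: "continuous_on UNIV \<Phi>"
  using Phi_deriv by (auto simp: continuous_on_eq_continuous_at intro: DERIV_isCont)

lemma Phi_measurable [measurable]: "\<Phi> \<in> borel_measurable borel"
  by (rule borel_measurable_continuous_onI[OF Phi_cont])

lemma u0_measurable [measurable]: "u\<^sub>0 \<in> borel_measurable \<nu>"
  using u0_L2 by (simp add: in_Lp_2_iff)

lemma u0_integrable: "integrable \<nu> u\<^sub>0"
  using integrable_mult_L2[of u\<^sub>0 \<nu> "\<lambda>_. 1"] u0_L2 by (simp add: in_Lp_2_iff)

lemma Phi_u0_integrable: "integrable \<nu> (\<lambda>x. \<Phi> (u\<^sub>0 x))"
proof (rule Bochner_Integration.integrable_bound)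
  show "integrable \<nu> (\<lambda>x. \<bar>\<Phi> 0\<bar> + K * \<bar>u\<^sub>0 x\<bar>)" using u0_integrable by auto
  show "AE x in \<nu>. norm (\<Phi> (u\<^sub>0 x)) \<le> norm (\<bar>\<Phi> 0\<bar> + K * \<bar>u\<^sub>0 x\<bar>)"
    using Phi_growth by (intro always_eventually allI) (metis abs_ge_self order_trans real_norm_def)
qed measurable

definition W :: "real \<Rightarrow> real \<times> 'a \<Rightarrow> real" where
  "W s = time_cut s (\<lambda>z. exp (c * fst z) * \<Phi> (u (fst z) (snd z)))"

lemma W_eq: "s \<le> \<tau> \<Longrightarrow> W s = (\<lambda>z. time_cut s (\<lambda>_. 1) z * (exp (c * fst z) * \<Phi> (uT \<tau> z)))"
  by (auto simp: W_def time_cut_def uT_def fun_eq_iff)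

lemma W_measurable [measurable]: "s \<le> \<tau> \<Longrightarrow> W s \<in> borel_measurable (lborel \<Otimes>\<^sub>M \<nu>)"
  using uT_measurable[OF tau] unfolding W_eq by measurable

lemma W_integrable: assumes s: "s \<le> \<tau>" shows "integrable (lborel \<Otimes>\<^sub>M \<nu>) (W s)"
proof (rule slab_integrable[OF tau W_measurable[OF s]])
  fix z
  show "\<bar>W s z\<bar> \<le> (exp (\<bar>c\<bar> * \<tau>) * K) * \<bar>uT \<tau> z\<bar> + time_cut \<tau> (\<lambda>_. exp (\<bar>c\<bar> * \<tau>) * \<bar>\<Phi> 0\<bar>) z"
  proof (cases "0 < fst z \<and> fst z < s")
    case True
    then have t: "0 < fst z" "fst z < \<tau>" using s by auto
    have "\<bar>W s z\<bar> = exp (c * fst z) * \<bar>\<Phi> (uT \<tau> z)\<bar>" using True by (simp add: W_eq[OF s] abs_mult time_cut_def)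
    also have "\<dots> \<le> exp (\<bar>c\<bar> * \<tau>) * (\<bar>\<Phi> 0\<bar> + K * \<bar>uT \<tau> z\<bar>)"
      by (intro mult_mono exp_le t Phi_growth) auto
    finally show ?thesis using t by (simp add: time_cut_def algebra_simps)
  next
    case False
    then have "W s z = 0" by (auto simp: W_def time_cut_def)
    then show ?thesis using K_nonneg by (simp add: time_cut_def)
  qed
qed

definition e where "e t = (LINT x|\<nu>. \<Phi> (u t x))"
definition k where "k s t = (if 0 < t \<and> t < s then exp (c * t) * e t else 0)" for s t :: real

lemma k_eq: "k s t = (LINT x|\<nu>. W s (t, x))"
  by (auto simp: k_def W_def time_cut_def e_def)

lemma k_integrable: "s \<le> \<tau> \<Longrightarrow> integrable lborel (k s)"
  using Pnu.integrable_fst'[OF W_integrable] by (simp add: k_eq[abs_def])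

lemma integral_W: "s \<le> \<tau> \<Longrightarrow> (LINT z|(lborel \<Otimes>\<^sub>M \<nu>). W s z) = (LINT t|lborel. k s t)"
  using Pnu.integral_fst'[OF W_integrable] by (simp add: k_eq[abs_def])

definition V where "V h = time_cut \<tau> (\<lambda>z. if fst z \<le> h then u\<^sub>0 (snd z) else uT \<tau> (fst z - h, snd z))" for h :: real
definition Rem where "Rem h = (LINT s|unit_unif. LINT z|(lborel \<Otimes>\<^sub>M \<mu>). GT \<tau> z \<bullet> H (tshift (h * s) z))"

lemma uT_tshift_measurable [measurable]: "(\<lambda>z. uT \<tau> (tshift a z)) \<in> borel_measurable (lborel \<Otimes>\<^sub>M \<nu>)"
  using measurable_compose[OF measurable_tshift uT_measurable[OF tau]] .

lemma uT_integrable: "integrable (lborel \<Otimes>\<^sub>M \<nu>) (uT \<tau>)"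
  by (rule slab_integrable[OF tau uT_measurable[OF tau], of 1 0]) (simp add: time_cut_def)

lemma time_space_product_integrable:
  fixes g :: "'a \<Rightarrow> real" and f :: "real \<Rightarrow> real"
  assumes g: "integrable \<nu> g" and f: "integrable lborel f"
  shows "integrable (lborel \<Otimes>\<^sub>M \<nu>) (\<lambda>z. f (fst z) * g (snd z))"
proof -
  have [measurable]: "f \<in> borel_measurable borel" "g \<in> borel_measurable \<nu>" using f g by auto
  show ?thesis
  proof (rule Pnu.Fubini_integrable[where f="\<lambda>z. f (fst z) * g (snd z)"])
    show "(\<lambda>z. f (fst z) * g (snd z)) \<in> borel_measurable (lborel \<Otimes>\<^sub>M \<nu>)" by measurable
    show "integrable lborel (\<lambda>t. LINT x|\<nu>. norm (f (fst (t, x)) * g (snd (t, x))))"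
      using f by (simp add: abs_mult)
  qed (use g in simp)
qed

text \<open>A discrete integration by parts in time: in the tested equation the difference of \<open>p\<close> is moved to \<open>u\<close>. The
function \<open>V h\<close> is \<open>u\<close> delayed by \<open>h\<close>, with the initial datum filling the first \<open>h\<close> units of time, and
thereby absorbs the initial term.\<close>

lemma V_p_identity:
  assumes h: "0 < h"
  shows "(LINT z|(lborel \<Otimes>\<^sub>M \<nu>). (V h z - uT \<tau> z) * p z) = h * Rem h"
    and "integrable (lborel \<Otimes>\<^sub>M \<nu>) (\<lambda>z. (V h z - uT \<tau> z) * p z)"
proof -
  let ?P = "lborel \<Otimes>\<^sub>M \<nu>"
  have uTi: "integrable ?P (\<lambda>z. uT \<tau> (tshift a z))" for a by (rule integrable_tshift[OF nu.sigma_finite_weighted uT_integrable])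
  have pm: "(\<lambda>z. p (tshift a z)) \<in> borel_measurable ?P" for a
    using measurable_compose[OF measurable_tshift p_measurable] .
  have i1: "integrable ?P (\<lambda>z. uT \<tau> z * p (tshift a z))" for a
    by (rule integrable_mult_bounded[OF uT_integrable pm]) (rule p_bound)
  have i0: "integrable ?P (\<lambda>z. uT \<tau> z * p z)"
    by (rule integrable_mult_bounded[OF uT_integrable p_measurable]) (rule p_bound)
  have i2: "integrable ?P (\<lambda>z. uT \<tau> (tshift (- h) z) * p z)"
    by (rule integrable_mult_bounded[OF uTi p_measurable]) (rule p_bound)
  have i3: "integrable ?P (\<lambda>z. (indicator {0..h} (fst z) * u\<^sub>0 (snd z)) * p z)"
  proof (rule integrable_mult_bounded[OF time_space_product_integrable[OF u0_integrable] p_measurable])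
    show "integrable lborel (indicat_real {0..h})" by (intro integrable_real_indicator emeasure_compact_finite) auto
  qed (rule p_bound)
  have L: "(LINT t:{0<..<\<tau>}|lborel. LINT x|\<nu>. u t x * ((p (t + h, x) - p (t, x)) / h))
     = ((LINT z|?P. uT \<tau> (tshift (- h) z) * p z) - (LINT z|?P. uT \<tau> z * p z)) / h"
  proof -
    have "(LINT t:{0<..<\<tau>}|lborel. LINT x|\<nu>. u t x * ((p (t + h, x) - p (t, x)) / h))
      = (LINT t|lborel. LINT x|\<nu>. (uT \<tau> (t, x) * p (tshift h (t, x)) - uT \<tau> (t, x) * p (t, x)) / h)"
      unfolding set_lebesgue_integral_def
      by (intro Bochner_Integration.integral_cong)
         (auto simp: uT_def time_cut_def indicator_def tshift_def algebra_simps)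
    also have "\<dots> = (LINT z|?P. (uT \<tau> z * p (tshift h z) - uT \<tau> z * p z) / h)"
      by (rule Pnu.integral_fst'[where f="\<lambda>z. (uT \<tau> z * p (tshift h z) - uT \<tau> z * p z) / h"]) (use i1 i0 in auto)
    also have "\<dots> = ((LINT z|?P. uT \<tau> z * p (tshift h z)) - (LINT z|?P. uT \<tau> z * p z)) / h"
      using i1 i0 by simp
    also have "(LINT z|?P. uT \<tau> z * p (tshift h z)) = (LINT z|?P. uT \<tau> (tshift (- h) z) * p z)"
      using integral_tshift[OF nu.sigma_finite_weighted, of "\<lambda>z. uT \<tau> (tshift (- h) z) * p z" h] i2
      by (simp add: tshift_def borel_measurable_integrable)
    finally show ?thesis .
  qed
  have I: "(LINT x|\<nu>. u\<^sub>0 x * eta h 0 x) = (LINT z|?P. (indicator {0..h} (fst z) * u\<^sub>0 (snd z)) * p z) / h"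
  proof -
    have "(LINT x|\<nu>. u\<^sub>0 x * eta h 0 x) = (LINT x|\<nu>. (LINT t|lborel. (indicator {0..h} t * u\<^sub>0 x) * p (t, x)) / h)"
    proof (rule Bochner_Integration.integral_cong[OF refl])
      fix x assume "x \<in> space \<nu>"
      then have "(\<lambda>t. p (t, x)) \<in> borel_measurable borel" by measurable
      from average_shift_eq[OF this h, of 0]
      have "eta h 0 x = (LINT t|lborel. indicator {0..h} t * p (t, x)) / h" by (simp add: eta_def)
      then show "u\<^sub>0 x * eta h 0 x = (LINT t|lborel. (indicator {0..h} t * u\<^sub>0 x) * p (t, x)) / h"
        by (simp add: mult_ac)
    qed
    also have "\<dots> = (LINT x|\<nu>. (LINT t|lborel. (indicator {0..h} t * u\<^sub>0 x) * p (t, x))) / h" by simp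
    also have "(LINT x|\<nu>. (LINT t|lborel. (indicator {0..h} t * u\<^sub>0 x) * p (t, x)))
       = (LINT z|?P. (indicator {0..h} (fst z) * u\<^sub>0 (snd z)) * p z)"
      using Pnu.integral_snd[of "\<lambda>t x. (indicator {0..h} t * u\<^sub>0 x) * p (t, x)"] i3 by (simp add: case_prod_beta')
    finally show ?thesis .
  qed
  have Veq: "(V h z - uT \<tau> z) * p z = uT \<tau> (tshift (- h) z) * p z + (indicator {0..h} (fst z) * u\<^sub>0 (snd z)) * p z - uT \<tau> z * p z" for z
  proof (cases "0 < fst z \<and> fst z < \<tau>")
    case True
    then have "V h z = uT \<tau> (tshift (- h) z) + indicator {0..h} (fst z) * u\<^sub>0 (snd z)"
      using h by (auto simp: V_def time_cut_def tshift_def uT_def indicator_def)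
    then show ?thesis by (simp add: algebra_simps)
  next
    case False then show ?thesis by (auto simp: p_def time_cut_def)
  qed
  show "integrable ?P (\<lambda>z. (V h z - uT \<tau> z) * p z)"
    unfolding Veq using i0 i2 i3 by auto
  have "(LINT z|?P. (V h z - uT \<tau> z) * p z) = (LINT z|?P. uT \<tau> (tshift (- h) z) * p z)
     + (LINT z|?P. (indicator {0..h} (fst z) * u\<^sub>0 (snd z)) * p z) - (LINT z|?P. uT \<tau> z * p z)"
    unfolding Veq using i0 i2 i3 by simp
  also have "\<dots> = h * Rem h"
    using steklov_tested[OF h] h unfolding L I Rem_def[symmetric] by (simp add: field_simps)
  finally show "(LINT z|?P. (V h z - uT \<tau> z) * p z) = h * Rem h" .
qed

text \<open>The subgradient inequality for \<open>\<Phi>\<close> at \<open>u\<close> and the delayed solution \<open>V h\<close>, multiplied by \<open>e\<^sup>c\<^sup>t\<close> and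
integrated. Since the delay also shifts the weight, a factor \<open>e\<^sup>c\<^sup>h\<close> appears.\<close>

lemma entropy_difference:
  assumes h: "0 < h" "h < \<tau>"
  shows "(LINT t|lborel. k \<tau> t) - exp (c * h) * (LINT t|lborel. k (\<tau> - h) t)
     - (LINT x|\<nu>. \<Phi> (u\<^sub>0 x)) * (LINT t|lborel. indicator {0..h} t * exp (c * t)) \<le> - h * Rem h"
proof -
  let ?P = "lborel \<Otimes>\<^sub>M \<nu>"
  \<comment> \<open>This is \<open>e\<^sup>c\<^sup>t \<Phi>(V h)\<close> on the slab, split into the part before \<open>h\<close> and the shifted solution.\<close>
  define X where "X z = (indicator {0<..h} (fst z) * exp (c * fst z)) * \<Phi> (u\<^sub>0 (snd z)) + exp (c * h) * W (\<tau> - h) (tshift (- h) z)" for z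
  have ei: "integrable lborel (\<lambda>t. indicator {0<..h} t * exp (c * t))"
  proof (rule Bochner_Integration.integrable_bound)
    show "integrable lborel (\<lambda>t. exp (\<bar>c\<bar> * \<tau>) * indicat_real {0..h} t)"
      by (intro integrable_mult_right integrable_real_indicator emeasure_compact_finite) auto
    show "AE t in lborel. norm (indicator {0<..h} t * exp (c * t)) \<le> norm (exp (\<bar>c\<bar> * \<tau>) * indicat_real {0..h} t)"
      using h exp_le by (intro always_eventually allI) (auto simp: indicator_def)
  qed measurable
  have Wi: "integrable ?P (\<lambda>z. W (\<tau> - h) (tshift (- h) z))"
    using h by (intro integrable_tshift[OF nu.sigma_finite_weighted W_integrable]) simp
  have X1: "integrable ?P (\<lambda>z. (indicator {0<..h} (fst z) * exp (c * fst z)) * \<Phi> (u\<^sub>0 (snd z)))"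
    by (rule time_space_product_integrable[OF Phi_u0_integrable ei])
  have Xi: "integrable ?P X" unfolding X_def using X1 Wi by auto
  have pt: "W \<tau> z - X z \<le> - ((V h z - uT \<tau> z) * p z)" for z
  proof (cases "0 < fst z \<and> fst z < \<tau>")
    case True
    have X: "X z = exp (c * fst z) * \<Phi> (V h z)"
      using True h by (auto simp: X_def W_def V_def uT_def time_cut_def tshift_def indicator_def right_diff_distrib simp flip: exp_add)
    have Wz: "W \<tau> z = exp (c * fst z) * \<Phi> (uT \<tau> z)"
      using True by (simp add: W_def uT_def time_cut_def case_prod_beta')
    have p: "p z = exp (c * fst z) * \<psi> (spow m (uT \<tau> z))"
      using True by (simp add: p_def uT_def time_cut_def case_prod_beta')
    have "exp (c * fst z) * (\<Phi> (uT \<tau> z) - \<Phi> (V h z)) \<le> exp (c * fst z) * (\<psi> (spow m (uT \<tau> z)) * (uT \<tau> z - V h z))"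
      by (intro mult_left_mono Phi_subgradient) auto
    then show ?thesis unfolding X Wz p by (simp add: algebra_simps)
  next
    case False
    then show ?thesis using h by (auto simp: X_def W_def p_def time_cut_def tshift_def)
  qed
  have "(LINT z|?P. W \<tau> z - X z) \<le> (LINT z|?P. - ((V h z - uT \<tau> z) * p z))"
    using V_p_identity(2)[OF h(1)] by (intro integral_mono pt Bochner_Integration.integrable_diff W_integrable Xi) auto
  also have "\<dots> = - h * Rem h" using V_p_identity[OF h(1)] by simp
  also have "(LINT z|?P. W \<tau> z - X z) = (LINT t|lborel. k \<tau> t) - (LINT z|?P. X z)"
    using W_integrable[of \<tau>] Xi integral_W[of \<tau>] by simp
  also have "(LINT z|?P. X z) = (LINT z|?P. (indicator {0<..h} (fst z) * exp (c * fst z)) * \<Phi> (u\<^sub>0 (snd z)))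
      + exp (c * h) * (LINT z|?P. W (\<tau> - h) (tshift (- h) z))"
    unfolding X_def using X1 Wi by simp
  also have "(LINT z|?P. W (\<tau> - h) (tshift (- h) z)) = (LINT t|lborel. k (\<tau> - h) t)"
    using integral_tshift[OF nu.sigma_finite_weighted, of "W (\<tau> - h)" "- h"] integral_W[of "\<tau> - h"] h W_measurable[of "\<tau> - h"] by simp
  also have "(LINT z|?P. (indicator {0<..h} (fst z) * exp (c * fst z)) * \<Phi> (u\<^sub>0 (snd z)))
      = (LINT x|\<nu>. \<Phi> (u\<^sub>0 x)) * (LINT t|lborel. indicator {0<..h} t * exp (c * t))"
    using Pnu.integral_fst'[OF X1] by (simp add: mult.commute)
  also have "(LINT t|lborel. indicator {0<..h} t * exp (c * t)) = (LINT t|lborel. indicator {0..h} t * exp (c * t))"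
    by (rule integral_cong_AE) (use AE_lborel_singleton[of "0::real"] in \<open>auto simp: indicator_def elim!: eventually_mono\<close>)
  finally show ?thesis by simp
qed

text \<open>The inequality \<open>entropy_difference\<close> is divided by \<open>h\<close>. The limit \<open>l\<close> is the value at \<open>\<tau>\<close> of the
weighted entropy, provided that \<open>\<tau>\<close> is a point where averages over \<open>[\<tau> - h, \<tau>]\<close> converge.\<close>

lemma entropy_limit:
  assumes h: "\<And>n. 0 < h n" "\<And>n. h n < \<tau>" and hlim: "h \<longlonglongrightarrow> 0"
    and leb: "(\<lambda>n. ((LINT t|lborel. k \<tau> t) - (LINT t|lborel. k (\<tau> - h n) t)) / h n) \<longlonglongrightarrow> l"
  shows "l - c * (LINT t|lborel. k \<tau> t) + (LINT z|(lborel \<Otimes>\<^sub>M \<mu>). GT \<tau> z \<bullet> H z) \<le> (LINT x|\<nu>. \<Phi> (u\<^sub>0 x))"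
proof -
  define E0 where "E0 = (LINT x|\<nu>. \<Phi> (u\<^sub>0 x))"
  define J where "J s = (LINT t|lborel. k s t)" for s
  define q where "q n = (J \<tau> - J (\<tau> - h n)) / h n" for n
  have q: "q \<longlonglongrightarrow> l" using leb by (simp add: q_def[abs_def] J_def)
  \<comment> \<open>Convergence of the difference quotient forces continuity from the left.\<close>
  have Jlim: "(\<lambda>n. J (\<tau> - h n)) \<longlonglongrightarrow> J \<tau>"
  proof -
    have "J (\<tau> - h n) = J \<tau> - h n * q n" for n using h(1)[of n] by (simp add: q_def)
    moreover have "(\<lambda>n. J \<tau> - h n * q n) \<longlonglongrightarrow> J \<tau> - 0 * l" by (intro tendsto_intros hlim q)
    ultimately show ?thesis by simp
  qed
  have elim: "(\<lambda>n. (exp (c * h n) - 1) / h n) \<longlonglongrightarrow> c"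
  proof -
    have "((\<lambda>x. exp (c * x)) has_real_derivative c) (at 0)" by (auto intro!: derivative_eq_intros)
    then have "((\<lambda>x. (exp (c * x) - 1) / x) \<longlongrightarrow> c) (at 0)" by (simp add: DERIV_def)
    moreover have "h n \<noteq> 0" for n using h(1)[of n] by simp
    then have "filterlim h (at 0) sequentially" using hlim by (auto simp: filterlim_at)
    ultimately show ?thesis by (rule filterlim_compose)
  qed
  define av where "av n = (LINT t|lborel. indicator {0..h n} t * exp (c * t)) / h n" for n
  have av: "av \<longlonglongrightarrow> 1"
  proof -
    have "av n = (LINT s|unit_unif. exp (c * (h n * s)))" for n
      using average_shift_eq[of "\<lambda>t. exp (c * t)" "h n" 0] h(1)[of n] by (simp add: av_def)
    then have "av = (\<lambda>n. LINT s|unit_unif. exp (c * (h n * s)))" by (rule ext)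
    moreover have "(\<lambda>n. LINT s|unit_unif. exp (c * (h n * s))) \<longlonglongrightarrow> (LINT s|unit_unif. 1)"
    proof (rule integral_dominated_convergence[where w="\<lambda>_. exp (\<bar>c\<bar> * \<tau>)"])
      show "AE s in unit_unif. (\<lambda>n. exp (c * (h n * s))) \<longlonglongrightarrow> 1"
      proof (intro always_eventually allI)
        fix s
        have "(\<lambda>n. exp (c * (h n * s))) \<longlonglongrightarrow> exp (c * (0 * s))" by (intro tendsto_intros hlim)
        then show "(\<lambda>n. exp (c * (h n * s))) \<longlonglongrightarrow> 1" by simp
      qed
      show "AE s in unit_unif. norm (exp (c * (h n * s))) \<le> exp (\<bar>c\<bar> * \<tau>)" for n
        using AE_unit_unif
      proof eventually_elim
        case (elim s)
        have "h n * s \<le> \<tau> * 1" using elim h[of n] by (intro mult_mono) auto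
        then have "\<bar>c\<bar> * (h n * s) \<le> \<bar>c\<bar> * \<tau>" by (intro mult_left_mono) auto
        moreover have "c * (h n * s) \<le> \<bar>c\<bar> * (h n * s)"
          using elim h(1)[of n] by (intro mult_right_mono) auto
        ultimately show ?case by simp
      qed
    qed auto
    ultimately show ?thesis using unit_unif.prob_space by simp
  qed
  have Rlim: "(\<lambda>n. Rem (h n)) \<longlonglongrightarrow> (LINT z|(lborel \<Otimes>\<^sub>M \<mu>). GT \<tau> z \<bullet> H z)"
    unfolding Rem_def
    by (rule tshift_averaged_correlation_inner[OF mu.sigma_finite_weighted GT_measurable[OF tau] H_measurable GT_L2[OF tau] H_L2 hlim])
  have le: "q n - (exp (c * h n) - 1) / h n * J (\<tau> - h n) - E0 * av n \<le> - Rem (h n)" for n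
  proof -
    have "(J \<tau> - exp (c * h n) * J (\<tau> - h n) - E0 * (LINT t|lborel. indicator {0..h n} t * exp (c * t))) / h n \<le> - h n * Rem (h n) / h n"
      using entropy_difference[OF h(1)[of n] h(2)[of n]] h(1)[of n]
      by (intro divide_right_mono) (auto simp: E0_def J_def)
    moreover have "(J \<tau> - exp (c * h n) * J (\<tau> - h n) - E0 * (LINT t|lborel. indicator {0..h n} t * exp (c * t))) / h n
       = q n - (exp (c * h n) - 1) / h n * J (\<tau> - h n) - E0 * av n"
      by (simp add: q_def av_def diff_divide_distrib add_divide_distrib algebra_simps)
    ultimately show ?thesis using h(1)[of n] by simp
  qed
  have "(\<lambda>n. q n - (exp (c * h n) - 1) / h n * J (\<tau> - h n) - E0 * av n) \<longlonglongrightarrow> l - c * J \<tau> - E0 * 1"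
    by (rule tendsto_diff[OF tendsto_diff[OF q tendsto_mult[OF elim Jlim]] tendsto_mult_left[OF av]])
  from LIMSEQ_le[OF this tendsto_minus[OF Rlim] exI[of _ 0]] le
  have "l - c * J \<tau> - E0 * 1 \<le> - (LINT z|(lborel \<Otimes>\<^sub>M \<mu>). GT \<tau> z \<bullet> H z)" by simp
  then show ?thesis by (simp add: E0_def J_def)
qed

end

context pme_solution
begin

text \<open>Averages over \<open>[\<tau> - h, \<tau>]\<close> of the integrable function \<open>t \<mapsto> e\<^sup>c\<^sup>t \<integral> \<Phi>(u(t)) d\<nu>\<close> converge for almost
every \<open>\<tau>\<close> along a subsequence, which suffices to apply \<open>entropy_limit\<close>. Since that subsequence has
to be chosen independently of \<open>\<tau>\<close>, it is taken on a fixed interval \<open>(0, T)\<close>.\<close>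

theorem entropy_inequality:
  fixes \<psi> \<psi>' \<Phi> :: "real \<Rightarrow> real"
  assumes psi_deriv: "\<And>y. (\<psi> has_real_derivative \<psi>' y) (at y)" and psi'_cont: "continuous_on UNIV \<psi>'"
    and psi'_nonneg: "\<And>y. 0 \<le> \<psi>' y" and psi'_le: "\<And>y. \<psi>' y \<le> L" and psi_bound: "\<And>y. \<bar>\<psi> y\<bar> \<le> K"
    and Phi_deriv: "\<And>s. (\<Phi> has_real_derivative \<psi> (spow m s)) (at s)"
  shows "AE \<tau> in lborel. 0 < \<tau> \<longrightarrow>
    exp (c * \<tau>) * (LINT x|\<nu>. \<Phi> (u \<tau> x)) - c * (LINT t:{0<..<\<tau>}|lborel. exp (c * t) * (LINT x|\<nu>. \<Phi> (u t x)))
    + (LINT z|(lborel \<Otimes>\<^sub>M \<mu>). time_cut \<tau> (\<lambda>z. exp (c * fst z) * \<psi>' (spow m (u (fst z) (snd z))) * (norm (G (fst z) (snd z)))\<^sup>2) z)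
    \<le> (LINT x|\<nu>. \<Phi> (u\<^sub>0 x))" (is "AE \<tau> in lborel. 0 < \<tau> \<longrightarrow> ?P \<tau>")
proof -
  have "AE \<tau> in lborel. 0 < \<tau> \<and> \<tau> < T \<longrightarrow> ?P \<tau>" if T: "0 < T" for T
  proof -
    interpret ET: pme_entropy \<Omega> \<rho>\<^sub>\<nu> \<rho>\<^sub>\<mu> m u\<^sub>0 u G \<psi> \<psi>' K L c T \<Phi>
      by unfold_locales (use assms T in auto)
    define h where "h n = 1 / real (Suc n)" for n
    have h: "0 < h n" for n by (simp add: h_def)
    have hlim: "h \<longlonglongrightarrow> 0" unfolding h_def by (rule LIMSEQ_Suc[OF lim_1_over_n])
    have ki: "integrable lborel (ET.k T)" by (rule ET.k_integrable) simp
    have [measurable]: "ET.k T \<in> borel_measurable borel" using ki by auto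
    obtain r where r: "strict_mono r"
      and rAE: "AE t in lborel. (\<lambda>n. (LINT s|unit_unif. ET.k T (t + (h (r n) * s) *\<^sub>R (-1))) - ET.k T t) \<longlonglongrightarrow> 0"
    proof -
      have i: "integrable lborel (\<lambda>t. (LINT s|unit_unif. ET.k T (t + (h n * s) *\<^sub>R (-1))) - ET.k T t)" for n
        by (rule Bochner_Integration.integrable_diff[OF directional_average_L1(2)[OF ki hlim] ki])
      from tendsto_L1_AE_subseq[of lborel "\<lambda>n t. (LINT s|unit_unif. ET.k T (t + (h n * s) *\<^sub>R (-1))) - ET.k T t", OF i] directional_average_L1(1)[OF ki hlim, of "-1"] that
      show thesis unfolding real_norm_def by blast
    qed
    show ?thesis using rAE
    proof eventually_elim
      case (elim \<tau>)
      show ?case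
      proof
        assume \<tau>: "0 < \<tau> \<and> \<tau> < T"
        interpret E: pme_entropy \<Omega> \<rho>\<^sub>\<nu> \<rho>\<^sub>\<mu> m u\<^sub>0 u G \<psi> \<psi>' K L c \<tau> \<Phi>
          by unfold_locales (use assms \<tau> in auto)
        have "(\<lambda>n. h (r n)) \<longlonglongrightarrow> 0" using LIMSEQ_subseq_LIMSEQ[OF hlim r] by (simp add: o_def)
        then have "\<forall>\<^sub>F n in sequentially. h (r n) < \<tau>" using \<tau> by (intro order_tendstoD(2)) auto
        then obtain N where N: "\<And>n. n \<ge> N \<Longrightarrow> h (r n) < \<tau>" by (auto simp: eventually_sequentially)
        define h' where "h' n = h (r (n + N))" for n
        have h': "0 < h' n" "h' n < \<tau>" for n using h N by (auto simp: h'_def)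
        have h'lim: "h' \<longlonglongrightarrow> 0" unfolding h'_def by (rule LIMSEQ_ignore_initial_segment) fact
        have av: "(LINT s|unit_unif. ET.k T (\<tau> + (h' n * s) *\<^sub>R (-1))) = ((LINT t|lborel. ET.k \<tau> t) - (LINT t|lborel. ET.k (\<tau> - h' n) t)) / h' n" for n
        proof -
          have "(LINT s|unit_unif. ET.k T (\<tau> + (h' n * s) *\<^sub>R (-1))) = (LINT t|lborel. indicator {\<tau> - h' n..\<tau>} t * ET.k T t) / h' n"
            using average_shift_backward_eq[OF _ h'(1), of "ET.k T" \<tau> n] by simp
          also have "(LINT t|lborel. indicator {\<tau> - h' n..\<tau>} t * ET.k T t) = (LINT t|lborel. ET.k \<tau> t - ET.k (\<tau> - h' n) t)"
          proof (rule integral_cong_AE)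
            show "AE t in lborel. indicator {\<tau> - h' n..\<tau>} t * ET.k T t = ET.k \<tau> t - ET.k (\<tau> - h' n) t"
              using AE_lborel_singleton[of \<tau>]
              by eventually_elim (use \<tau> h'[of n] in \<open>auto simp: indicator_def ET.k_def\<close>)
            show "(\<lambda>t. ET.k \<tau> t - ET.k (\<tau> - h' n) t) \<in> borel_measurable lborel"
              using ET.k_integrable[of \<tau>] ET.k_integrable[of "\<tau> - h' n"] \<tau> h'[of n] by auto
          qed simp
          also have "\<dots> = (LINT t|lborel. ET.k \<tau> t) - (LINT t|lborel. ET.k (\<tau> - h' n) t)"
            using ET.k_integrable[of \<tau>] ET.k_integrable[of "\<tau> - h' n"] \<tau> h'[of n] by simp
          finally show ?thesis .
        qed
        have leb: "(\<lambda>n. ((LINT t|lborel. ET.k \<tau> t) - (LINT t|lborel. ET.k (\<tau> - h' n) t)) / h' n) \<longlonglongrightarrow> ET.k T \<tau>"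
        proof -
          have "(\<lambda>n. LINT s|unit_unif. ET.k T (\<tau> + (h' n * s) *\<^sub>R (-1))) \<longlonglongrightarrow> ET.k T \<tau>"
            using LIMSEQ_ignore_initial_segment[OF LIM_zero_cancel[OF elim], of N] by (simp only: h'_def)
          then show ?thesis unfolding av .
        qed
        have fin: "ET.k T \<tau> - c * (LINT t|lborel. ET.k \<tau> t) + (LINT z|(lborel \<Otimes>\<^sub>M \<mu>). GT \<tau> z \<bullet> E.H z) \<le> (LINT x|\<nu>. \<Phi> (u\<^sub>0 x))"
          by (rule E.entropy_limit[OF h' h'lim leb])
        have 1: "ET.k T \<tau> = exp (c * \<tau>) * (LINT x|\<nu>. \<Phi> (u \<tau> x))" using \<tau> by (simp add: ET.k_def ET.e_def)
        have 2: "(LINT t|lborel. ET.k \<tau> t) = (LINT t:{0<..<\<tau>}|lborel. exp (c * t) * (LINT x|\<nu>. \<Phi> (u t x)))"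
          unfolding set_lebesgue_integral_def by (intro Bochner_Integration.integral_cong) (auto simp: ET.k_def ET.e_def indicator_def)
        have 3: "GT \<tau> z \<bullet> E.H z = time_cut \<tau> (\<lambda>z. exp (c * fst z) * \<psi>' (spow m (u (fst z) (snd z))) * (norm (G (fst z) (snd z)))\<^sup>2) z" for z
          by (auto simp: GT_def E.H_def time_cut_def case_prod_beta' power2_norm_eq_inner)
        show "?P \<tau>" using fin unfolding 1 2 3 .
      qed
    qed
  qed
  then have "AE \<tau> in lborel. \<forall>n::nat. 0 < \<tau> \<and> \<tau> < real (Suc n) \<longrightarrow> ?P \<tau>"
    unfolding AE_all_countable by simp
  then show ?thesis
  proof eventually_elim
    case (elim \<tau>)
    obtain n where "\<tau> < real n" using reals_Archimedean2 by blast
    then have "\<tau> < real (Suc n)" by simp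
    then show ?case using elim by blast
  qed
qed

end

section \<open>Dissipation, conservation of mass and the maximum principle\<close>

lemma antiderivative_exists:
  fixes f :: "real \<Rightarrow> real"
  assumes "continuous_on UNIV f"
  obtains F where "\<And>s. (F has_real_derivative f s) (at s)" "F a = 0"
proof -
  obtain F where F: "\<And>x. (F has_vector_derivative f x) (at x)"
    using einterval_antiderivative[of "-\<infinity>" "\<infinity>" f] assms by (auto simp: continuous_on_eq_continuous_at)
  have "((\<lambda>s. F s - F a) has_real_derivative f s) (at s)" for s
  proof -
    have "(F has_real_derivative f s) (at s)" using F by (simp add: has_real_derivative_iff_has_vector_derivative)
    then show ?thesis by (auto intro!: derivative_eq_intros)
  qed
  then show ?thesis by (intro that[of "\<lambda>s. F s - F a"]) auto
qed

context pme_test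
begin

lemma dissipation_eq: "GT \<tau> z \<bullet> H z = time_cut \<tau> (\<lambda>z. exp (c * fst z) * \<psi>' (spow m (u (fst z) (snd z))) * (norm (G (fst z) (snd z)))\<^sup>2) z"
  by (auto simp: GT_def H_def time_cut_def case_prod_beta' power2_norm_eq_inner)

lemma dissipation_integrable: "integrable (lborel \<Otimes>\<^sub>M \<mu>) (\<lambda>z. GT \<tau> z \<bullet> H z)"
proof (rule Bochner_Integration.integrable_bound)
  show "integrable (lborel \<Otimes>\<^sub>M \<mu>) (\<lambda>z. (exp (\<bar>c\<bar> * \<tau>) * L) * (norm (GT \<tau> z))\<^sup>2)"
    using GT_L2[OF tau] by (rule integrable_mult_right)
  show "(\<lambda>z. GT \<tau> z \<bullet> H z) \<in> borel_measurable (lborel \<Otimes>\<^sub>M \<mu>)"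
    using GT_measurable[OF tau] by measurable
  show "AE z in lborel \<Otimes>\<^sub>M \<mu>. norm (GT \<tau> z \<bullet> H z) \<le> norm ((exp (\<bar>c\<bar> * \<tau>) * L) * (norm (GT \<tau> z))\<^sup>2)"
  proof (intro always_eventually allI)
    fix z
    have "\<bar>GT \<tau> z \<bullet> H z\<bar> \<le> norm (GT \<tau> z) * norm (H z)" by (rule Cauchy_Schwarz_ineq2)
    also have "\<dots> \<le> norm (GT \<tau> z) * ((exp (\<bar>c\<bar> * \<tau>) * L) * norm (GT \<tau> z))"
      by (intro mult_left_mono norm_H_le) auto
    also have "\<dots> = (exp (\<bar>c\<bar> * \<tau>) * L) * (norm (GT \<tau> z))\<^sup>2" by (simp add: power2_eq_square)
    finally show "norm (GT \<tau> z \<bullet> H z) \<le> norm ((exp (\<bar>c\<bar> * \<tau>) * L) * (norm (GT \<tau> z))\<^sup>2)" by simp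
  qed
qed

end

lemma Lp_norm_2_square:
  "(Lp_norm 2 M f)\<^sup>2 = (LINT x|M. (norm (f x))\<^sup>2)"
proof -
  have "0 \<le> (LINT x|M. (norm (f x))\<^sup>2)" by (rule integral_nonneg_AE) auto
  then show ?thesis by (simp add: Lp_norm_def powr_half_sqrt)
qed

context pme_solution
begin

lemma slice_measurable: "0 < t \<Longrightarrow> u t \<in> borel_measurable \<nu>"
proof -
  assume t: "0 < t"
  have "(\<lambda>x. uT (t + 1) (t, x)) \<in> borel_measurable \<nu>"
    using measurable_compose[OF measurable_Pair1'[of t lborel \<nu>] uT_measurable[of "t + 1"]] t by simp
  then show ?thesis using t by (simp add: uT_def time_cut_def)
qed

lemma AE_slice_integrable: "AE t in lborel. 0 < t \<longrightarrow> integrable \<nu> (u t)"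
proof -
  have "AE t in lborel. \<forall>n::nat. integrable \<nu> (\<lambda>x. uT (real (Suc n)) (t, x))"
    unfolding AE_all_countable
  proof
    fix n :: nat
    have "integrable (lborel \<Otimes>\<^sub>M \<nu>) (uT (real (Suc n)))"
      by (rule slab_integrable[where T="real (Suc n)" and A=1 and B=0]) (auto simp: time_cut_def simp del: of_nat_Suc intro: uT_measurable)
    then show "AE t in lborel. integrable \<nu> (\<lambda>x. uT (real (Suc n)) (t, x))"
      by (rule Pnu.AE_integrable_fst')
  qed
  then show ?thesis
  proof eventually_elim
    case (elim t)
    show ?case
    proof
      assume t: "0 < t"
      obtain n where "t < real n" using reals_Archimedean2 by blast
      then have n: "t < real (Suc n)" by simp
      have "integrable \<nu> (\<lambda>x. uT (real (Suc n)) (t, x))" using elim by blast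
      then show "integrable \<nu> (u t)" using n t by (simp add: uT_def time_cut_def del: of_nat_Suc)
    qed
  qed
qed

text \<open>On almost every time slice, \<open>F'\<^sup>2 \<le> \<psi>'\<close> and the chain rule bound the energy of \<open>F(u\<^sup>m)\<close> by the
dissipation, and the Poincare inequality applies to the bounded function \<open>F(u\<^sup>m)\<close>. The mean of \<open>F(u\<^sup>m)\<close>
changes with time, which is why the variance appears.\<close>

lemma poincare_dissipation:
  fixes \<psi> \<psi>' F F' :: "real \<Rightarrow> real"
  assumes P: "zero_mean_poincare \<Omega> \<rho>\<^sub>\<nu> \<rho>\<^sub>\<mu> M\<^sub>P" and MP: "0 < M\<^sub>P"
    and psi_deriv: "\<And>y. (\<psi> has_real_derivative \<psi>' y) (at y)" and psi'_cont: "continuous_on UNIV \<psi>'"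
    and psi'_nonneg: "\<And>y. 0 \<le> \<psi>' y" and psi'_le: "\<And>y. \<psi>' y \<le> L" and psi_bound: "\<And>y. \<bar>\<psi> y\<bar> \<le> K"
    and F_deriv: "\<And>y. (F has_real_derivative F' y) (at y)" and F'_cont: "continuous_on UNIV F'"
    and F_bound: "\<And>y. \<bar>F y\<bar> \<le> B" and F'_sq: "\<And>y. (F' y)\<^sup>2 \<le> \<psi>' y"
    and tau: "0 < \<tau>"
  shows "(LINT t:{0<..<\<tau>}|lborel. exp (c * t) * (LINT x|\<nu>. (F (spow m (u t x)) - mean_value \<nu> (\<lambda>x. F (spow m (u t x))))\<^sup>2))
    \<le> M\<^sub>P\<^sup>2 * (LINT z|(lborel \<Otimes>\<^sub>M \<mu>). time_cut \<tau> (\<lambda>z. exp (c * fst z) * \<psi>' (spow m (u (fst z) (snd z))) * (norm (G (fst z) (snd z)))\<^sup>2) z)"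
proof -
  interpret T: pme_test \<Omega> \<rho>\<^sub>\<nu> \<rho>\<^sub>\<mu> m u\<^sub>0 u G \<psi> \<psi>' K L c \<tau>
    by unfold_locales (use assms in auto)
  define V where "V t = (LINT x|\<nu>. (F (spow m (u t x)) - mean_value \<nu> (\<lambda>x. F (spow m (u t x))))\<^sup>2)" for t
  define D where "D z = GT \<tau> z \<bullet> T.H z" for z
  have Di: "integrable (lborel \<Otimes>\<^sub>M \<mu>) D" unfolding D_def by (rule T.dissipation_integrable)
  have F'_abs: "\<bar>F' y\<bar> \<le> sqrt L" for y
    using F'_sq[of y] psi'_le[of y] by (metis order_trans real_le_rsqrt power2_abs)
  have Fc: "continuous_on UNIV F"
    using F_deriv by (auto simp: continuous_on_eq_continuous_at intro: DERIV_isCont)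
  have [measurable]: "F \<in> borel_measurable borel" "F' \<in> borel_measurable borel" "spow m \<in> borel_measurable borel"
    using borel_measurable_continuous_onI Fc F'_cont T.spow_m_continuous by auto
  have AEi: "AE t in lborel. integrable \<mu> (\<lambda>x. D (t, x))" using Pmu.AE_integrable_fst'[OF Di] .
  have AEG: "AE t in lborel. integrable \<mu> (\<lambda>x. (norm (GT \<tau> (t, x)))\<^sup>2)" using Pmu.AE_integrable_fst'[OF GT_L2[OF tau]] .
  have key: "AE t in lborel. indicator {0<..<\<tau>} t *\<^sub>R (exp (c * t) * V t) \<le> M\<^sub>P\<^sup>2 * (LINT x|\<mu>. D (t, x))"
    using gradient AEi AEG
  proof eventually_elim
    case (elim t)
    show ?case
    proof (cases "0 < t \<and> t < \<tau>")
      case True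
      define w where "w x = spow m (u t x)" for x
      have W: "has_weak_gradient \<Omega> w (G t)" using elim(1) True by (simp add: w_def[abs_def])
      have GW: "has_weak_gradient \<Omega> (\<lambda>x. F (w x)) (\<lambda>x. F' (w x) *\<^sub>R G t x)"
        by (rule has_weak_gradient_compose[OF nu.open_domain W F_deriv F'_cont F'_abs])
      have um: "u t \<in> borel_measurable \<nu>" using slice_measurable True by simp
      then have um'[measurable]: "u t \<in> borel_measurable \<mu>" by (simp cong: measurable_cong_sets add: sets_nu_mu)
      have wm[measurable]: "w \<in> borel_measurable \<nu>" "w \<in> borel_measurable \<mu>"
        unfolding w_def using um um' by measurable
      have "(\<lambda>x. GT \<tau> (t, x)) \<in> borel_measurable \<mu>"
        using measurable_compose[OF measurable_Pair1'[of t lborel \<mu>] GT_measurable[OF tau]] by simp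
      then have Gm[measurable]: "G t \<in> borel_measurable \<mu>" using True by (simp add: GT_def time_cut_def)
      have Gi: "integrable \<mu> (\<lambda>x. (norm (G t x))\<^sup>2)" using elim(3) True by (simp add: GT_def time_cut_def)
      have Deq: "D (t, x) = exp (c * t) * \<psi>' (w x) * (norm (G t x))\<^sup>2" for x
        using True unfolding D_def T.dissipation_eq by (simp add: time_cut_def w_def)
      have di: "integrable \<mu> (\<lambda>x. \<psi>' (w x) * (norm (G t x))\<^sup>2)"
      proof -
        have "integrable \<mu> (\<lambda>x. exp (- (c * t)) * D (t, x))" using elim(2) by simp
        moreover have "exp (- (c * t)) * D (t, x) = \<psi>' (w x) * (norm (G t x))\<^sup>2" for x
          unfolding Deq by (simp add: exp_minus)
        ultimately show ?thesis by simp
      qed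
      have gsq: "(norm (F' (w x) *\<^sub>R G t x))\<^sup>2 \<le> \<psi>' (w x) * (norm (G t x))\<^sup>2" for x
        using F'_sq[of "w x"] by (simp add: power_mult_distrib mult_right_mono)
      have gi: "integrable \<mu> (\<lambda>x. (norm (F' (w x) *\<^sub>R G t x))\<^sup>2)"
      proof (rule Bochner_Integration.integrable_bound[OF di])
        show "AE x in \<mu>. norm ((norm (F' (w x) *\<^sub>R G t x))\<^sup>2) \<le> norm (\<psi>' (w x) * (norm (G t x))\<^sup>2)"
        proof (intro always_eventually allI)
          fix x
          show "norm ((norm (F' (w x) *\<^sub>R G t x))\<^sup>2) \<le> norm (\<psi>' (w x) * (norm (G t x))\<^sup>2)"
            using gsq[of x] unfolding real_norm_def by (simp only: abs_of_nonneg[OF zero_le_power2])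
        qed
      qed measurable
      have W12: "in_W12 \<Omega> \<rho>\<^sub>\<nu> \<rho>\<^sub>\<mu> (\<lambda>x. F (w x))"
        unfolding in_W12_def
      proof (intro conjI exI)
        show "in_Lp 2 \<nu> (\<lambda>x. F (w x))" by (rule in_Lp_2_bounded[OF finite_nu _ F_bound]) measurable
        show "has_weak_gradient \<Omega> (\<lambda>x. F (w x)) (\<lambda>x. F' (w x) *\<^sub>R G t x)" by (rule GW)
        show "in_Lp 2 \<mu> (\<lambda>x. F' (w x) *\<^sub>R G t x)" unfolding in_Lp_2_iff using gi by auto
      qed
      have "Lp_norm 2 \<nu> (\<lambda>x. F (w x) - mean_value \<nu> (\<lambda>x. F (w x))) \<le> M\<^sub>P * Lp_norm 2 \<mu> (\<lambda>x. F' (w x) *\<^sub>R G t x)"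
        using P W12 GW unfolding zero_mean_poincare_def by blast
      then have "(Lp_norm 2 \<nu> (\<lambda>x. F (w x) - mean_value \<nu> (\<lambda>x. F (w x))))\<^sup>2 \<le> (M\<^sub>P * Lp_norm 2 \<mu> (\<lambda>x. F' (w x) *\<^sub>R G t x))\<^sup>2"
        by (intro power_mono) (auto simp: Lp_norm_def)
      then have "V t \<le> M\<^sub>P\<^sup>2 * (LINT x|\<mu>. (norm (F' (w x) *\<^sub>R G t x))\<^sup>2)"
        unfolding power_mult_distrib Lp_norm_2_square by (simp add: V_def w_def)
      also have "\<dots> \<le> M\<^sub>P\<^sup>2 * (LINT x|\<mu>. \<psi>' (w x) * (norm (G t x))\<^sup>2)"
        by (intro mult_left_mono integral_mono gi di gsq) auto
      finally have "exp (c * t) * V t \<le> exp (c * t) * (M\<^sub>P\<^sup>2 * (LINT x|\<mu>. \<psi>' (w x) * (norm (G t x))\<^sup>2))"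
        by (intro mult_left_mono) auto
      also have "\<dots> = M\<^sub>P\<^sup>2 * (LINT x|\<mu>. D (t, x))" unfolding Deq by (simp add: mult.assoc)
      finally show ?thesis using True by simp
    next
      case False
      then have "D (t, x) = 0" for x by (auto simp: D_def GT_def time_cut_def)
      then show ?thesis using False by auto
    qed
  qed
  have "(LINT t:{0<..<\<tau>}|lborel. exp (c * t) * V t) \<le> (LINT t|lborel. M\<^sub>P\<^sup>2 * (LINT x|\<mu>. D (t, x)))"
    unfolding set_lebesgue_integral_def
  proof (rule integral_mono_AE'[OF _ key])
    show "integrable lborel (\<lambda>t. M\<^sub>P\<^sup>2 * (LINT x|\<mu>. D (t, x)))"
      using Pmu.integrable_fst'[OF Di] by simp
    show "AE t in lborel. 0 \<le> M\<^sub>P\<^sup>2 * (LINT x|\<mu>. D (t, x))"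
    proof (intro always_eventually allI mult_nonneg_nonneg integral_nonneg_AE)
      fix t x
      show "0 \<le> D (t, x)" unfolding D_def T.dissipation_eq using psi'_nonneg by (simp add: time_cut_def)
    qed auto
  qed
  also have "\<dots> = M\<^sub>P\<^sup>2 * (LINT z|(lborel \<Otimes>\<^sub>M \<mu>). D z)"
    using Pmu.integral_fst'[OF Di] by simp
  finally show ?thesis unfolding V_def D_def T.dissipation_eq .
qed

text \<open>The constants \<open>\<psi> = 1\<close> and \<open>\<psi> = -1\<close> have no dissipation; they give the two inequalities.\<close>

lemma mean_conserved: "AE t in lborel. 0 < t \<longrightarrow> (LINT x|\<nu>. u t x) = (LINT x|\<nu>. u\<^sub>0 x)"
proof -
  have "AE \<tau> in lborel. 0 < \<tau> \<longrightarrow> s * (LINT x|\<nu>. u \<tau> x) \<le> s * (LINT x|\<nu>. u\<^sub>0 x)" for s :: real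
  proof -
    have "AE \<tau> in lborel. 0 < \<tau> \<longrightarrow>
      exp (0 * \<tau>) * (LINT x|\<nu>. s * u \<tau> x) - 0 * (LINT t:{0<..<\<tau>}|lborel. exp (0 * t) * (LINT x|\<nu>. s * u t x))
      + (LINT z|(lborel \<Otimes>\<^sub>M \<mu>). time_cut \<tau> (\<lambda>z. exp (0 * fst z) * 0 * (norm (G (fst z) (snd z)))\<^sup>2) z)
      \<le> (LINT x|\<nu>. s * u\<^sub>0 x)"
      by (rule entropy_inequality[where \<psi>="\<lambda>_. s" and \<psi>'="\<lambda>_. 0" and L=0 and K="\<bar>s\<bar>"]) (auto intro!: derivative_eq_intros)
    then show ?thesis by (simp add: time_cut_def)
  qed
  from this[of 1] this[of "-1"] show ?thesis by eventually_elim auto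
qed

text \<open>The entropy whose derivative is a bounded smooth version of the positive part of \<open>u\<^sup>m - b\<^sup>m\<close> vanishes for
\<open>s \<le> b\<close> and is positive for \<open>s > b\<close>. It is zero initially and does not increase.\<close>

lemma maximum_principle:
  assumes b: "AE x in \<nu>. u\<^sub>0 x \<le> b"
  shows "AE t in lborel. 0 < t \<longrightarrow> (AE x in \<nu>. u t x \<le> b)"
proof -
  define r where "r y = max (y - spow m b) 0" for y
  define \<psi> where "\<psi> y = (r y)\<^sup>2 / (1 + (r y)\<^sup>2)" for y
  define \<psi>' where "\<psi>' y = 2 * r y / (1 + (r y)\<^sup>2)\<^sup>2" for y
  have pos: "0 < 1 + (r y)\<^sup>2" for y by (simp add: add_pos_nonneg)
  have r0: "0 \<le> r y" for y by (simp add: r_def)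
  have r2: "((\<lambda>y. (r y)\<^sup>2) has_real_derivative 2 * r y) (at y)" for y
  proof -
    consider "y < spow m b" | "y = spow m b" | "spow m b < y" by linarith
    then show ?thesis
    proof cases
      case 1
      have "((\<lambda>y. 0) has_real_derivative 2 * r y) (at y)" using 1 by (simp add: r_def)
      then show ?thesis
        by (rule has_field_derivative_transform_within_open[of _ _ _ "{..<spow m b}"]) (use 1 in \<open>auto simp: r_def\<close>)
    next
      case 2
      have "((\<lambda>y. (r y)\<^sup>2) has_real_derivative 0) (at y)"
        by (rule DERIV_zero_if_quadratic_bound[of _ 1]) (use 2 in \<open>auto simp: r_def max_def\<close>)
      then show ?thesis using 2 by (simp add: r_def)
    next
      case 3
      have "((\<lambda>y. (y - spow m b)\<^sup>2) has_real_derivative 2 * r y) (at y)"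
        using 3 by (auto intro!: derivative_eq_intros simp: r_def)
      then show ?thesis
        by (rule has_field_derivative_transform_within_open[of _ _ _ "{spow m b<..}"]) (use 3 in \<open>auto simp: r_def\<close>)
    qed
  qed
  have D: "(\<psi> has_real_derivative \<psi>' y) (at y)" for y
  proof -
    have "(\<psi> has_real_derivative ((2 * r y) * (1 + (r y)\<^sup>2) - (r y)\<^sup>2 * (0 + 2 * r y)) / ((1 + (r y)\<^sup>2) * (1 + (r y)\<^sup>2))) (at y)"
      unfolding \<psi>_def[abs_def] using pos[of y] by (intro DERIV_divide DERIV_add r2 DERIV_const) auto
    then show ?thesis by (simp add: \<psi>'_def power2_eq_square algebra_simps)
  qed
  have c': "continuous_on UNIV \<psi>'"
  proof -
    have "(1 + (max (y - spow m b) 0)\<^sup>2)\<^sup>2 \<noteq> 0" for y using pos[of y] unfolding r_def by simp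
    then show ?thesis unfolding \<psi>'_def r_def by (intro continuous_intros) blast
  qed
  have n: "0 \<le> \<psi>' y" for y unfolding \<psi>'_def using r0 by simp
  have L: "\<psi>' y \<le> 1" for y
  proof -
    have "2 * r y \<le> 1 + (r y)\<^sup>2" using sum_squares_bound[of "r y" 1] by simp
    also have "\<dots> \<le> (1 + (r y)\<^sup>2)\<^sup>2" using self_le_power[of "1 + (r y)\<^sup>2" 2] by simp
    finally show ?thesis unfolding \<psi>'_def using pos[of y] by (simp add: divide_le_eq)
  qed
  have K: "\<bar>\<psi> y\<bar> \<le> 1" for y unfolding \<psi>_def using pos[of y] by (simp add: divide_le_eq)
  have \<psi>0: "\<psi> (spow m s) = 0" if "s \<le> b" for s
    using spow_mono[of m s b] m that by (simp add: \<psi>_def r_def)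
  have \<psi>1: "0 < \<psi> (spow m s)" if "b < s" for s
    using spow_strict_mono[of m b s] m that pos[of "spow m s"] by (simp add: \<psi>_def r_def)
  have \<psi>c: "continuous_on UNIV \<psi>" using D by (auto simp: continuous_on_eq_continuous_at intro: DERIV_isCont)
  have spc: "continuous_on UNIV (spow m)" using m by (intro spow_continuous) simp
  have "continuous_on UNIV (\<lambda>s. \<psi> (spow m s))" by (rule continuous_on_compose2[OF \<psi>c spc]) simp
  then obtain \<Phi> where \<Phi>: "\<And>s. (\<Phi> has_real_derivative \<psi> (spow m s)) (at s)" "\<Phi> b = 0"
    using antiderivative_exists by blast
  \<comment> \<open>The parameters \<open>c = 0\<close> and \<open>\<tau> = 1\<close> are arbitrary: only the facts about \<open>\<Phi>\<close> are taken from here.\<close>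
  interpret E: pme_entropy \<Omega> \<rho>\<^sub>\<nu> \<rho>\<^sub>\<mu> m u\<^sub>0 u G \<psi> \<psi>' 1 1 0 1 \<Phi>
    by unfold_locales (use D c' n L K \<Phi> in auto)
  have \<Phi>nonneg: "0 \<le> \<Phi> s" for s using E.Phi_subgradient[of b s] \<Phi>(2) \<psi>0[of b] by simp
  have \<Phi>zero: "\<Phi> s = 0" if "s \<le> b" for s
    using E.Phi_subgradient[of s b] \<Phi>(2) \<psi>0[OF that] \<Phi>nonneg[of s] by simp
  have \<Phi>pos: "0 < \<Phi> s" if "b < s" for s
  proof -
    define s' where "s' = (s + b) / 2"
    have s': "b < s'" "s' < s" using that by (auto simp: s'_def)
    have "\<Phi> s' - \<Phi> s \<le> \<psi> (spow m s') * (s' - s)" by (rule E.Phi_subgradient)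
    also have "\<dots> < 0" using \<psi>1[OF s'(1)] s'(2) by (intro mult_pos_neg) auto
    finally show ?thesis using \<Phi>nonneg[of s'] by simp
  qed
  have "(LINT x|\<nu>. \<Phi> (u\<^sub>0 x)) = (LINT x|\<nu>. 0)"
    by (rule integral_cong_AE) (use b \<Phi>zero in \<open>auto elim!: eventually_mono\<close>)
  then have \<Phi>u0: "(LINT x|\<nu>. \<Phi> (u\<^sub>0 x)) = 0" by simp
  have "AE \<tau> in lborel. 0 < \<tau> \<longrightarrow>
      exp (0 * \<tau>) * (LINT x|\<nu>. \<Phi> (u \<tau> x)) - 0 * (LINT t:{0<..<\<tau>}|lborel. exp (0 * t) * (LINT x|\<nu>. \<Phi> (u t x)))
      + (LINT z|(lborel \<Otimes>\<^sub>M \<mu>). time_cut \<tau> (\<lambda>z. exp (0 * fst z) * \<psi>' (spow m (u (fst z) (snd z))) * (norm (G (fst z) (snd z)))\<^sup>2) z)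
      \<le> (LINT x|\<nu>. \<Phi> (u\<^sub>0 x))"
    by (rule entropy_inequality[OF D c' n L K \<Phi>(1)])
  then show ?thesis using AE_slice_integrable
  proof eventually_elim
    case (elim \<tau>)
    show ?case
    proof
      assume t: "0 < \<tau>"
      have "0 \<le> (LINT z|(lborel \<Otimes>\<^sub>M \<mu>). time_cut \<tau> (\<lambda>z. exp (0 * fst z) * \<psi>' (spow m (u (fst z) (snd z))) * (norm (G (fst z) (snd z)))\<^sup>2) z)"
        using n by (intro integral_nonneg_AE) (auto simp: time_cut_def)
      then have le: "(LINT x|\<nu>. \<Phi> (u \<tau> x)) \<le> 0" using elim(1) t unfolding \<Phi>u0 by simp
      have ui: "integrable \<nu> (u \<tau>)" using elim(2) t by simp
      then have [measurable]: "u \<tau> \<in> borel_measurable \<nu>" by auto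
      have \<Phi>i: "integrable \<nu> (\<lambda>x. \<Phi> (u \<tau> x))"
      proof (rule Bochner_Integration.integrable_bound)
        show "integrable \<nu> (\<lambda>x. \<bar>\<Phi> 0\<bar> + 1 * \<bar>u \<tau> x\<bar>)" using ui by auto
        show "AE x in \<nu>. norm (\<Phi> (u \<tau> x)) \<le> norm (\<bar>\<Phi> 0\<bar> + 1 * \<bar>u \<tau> x\<bar>)"
          using E.Phi_growth by (intro always_eventually allI) (metis abs_ge_self order_trans real_norm_def)
      qed measurable
      have "(LINT x|\<nu>. \<Phi> (u \<tau> x)) = 0"
      proof -
        have "0 \<le> (LINT x|\<nu>. \<Phi> (u \<tau> x))" by (rule integral_nonneg_AE) (use \<Phi>nonneg in auto)
        then show ?thesis using le by linarith
      qed
      then have "AE x in \<nu>. \<Phi> (u \<tau> x) = 0"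
        using integral_nonneg_eq_0_iff_AE[OF \<Phi>i] \<Phi>nonneg by simp
      then show "AE x in \<nu>. u \<tau> x \<le> b"
        by eventually_elim (use \<Phi>pos in \<open>metis less_irrefl not_le\<close>)
    qed
  qed
qed

end

lemma spow_minus: "spow q (- x) = - spow q x"
  by (simp add: spow_def sgn_minus)

lemma in_Lp_minus: "in_Lp q M f \<Longrightarrow> in_Lp q M (\<lambda>x. - f x)"
  by (auto simp: in_Lp_def)

text \<open>The signed power is odd. This yields lower bounds from the maximum principle and reduces negative means to
positive ones.\<close>

lemma pme_solution_minus:
  assumes "pme_solution \<Omega> \<rho>\<^sub>\<nu> \<rho>\<^sub>\<mu> m u\<^sub>0 u G"
  shows "pme_solution \<Omega> \<rho>\<^sub>\<nu> \<rho>\<^sub>\<mu> m (\<lambda>x. - u\<^sub>0 x) (\<lambda>t x. - u t x) (\<lambda>t x. - G t x)"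
proof -
  interpret pme_solution \<Omega> \<rho>\<^sub>\<nu> \<rho>\<^sub>\<mu> m u\<^sub>0 u G by fact
  show ?thesis
  proof unfold_locales
    show "AE t in lborel. 0 < t \<longrightarrow> has_weak_gradient \<Omega> (\<lambda>x. spow m (- u t x)) (\<lambda>x. - G t x)"
      using gradient
    proof eventually_elim
      case (elim t)
      show ?case
      proof
        assume "0 < t"
        then have W: "has_weak_gradient \<Omega> (\<lambda>x. spow m (u t x)) (G t)" using elim by simp
        have "has_weak_gradient \<Omega> (\<lambda>x. - spow m (u t x)) (\<lambda>x. (-1) *\<^sub>R G t x)"
          by (rule has_weak_gradient_compose[OF nu.open_domain W, of uminus "\<lambda>_. -1" 1]) (auto intro!: derivative_eq_intros)
        then show "has_weak_gradient \<Omega> (\<lambda>x. spow m (- u t x)) (\<lambda>x. - G t x)" by (simp add: spow_minus)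
      qed
    qed
    show "in_Lp 2 \<nu> (\<lambda>x. - u\<^sub>0 x)" by (rule in_Lp_minus[OF u0_L2])
    show "in_LpLp 2 T \<nu> (\<lambda>t x. - u t x)" if "0 < T" for T
      using in_Lp_minus[OF u_L2[OF that, unfolded in_LpLp_def]] by (simp add: in_LpLp_def case_prod_beta')
    show "in_LpLp 2 T \<mu> (\<lambda>t x. - G t x)" if "0 < T" for T
      using in_Lp_minus[OF G_L2[OF that, unfolded in_LpLp_def]] by (simp add: in_LpLp_def case_prod_beta')
    fix T \<eta> \<eta>' \<zeta>
    assume "0 < T" "in_W12_time T \<nu> \<eta> \<eta>'" "AE t in lborel. t \<in> {0<..<T} \<longrightarrow> has_weak_gradient \<Omega> (\<eta> t) (\<zeta> t)"
      "in_LpLp 2 T \<mu> \<zeta>" "AE x in \<nu>. \<eta> T x = 0"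
    from weak[OF this]
    show "(LINT t:{0<..<T}|lborel. LINT x|\<nu>. - u t x * \<eta>' t x) =
       - (LINT x|\<nu>. - u\<^sub>0 x * \<eta> 0 x) + (LINT t:{0<..<T}|lborel. LINT x|\<mu>. - G t x \<bullet> \<zeta> t x)"
      by (simp add: set_lebesgue_integral_def)
  qed (use m in auto)
qed

section \<open>Regularisation of the power entropies\<close>

text \<open>A smooth substitute for \<open>spow p z\<close>: the singular factor \<open>\<bar>z\<bar> powr (p - 1)\<close> is taken at \<open>sqrt (z\<^sup>2 + \<delta>)\<close>.\<close>

definition rpow :: "real \<Rightarrow> real \<Rightarrow> real \<Rightarrow> real" where
  "rpow \<delta> p z = z * (z\<^sup>2 + \<delta>) powr ((p - 1) / 2)"

definition rpow' :: "real \<Rightarrow> real \<Rightarrow> real \<Rightarrow> real" where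
  "rpow' \<delta> p z = (z\<^sup>2 + \<delta>) powr ((p - 3) / 2) * (p * z\<^sup>2 + \<delta>)"

lemma rpow_base_pos: "0 < \<delta> \<Longrightarrow> 0 < z\<^sup>2 + (\<delta>::real)"
  by (simp add: add_nonneg_pos)

lemma rpow_deriv:
  assumes d: "0 < \<delta>" shows "(rpow \<delta> p has_real_derivative rpow' \<delta> p z) (at z)"
proof -
  have pos: "0 < z\<^sup>2 + \<delta>" by (rule rpow_base_pos[OF d])
  have D1: "((\<lambda>z. z\<^sup>2 + \<delta>) has_real_derivative 2 * z) (at z)" by (auto intro!: derivative_eq_intros)
  have D2: "((\<lambda>z. (z\<^sup>2 + \<delta>) powr ((p - 1) / 2)) has_real_derivative ((p - 1) / 2) * (z\<^sup>2 + \<delta>) powr ((p - 1) / 2 - 1) * (2 * z)) (at z)"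
    by (rule DERIV_chain2[OF has_real_derivative_powr[OF pos] D1])
  have e: "(p - 1) / 2 - 1 = (p - 3) / 2" by (simp add: field_simps)
  have pw: "(z\<^sup>2 + \<delta>) powr ((p - 1) / 2) = (z\<^sup>2 + \<delta>) powr ((p - 3) / 2) * (z\<^sup>2 + \<delta>)"
  proof -
    have "(z\<^sup>2 + \<delta>) powr ((p - 1) / 2) = (z\<^sup>2 + \<delta>) powr ((p - 3) / 2 + 1)" by (simp add: field_simps)
    then show ?thesis using pos by (simp add: powr_add)
  qed
  have "(rpow \<delta> p has_real_derivative 1 * (z\<^sup>2 + \<delta>) powr ((p - 1) / 2) + ((p - 1) / 2) * (z\<^sup>2 + \<delta>) powr ((p - 1) / 2 - 1) * (2 * z) * z) (at z)"
    unfolding rpow_def[abs_def] by (rule DERIV_mult[OF DERIV_ident D2])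
  also have "1 * (z\<^sup>2 + \<delta>) powr ((p - 1) / 2) + ((p - 1) / 2) * (z\<^sup>2 + \<delta>) powr ((p - 1) / 2 - 1) * (2 * z) * z = rpow' \<delta> p z"
    unfolding e pw rpow'_def by (simp add: field_simps power2_eq_square)
  finally show ?thesis .
qed

lemma rpow'_continuous: "0 < \<delta> \<Longrightarrow> continuous_on UNIV (rpow' \<delta> p)"
proof -
  assume "0 < \<delta>"
  then have "z\<^sup>2 + \<delta> \<noteq> 0" for z using rpow_base_pos[of \<delta> z] by simp
  then show ?thesis unfolding rpow'_def[abs_def]
    by (intro continuous_on_mult continuous_on_powr continuous_on_add continuous_on_power continuous_on_id continuous_on_const) blast
qed

text \<open>Up to constants depending on \<open>p\<close> only, derivatives of regularised powers behave like the powers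
\<open>(z\<^sup>2 + \<delta>) powr ((p - 1) / 2)\<close>; therefore comparisons between different exponents survive the
regularisation uniformly in \<open>\<delta>\<close>.\<close>

lemma rpow'_bounds:
  assumes d: "0 < \<delta>"
  shows "min p 1 * (z\<^sup>2 + \<delta>) powr ((p - 1) / 2) \<le> rpow' \<delta> p z" "rpow' \<delta> p z \<le> max p 1 * (z\<^sup>2 + \<delta>) powr ((p - 1) / 2)"
proof -
  have pos: "0 < z\<^sup>2 + \<delta>" by (rule rpow_base_pos[OF d])
  have pw: "(z\<^sup>2 + \<delta>) powr ((p - 1) / 2) = (z\<^sup>2 + \<delta>) powr ((p - 3) / 2) * (z\<^sup>2 + \<delta>)"
  proof -
    have "(z\<^sup>2 + \<delta>) powr ((p - 1) / 2) = (z\<^sup>2 + \<delta>) powr ((p - 3) / 2 + 1)" by (simp add: field_simps)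
    then show ?thesis using pos by (simp add: powr_add)
  qed
  have 1: "min p 1 * (z\<^sup>2 + \<delta>) \<le> p * z\<^sup>2 + \<delta>"
  proof -
    have "min p 1 * z\<^sup>2 \<le> p * z\<^sup>2" "min p 1 * \<delta> \<le> 1 * \<delta>" using d by (auto intro!: mult_right_mono)
    then show ?thesis by (simp add: algebra_simps)
  qed
  have 2: "p * z\<^sup>2 + \<delta> \<le> max p 1 * (z\<^sup>2 + \<delta>)"
  proof -
    have "p * z\<^sup>2 \<le> max p 1 * z\<^sup>2" "1 * \<delta> \<le> max p 1 * \<delta>" using d by (auto intro!: mult_right_mono)
    then show ?thesis by (simp add: algebra_simps)
  qed
  show "min p 1 * (z\<^sup>2 + \<delta>) powr ((p - 1) / 2) \<le> rpow' \<delta> p z"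
    unfolding rpow'_def pw using mult_left_mono[OF 1, of "(z\<^sup>2 + \<delta>) powr ((p - 3) / 2)"] by (simp add: mult_ac)
  show "rpow' \<delta> p z \<le> max p 1 * (z\<^sup>2 + \<delta>) powr ((p - 1) / 2)"
    unfolding rpow'_def pw using mult_left_mono[OF 2, of "(z\<^sup>2 + \<delta>) powr ((p - 3) / 2)"] by (simp add: mult_ac)
qed

lemma rpow'_nonneg: "0 < \<delta> \<Longrightarrow> 0 \<le> p \<Longrightarrow> 0 \<le> rpow' \<delta> p z"
  by (simp add: rpow'_def)

lemma rpow_abs_le:
  assumes d: "0 < \<delta>" shows "\<bar>rpow \<delta> p z\<bar> \<le> (z\<^sup>2 + \<delta>) powr (p / 2)"
proof -
  have pos: "0 < z\<^sup>2 + \<delta>" by (rule rpow_base_pos[OF d])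
  have "\<bar>z\<bar> = sqrt (z\<^sup>2)" by simp
  also have "\<dots> \<le> sqrt (z\<^sup>2 + \<delta>)" using d by (intro real_sqrt_le_mono) simp
  also have "\<dots> = (z\<^sup>2 + \<delta>) powr (1/2)" using pos by (simp add: powr_half_sqrt)
  finally have "\<bar>z\<bar> * (z\<^sup>2 + \<delta>) powr ((p - 1) / 2) \<le> (z\<^sup>2 + \<delta>) powr (1/2) * (z\<^sup>2 + \<delta>) powr ((p - 1) / 2)"
    by (intro mult_right_mono) auto
  also have "\<dots> = (z\<^sup>2 + \<delta>) powr (p / 2)" by (simp add: field_simps flip: powr_add)
  finally show ?thesis by (simp add: rpow_def abs_mult)
qed

lemma rpow_abs_bound:
  assumes d: "0 < \<delta>" "\<delta> \<le> 1" and p: "0 < p" and z: "\<bar>z\<bar> \<le> Z"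
  shows "\<bar>rpow \<delta> p z\<bar> \<le> (Z\<^sup>2 + 1) powr (p / 2)"
proof -
  have "z\<^sup>2 \<le> Z\<^sup>2" using z by (simp add: abs_le_square_iff[symmetric])
  then have "(z\<^sup>2 + \<delta>) powr (p / 2) \<le> (Z\<^sup>2 + 1) powr (p / 2)"
    using d p rpow_base_pos[OF d(1), of z] by (intro powr_mono2) auto
  then show ?thesis using rpow_abs_le[OF d(1), of p z] by linarith
qed

lemma rpow_tendsto:
  assumes d: "\<And>n. 0 < \<delta> n" "\<delta> \<longlonglongrightarrow> 0" and z: "z \<longlonglongrightarrow> y" and p: "0 < p"
  shows "(\<lambda>n. rpow (\<delta> n) p (z n)) \<longlonglongrightarrow> spow p y"
proof (cases "y = 0")
  case True
  have "(\<lambda>n. (z n)\<^sup>2 + \<delta> n) \<longlonglongrightarrow> y\<^sup>2 + 0" by (intro tendsto_intros z d)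
  then have "(\<lambda>n. ((z n)\<^sup>2 + \<delta> n) powr (p / 2)) \<longlonglongrightarrow> 0 powr (p / 2)"
    using True p d by (intro tendsto_powr') (auto intro!: always_eventually less_imp_le rpow_base_pos)
  then have "(\<lambda>n. ((z n)\<^sup>2 + \<delta> n) powr (p / 2)) \<longlonglongrightarrow> 0" using p by simp
  then have "(\<lambda>n. rpow (\<delta> n) p (z n)) \<longlonglongrightarrow> 0"
    by (rule Lim_null_comparison[rotated]) (use rpow_abs_le[OF d(1)] in auto)
  then show ?thesis using True by (simp add: spow_def)
next
  case False
  have "(\<lambda>n. rpow (\<delta> n) p (z n)) \<longlonglongrightarrow> y * (y\<^sup>2 + 0) powr ((p - 1) / 2)"
    unfolding rpow_def by (intro tendsto_mult tendsto_powr tendsto_add tendsto_power z d tendsto_const) (use False in auto)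
  also have "y * (y\<^sup>2 + 0) powr ((p - 1) / 2) = spow p y"
  proof -
    have "(y\<^sup>2) powr ((p - 1) / 2) = \<bar>y\<bar> powr (p - 1)"
    proof -
      have "(y\<^sup>2) powr ((p - 1) / 2) = (\<bar>y\<bar> powr 2) powr ((p - 1) / 2)" using False by (simp add: powr_numeral)
      also have "\<dots> = \<bar>y\<bar> powr (2 * ((p - 1) / 2))" by (rule powr_powr)
      also have "2 * ((p - 1) / 2) = p - 1" by (simp add: field_simps)
      finally show ?thesis .
    qed
    moreover have "y = sgn y * \<bar>y\<bar>" by (simp add: sgn_mult_abs)
    moreover have "\<bar>y\<bar> * \<bar>y\<bar> powr (p - 1) = \<bar>y\<bar> powr p" using False by (simp add: powr_mult_base)
    ultimately show ?thesis unfolding spow_def by (metis add.right_neutral mult.assoc mult.commute)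
  qed
  finally show ?thesis .
qed

lemma spow_spow: "0 < p \<Longrightarrow> spow p (spow q x) = spow (q * p) x"
  by (cases "x = 0") (auto simp: spow_def abs_mult powr_powr sgn_mult sgn_if)

lemma spow_1: "spow 1 x = x" by (simp add: spow_def sgn_if)

lemma abs_spow: "\<bar>spow q x\<bar> = \<bar>x\<bar> powr q" by (auto simp: spow_def abs_mult sgn_if)

text \<open>The function is the antiderivative of a trapezoid.\<close>

lemma cutoff_exists:
  fixes W :: real assumes W: "0 < W"
  obtains b b' where "\<And>w. (b has_real_derivative b' w) (at w)" "continuous_on UNIV b'"
    "\<And>w. 0 \<le> b' w" "\<And>w. b' w \<le> 1" "\<And>w. \<bar>w\<bar> \<le> W \<Longrightarrow> b w = w" "\<And>w. \<bar>b w\<bar> \<le> W + 1"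
proof -
  define cut where "cut w = max 0 (min 1 (W + 1 - \<bar>w\<bar>))" for w :: real
  have c: "continuous_on UNIV cut" unfolding cut_def by (intro continuous_intros)
  obtain b where D: "\<And>w. (b has_real_derivative cut w) (at w)" and b0: "b 0 = 0"
    using antiderivative_exists[OF c] by blast
  have cut01: "0 \<le> cut w" "cut w \<le> 1" for w by (auto simp: cut_def)
  have id: "b w = w" if "\<bar>w\<bar> \<le> W" for w
  proof -
    consider "0 < w" | "w = 0" | "w < 0" by linarith
    then show ?thesis
    proof cases
      case 1
      obtain z where "0 < z" "z < w" "b w - b 0 = (w - 0) * cut z" using MVT2[OF 1, of b cut] D by blast
      then show ?thesis using that b0 by (simp add: cut_def)
    next
      case 3
      obtain z where "w < z" "z < 0" "b 0 - b w = (0 - w) * cut z" using MVT2[OF 3, of b cut] D by blast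
      then show ?thesis using that b0 by (simp add: cut_def)
    qed (simp add: b0)
  qed
  have le: "\<bar>b w\<bar> \<le> \<bar>w\<bar>" for w
    using lipschitz_of_bounded_derivative[OF D, of 1 w 0] cut01 b0 by simp
  have "\<bar>b w\<bar> \<le> W + 1" for w
  proof -
    consider "\<bar>w\<bar> \<le> W + 1" | "W + 1 < w" | "w < - (W + 1)" by linarith
    then show ?thesis
    proof cases
      case 1 then show ?thesis using le[of w] by simp
    next
      case 2
      obtain z where "W + 1 < z" "b w - b (W + 1) = (w - (W + 1)) * cut z" using MVT2[OF 2, of b cut] D by blast
      then show ?thesis using le[of "W + 1"] W by (simp add: cut_def)
    next
      case 3
      obtain z where "z < - (W + 1)" "b (- (W + 1)) - b w = (- (W + 1) - w) * cut z" using MVT2[OF 3, of b cut] D by blast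
      then show ?thesis using le[of "- (W + 1)"] W by (simp add: cut_def)
    qed
  qed
  then show ?thesis using that[of b cut] D c cut01 id by blast
qed

text \<open>The slope rises linearly from \<open>0\<close> at \<open>-a\<close> to \<open>1\<close> at \<open>0\<close>. It is at least \<open>1/2\<close> on \<open>[-a/2, 0]\<close>, whence the
lower bound.\<close>

lemma flattening_exists:
  fixes a :: real assumes a: "0 < a"
  obtains y y' where "\<And>z. (y has_real_derivative y' z) (at z)" "continuous_on UNIV y'"
    "\<And>z. 0 \<le> y' z" "\<And>z. y' z \<le> 1" "\<And>z. z \<le> - a \<Longrightarrow> y' z = 0" "\<And>z. 0 \<le> z \<Longrightarrow> y z = z"
    "\<And>z. z \<le> 0 \<Longrightarrow> y z \<le> 0" "\<And>z. \<bar>y z\<bar> \<le> \<bar>z\<bar>" "\<And>z. min (\<bar>z\<bar> / 2) (a / 4) \<le> \<bar>y z\<bar>"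
proof -
  define cut where "cut z = max 0 (min 1 (1 + z / a))" for z :: real
  have c: "continuous_on UNIV cut" unfolding cut_def using a by (intro continuous_intros) auto
  obtain y where D: "\<And>w. (y has_real_derivative cut w) (at w)" and y0: "y 0 = 0"
    using antiderivative_exists[OF c] by blast
  have cut01: "0 \<le> cut w" "cut w \<le> 1" for w by (auto simp: cut_def)
  have mono: "y v \<le> y w" if "v \<le> w" for v w
    using that by (rule DERIV_nonneg_imp_nondecreasing) (use D cut01 in blast)
  have zero: "cut z = 0" if "z \<le> - a" for z using that a by (auto simp: cut_def field_simps max_def min_def)
  have id: "y z = z" if "0 \<le> z" for z
  proof (cases "z = 0")
    case False
    then have 1: "0 < z" using that by simp
    obtain x where "0 < x" "y z - y 0 = (z - 0) * cut x" using MVT2[OF 1, of y cut] D by blast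
    then show ?thesis using a y0 by (simp add: cut_def)
  qed (simp add: y0)
  have neg: "y z \<le> 0" if "z \<le> 0" for z using mono[OF that] y0 by simp
  have le: "\<bar>y w\<bar> \<le> \<bar>w\<bar>" for w
    using lipschitz_of_bounded_derivative[OF D, of 1 w 0] cut01 y0 by simp
  have half: "\<bar>z\<bar> / 2 \<le> \<bar>y z\<bar>" if lo: "- a / 2 \<le> z" and hi: "z < 0" for z
  proof -
    obtain x where x: "z < x" "x < 0" "y 0 - y z = (0 - z) * cut x" using MVT2[OF hi, of y cut] D by blast
    have "1 / 2 \<le> 1 + x / a" using x lo a by (simp add: field_simps)
    moreover have "1 + x / a \<le> 1" using x a by (simp add: field_simps)
    moreover have "1 / 2 \<le> max 0 (min 1 t)" if "1 / 2 \<le> t" for t :: real using that by auto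
    ultimately have "1 / 2 \<le> cut x" unfolding cut_def by blast
    then have "(0 - z) * (1 / 2) \<le> (0 - z) * cut x" using hi by (intro mult_left_mono) auto
    then have "- z / 2 \<le> - y z" using x y0 by simp
    then show ?thesis using hi by linarith
  qed
  have low: "min (\<bar>z\<bar> / 2) (a / 4) \<le> \<bar>y z\<bar>" for z
  proof -
    consider "0 \<le> z" | "- a / 2 \<le> z" "z < 0" | "z < - a / 2" by linarith
    then show ?thesis
    proof cases
      case 1 then show ?thesis using id[of z] by simp
    next
      case 2 then show ?thesis using half[of z] by simp
    next
      case 3
      have "y z \<le> y (- a / 2)" using 3 by (intro mono) simp
      moreover have "\<bar>- a / 2\<bar> / 2 \<le> \<bar>y (- a / 2)\<bar>" using a by (intro half) auto
      moreover have "y (- a / 2) \<le> 0" using a by (intro neg) auto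
      ultimately show ?thesis using a by simp
    qed
  qed
  show ?thesis
    by (rule that[of y cut]) (use D c cut01 zero id neg le low in blast)+
qed

text \<open>In the limit, with \<open>s = w\<^sup>(\<^sup>1\<^sup>/\<^sup>m\<^sup>)\<close> and \<open>z = s - v\<close>, the functions are \<open>\<psi> = r z\<^sup>(\<^sup>r\<^sup>-\<^sup>1\<^sup>)\<close> and \<open>F = A y(z)\<^sup>(\<^sup>r\<^sup>/\<^sup>2\<^sup>)\<close>. Up to
constants, \<open>F'\<^sup>2 \<le> \<psi>'\<close> says that \<open>A\<^sup>2 \<bar>y(z)\<bar>\<^sup>r\<^sup>-\<^sup>2 y'(z)\<^sup>2 (ds/dw)\<^sup>2 \<le> \<bar>z\<bar>\<^sup>r\<^sup>-\<^sup>2 ds/dw\<close>. Where \<open>y'\<close> does not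
vanish, \<open>\<bar>y(z)\<bar>\<close> is comparable with \<open>\<bar>z\<bar>\<close>, and \<open>s \<ge> v/2\<close> gives \<open>ds/dw \<le> (v/2)\<^sup>1\<^sup>-\<^sup>m\<close>; this determines \<open>A\<close>.

All powers, the root included, are regularised with the same parameter \<open>1 / (n + 1)\<close>, and \<open>w\<close> is cut off
beyond \<open>W\<close>, so that the functions are bounded uniformly in \<open>n\<close>. The derivatives \<open>\<psi>'\<close> are only bounded
for each \<open>n\<close>.\<close>

lemma regularised_entropies:
  fixes m r v W :: real and y y' :: "real \<Rightarrow> real"
  assumes m: "1 < m" and r: "1 < r" and v: "0 < v" and W: "0 < W"
    and y_deriv: "\<And>z. (y has_real_derivative y' z) (at z)" and y'_cont: "continuous_on UNIV y'"
    and y': "\<And>z. 0 \<le> y' z" "\<And>z. y' z \<le> 1" "\<And>z. z \<le> - (v / 2) \<Longrightarrow> y' z = 0"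
    and y_le: "\<And>z. \<bar>y z\<bar> \<le> \<bar>z\<bar>" and y_ge: "\<And>z. min (\<bar>z\<bar> / 2) (v / 2 / 4) \<le> \<bar>y z\<bar>"
    and y_id: "\<And>z. 0 \<le> z \<Longrightarrow> y z = z"
  defines "A \<equiv> sqrt (r * min (r - 1) 1 * (v / 2) powr (m - 1) / (4 * (max (r / 2) 1)\<^sup>2))"
  obtains \<psi> \<psi>' F F' :: "nat \<Rightarrow> real \<Rightarrow> real" and L :: "nat \<Rightarrow> real" and K :: real where
    "\<And>n w. (\<psi> n has_real_derivative \<psi>' n w) (at w)" "\<And>n. continuous_on UNIV (\<psi>' n)"
    "\<And>n w. 0 \<le> \<psi>' n w" "\<And>n w. \<psi>' n w \<le> L n" "\<And>n w. \<bar>\<psi> n w\<bar> \<le> K"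
    "\<And>n w. (F n has_real_derivative F' n w) (at w)" "\<And>n. continuous_on UNIV (F' n)"
    "\<And>n w. \<bar>F n w\<bar> \<le> K" "\<And>n w. (F' n w)\<^sup>2 \<le> \<psi>' n w"
    "\<And>s. \<bar>spow m s\<bar> \<le> W \<Longrightarrow> (\<lambda>n. \<psi> n (spow m s)) \<longlonglongrightarrow> r * spow (r - 1) (s - v)"
    "\<And>s. \<bar>spow m s\<bar> \<le> W \<Longrightarrow> (\<lambda>n. F n (spow m s)) \<longlonglongrightarrow> A * spow (r / 2) (y (s - v))"
proof -
  obtain b b' where b_deriv: "\<And>w. (b has_real_derivative b' w) (at w)" and b'_cont: "continuous_on UNIV b'"
    and b': "\<And>w. 0 \<le> b' w" "\<And>w. b' w \<le> 1" and b_id: "\<And>w. \<bar>w\<bar> \<le> W \<Longrightarrow> b w = w" and b_le: "\<And>w. \<bar>b w\<bar> \<le> W + 1"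
    using cutoff_exists[OF W] by blast
  define \<delta> where "\<delta> n = 1 / real (Suc n)" for n
  have d: "0 < \<delta> n" "\<delta> n \<le> 1" for n by (auto simp: \<delta>_def)
  have dlim: "\<delta> \<longlonglongrightarrow> 0" unfolding \<delta>_def by (rule LIMSEQ_Suc[OF lim_1_over_n])
  define A2 where "A2 = r * min (r - 1) 1 * (v / 2) powr (m - 1) / (4 * (max (r / 2) 1)\<^sup>2)"
  have A2: "0 \<le> A2" "A\<^sup>2 = A2" "0 \<le> A" using r v by (auto simp: A2_def A_def)
  define \<sigma> where "\<sigma> n = rpow (\<delta> n) (1 / m)" for n
  define \<sigma>' where "\<sigma>' n = rpow' (\<delta> n) (1 / m)" for n
  define z where "z n w = \<sigma> n (b w) - v" for n w
  define \<psi> where "\<psi> n w = r * rpow (\<delta> n) (r - 1) (z n w)" for n w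
  define \<psi>' where "\<psi>' n w = r * rpow' (\<delta> n) (r - 1) (z n w) * \<sigma>' n (b w) * b' w" for n w
  define F where "F n w = A * rpow (\<delta> n) (r / 2) (y (z n w))" for n w
  define F' where "F' n w = A * rpow' (\<delta> n) (r / 2) (y (z n w)) * y' (z n w) * \<sigma>' n (b w) * b' w" for n w
  have \<sigma>D: "(\<sigma> n has_real_derivative \<sigma>' n w) (at w)" for n w unfolding \<sigma>_def \<sigma>'_def by (rule rpow_deriv[OF d(1)])
  have zD: "(z n has_real_derivative \<sigma>' n (b w) * b' w) (at w)" for n w
    unfolding z_def[abs_def] using DERIV_chain2[OF \<sigma>D b_deriv] by (auto intro!: derivative_eq_intros)
  have \<psi>D: "(\<psi> n has_real_derivative \<psi>' n w) (at w)" for n w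
  proof -
    have "((\<lambda>w. r * rpow (\<delta> n) (r - 1) (z n w)) has_real_derivative r * (rpow' (\<delta> n) (r - 1) (z n w) * (\<sigma>' n (b w) * b' w))) (at w)"
      by (rule DERIV_cmult, rule DERIV_chain2[OF rpow_deriv[OF d(1)] zD])
    then show ?thesis by (simp add: \<psi>_def[abs_def] \<psi>'_def mult_ac)
  qed
  have FD: "(F n has_real_derivative F' n w) (at w)" for n w
  proof -
    have "((\<lambda>w. A * rpow (\<delta> n) (r / 2) (y (z n w))) has_real_derivative A * (rpow' (\<delta> n) (r / 2) (y (z n w)) * (y' (z n w) * (\<sigma>' n (b w) * b' w)))) (at w)"
      by (rule DERIV_cmult, rule DERIV_chain2[OF rpow_deriv[OF d(1)] DERIV_chain2[OF y_deriv zD]])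
    then show ?thesis by (simp add: F_def[abs_def] F'_def mult_ac)
  qed
  have bc: "continuous_on UNIV b" using b_deriv by (auto simp: continuous_on_eq_continuous_at intro: DERIV_isCont)
  have yc: "continuous_on UNIV y" using y_deriv by (auto simp: continuous_on_eq_continuous_at intro: DERIV_isCont)
  have zc: "continuous_on UNIV (z n)" for n using zD by (auto simp: continuous_on_eq_continuous_at intro: DERIV_isCont)
  have \<sigma>c: "continuous_on UNIV (\<sigma> n)" for n using \<sigma>D by (auto simp: continuous_on_eq_continuous_at intro: DERIV_isCont)
  have \<sigma>'c: "continuous_on UNIV (\<sigma>' n)" for n unfolding \<sigma>'_def by (rule rpow'_continuous[OF d(1)])
  have comp: "continuous_on UNIV (\<lambda>w. f (g w))" if "continuous_on UNIV f" "continuous_on UNIV g" for f g :: "real \<Rightarrow> real"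
    by (rule continuous_on_compose2[OF that]) simp
  have \<psi>'c: "continuous_on UNIV (\<psi>' n)" for n
    unfolding \<psi>'_def[abs_def]
    by (intro continuous_on_mult continuous_on_const comp[OF rpow'_continuous[OF d(1)] zc] comp[OF \<sigma>'c bc] b'_cont)
  have F'c: "continuous_on UNIV (F' n)" for n
    unfolding F'_def[abs_def]
    by (intro continuous_on_mult continuous_on_const comp[OF rpow'_continuous[OF d(1)] comp[OF yc zc]] comp[OF y'_cont zc] comp[OF \<sigma>'c bc] b'_cont)
  have \<sigma>'nn: "0 \<le> \<sigma>' n w" for n w unfolding \<sigma>'_def using m by (intro rpow'_nonneg d) auto
  have \<psi>'nn: "0 \<le> \<psi>' n w" for n w
    unfolding \<psi>'_def using r b' \<sigma>'nn rpow'_nonneg[OF d(1), of "r - 1" n] by (intro mult_nonneg_nonneg) auto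
  have "\<exists>L. \<forall>w. \<psi>' n w \<le> L" for n
  proof -
    define g where "g u = r * rpow' (\<delta> n) (r - 1) (\<sigma> n u - v) * \<sigma>' n u" for u
    have gc: "continuous_on UNIV g" unfolding g_def[abs_def]
      by (intro continuous_on_mult continuous_on_const comp[OF rpow'_continuous[OF d(1)], of "\<lambda>u. \<sigma> n u - v"] continuous_on_diff \<sigma>c \<sigma>'c)
    have "bounded (g ` {- (W + 1)..W + 1})"
      by (intro compact_imp_bounded compact_continuous_image continuous_on_subset[OF gc]) auto
    then have "\<exists>L. \<forall>x\<in>g ` {- (W + 1)..W + 1}. norm x \<le> L" by (simp only: bounded_iff)
    then obtain L where L0: "\<forall>x\<in>g ` {- (W + 1)..W + 1}. norm x \<le> L" by (rule exE)
    have L: "\<bar>g u\<bar> \<le> L" if "u \<in> {- (W + 1)..W + 1}" for u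
      using bspec[OF L0 imageI[OF that]] by (simp only: real_norm_def)
    have "\<psi>' n w \<le> L" for w
    proof -
      have "b w \<in> {- (W + 1)..W + 1}" using b_le[of w] by (simp add: abs_le_iff)
      from L[OF this] have gL: "\<bar>g (b w)\<bar> \<le> L" .
      have "\<psi>' n w = g (b w) * b' w" by (simp add: \<psi>'_def g_def z_def)
      also have "\<dots> \<le> \<bar>g (b w)\<bar> * 1" using b'[of w] by (intro mult_mono) auto
      finally show ?thesis using gL by simp
    qed
    then show ?thesis by blast
  qed
  then obtain L where L: "\<And>n w. \<psi>' n w \<le> L n" by metis
  define S where "S = ((W + 1)\<^sup>2 + 1) powr (1 / m / 2)"
  have \<sigma>b: "\<bar>\<sigma> n (b w)\<bar> \<le> S" for n w
    unfolding \<sigma>_def S_def using m by (intro rpow_abs_bound d b_le) auto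
  have zb: "\<bar>z n w\<bar> \<le> S + v" for n w using \<sigma>b[of n w] v unfolding z_def by linarith
  define K where "K = r * ((S + v)\<^sup>2 + 1) powr ((r - 1) / 2) + A * ((S + v)\<^sup>2 + 1) powr (r / 2 / 2)"
  have K1: "\<bar>\<psi> n w\<bar> \<le> K" for n w
  proof -
    have "\<bar>\<psi> n w\<bar> = r * \<bar>rpow (\<delta> n) (r - 1) (z n w)\<bar>" using r by (simp add: \<psi>_def abs_mult)
    also have "\<dots> \<le> r * ((S + v)\<^sup>2 + 1) powr ((r - 1) / 2)"
      using r by (intro mult_left_mono rpow_abs_bound d zb) auto
    also have "\<dots> \<le> K" unfolding K_def using A2 by simp
    finally show ?thesis .
  qed
  have K2: "\<bar>F n w\<bar> \<le> K" for n w
  proof -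
    have "\<bar>F n w\<bar> = A * \<bar>rpow (\<delta> n) (r / 2) (y (z n w))\<bar>" using A2 by (simp add: F_def abs_mult)
    also have "\<dots> \<le> A * ((S + v)\<^sup>2 + 1) powr (r / 2 / 2)"
      using r A2 by (intro mult_left_mono rpow_abs_bound d order_trans[OF y_le zb]) auto
    also have "\<dots> \<le> K" unfolding K_def using r by simp
    finally show ?thesis .
  qed
  have sq: "(F' n w)\<^sup>2 \<le> \<psi>' n w" for n w
  proof (cases "z n w \<le> - (v / 2)")
    case True
    then show ?thesis using y'(3) \<psi>'nn by (simp add: F'_def)
  next
    case False
    define Z where "Z = z n w"
    define D where "D = \<delta> n"
    have D: "0 < D" using d by (simp add: D_def)
    define u where "u = b w"
    have zu: "Z = \<sigma> n u - v" by (simp add: Z_def z_def u_def)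
    have su: "v / 2 < \<sigma> n u" using False zu by (simp add: Z_def)
    \<comment> \<open>A value of the regularised root above \<open>v / 2\<close> forces \<open>u\<^sup>2 + D \<ge> (v / 2)\<^sup>2\<^sup>m\<close>, and this bounds its slope.\<close>
    have s1: "\<sigma>' n u \<le> (v / 2) powr (1 - m)"
    proof -
      have pos: "0 < u\<^sup>2 + D" by (rule rpow_base_pos[OF D])
      have "v / 2 \<le> \<bar>\<sigma> n u\<bar>" using su by simp
      also have "\<dots> \<le> (u\<^sup>2 + D) powr (1 / m / 2)" unfolding \<sigma>_def D_def by (rule rpow_abs_le[OF d(1)])
      finally have "(v / 2) powr (2 * m) \<le> ((u\<^sup>2 + D) powr (1 / m / 2)) powr (2 * m)"
        using v m by (intro powr_mono2) auto
      also have "\<dots> = (u\<^sup>2 + D) powr (1 / m / 2 * (2 * m))" by (rule powr_powr)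
      also have "\<dots> = u\<^sup>2 + D" using m pos by simp
      finally have low: "(v / 2) powr (2 * m) \<le> u\<^sup>2 + D" .
      have "\<sigma>' n u \<le> max (1 / m) 1 * (u\<^sup>2 + D) powr ((1 / m - 1) / 2)"
        unfolding \<sigma>'_def D_def by (rule rpow'_bounds[OF d(1)])
      also have "\<dots> = (u\<^sup>2 + D) powr ((1 / m - 1) / 2)" using m by (simp add: max_def)
      also have "\<dots> \<le> ((v / 2) powr (2 * m)) powr ((1 / m - 1) / 2)"
        using low v m by (intro powr_mono2') auto
      also have "\<dots> = (v / 2) powr (2 * m * ((1 / m - 1) / 2))" by (rule powr_powr)
      also have "2 * m * ((1 / m - 1) / 2) = 1 - m" using m by (simp add: field_simps)
      finally show ?thesis .
    qed
    \<comment> \<open>For \<open>r \<ge> 2\<close> the bound \<open>\<bar>y Z\<bar> \<le> \<bar>Z\<bar>\<close> is used, for \<open>r < 2\<close> the reverse bound with the factor \<open>1/4\<close>.\<close>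
    have yZ: "((y Z)\<^sup>2 + D) powr (r / 2 - 1) \<le> 4 * (Z\<^sup>2 + D) powr (r / 2 - 1)"
    proof -
      have y1: "\<bar>y Z\<bar> \<le> \<bar>Z\<bar>" by (rule y_le)
      have y2: "\<bar>Z\<bar> / 4 \<le> \<bar>y Z\<bar>"
      proof (cases "0 \<le> Z")
        case True then show ?thesis using y_id by simp
      next
        case Z: False
        then have "\<bar>Z\<bar> \<le> v / 2" using False by (simp add: Z_def)
        then show ?thesis using y_ge[of Z] by (simp add: min_def split: if_splits)
      qed
      have pos: "0 < Z\<^sup>2 + D" "0 < (y Z)\<^sup>2 + D" using rpow_base_pos[OF D] by auto
      show ?thesis
      proof (cases "1 \<le> r / 2")
        case True
        have "(y Z)\<^sup>2 \<le> Z\<^sup>2" using y1 by (simp add: abs_le_square_iff)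
        then have "((y Z)\<^sup>2 + D) powr (r / 2 - 1) \<le> (Z\<^sup>2 + D) powr (r / 2 - 1)"
          using True pos by (intro powr_mono2) auto
        moreover have "0 \<le> (Z\<^sup>2 + D) powr (r / 2 - 1)" by (rule powr_ge_zero)
        ultimately show ?thesis by linarith
      next
        case q1: False
        have "(\<bar>Z\<bar> / 4)\<^sup>2 \<le> \<bar>y Z\<bar>\<^sup>2" using y2 by (intro power_mono) auto
        then have "(Z\<^sup>2 + D) / 16 \<le> (y Z)\<^sup>2 + D" using D by (simp add: power_divide)
        then have "((y Z)\<^sup>2 + D) powr (r / 2 - 1) \<le> ((Z\<^sup>2 + D) / 16) powr (r / 2 - 1)"
          using q1 pos by (intro powr_mono2') auto
        also have "\<dots> = (Z\<^sup>2 + D) powr (r / 2 - 1) * 16 powr (1 - r / 2)"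
        proof -
          have "16 powr (1 - r / 2) = 1 / 16 powr (r / 2 - 1)" using powr_minus_divide[of 16 "r / 2 - 1"] by simp
          moreover have "((Z\<^sup>2 + D) / 16) powr (r / 2 - 1) = (Z\<^sup>2 + D) powr (r / 2 - 1) / 16 powr (r / 2 - 1)"
            by (rule powr_divide)
          ultimately show ?thesis by simp
        qed
        also have "\<dots> \<le> (Z\<^sup>2 + D) powr (r / 2 - 1) * 16 powr (1 / 2)"
          using r by (intro mult_left_mono powr_mono) auto
        also have "16 powr (1 / 2) = (4::real)" by (simp add: powr_half_sqrt)
        finally show ?thesis by simp
      qed
    qed
    have F1: "(rpow' D (r / 2) (y Z))\<^sup>2 \<le> (max (r / 2) 1)\<^sup>2 * (4 * (Z\<^sup>2 + D) powr (r / 2 - 1))"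
    proof -
      have "(rpow' D (r / 2) (y Z))\<^sup>2 \<le> (max (r / 2) 1 * ((y Z)\<^sup>2 + D) powr ((r / 2 - 1) / 2))\<^sup>2"
        using r by (intro power_mono rpow'_bounds(2)[OF D] rpow'_nonneg[OF D]) auto
      also have "\<dots> = (max (r / 2) 1)\<^sup>2 * ((y Z)\<^sup>2 + D) powr (r / 2 - 1)"
      proof -
        have "(((y Z)\<^sup>2 + D) powr ((r / 2 - 1) / 2))\<^sup>2 = ((y Z)\<^sup>2 + D) powr (r / 2 - 1)"
          by (simp add: power2_eq_square flip: powr_add)
        then show ?thesis by (simp add: power_mult_distrib)
      qed
      also have "\<dots> \<le> (max (r / 2) 1)\<^sup>2 * (4 * (Z\<^sup>2 + D) powr (r / 2 - 1))"
        by (intro mult_left_mono yZ) auto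
      finally show ?thesis .
    qed
    have P1: "min (r - 1) 1 * (Z\<^sup>2 + D) powr (r / 2 - 1) \<le> rpow' D (r - 1) Z"
    proof -
      have e: "(r - 1 - 1) / 2 = r / 2 - 1" by (simp add: field_simps)
      show ?thesis using rpow'_bounds(1)[OF D, of "r - 1" Z] unfolding e .
    qed
    have "A\<^sup>2 * (rpow' D (r / 2) (y Z))\<^sup>2 * \<sigma>' n u \<le> A2 * ((max (r / 2) 1)\<^sup>2 * (4 * (Z\<^sup>2 + D) powr (r / 2 - 1))) * (v / 2) powr (1 - m)"
      unfolding A2(2) using A2(1) \<sigma>'nn by (intro mult_mono F1 s1 order_refl mult_nonneg_nonneg) auto
    also have "\<dots> = r * (min (r - 1) 1 * (Z\<^sup>2 + D) powr (r / 2 - 1)) * ((v / 2) powr (m - 1) * (v / 2) powr (1 - m))"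
    proof -
      have "0 < (max (r / 2) 1)\<^sup>2" by (simp add: zero_less_power2) 
      then show ?thesis by (simp add: A2_def)
    qed
    also have "(v / 2) powr (m - 1) * (v / 2) powr (1 - m) = 1" using v by (simp flip: powr_add)
    also have "r * (min (r - 1) 1 * (Z\<^sup>2 + D) powr (r / 2 - 1)) * 1 \<le> r * rpow' D (r - 1) Z"
      using r P1 by simp
    finally have main: "A\<^sup>2 * (rpow' D (r / 2) (y Z))\<^sup>2 * \<sigma>' n u \<le> r * rpow' D (r - 1) Z" .
    have "(F' n w)\<^sup>2 = (A\<^sup>2 * (rpow' D (r / 2) (y Z))\<^sup>2 * \<sigma>' n u) * (\<sigma>' n u * ((y' Z)\<^sup>2 * (b' w)\<^sup>2))"
      by (simp add: F'_def Z_def[symmetric] D_def[symmetric] u_def[symmetric] power_mult_distrib power2_eq_square mult_ac)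
    also have "\<dots> \<le> (r * rpow' D (r - 1) Z) * (\<sigma>' n u * b' w)"
    proof (rule mult_mono[OF main])
      have "(y' Z)\<^sup>2 \<le> 1" using y'[of Z] by (simp add: power_le_one)
      moreover have "(b' w)\<^sup>2 \<le> b' w" using b'[of w] by (simp add: power2_eq_square mult_left_le)
      \<comment> \<open>A slope in \<open>[0, 1]\<close> dominates its square, so the cutoff costs nothing.\<close>
      ultimately have "(y' Z)\<^sup>2 * (b' w)\<^sup>2 \<le> 1 * b' w" using b'[of w] by (intro mult_mono) auto
      then show "\<sigma>' n u * ((y' Z)\<^sup>2 * (b' w)\<^sup>2) \<le> \<sigma>' n u * b' w" using \<sigma>'nn by (intro mult_left_mono) auto
      show "0 \<le> r * rpow' D (r - 1) Z" using r rpow'_nonneg[OF D, of "r - 1" Z] by simp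
      show "0 \<le> \<sigma>' n u * ((y' Z)\<^sup>2 * (b' w)\<^sup>2)" using \<sigma>'nn by simp
    qed
    also have "\<dots> = \<psi>' n w" by (simp add: \<psi>'_def Z_def D_def u_def)
    finally show ?thesis .
  qed
  have zlim: "(\<lambda>n. z n (spow m s)) \<longlonglongrightarrow> s - v" if "\<bar>spow m s\<bar> \<le> W" for s
  proof -
    have "(\<lambda>n. \<sigma> n (spow m s)) \<longlonglongrightarrow> spow (1 / m) (spow m s)"
      unfolding \<sigma>_def using m by (intro rpow_tendsto d dlim tendsto_const) auto
    also have "spow (1 / m) (spow m s) = s" using m by (simp add: spow_spow spow_1)
    finally show ?thesis unfolding z_def b_id[OF that] by (intro tendsto_intros)
  qed
  have \<psi>lim: "(\<lambda>n. \<psi> n (spow m s)) \<longlonglongrightarrow> r * spow (r - 1) (s - v)" if "\<bar>spow m s\<bar> \<le> W" for s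
    unfolding \<psi>_def using r by (intro tendsto_mult tendsto_const rpow_tendsto d dlim zlim that) auto
  have Flim: "(\<lambda>n. F n (spow m s)) \<longlonglongrightarrow> A * spow (r / 2) (y (s - v))" if "\<bar>spow m s\<bar> \<le> W" for s
  proof -
    have "isCont y (s - v)" using y_deriv DERIV_isCont by blast
    from isCont_tendsto_compose[OF this zlim[OF that]]
    have "(\<lambda>n. y (z n (spow m s))) \<longlonglongrightarrow> y (s - v)" .
    then show ?thesis unfolding F_def using r by (intro tendsto_mult tendsto_const rpow_tendsto d dlim) auto
  qed
  show ?thesis
    by (rule that[OF \<psi>D \<psi>'c \<psi>'nn L K1 FD F'c K2 sq \<psi>lim Flim])
qed

lemma abs_powr_deriv:
  fixes r z :: real assumes r: "1 < r"
  shows "((\<lambda>z. \<bar>z\<bar> powr r) has_real_derivative r * spow (r - 1) z) (at z)"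
proof -
  consider "0 < z" | "z < 0" | "z = 0" by linarith
  then show ?thesis
  proof cases
    case 1
    have "((\<lambda>z. z powr r) has_real_derivative r * z powr (r - 1)) (at z)" by (rule has_real_derivative_powr[OF 1])
    then have "((\<lambda>z. \<bar>z\<bar> powr r) has_real_derivative r * z powr (r - 1)) (at z)"
      by (rule has_field_derivative_transform_within_open[of _ _ _ "{0<..}"]) (use 1 in auto)
    then show ?thesis using 1 by (simp add: spow_def)
  next
    case 2
    have "((\<lambda>z. (- z) powr r) has_real_derivative r * (- z) powr (r - 1) * - 1) (at z)"
      by (rule DERIV_chain2[OF has_real_derivative_powr]) (use 2 in \<open>auto intro!: derivative_eq_intros\<close>)
    then have "((\<lambda>z. \<bar>z\<bar> powr r) has_real_derivative r * (- z) powr (r - 1) * - 1) (at z)"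
      by (rule has_field_derivative_transform_within_open[of _ _ _ "{..<0}"]) (use 2 in auto)
    then show ?thesis using 2 by (simp add: spow_def)
  next
    case 3
    have "((\<lambda>h. (\<bar>0 + h\<bar> powr r - \<bar>0\<bar> powr r) / h) \<longlongrightarrow> 0) (at 0)"
    proof (rule Lim_null_comparison)
      show "\<forall>\<^sub>F h in at 0. norm ((\<bar>0 + h\<bar> powr r - \<bar>0\<bar> powr r) / h) \<le> \<bar>h\<bar> powr (r - 1)"
      proof (rule eventually_at_filter[THEN iffD2], intro always_eventually allI impI)
        fix h :: real assume h: "h \<noteq> 0"
        have "\<bar>h\<bar> powr r = \<bar>h\<bar> * \<bar>h\<bar> powr (r - 1)" using h by (simp add: powr_mult_base)
        then show "norm ((\<bar>0 + h\<bar> powr r - \<bar>0\<bar> powr r) / h) \<le> \<bar>h\<bar> powr (r - 1)" using h by simp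
      qed
      have "((\<lambda>h. \<bar>h\<bar> powr (r - 1)) \<longlongrightarrow> \<bar>0\<bar> powr (r - 1)) (at 0)"
      proof (rule tendsto_powr')
        show "((\<lambda>h::real. \<bar>h\<bar>) \<longlongrightarrow> \<bar>0\<bar>) (at 0)" by (intro tendsto_intros)
      qed (use r in auto)
      then show "((\<lambda>h. \<bar>h\<bar> powr (r - 1)) \<longlongrightarrow> 0) (at 0)" by simp
    qed
    then show ?thesis using 3 by (simp add: DERIV_def spow_def)
  qed
qed

text \<open>Bounded convergence under the integral; it transfers the limit from \<open>\<psi>\<close> to the entropies.\<close>

lemma antiderivatives_converge:
  fixes \<Phi> f :: "nat \<Rightarrow> real \<Rightarrow> real" and \<Theta> g :: "real \<Rightarrow> real"
  assumes ab: "a \<le> b" and D: "\<And>n x. (\<Phi> n has_real_derivative f n x) (at x)" and D': "\<And>x. (\<Theta> has_real_derivative g x) (at x)"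
    and lim: "\<And>x. x \<in> {a..b} \<Longrightarrow> (\<lambda>n. f n x) \<longlonglongrightarrow> g x" and K: "\<And>n x. \<bar>f n x\<bar> \<le> K"
  shows "(\<lambda>n. \<Phi> n b - \<Phi> n a) \<longlonglongrightarrow> \<Theta> b - \<Theta> a"
proof -
  have I: "(f n has_integral (\<Phi> n b - \<Phi> n a)) {a..b}" for n
    by (rule fundamental_theorem_of_calculus[OF ab])
       (use D in \<open>auto simp: has_real_derivative_iff_has_vector_derivative[symmetric] intro: DERIV_subset\<close>)
  have J: "(g has_integral (\<Theta> b - \<Theta> a)) {a..b}"
    by (rule fundamental_theorem_of_calculus[OF ab])
       (use D' in \<open>auto simp: has_real_derivative_iff_has_vector_derivative[symmetric] intro: DERIV_subset\<close>)
  have "(\<lambda>n. integral {a..b} (f n)) \<longlonglongrightarrow> integral {a..b} g"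
  proof (rule dominated_convergence(2)[where h="\<lambda>_. K"])
    show "f n integrable_on {a..b}" for n using I by blast
  qed (use lim K in auto)
  then show ?thesis using integral_unique[OF I] integral_unique[OF J] by simp
qed

section \<open>The variance of powers of functions with mean zero\<close>

text \<open>By symmetry let \<open>k > 0\<close>. If \<open>y \<ge> k/2\<close>, then \<open>z \<ge> k/2\<close> and the left-hand side is not positive. If
\<open>0 \<le> y < k/2\<close>, then the linear term has the good sign, and \<open>k\<^sup>q - y\<^sup>q\<close> is at least \<open>(1 - 2\<^sup>-\<^sup>q) k\<^sup>q\<close>. If \<open>y < 0\<close>,
then the squares of both powers add up, and they absorb the linear term because
\<open>k\<^sup>2\<^sup>q\<^sup>-\<^sup>1 t \<le> k\<^sup>2\<^sup>q + t\<^sup>2\<^sup>q\<close>.\<close>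

lemma distance_to_constant_lower_bound:
  fixes q lam y z k :: real
  assumes q: "1 / 2 < q" and lam: "0 < lam" "lam \<le> 1"
    and y: "lam * \<bar>z\<bar> \<le> \<bar>y\<bar>" "\<bar>y\<bar> \<le> \<bar>z\<bar>" and sign: "0 \<le> z \<Longrightarrow> 0 \<le> y" "z \<le> 0 \<Longrightarrow> y \<le> 0"
  defines "\<alpha> \<equiv> min ((1 - 2 powr (- q))\<^sup>2) (lam / 4)"
  shows "\<alpha> * \<bar>k\<bar> powr (2 * q) - 2 * \<alpha> * spow (2 * q - 1) k * z \<le> (spow q y - spow q k)\<^sup>2"
proof -
  have \<alpha>: "0 \<le> \<alpha>" "\<alpha> \<le> (1 - 2 powr (- q))\<^sup>2" "\<alpha> \<le> lam / 4" unfolding \<alpha>_def using lam by auto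
  have main: "\<alpha> * k powr (2 * q) - 2 * \<alpha> * k powr (2 * q - 1) * z \<le> (spow q y - spow q k)\<^sup>2"
    if k: "0 < k" and y: "lam * \<bar>z\<bar> \<le> \<bar>y\<bar>" "\<bar>y\<bar> \<le> \<bar>z\<bar>" and sign: "0 \<le> z \<Longrightarrow> 0 \<le> y" "z \<le> 0 \<Longrightarrow> y \<le> 0" for k y z :: real
  proof -
    have kp: "k powr (2 * q) = k powr (2 * q - 1) * k" using k by (simp add: powr_mult_base mult.commute)
    have kq: "k powr (2 * q) = (k powr q)\<^sup>2" using k by (simp add: powr_powr[symmetric] power2_eq_square flip: powr_add)
    have sk: "spow q k = k powr q" using k by (simp add: spow_def)
    consider "k / 2 \<le> y" | "0 \<le> y" "y < k / 2" | "y < 0" by linarith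
    then show ?thesis
    proof cases
      case 1
      then have "0 < y" using k by simp
      then have "0 < z" using sign(2) by (cases "z \<le> 0") auto
      then have "k / 2 \<le> z" using 1 \<open>0 < y\<close> y(2) by simp
      then have "\<alpha> * (k powr (2 * q - 1) * k) \<le> \<alpha> * (k powr (2 * q - 1) * (2 * z))"
        using \<alpha> by (intro mult_left_mono) auto
      then have "\<alpha> * k powr (2 * q) - 2 * \<alpha> * k powr (2 * q - 1) * z \<le> 0" unfolding kp by (simp add: mult_ac)
      then show ?thesis using zero_le_power2[of "spow q y - spow q k"] by linarith
    next
      case 2
      have z: "0 \<le> z"
      proof (rule ccontr)
        assume "\<not> 0 \<le> z"
        then have "y = 0" using sign(2) 2 by simp
        moreover have "0 < lam * \<bar>z\<bar>" using \<open>\<not> 0 \<le> z\<close> lam by (intro mult_pos_pos) auto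
        ultimately have "y = 0" "0 < lam * \<bar>z\<bar>" by auto
        then show False using y(1) by simp
      qed
      have "spow q y = y powr q" using 2 by (auto simp: spow_def sgn_if)
      also have "\<dots> \<le> (k / 2) powr q" using 2 q by (intro powr_mono2) auto
      also have "\<dots> = 2 powr (- q) * k powr q" using k by (simp add: powr_divide powr_minus_divide)
      finally have "(1 - 2 powr (- q)) * k powr q \<le> k powr q - spow q y" by (simp add: algebra_simps)
      moreover have "0 \<le> (1 - 2 powr (- q)) * k powr q" using q ge_one_powr_ge_zero[of 2 q] by (intro mult_nonneg_nonneg) (auto simp: powr_minus_divide)
      ultimately have "((1 - 2 powr (- q)) * k powr q)\<^sup>2 \<le> (k powr q - spow q y)\<^sup>2" by (intro power_mono) auto
      moreover have "\<alpha> * k powr (2 * q) \<le> ((1 - 2 powr (- q)) * k powr q)\<^sup>2"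
        unfolding kq power_mult_distrib using \<alpha> by (intro mult_right_mono) auto
      moreover have "0 \<le> 2 * \<alpha> * k powr (2 * q - 1) * z" using \<alpha> z by simp
      ultimately show ?thesis unfolding sk power2_commute[of "spow q y"] by linarith
    next
      case 3
      have z: "z < 0" using 3 sign(1) by (cases "0 \<le> z") auto
      have sy: "spow q y = - (\<bar>y\<bar> powr q)" using 3 by (simp add: spow_def)
      have "(lam * \<bar>z\<bar>) powr (2 * q) \<le> \<bar>y\<bar> powr (2 * q)" using y q lam by (intro powr_mono2) auto
      also have "\<dots> = (\<bar>y\<bar> powr q)\<^sup>2" by (simp add: power2_eq_square flip: powr_add)
      finally have 1: "k powr (2 * q) + (lam * \<bar>z\<bar>) powr (2 * q) \<le> (spow q y - spow q k)\<^sup>2"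
      proof -
        assume a: "(lam * \<bar>z\<bar>) powr (2 * q) \<le> (\<bar>y\<bar> powr q)\<^sup>2"
        have "0 \<le> k powr q * \<bar>y\<bar> powr q" by simp
        then have "(k powr q)\<^sup>2 + (\<bar>y\<bar> powr q)\<^sup>2 \<le> (spow q y - spow q k)\<^sup>2"
          unfolding sy sk by (simp add: power2_eq_square algebra_simps)
        then show ?thesis using a unfolding kq by linarith
      qed
      define t where "t = lam * \<bar>z\<bar>"
      have t: "0 < t" unfolding t_def using lam z by (intro mult_pos_pos) auto
      have az: "\<bar>z\<bar> = t / lam" using lam by (simp add: t_def)
      have "k powr (2 * q - 1) * t \<le> k powr (2 * q) + t powr (2 * q)"
      proof (cases "t \<le> k")
        case True
        then have "k powr (2 * q - 1) * t \<le> k powr (2 * q - 1) * k" by (intro mult_left_mono) auto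
        then show ?thesis unfolding kp[symmetric] by (rule order_trans) simp
      next
        case False
        then have "k powr (2 * q - 1) * t \<le> t powr (2 * q - 1) * t" using k q by (intro mult_right_mono powr_mono2) auto
        also have "\<dots> = t powr (2 * q)" using t by (simp add: powr_mult_base mult.commute)
        finally show ?thesis by (rule order_trans) simp
      qed
      then have "(2 * \<alpha> / lam) * (k powr (2 * q - 1) * t) \<le> (2 * \<alpha> / lam) * (k powr (2 * q) + t powr (2 * q))"
        using \<alpha> lam by (intro mult_left_mono) auto
      also have "\<dots> \<le> (1 / 2) * (k powr (2 * q) + t powr (2 * q))"
        using \<alpha> lam by (intro mult_right_mono) (auto simp: field_simps)
      finally have 2: "2 * \<alpha> * k powr (2 * q - 1) * \<bar>z\<bar> \<le> (1 / 2) * (k powr (2 * q) + t powr (2 * q))"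
        unfolding az by (simp add: mult_ac)
      have "\<alpha> * k powr (2 * q) \<le> (1 / 2) * k powr (2 * q)" using \<alpha> lam by (intro mult_right_mono) auto
      moreover have "0 \<le> t powr (2 * q)" by simp
      moreover have "a + x \<le> p + t" if "a \<le> 1 / 2 * p" "0 \<le> t" "x \<le> 1 / 2 * (p + t)" for a x p t :: real
        using that by (simp add: field_simps)
      ultimately have "\<alpha> * k powr (2 * q) + 2 * \<alpha> * k powr (2 * q - 1) * \<bar>z\<bar> \<le> k powr (2 * q) + t powr (2 * q)"
        using 2 by blast
      then show ?thesis using 1 z unfolding t_def by simp
    qed
  qed
  consider "0 < k" | "k = 0" | "k < 0" by linarith
  then show ?thesis
  proof cases
    case 1
    then show ?thesis using main[OF 1 y sign] by (simp add: spow_def)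
  next
    case 2
    then show ?thesis using q by (simp add: spow_def)
  next
    case 3
    have "\<alpha> * (- k) powr (2 * q) - 2 * \<alpha> * (- k) powr (2 * q - 1) * (- z) \<le> (spow q (- y) - spow q (- k))\<^sup>2"
      by (rule main) (use 3 y sign in auto)
    also have "(spow q (- y) - spow q (- k))\<^sup>2 = (spow q y - spow q k)\<^sup>2"
      by (simp add: spow_minus power2_commute)
    finally show ?thesis using 3 by (simp add: spow_def)
  qed
qed

text \<open>Let \<open>c = k\<^sup>q\<close> be the mean of \<open>y\<^sup>q\<close> and integrate \<open>distance_to_constant_lower_bound\<close>: the linear term drops out
since \<open>z\<close> has mean zero, so \<open>\<alpha> c\<^sup>2\<close> times the total mass is at most the variance. As the integral of
\<open>\<bar>y\<bar>\<^sup>2\<^sup>q\<close> is the variance plus \<open>c\<^sup>2\<close> times the total mass, it is at most \<open>1 + 1 / \<alpha>\<close> times the variance.\<close>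

lemma zero_mean_power_inequality:
  fixes z y :: "'b \<Rightarrow> real"
  assumes N: "finite_measure N" and pos: "0 < measure N (space N)"
    and q: "1 / 2 < q" and lam: "0 < lam" "lam \<le> 1"
    and zm[measurable]: "z \<in> borel_measurable N" and ym[measurable]: "y \<in> borel_measurable N"
    and zb: "AE x in N. \<bar>z x\<bar> \<le> Z" and mean: "(LINT x|N. z x) = 0"
    and y: "AE x in N. lam * \<bar>z x\<bar> \<le> \<bar>y x\<bar>" "\<And>x. \<bar>y x\<bar> \<le> \<bar>z x\<bar>" and sign: "\<And>x. 0 \<le> z x \<Longrightarrow> 0 \<le> y x" "\<And>x. z x \<le> 0 \<Longrightarrow> y x \<le> 0"
  defines "\<alpha> \<equiv> min ((1 - 2 powr (- q))\<^sup>2) (lam / 4)"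
  shows "lam powr (2 * q) / (1 + 1 / \<alpha>) * (LINT x|N. \<bar>z x\<bar> powr (2 * q))
     \<le> (LINT x|N. (spow q (y x) - mean_value N (\<lambda>x. spow q (y x)))\<^sup>2)"
proof -
  interpret finite_measure N by fact
  have q0: "0 < q" using q by simp
  have spm[measurable]: "spow q \<in> borel_measurable borel" by (rule borel_measurable_continuous_onI[OF spow_continuous[OF q0]])
  have \<alpha>0: "0 < \<alpha>"
  proof -
    have "2 powr (- q) \<noteq> (1::real)" using q0 by simp
    then show ?thesis unfolding \<alpha>_def using lam by auto
  qed
  define f where "f x = spow q (y x)" for x
  have [measurable]: "f \<in> borel_measurable N" unfolding f_def by measurable
  define c where "c = mean_value N f"
  \<comment> \<open>The mean of \<open>f\<close> is written as a signed power, as the pointwise inequality requires.\<close>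
  define k where "k = spow (1 / q) c"
  have ck: "spow q k = c" using q0 by (simp add: k_def spow_spow spow_1)
  have kc: "\<bar>k\<bar> powr (2 * q) = c\<^sup>2"
  proof -
    have "\<bar>k\<bar> powr (2 * q) = (\<bar>k\<bar> powr q)\<^sup>2" by (simp add: power2_eq_square flip: powr_add)
    also have "\<bar>k\<bar> powr q = \<bar>c\<bar>" using abs_spow[of q k] ck by simp
    finally show ?thesis by simp
  qed
  have fb: "AE x in N. \<bar>f x\<bar> \<le> Z powr q"
    using zb
  proof eventually_elim
    case (elim x)
    then show ?case unfolding f_def abs_spow using y(2)[of x] q0 by (intro powr_mono2) auto
  qed
  have zi: "integrable N z" by (rule integrable_const_bound[of _ Z]) (use zb in auto)
  have fi: "integrable N f" by (rule integrable_const_bound[of _ "Z powr q"]) (use fb in auto)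
  have f2i: "integrable N (\<lambda>x. (f x)\<^sup>2)"
  proof (rule integrable_const_bound[of _ "(Z powr q)\<^sup>2"])
    show "AE x in N. norm ((f x)\<^sup>2) \<le> (Z powr q)\<^sup>2"
      using fb
    proof eventually_elim
      case (elim x)
      then have "\<bar>f x\<bar>\<^sup>2 \<le> (Z powr q)\<^sup>2" by (intro power_mono) auto
      then show ?case by simp
    qed
  qed measurable
  have fci: "integrable N (\<lambda>x. (f x - c)\<^sup>2)"
    using f2i fi by (simp add: power2_diff)
  define V where "V = (LINT x|N. (f x - c)\<^sup>2)"
  define n where "n = measure N (space N)"
  have "(LINT x|N. \<alpha> * c\<^sup>2 - 2 * \<alpha> * spow (2 * q - 1) k * z x) \<le> V"
    unfolding V_def
  proof (rule integral_mono_AE)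
    show "AE x in N. \<alpha> * c\<^sup>2 - 2 * \<alpha> * spow (2 * q - 1) k * z x \<le> (f x - c)\<^sup>2"
      using y(1)
    proof eventually_elim
      case (elim x)
      from distance_to_constant_lower_bound[OF q lam elim y(2)[of x] sign, of k]
      show ?case unfolding \<alpha>_def[symmetric] kc ck f_def .
    qed
  qed (use fci zi in auto)
  then have 1: "\<alpha> * c\<^sup>2 * n \<le> V" using zi mean by (simp add: n_def mult_ac)
  have cn: "(LINT x|N. f x) = c * n" using pos by (simp add: c_def mean_value_def n_def)
  have "V = (LINT x|N. (f x)\<^sup>2) - c\<^sup>2 * n"
  proof -
    have "V = (LINT x|N. (f x)\<^sup>2 + c\<^sup>2 - 2 * c * f x)" unfolding V_def by (simp add: power2_diff mult_ac)
    also have "\<dots> = (LINT x|N. (f x)\<^sup>2) + c\<^sup>2 * n - 2 * c * (c * n)" using f2i fi by (simp add: n_def cn[unfolded n_def] mult_ac)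
    finally show ?thesis by (simp add: power2_eq_square algebra_simps)
  qed
  moreover have "c\<^sup>2 * n \<le> V / \<alpha>" using 1 \<alpha>0 by (simp add: field_simps)
  ultimately have f2: "(LINT x|N. (f x)\<^sup>2) \<le> (1 + 1 / \<alpha>) * V" by (simp add: algebra_simps)
  have "lam powr (2 * q) * (LINT x|N. \<bar>z x\<bar> powr (2 * q)) = (LINT x|N. lam powr (2 * q) * \<bar>z x\<bar> powr (2 * q))" by simp
  also have "\<dots> \<le> (LINT x|N. (f x)\<^sup>2)"
  proof (rule integral_mono_AE'[OF f2i])
    show "AE x in N. lam powr (2 * q) * \<bar>z x\<bar> powr (2 * q) \<le> (f x)\<^sup>2"
      using y(1)
    proof eventually_elim
      case (elim x)
      have "lam powr (2 * q) * \<bar>z x\<bar> powr (2 * q) = (lam * \<bar>z x\<bar>) powr (2 * q)" using lam by (simp add: powr_mult)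
      also have "\<dots> \<le> \<bar>y x\<bar> powr (2 * q)" using elim lam q0 by (intro powr_mono2) auto
      also have "\<dots> = (\<bar>y x\<bar> powr q)\<^sup>2" by (simp add: power2_eq_square flip: powr_add)
      also have "\<dots> = (f x)\<^sup>2" unfolding f_def abs_spow[symmetric] by simp
      finally show ?case .
    qed
  qed auto
  also note f2
  finally have "lam powr (2 * q) * (LINT x|N. \<bar>z x\<bar> powr (2 * q)) \<le> (1 + 1 / \<alpha>) * V" .
  moreover have "0 < 1 + 1 / \<alpha>" using \<alpha>0 by (simp add: add_pos_pos)
  ultimately have "lam powr (2 * q) / (1 + 1 / \<alpha>) * (LINT x|N. \<bar>z x\<bar> powr (2 * q)) \<le> V"
    by (simp add: pos_divide_le_eq mult.commute)
  then show ?thesis unfolding V_def f_def c_def .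
qed

section \<open>Exponential decay\<close>

text \<open>The constant multiplies the factor of \<open>zero_mean_power_inequality\<close> for \<open>q = r / 2\<close> by the square of the
normalisation \<open>A\<close> in \<open>regularised_entropies\<close> for \<open>v = 1\<close>, and divides by \<open>M\<^sub>P\<^sup>2\<close>. The number \<open>lam\<close>
compares the flattened function with the identity on \<open>[-R, R]\<close>; the flattening starts from \<open>a = 1/2\<close>, which
explains \<open>1/8\<close>.\<close>

definition decay_const :: "real \<Rightarrow> real \<Rightarrow> real \<Rightarrow> real \<Rightarrow> real" where
  "decay_const m r R M\<^sub>P = (let lam = min (1 / 2) (1 / (8 * R)) in
     lam powr r / (1 + 1 / min ((1 - 2 powr (- (r / 2)))\<^sup>2) (lam / 4))
     * (r * min (r - 1) 1 * (1 / 2) powr (m - 1) / (4 * (max (r / 2) 1)\<^sup>2)) / M\<^sub>P\<^sup>2)"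

lemma decay_const_pos:
  assumes "1 < r" "0 < R" "0 < M\<^sub>P" shows "0 < decay_const m r R M\<^sub>P"
proof -
  define lam where "lam = min (1 / 2) (1 / (8 * R))"
  have lam: "0 < lam" using assms by (simp add: lam_def)
  have "2 powr (- (r / 2)) \<noteq> (1::real)" using assms by simp
  then have "0 < min ((1 - 2 powr (- (r / 2)))\<^sup>2) (lam / 4)" using lam by simp
  then have 1: "0 < 1 + 1 / min ((1 - 2 powr (- (r / 2)))\<^sup>2) (lam / 4)" by (intro add_pos_pos) auto
  have 2: "0 < r * min (r - 1) 1 * (1 / 2) powr (m - 1) / (4 * (max (r / 2) 1)\<^sup>2)"
    using assms by (intro divide_pos_pos mult_pos_pos) (auto simp: zero_less_power2)
  show ?thesis unfolding decay_const_def Let_def lam_def[symmetric]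
    using assms lam 1 2 by (intro divide_pos_pos mult_pos_pos) auto
qed

context pme_solution
begin

lemma convergence_bounded:
  fixes f :: "nat \<Rightarrow> 'a \<Rightarrow> real"
  assumes m: "\<And>n. f n \<in> borel_measurable \<nu>" "g \<in> borel_measurable \<nu>"
    and b: "\<And>n. AE x in \<nu>. \<bar>f n x\<bar> \<le> C" and lim: "AE x in \<nu>. (\<lambda>n. f n x) \<longlonglongrightarrow> g x"
  shows "(\<lambda>n. LINT x|\<nu>. f n x) \<longlonglongrightarrow> (LINT x|\<nu>. g x)"
  by (rule integral_dominated_convergence[where w="\<lambda>_. C"]) (use assms in auto)

text \<open>For the regularised entropies, \<open>entropy_inequality\<close> and \<open>poincare_dissipation\<close> combine to an inequality in
which the variance of \<open>F n (u\<^sup>m)\<close> and the entropy carry opposite signs. Their difference becomes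
nonnegative only in the limit, where \<open>zero_mean_power_inequality\<close> applies. Hence the limit is taken
in the integrated inequality first, and the difference is discarded afterwards.\<close>

theorem decay_positive_mean:
  fixes r R v :: real
  assumes P: "zero_mean_poincare \<Omega> \<rho>\<^sub>\<nu> \<rho>\<^sub>\<mu> M\<^sub>P" and MP: "0 < M\<^sub>P" and r: "1 < r" and R: "0 < R" and v: "0 < v"
    and mean: "v = mean_value \<nu> u\<^sub>0" and u0b: "AE x in \<nu>. \<bar>u\<^sub>0 x - v\<bar> \<le> R * v"
  defines "c \<equiv> decay_const m r R M\<^sub>P * v powr (m - 1)"
  shows "AE t in lborel. 0 < t \<longrightarrow> (AE x in \<nu>. \<bar>u t x - v\<bar> \<le> R * v) \<and>
    (LINT x|\<nu>. \<bar>u t x - v\<bar> powr r) \<le> exp (- c * t) * (LINT x|\<nu>. \<bar>u\<^sub>0 x - v\<bar> powr r)"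
proof -
  have m0: "0 < m" using m by simp
  define N where "N = measure \<nu> (space \<nu>)"
  have Neq: "measure \<nu> \<Omega> = N" by (simp add: N_def)
  have N: "0 < N"
  proof (rule ccontr)
    assume "\<not> 0 < N"
    then have "N = 0" unfolding N_def using measure_nonneg[of \<nu> "space \<nu>"] by linarith
    then show False using mean v by (simp add: mean_value_def N_def)
  qed
  define S where "S = v + R * v"
  have S: "0 < S" using v R by (simp add: S_def add_pos_pos)
  define W where "W = S powr m"
  have W: "0 < W" using S by (simp add: W_def)
  have sW: "\<bar>spow m s\<bar> \<le> W" if "\<bar>s\<bar> \<le> S" for s
    unfolding abs_spow W_def using that m0 by (intro powr_mono2) auto
  obtain y y' where y_deriv: "\<And>z. (y has_real_derivative y' z) (at z)" and y'_cont: "continuous_on UNIV y'"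
    and y': "\<And>z. 0 \<le> y' z" "\<And>z. y' z \<le> 1" "\<And>z. z \<le> - (v / 2) \<Longrightarrow> y' z = 0"
    and y_id: "\<And>z. 0 \<le> z \<Longrightarrow> y z = z" and y_neg: "\<And>z. z \<le> 0 \<Longrightarrow> y z \<le> 0"
    and y_le: "\<And>z. \<bar>y z\<bar> \<le> \<bar>z\<bar>" and y_ge: "\<And>z. min (\<bar>z\<bar> / 2) (v / 2 / 4) \<le> \<bar>y z\<bar>"
    using flattening_exists[of "v / 2"] v by (metis half_gt_zero)
  define A where "A = sqrt (r * min (r - 1) 1 * (v / 2) powr (m - 1) / (4 * (max (r / 2) 1)\<^sup>2))"
  obtain \<psi> \<psi>' F F' :: "nat \<Rightarrow> real \<Rightarrow> real" and L :: "nat \<Rightarrow> real" and K :: real where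
    \<psi>D: "\<And>n w. (\<psi> n has_real_derivative \<psi>' n w) (at w)" and \<psi>'c: "\<And>n. continuous_on UNIV (\<psi>' n)"
    and \<psi>'n: "\<And>n w. 0 \<le> \<psi>' n w" and \<psi>'L: "\<And>n w. \<psi>' n w \<le> L n" and \<psi>K: "\<And>n w. \<bar>\<psi> n w\<bar> \<le> K"
    and FD: "\<And>n w. (F n has_real_derivative F' n w) (at w)" and F'c: "\<And>n. continuous_on UNIV (F' n)"
    and FK: "\<And>n w. \<bar>F n w\<bar> \<le> K" and F'sq: "\<And>n w. (F' n w)\<^sup>2 \<le> \<psi>' n w"
    and \<psi>lim: "\<And>s. \<bar>spow m s\<bar> \<le> W \<Longrightarrow> (\<lambda>n. \<psi> n (spow m s)) \<longlonglongrightarrow> r * spow (r - 1) (s - v)"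
    and Flim: "\<And>s. \<bar>spow m s\<bar> \<le> W \<Longrightarrow> (\<lambda>n. F n (spow m s)) \<longlonglongrightarrow> A * spow (r / 2) (y (s - v))"
    using regularised_entropies[OF m r v W y_deriv y'_cont y' y_le y_ge y_id] unfolding A_def by metis
  have K0: "0 \<le> K" using \<psi>K[of 0 0] by simp
  have spc: "continuous_on UNIV (spow m)" using m0 by (rule spow_continuous)
  have \<psi>spc: "continuous_on UNIV (\<lambda>s. \<psi> n (spow m s))" for n
  proof (rule continuous_on_compose2[OF _ spc])
    show "continuous_on UNIV (\<psi> n)" using \<psi>D by (auto simp: continuous_on_eq_continuous_at intro: DERIV_isCont)
  qed simp
  have "\<exists>\<Phi>. (\<forall>s. (\<Phi> has_real_derivative \<psi> n (spow m s)) (at s)) \<and> \<Phi> v = 0" for n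
    using antiderivative_exists[OF \<psi>spc[of n], of v] by metis
  then obtain \<Phi> where \<Phi>D: "\<And>n s. (\<Phi> n has_real_derivative \<psi> n (spow m s)) (at s)" and \<Phi>v: "\<And>n. \<Phi> n v = 0"
    by metis
  have \<Phi>le: "\<bar>\<Phi> n s\<bar> \<le> K * \<bar>s - v\<bar>" for n s
    using lipschitz_of_bounded_derivative[OF \<Phi>D \<psi>K, of n s v] \<Phi>v by simp
  define \<Theta> where "\<Theta> s = \<bar>s - v\<bar> powr r" for s
  have \<Theta>D: "(\<Theta> has_real_derivative r * spow (r - 1) (s - v)) (at s)" for s
  proof -
    have "((\<lambda>s. s - v) has_real_derivative 1) (at s)" by (auto intro!: derivative_eq_intros)
    from DERIV_chain2[OF abs_powr_deriv[OF r] this] show ?thesis by (simp add: \<Theta>_def[abs_def])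
  qed
  have \<Phi>lim: "(\<lambda>n. \<Phi> n s) \<longlonglongrightarrow> \<Theta> s" if s: "\<bar>s\<bar> \<le> S" for s
  proof -
    have vS: "v \<le> S" using R v by (simp add: S_def)
    show ?thesis
    proof (cases "v \<le> s")
      case True
      have "(\<lambda>n. \<Phi> n s - \<Phi> n v) \<longlonglongrightarrow> \<Theta> s - \<Theta> v"
        by (rule antiderivatives_converge[OF True \<Phi>D \<Theta>D _ \<psi>K], rule \<psi>lim, rule sW) (use s v in auto)
      then show ?thesis by (simp add: \<Phi>v \<Theta>_def)
    next
      case False
      then have "(\<lambda>n. \<Phi> n v - \<Phi> n s) \<longlonglongrightarrow> \<Theta> v - \<Theta> s"
        by (intro antiderivatives_converge[OF _ \<Phi>D \<Theta>D _ \<psi>K] \<psi>lim sW) (use s v vS in auto)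
      then have "(\<lambda>n. - \<Phi> n s) \<longlonglongrightarrow> - \<Theta> s" by (simp add: \<Phi>v \<Theta>_def)
      from tendsto_minus[OF this] show ?thesis by simp
    qed
  qed
  have \<Phi>m[measurable]: "\<Phi> n \<in> borel_measurable borel" for n
    using \<Phi>D by (intro borel_measurable_continuous_onI) (auto simp: continuous_on_eq_continuous_at intro: DERIV_isCont)
  have Fm[measurable]: "F n \<in> borel_measurable borel" for n
    using FD by (intro borel_measurable_continuous_onI) (auto simp: continuous_on_eq_continuous_at intro: DERIV_isCont)
  have ym[measurable]: "y \<in> borel_measurable borel"
    using y_deriv by (intro borel_measurable_continuous_onI) (auto simp: continuous_on_eq_continuous_at intro: DERIV_isCont)
  have spm[measurable]: "spow m \<in> borel_measurable borel" "spow (r / 2) \<in> borel_measurable borel"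
    using r by (auto intro!: borel_measurable_continuous_onI spow_continuous spc)
  have \<Theta>m[measurable]: "\<Theta> \<in> borel_measurable borel" unfolding \<Theta>_def by measurable
  have u0m[measurable]: "u\<^sub>0 \<in> borel_measurable \<nu>" using u0_L2 by (simp add: in_Lp_2_iff)
  \<comment> \<open>Almost every time is good; the limits below are taken at good times only.\<close>
  define good where "good t \<longleftrightarrow> u t \<in> borel_measurable \<nu> \<and> integrable \<nu> (u t) \<and> (AE x in \<nu>. \<bar>u t x - v\<bar> \<le> R * v) \<and> (LINT x|\<nu>. u t x - v) = 0" for t
  have upper: "AE t in lborel. 0 < t \<longrightarrow> (AE x in \<nu>. u t x \<le> v + R * v)"
  proof (rule maximum_principle)
    show "AE x in \<nu>. u\<^sub>0 x \<le> v + R * v" using u0b by eventually_elim linarith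
  qed
  interpret neg: pme_solution \<Omega> \<rho>\<^sub>\<nu> \<rho>\<^sub>\<mu> m "\<lambda>x. - u\<^sub>0 x" "\<lambda>t x. - u t x" "\<lambda>t x. - G t x"
    by (rule pme_solution_minus) unfold_locales
  have lower: "AE t in lborel. 0 < t \<longrightarrow> (AE x in \<nu>. - u t x \<le> R * v - v)"
  proof (rule neg.maximum_principle)
    show "AE x in \<nu>. - u\<^sub>0 x \<le> R * v - v" using u0b by eventually_elim linarith
  qed
  have mean0: "(LINT x|\<nu>. u\<^sub>0 x) = v * N" using N mean by (simp add: mean_value_def N_def)
  have good: "AE t in lborel. 0 < t \<longrightarrow> good t"
    using upper lower mean_conserved AE_slice_integrable
  proof eventually_elim
    case (elim t)
    show ?case
    proof
      assume t: "0 < t"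
      have 1: "AE x in \<nu>. u t x \<le> v + R * v" and 2: "AE x in \<nu>. - u t x \<le> R * v - v" using elim t by auto
      have "AE x in \<nu>. \<bar>u t x - v\<bar> \<le> R * v" using 1 2 by eventually_elim (auto simp: abs_le_iff)
      moreover have "(LINT x|\<nu>. u t x - v) = 0" using elim(3,4) t mean0 by (simp add: N_def mult.commute)
      ultimately show "good t" unfolding good_def using elim(4) t slice_measurable by auto
    qed
  qed
  define e where "e t = (LINT x|\<nu>. \<Theta> (u t x))" for t
  define en where "en n t = (LINT x|\<nu>. \<Phi> n (u t x))" for n t
  define f where "f t x = spow (r / 2) (y (u t x - v))" for t x
  define V where "V t = (LINT x|\<nu>. (f t x - mean_value \<nu> (f t))\<^sup>2)" for t
  define Vn where "Vn n t = (LINT x|\<nu>. (F n (spow m (u t x)) - mean_value \<nu> (\<lambda>x. F n (spow m (u t x))))\<^sup>2)" for n t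
  have enC: "\<bar>en n t\<bar> \<le> K * (R * v) * N" if g: "good t" for n t
  proof -
    have [measurable]: "u t \<in> borel_measurable \<nu>" using g by (simp add: good_def)
    have b: "AE x in \<nu>. \<bar>\<Phi> n (u t x)\<bar> \<le> K * (R * v)"
      using g unfolding good_def
      by (auto elim!: eventually_mono intro: order_trans[OF \<Phi>le] mult_left_mono K0)
    have "\<bar>en n t\<bar> \<le> (LINT x|\<nu>. \<bar>\<Phi> n (u t x)\<bar>)" unfolding en_def by (rule integral_abs_bound)
    also have "\<dots> \<le> (LINT x|\<nu>. K * (R * v))"
      by (rule integral_mono_AE'[OF _ b]) (use K0 R v in auto)
    finally show ?thesis by (simp add: N_def mult_ac)
  qed
  have gS: "AE x in \<nu>. \<bar>u t x\<bar> \<le> S" if "good t" for t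
  proof -
    have "AE x in \<nu>. \<bar>u t x - v\<bar> \<le> R * v" using that by (simp add: good_def)
    then show ?thesis by eventually_elim (use v in \<open>auto simp: S_def abs_le_iff\<close>)
  qed
  have en_lim: "(\<lambda>n. en n t) \<longlonglongrightarrow> e t" if g: "good t" for t
  proof -
    have [measurable]: "u t \<in> borel_measurable \<nu>" using g by (simp add: good_def)
    show ?thesis unfolding en_def e_def
    proof (rule convergence_bounded[where C="K * (R * v)"])
      show "AE x in \<nu>. \<bar>\<Phi> n (u t x)\<bar> \<le> K * (R * v)" for n
        using g unfolding good_def
        by (auto elim!: eventually_mono intro: order_trans[OF \<Phi>le] mult_left_mono K0)
      show "AE x in \<nu>. (\<lambda>n. \<Phi> n (u t x)) \<longlonglongrightarrow> \<Theta> (u t x)"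
        using gS[OF g] by eventually_elim (rule \<Phi>lim)
    qed measurable
  qed
  have mvb: "\<bar>mean_value \<nu> g\<bar> \<le> K" if "\<And>x. \<bar>g x\<bar> \<le> K" "g \<in> borel_measurable \<nu>" for g
  proof -
    have gi: "integrable \<nu> (\<lambda>x. \<bar>g x\<bar>)" using that by (intro fnu.integrable_const_bound[of _ K]) auto
    have "\<bar>LINT x|\<nu>. g x\<bar> \<le> (LINT x|\<nu>. \<bar>g x\<bar>)" by (rule integral_abs_bound)
    also have "\<dots> \<le> (LINT x|\<nu>. K)" by (rule integral_mono[OF gi]) (use that in auto)
    also have "\<dots> = K * N" by (simp add: N_def)
    finally show ?thesis using N by (simp add: mean_value_def Neq abs_divide pos_divide_le_eq)
  qed
  have sqb: "(F n (spow m s) - mean_value \<nu> (\<lambda>x. F n (spow m (u t x))))\<^sup>2 \<le> (2 * K)\<^sup>2"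
    if "u t \<in> borel_measurable \<nu>" for n s t
  proof -
    have [measurable]: "u t \<in> borel_measurable \<nu>" by fact
    have "\<bar>mean_value \<nu> (\<lambda>x. F n (spow m (u t x)))\<bar> \<le> K" by (rule mvb) (use FK in auto)
    then have "\<bar>F n (spow m s) - mean_value \<nu> (\<lambda>x. F n (spow m (u t x)))\<bar> \<le> 2 * K" using FK[of n "spow m s"] by linarith
    then have "\<bar>F n (spow m s) - mean_value \<nu> (\<lambda>x. F n (spow m (u t x)))\<bar>\<^sup>2 \<le> (2 * K)\<^sup>2" by (intro power_mono) auto
    then show ?thesis by simp
  qed
  have VnC: "\<bar>Vn n t\<bar> \<le> (2 * K)\<^sup>2 * N" if "u t \<in> borel_measurable \<nu>" for n t
  proof -
    have "Vn n t \<le> (LINT x|\<nu>. (2 * K)\<^sup>2)" unfolding Vn_def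
      by (rule integral_mono_AE') (use sqb[OF that] in auto)
    moreover have "0 \<le> Vn n t" unfolding Vn_def by (rule integral_nonneg_AE) auto
    ultimately show ?thesis by (simp add: N_def mult_ac)
  qed
  have Vn_lim: "(\<lambda>n. Vn n t) \<longlonglongrightarrow> A\<^sup>2 * V t" if g: "good t" for t
  proof -
    have um[measurable]: "u t \<in> borel_measurable \<nu>" using g by (simp add: good_def)
    have fm[measurable]: "f t \<in> borel_measurable \<nu>" unfolding f_def by measurable
    have lim: "AE x in \<nu>. (\<lambda>n. F n (spow m (u t x))) \<longlonglongrightarrow> A * f t x"
      using gS[OF g] unfolding f_def by eventually_elim (rule Flim[OF sW])
    have "(\<lambda>n. LINT x|\<nu>. F n (spow m (u t x))) \<longlonglongrightarrow> (LINT x|\<nu>. A * f t x)"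
      by (rule convergence_bounded[OF _ _ _ lim, where C=K]) (use FK in auto)
    then have ml: "(\<lambda>n. mean_value \<nu> (\<lambda>x. F n (spow m (u t x)))) \<longlonglongrightarrow> A * mean_value \<nu> (f t)"
      unfolding mean_value_def using N by (auto intro!: tendsto_eq_intros simp: N_def)
    have "(\<lambda>n. Vn n t) \<longlonglongrightarrow> (LINT x|\<nu>. (A * f t x - A * mean_value \<nu> (f t))\<^sup>2)"
      unfolding Vn_def
    proof (rule convergence_bounded[where C="(2 * K)\<^sup>2"])
      show "AE x in \<nu>. (\<lambda>n. (F n (spow m (u t x)) - mean_value \<nu> (\<lambda>x. F n (spow m (u t x))))\<^sup>2) \<longlonglongrightarrow> (A * f t x - A * mean_value \<nu> (f t))\<^sup>2"
        using lim by eventually_elim (intro tendsto_intros ml)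
    qed (use sqb[OF um] in auto)
    also have "(\<lambda>x. (A * f t x - A * mean_value \<nu> (f t))\<^sup>2) = (\<lambda>x. A\<^sup>2 * (f t x - mean_value \<nu> (f t))\<^sup>2)"
      by (simp add: power_mult_distrib flip: right_diff_distrib)
    finally show ?thesis by (simp add: V_def)
  qed
  \<comment> \<open>This is \<open>c E \<le> D\<close> with the dissipation replaced by its lower bound; it holds with \<open>decay_const\<close> by
    homogeneity in \<open>v\<close>.\<close>
  have ce: "c * e t \<le> A\<^sup>2 * V t / M\<^sub>P\<^sup>2" if g: "good t" for t
  proof -
    have um[measurable]: "u t \<in> borel_measurable \<nu>" using g by (simp add: good_def)
    define lam where "lam = min (1 / 2) (1 / (8 * R))"
    have lam: "0 < lam" "lam \<le> 1" using R by (auto simp: lam_def)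
    define \<alpha> where "\<alpha> = min ((1 - 2 powr (- (r / 2)))\<^sup>2) (lam / 4)"
    have b: "AE x in \<nu>. \<bar>u t x - v\<bar> \<le> R * v" using g by (simp add: good_def)
    have ylam: "AE x in \<nu>. lam * \<bar>u t x - v\<bar> \<le> \<bar>y (u t x - v)\<bar>"
      using b
    proof eventually_elim
      case (elim x)
      have "lam * \<bar>u t x - v\<bar> \<le> (1 / 2) * \<bar>u t x - v\<bar>" by (rule mult_right_mono) (auto simp: lam_def)
      moreover have "lam * \<bar>u t x - v\<bar> \<le> 1 / (8 * R) * (R * v)"
        using elim R by (intro mult_mono) (auto simp: lam_def)
      moreover have "1 / (8 * R) * (R * v) = v / 2 / 4" using R by simp
      ultimately show ?case using y_ge[of "u t x - v"] by (simp add: min_def split: if_splits)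
    qed
    have "lam powr (2 * (r / 2)) / (1 + 1 / \<alpha>) * (LINT x|\<nu>. \<bar>u t x - v\<bar> powr (2 * (r / 2))) \<le> V t"
      unfolding V_def f_def \<alpha>_def
      by (rule zero_mean_power_inequality[OF finite_nu _ _ lam _ _ b _ ylam])
         (use g r N y_le y_id y_neg in \<open>auto simp: good_def N_def\<close>)
    then have fi: "lam powr r / (1 + 1 / \<alpha>) * e t \<le> V t" by (simp add: e_def \<Theta>_def)
    have A2: "A\<^sup>2 = r * min (r - 1) 1 * (v / 2) powr (m - 1) / (4 * (max (r / 2) 1)\<^sup>2)"
      unfolding A_def using r by simp
    have vp: "(v / 2) powr (m - 1) = (1 / 2) powr (m - 1) * v powr (m - 1)"
      using powr_mult[of "1/2" v "m - 1"] by simp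
    have "c = (lam powr r / (1 + 1 / \<alpha>)) * A\<^sup>2 / M\<^sub>P\<^sup>2"
      unfolding c_def decay_const_def Let_def lam_def[symmetric] \<alpha>_def[symmetric] A2 vp by simp
    then have "c * e t = A\<^sup>2 / M\<^sub>P\<^sup>2 * (lam powr r / (1 + 1 / \<alpha>) * e t)" by (simp add: mult_ac)
    also have "\<dots> \<le> A\<^sup>2 / M\<^sub>P\<^sup>2 * V t" by (intro mult_left_mono fi) auto
    finally show ?thesis by simp
  qed
  have ineq: "AE \<tau> in lborel. \<forall>n. 0 < \<tau> \<longrightarrow>
     exp (c * \<tau>) * en n \<tau> - c * (LINT t:{0<..<\<tau>}|lborel. exp (c * t) * en n t)
     + (LINT t:{0<..<\<tau>}|lborel. exp (c * t) * Vn n t) / M\<^sub>P\<^sup>2 \<le> (LINT x|\<nu>. \<Phi> n (u\<^sub>0 x))"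
    unfolding AE_all_countable
  proof
    fix n
    show "AE \<tau> in lborel. 0 < \<tau> \<longrightarrow>
     exp (c * \<tau>) * en n \<tau> - c * (LINT t:{0<..<\<tau>}|lborel. exp (c * t) * en n t)
     + (LINT t:{0<..<\<tau>}|lborel. exp (c * t) * Vn n t) / M\<^sub>P\<^sup>2 \<le> (LINT x|\<nu>. \<Phi> n (u\<^sub>0 x))"
      using entropy_inequality[OF \<psi>D \<psi>'c \<psi>'n \<psi>'L \<psi>K \<Phi>D, of c n]
    proof eventually_elim
      case (elim \<tau>)
      show ?case
      proof
        assume \<tau>: "0 < \<tau>"
        have "(LINT t:{0<..<\<tau>}|lborel. exp (c * t) * Vn n t)
          \<le> M\<^sub>P\<^sup>2 * (LINT z|(lborel \<Otimes>\<^sub>M \<mu>). time_cut \<tau> (\<lambda>z. exp (c * fst z) * \<psi>' n (spow m (u (fst z) (snd z))) * (norm (G (fst z) (snd z)))\<^sup>2) z)"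
          unfolding Vn_def by (rule poincare_dissipation[OF P MP \<psi>D \<psi>'c \<psi>'n \<psi>'L \<psi>K FD F'c FK F'sq \<tau>])
        then have V: "(LINT t:{0<..<\<tau>}|lborel. exp (c * t) * Vn n t) / M\<^sub>P\<^sup>2
          \<le> (LINT z|(lborel \<Otimes>\<^sub>M \<mu>). time_cut \<tau> (\<lambda>z. exp (c * fst z) * \<psi>' n (spow m (u (fst z) (snd z))) * (norm (G (fst z) (snd z)))\<^sup>2) z)"
          using MP by (simp add: pos_divide_le_eq mult.commute)
        show "exp (c * \<tau>) * en n \<tau> - c * (LINT t:{0<..<\<tau>}|lborel. exp (c * t) * en n t)
          + (LINT t:{0<..<\<tau>}|lborel. exp (c * t) * Vn n t) / M\<^sub>P\<^sup>2 \<le> (LINT x|\<nu>. \<Phi> n (u\<^sub>0 x))"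
        proof -
          have "x - y + a \<le> z" if "x - y + b \<le> z" "a \<le> b" for x y z a b :: real using that by linarith
          moreover have "exp (c * \<tau>) * en n \<tau> - c * (LINT t:{0<..<\<tau>}|lborel. exp (c * t) * en n t)
            + (LINT z|(lborel \<Otimes>\<^sub>M \<mu>). time_cut \<tau> (\<lambda>z. exp (c * fst z) * \<psi>' n (spow m (u (fst z) (snd z))) * (norm (G (fst z) (snd z)))\<^sup>2) z) \<le> (LINT x|\<nu>. \<Phi> n (u\<^sub>0 x))"
            using elim \<tau> unfolding en_def by blast
          ultimately show ?thesis using V by blast
        qed
      qed
    qed
  qed
  have u0S: "AE x in \<nu>. \<bar>u\<^sub>0 x\<bar> \<le> S"
    using u0b by eventually_elim (use v in \<open>auto simp: S_def abs_le_iff\<close>)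
  have init: "(\<lambda>n. LINT x|\<nu>. \<Phi> n (u\<^sub>0 x)) \<longlonglongrightarrow> (LINT x|\<nu>. \<Theta> (u\<^sub>0 x))"
  proof (rule convergence_bounded[where C="K * (R * v)"])
    show "AE x in \<nu>. \<bar>\<Phi> n (u\<^sub>0 x)\<bar> \<le> K * (R * v)" for n
      using u0b by (auto elim!: eventually_mono intro: order_trans[OF \<Phi>le] mult_left_mono K0)
    show "AE x in \<nu>. (\<lambda>n. \<Phi> n (u\<^sub>0 x)) \<longlonglongrightarrow> \<Theta> (u\<^sub>0 x)"
      using u0S by eventually_elim (rule \<Phi>lim)
  qed measurable
  show ?thesis using ineq good
  proof eventually_elim
    case (elim \<tau>)
    show ?case
    proof
      assume \<tau>: "0 < \<tau>"
      have g: "good \<tau>" using elim(2) \<tau> by simp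
      define I where "I n t = indicator {0<..<\<tau>} t * (exp (c * t) * (Vn n t / M\<^sub>P\<^sup>2 - c * en n t))" for n t
      define J where "J t = indicator {0<..<\<tau>} t * (exp (c * t) * (A\<^sup>2 * V t / M\<^sub>P\<^sup>2 - c * e t))" for t
      have uTm[measurable]: "uT \<tau> \<in> borel_measurable (lborel \<Otimes>\<^sub>M \<nu>)" by (rule uT_measurable[OF \<tau>])
      have enm: "(\<lambda>t. indicator {0<..<\<tau>} t * en n t) \<in> borel_measurable lborel" for n
      proof -
        have "(\<lambda>t. indicator {0<..<\<tau>} t * (LINT x|\<nu>. \<Phi> n (uT \<tau> (t, x)))) \<in> borel_measurable lborel" by measurable
        also have "(\<lambda>t. indicator {0<..<\<tau>} t * (LINT x|\<nu>. \<Phi> n (uT \<tau> (t, x)))) = (\<lambda>t. indicator {0<..<\<tau>} t * en n t)"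
          by (auto simp: fun_eq_iff indicator_def en_def uT_def time_cut_def)
        finally show ?thesis .
      qed
      have Vnm: "(\<lambda>t. indicator {0<..<\<tau>} t * Vn n t) \<in> borel_measurable lborel" for n
      proof -
        have "(\<lambda>t. indicator {0<..<\<tau>} t * (LINT x|\<nu>. (F n (spow m (uT \<tau> (t, x))) - (LINT x|\<nu>. F n (spow m (uT \<tau> (t, x)))) / N)\<^sup>2)) \<in> borel_measurable lborel" by measurable
        also have "(\<lambda>t. indicator {0<..<\<tau>} t * (LINT x|\<nu>. (F n (spow m (uT \<tau> (t, x))) - (LINT x|\<nu>. F n (spow m (uT \<tau> (t, x)))) / N)\<^sup>2)) = (\<lambda>t. indicator {0<..<\<tau>} t * Vn n t)"
          by (auto simp: fun_eq_iff indicator_def Vn_def uT_def time_cut_def mean_value_def N_def)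
        finally show ?thesis .
      qed
      define C where "C = exp (\<bar>c\<bar> * \<tau>) * ((2 * K)\<^sup>2 * N / M\<^sub>P\<^sup>2 + \<bar>c\<bar> * (K * (R * v) * N))"
      have exp_le: "exp (c * t) \<le> exp (\<bar>c\<bar> * \<tau>)" if "0 < t" "t < \<tau>" for t
      proof -
        have "c * t \<le> \<bar>c\<bar> * t" using that by (intro mult_right_mono) auto
        also have "\<dots> \<le> \<bar>c\<bar> * \<tau>" using that by (intro mult_left_mono) auto
        finally show ?thesis by simp
      qed
      have indi: "integrable lborel (indicat_real {0<..<\<tau>})"
        using emeasure_bounded_finite[of "{0<..<\<tau>}"] by (intro integrable_real_indicator) auto
      have I1: "integrable lborel (\<lambda>t. indicator {0<..<\<tau>} t * (exp (c * t) * en n t))" (is "integrable lborel ?f")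
        and I2: "integrable lborel (\<lambda>t. indicator {0<..<\<tau>} t * (exp (c * t) * Vn n t))" (is "integrable lborel ?g") for n
      proof -
        have "?f = (\<lambda>t. exp (c * t) * (indicator {0<..<\<tau>} t * en n t))" by (auto simp: fun_eq_iff)
        then have m1: "?f \<in> borel_measurable lborel" using enm[of n] by simp
        have "?g = (\<lambda>t. exp (c * t) * (indicator {0<..<\<tau>} t * Vn n t))" by (auto simp: fun_eq_iff)
        then have m2: "?g \<in> borel_measurable lborel" using Vnm[of n] by simp
        show "integrable lborel ?f"
        proof (rule Bochner_Integration.integrable_bound[OF _ m1])
          show "integrable lborel (\<lambda>t. (exp (\<bar>c\<bar> * \<tau>) * (K * (R * v) * N)) * indicat_real {0<..<\<tau>} t)"
            using indi by (rule integrable_mult_right)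
          show "AE t in lborel. norm (?f t) \<le> norm ((exp (\<bar>c\<bar> * \<tau>) * (K * (R * v) * N)) * indicat_real {0<..<\<tau>} t)"
            using good
          proof eventually_elim
            case (elim t)
            show ?case
            proof (cases "0 < t \<and> t < \<tau>")
              case True
              then have "\<bar>en n t\<bar> \<le> K * (R * v) * N" using enC elim by simp
              then have "exp (c * t) * \<bar>en n t\<bar> \<le> exp (\<bar>c\<bar> * \<tau>) * (K * (R * v) * N)"
                using exp_le True by (intro mult_mono) auto
              then have "norm (?f t) \<le> exp (\<bar>c\<bar> * \<tau>) * (K * (R * v) * N) * indicat_real {0<..<\<tau>} t"
                using True by (simp add: abs_mult)
              then show ?thesis unfolding real_norm_def by (rule order_trans[OF _ abs_ge_self])
            qed auto
          qed
        qed
        show "integrable lborel ?g"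
        proof (rule Bochner_Integration.integrable_bound[OF _ m2])
          show "integrable lborel (\<lambda>t. (exp (\<bar>c\<bar> * \<tau>) * ((2 * K)\<^sup>2 * N)) * indicat_real {0<..<\<tau>} t)"
            using indi by (rule integrable_mult_right)
          show "AE t in lborel. norm (?g t) \<le> norm ((exp (\<bar>c\<bar> * \<tau>) * ((2 * K)\<^sup>2 * N)) * indicat_real {0<..<\<tau>} t)"
          proof (intro always_eventually allI)
            fix t
            show "norm (?g t) \<le> norm ((exp (\<bar>c\<bar> * \<tau>) * ((2 * K)\<^sup>2 * N)) * indicat_real {0<..<\<tau>} t)"
            proof (cases "0 < t \<and> t < \<tau>")
              case True
              then have "\<bar>Vn n t\<bar> \<le> (2 * K)\<^sup>2 * N" using VnC slice_measurable by simp
              then have "exp (c * t) * \<bar>Vn n t\<bar> \<le> exp (\<bar>c\<bar> * \<tau>) * ((2 * K)\<^sup>2 * N)"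
                using exp_le True by (intro mult_mono) auto
              then have "norm (?g t) \<le> exp (\<bar>c\<bar> * \<tau>) * ((2 * K)\<^sup>2 * N) * indicat_real {0<..<\<tau>} t"
                using True by (simp add: abs_mult)
              then show ?thesis unfolding real_norm_def by (rule order_trans[OF _ abs_ge_self])
            qed auto
          qed
        qed
      qed
      have Ieq: "I n = (\<lambda>t. (indicator {0<..<\<tau>} t * (exp (c * t) * Vn n t)) / M\<^sub>P\<^sup>2 - c * (indicator {0<..<\<tau>} t * (exp (c * t) * en n t)))" for n
        by (auto simp: I_def fun_eq_iff right_diff_distrib)
      have Ii: "(LINT t|lborel. I n t) = (LINT t:{0<..<\<tau>}|lborel. exp (c * t) * Vn n t) / M\<^sub>P\<^sup>2 - c * (LINT t:{0<..<\<tau>}|lborel. exp (c * t) * en n t)" for n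
        unfolding Ieq set_lebesgue_integral_def using I1[of n] I2[of n] by simp
      have lim: "AE t in lborel. (\<lambda>n. I n t) \<longlonglongrightarrow> J t"
        using good
      proof eventually_elim
        case (elim t)
        show ?case
        proof (cases "0 < t \<and> t < \<tau>")
          case True
          then have "good t" using elim by simp
          then show ?thesis unfolding I_def J_def using MP by (intro tendsto_intros Vn_lim en_lim) auto
        next
          case False then show ?thesis by (auto simp: I_def J_def)
        qed
      qed
      have Ib: "AE t in lborel. norm (I n t) \<le> C * indicat_real {0<..<\<tau>} t" for n
        using good
      proof eventually_elim
        case (elim t)
        show ?case
        proof (cases "0 < t \<and> t < \<tau>")
          case True
          then have g': "good t" using elim by simp
          have 1: "\<bar>Vn n t\<bar> / M\<^sub>P\<^sup>2 \<le> (2 * K)\<^sup>2 * N / M\<^sub>P\<^sup>2" using VnC g' by (intro divide_right_mono) (auto simp: good_def)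
          have 2: "\<bar>c\<bar> * \<bar>en n t\<bar> \<le> \<bar>c\<bar> * (K * (R * v) * N)" using enC[OF g'] by (intro mult_left_mono) auto
          have "\<bar>Vn n t / M\<^sub>P\<^sup>2 - c * en n t\<bar> \<le> \<bar>Vn n t / M\<^sub>P\<^sup>2\<bar> + \<bar>c * en n t\<bar>" by (rule abs_triangle_ineq4)
          also have "\<dots> = \<bar>Vn n t\<bar> / M\<^sub>P\<^sup>2 + \<bar>c\<bar> * \<bar>en n t\<bar>" by (simp add: abs_divide abs_mult)
          also have "\<dots> \<le> (2 * K)\<^sup>2 * N / M\<^sub>P\<^sup>2 + \<bar>c\<bar> * (K * (R * v) * N)" using 1 2 by (rule add_mono)
          finally have "exp (c * t) * \<bar>Vn n t / M\<^sub>P\<^sup>2 - c * en n t\<bar> \<le> C"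
            unfolding C_def using exp_le True by (intro mult_mono) auto
          then show ?thesis using True by (simp add: I_def abs_mult)
        qed (auto simp: I_def)
      qed
      have Im: "I n \<in> borel_measurable lborel" for n unfolding Ieq using I1[of n] I2[of n] by simp
      \<comment> \<open>Measurability of the limit \<open>J\<close> is known only up to a null set, as \<open>u t\<close> is controlled for almost every
        \<open>t\<close>.\<close>
      obtain J' where J'm: "J' \<in> borel_measurable lborel" and J': "AE t in lborel. J t = J' t"
      proof -
        have "(\<lambda>t. lim (\<lambda>n. I n t)) \<in> borel_measurable lborel"
          using Im by (rule borel_measurable_lim_metric)
        moreover have "AE t in lborel. J t = lim (\<lambda>n. I n t)" using lim by eventually_elim (simp add: limI)
        ultimately show ?thesis using that by blast
      qed
      have "(\<lambda>n. LINT t|lborel. I n t) \<longlonglongrightarrow> (LINT t|lborel. J' t)"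
      proof (rule integral_dominated_convergence[where w="\<lambda>t. C * indicat_real {0<..<\<tau>} t"])
        show "AE t in lborel. (\<lambda>n. I n t) \<longlonglongrightarrow> J' t" using lim J' by eventually_elim simp
      qed (use J'm Im Ib indi in auto)
      moreover have "0 \<le> (LINT t|lborel. J' t)"
      proof (rule integral_nonneg_AE)
        show "AE t in lborel. 0 \<le> J' t"
          using J' good
        proof eventually_elim
          case (elim t)
          show ?case
          proof (cases "0 < t \<and> t < \<tau>")
            case True
            then show ?thesis using elim ce[of t] unfolding elim(1)[symmetric] J_def by simp
          next
            case False
            then show ?thesis unfolding elim(1)[symmetric] J_def by auto
          qed
        qed
      qed
      ultimately have "exp (c * \<tau>) * e \<tau> \<le> (LINT x|\<nu>. \<Theta> (u\<^sub>0 x))"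
      proof -
        assume Ilim: "(\<lambda>n. LINT t|lborel. I n t) \<longlonglongrightarrow> (LINT t|lborel. J' t)" and J0: "0 \<le> (LINT t|lborel. J' t)"
        have "(\<lambda>n. exp (c * \<tau>) * en n \<tau> + (LINT t|lborel. I n t)) \<longlonglongrightarrow> exp (c * \<tau>) * e \<tau> + (LINT t|lborel. J' t)"
          by (intro tendsto_intros en_lim g Ilim)
        moreover have "exp (c * \<tau>) * en n \<tau> + (LINT t|lborel. I n t) \<le> (LINT x|\<nu>. \<Phi> n (u\<^sub>0 x))" for n
          using elim(1) \<tau> unfolding Ii by (simp add: algebra_simps)
        ultimately have "exp (c * \<tau>) * e \<tau> + (LINT t|lborel. J' t) \<le> (LINT x|\<nu>. \<Theta> (u\<^sub>0 x))"
          by (intro LIMSEQ_le[OF _ init]) auto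
        then show ?thesis using J0 by linarith
      qed
      then have "exp (- c * \<tau>) * (exp (c * \<tau>) * e \<tau>) \<le> exp (- c * \<tau>) * (LINT x|\<nu>. \<Theta> (u\<^sub>0 x))"
        by (intro mult_left_mono) auto
      also have "exp (- c * \<tau>) * (exp (c * \<tau>) * e \<tau>) = e \<tau>" by (simp add: exp_minus)
      finally show "(AE x in \<nu>. \<bar>u \<tau> x - v\<bar> \<le> R * v) \<and>
        (LINT x|\<nu>. \<bar>u \<tau> x - v\<bar> powr r) \<le> exp (- c * \<tau>) * (LINT x|\<nu>. \<bar>u\<^sub>0 x - v\<bar> powr r)"
        using g by (simp add: good_def e_def \<Theta>_def)
    qed
  qed
qed

end

lemma Linf_norm_AE:
  assumes f: "in_Linf M f" and b: "Linf_norm M (\<lambda>x. f x - a) \<le> B"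
  shows "AE x in M. \<bar>f x - a\<bar> \<le> B"
proof -
  have [measurable]: "f \<in> borel_measurable M" using f by (simp add: in_Linf_def)
  define E where "E = esssup M (\<lambda>x. ereal \<bar>f x - a\<bar>)"
  have AE: "AE x in M. ereal \<bar>f x - a\<bar> \<le> E" unfolding E_def by (rule esssup_AE)
  have "E \<le> esssup M (\<lambda>x. ereal \<bar>f x\<bar>) + ereal \<bar>a\<bar>"
    unfolding E_def
  proof (rule esssup_I)
    show "AE x in M. ereal \<bar>f x - a\<bar> \<le> esssup M (\<lambda>x. ereal \<bar>f x\<bar>) + ereal \<bar>a\<bar>"
      using esssup_AE[of "\<lambda>x. ereal \<bar>f x\<bar>" M]
    proof eventually_elim
      case (elim x)
      have "ereal \<bar>f x - a\<bar> \<le> ereal \<bar>f x\<bar> + ereal \<bar>a\<bar>" by simp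
      also have "\<dots> \<le> esssup M (\<lambda>x. ereal \<bar>f x\<bar>) + ereal \<bar>a\<bar>" using elim by (rule add_right_mono)
      finally show ?case .
    qed
  qed measurable
  also have "\<dots> < \<infinity>" using f by (auto simp: in_Linf_def)
  finally have fin: "E < \<infinity>" .
  show ?thesis
  proof (cases E)
    case (real s)
    then have "s \<le> B" using b by (simp add: Linf_norm_def E_def)
    then show ?thesis using AE unfolding real by (auto elim!: eventually_mono)
  next
    case PInf then show ?thesis using fin by simp
  next
    case MInf then show ?thesis using AE by (auto elim!: eventually_mono)
  qed
qed

theorem theorem5p13:
  fixes \<Omega> :: "'a::euclidean_space set"
    and \<rho>\<^sub>\<nu> \<rho>\<^sub>\<mu> :: "'a \<Rightarrow> real"
    and m r R M\<^sub>P :: real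
  assumes "open \<Omega>" "connected \<Omega>" "\<Omega> \<noteq> {}"
    and "admissible_weights \<Omega> \<rho>\<^sub>\<nu> \<rho>\<^sub>\<mu>"
    and "emeasure (weighted \<Omega> \<rho>\<^sub>\<nu>) \<Omega> < \<infinity>"
    and "1 < m" "1 < r" "0 < R"
    and "0 < M\<^sub>P" "zero_mean_poincare \<Omega> \<rho>\<^sub>\<nu> \<rho>\<^sub>\<mu> M\<^sub>P"
  shows "\<exists>C>0. \<forall>u\<^sub>0 u. \<forall>ubar.
    in_Linf (restrict_space lborel \<Omega>) u\<^sub>0 \<and>
    ubar = mean_value (weighted \<Omega> \<rho>\<^sub>\<nu>) u\<^sub>0 \<and> ubar \<noteq> 0 \<and>
    Linf_norm (restrict_space lborel \<Omega>) (\<lambda>x. u\<^sub>0 x - ubar) / \<bar>ubar\<bar> \<le> R \<and>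
    energy_solution_N m \<Omega> \<rho>\<^sub>\<nu> \<rho>\<^sub>\<mu> u\<^sub>0 u \<longrightarrow>
    (AE t in lborel. 0 < t \<longrightarrow>
       in_Lp r (weighted \<Omega> \<rho>\<^sub>\<nu>) (\<lambda>x. u t x - ubar) \<and>
       Lp_norm r (weighted \<Omega> \<rho>\<^sub>\<nu>) (\<lambda>x. u t x - ubar)
         \<le> exp (- C * \<bar>ubar\<bar> powr (m - 1) * t) *
            Lp_norm r (weighted \<Omega> \<rho>\<^sub>\<nu>) (\<lambda>x. u\<^sub>0 x - ubar))"
proof (rule exI[of _ "decay_const m r R M\<^sub>P / r"], intro conjI allI impI)
  show "0 < decay_const m r R M\<^sub>P / r"
    using decay_const_pos[of r R M\<^sub>P m] assms by simp
  fix u\<^sub>0 u ubar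
  assume H: "in_Linf (restrict_space lborel \<Omega>) u\<^sub>0 \<and>
    ubar = mean_value (weighted \<Omega> \<rho>\<^sub>\<nu>) u\<^sub>0 \<and> ubar \<noteq> 0 \<and>
    Linf_norm (restrict_space lborel \<Omega>) (\<lambda>x. u\<^sub>0 x - ubar) / \<bar>ubar\<bar> \<le> R \<and>
    energy_solution_N m \<Omega> \<rho>\<^sub>\<nu> \<rho>\<^sub>\<mu> u\<^sub>0 u"
  let ?\<nu> = "weighted \<Omega> \<rho>\<^sub>\<nu>" and ?\<mu> = "weighted \<Omega> \<rho>\<^sub>\<mu>"
  note adm = admissible_weights_continuous[OF assms(4)]
  interpret nu: weighted_domain \<Omega> \<rho>\<^sub>\<nu> by unfold_locales (use assms adm in auto)
  interpret mu: weighted_domain \<Omega> \<rho>\<^sub>\<mu> by unfold_locales (use assms adm in auto)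
  have fin: "finite_measure ?\<nu>" by (rule finite_measureI) (use assms(5) in auto)
  interpret fnu: finite_measure ?\<nu> by (rule fin)
  have WS: "weak_solution_N m \<Omega> \<rho>\<^sub>\<nu> \<rho>\<^sub>\<mu> u\<^sub>0 u" using H by (simp add: energy_solution_N_def)
  then obtain G where G: "AE t in lborel. 0 < t \<longrightarrow> has_weak_gradient \<Omega> (\<lambda>x. spow m (u t x)) (G t)"
    and GT: "\<forall>T>0. in_LpLp 2 T ?\<nu> u \<and> in_LpLp 2 T ?\<mu> G \<and>
         (\<forall>\<eta> \<eta>' \<zeta>.
            in_W12_time T ?\<nu> \<eta> \<eta>' \<and>
            (AE t in lborel. t \<in> {0<..<T} \<longrightarrow> has_weak_gradient \<Omega> (\<eta> t) (\<zeta> t)) \<and>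
            in_LpLp 2 T ?\<mu> \<zeta> \<and>
            (AE x in ?\<nu>. \<eta> T x = 0) \<longrightarrow>
            (LINT t:{0<..<T}|lborel. LINT x|?\<nu>. u t x * \<eta>' t x) =
              - (LINT x|?\<nu>. u\<^sub>0 x * \<eta> 0 x)
              + (LINT t:{0<..<T}|lborel. LINT x|?\<mu>. G t x \<bullet> \<zeta> t x))"
    unfolding weak_solution_N_def by blast
  have sol: "pme_solution \<Omega> \<rho>\<^sub>\<nu> \<rho>\<^sub>\<mu> m u\<^sub>0 u G"
  proof unfold_locales
    show "in_Lp 2 ?\<nu> u\<^sub>0" using WS by (simp add: weak_solution_N_def)
  qed (use fin assms G GT in auto)
  interpret pme_solution \<Omega> \<rho>\<^sub>\<nu> \<rho>\<^sub>\<mu> m u\<^sub>0 u G by (rule sol)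
  define v where "v = \<bar>ubar\<bar>"
  have v: "0 < v" using H by (simp add: v_def)
  define c where "c = decay_const m r R M\<^sub>P * v powr (m - 1)"
  have "Linf_norm (restrict_space lborel \<Omega>) (\<lambda>x. u\<^sub>0 x - ubar) \<le> R * v"
  proof -
    have "Linf_norm (restrict_space lborel \<Omega>) (\<lambda>x. u\<^sub>0 x - ubar) / v \<le> R" unfolding v_def using H by blast
    then show ?thesis using v by (simp only: pos_divide_le_eq)
  qed
  with H have "AE x in restrict_space lborel \<Omega>. \<bar>u\<^sub>0 x - ubar\<bar> \<le> R * v" by (intro Linf_norm_AE) auto
  then have u0b: "AE x in ?\<nu>. \<bar>u\<^sub>0 x - ubar\<bar> \<le> R * v" by (simp add: nu.AE_weighted_iff)
  have mean: "ubar = mean_value ?\<nu> u\<^sub>0" using H by simp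
  \<comment> \<open>For a negative mean, \<open>-u\<close> has the positive mean \<open>v\<close> and the same distance to it.\<close>
  have key: "AE t in lborel. 0 < t \<longrightarrow> (AE x in ?\<nu>. \<bar>u t x - ubar\<bar> \<le> R * v) \<and>
    (LINT x|?\<nu>. \<bar>u t x - ubar\<bar> powr r) \<le> exp (- c * t) * (LINT x|?\<nu>. \<bar>u\<^sub>0 x - ubar\<bar> powr r)"
  proof (cases "0 < ubar")
    case True
    then have "v = ubar" by (simp add: v_def)
    then show ?thesis
      using decay_positive_mean[OF assms(10,9,7,8), of ubar] True u0b mean unfolding c_def by simp
  next
    case False
    then have vu: "v = - ubar" by (simp add: v_def)
    interpret neg: pme_solution \<Omega> \<rho>\<^sub>\<nu> \<rho>\<^sub>\<mu> m "\<lambda>x. - u\<^sub>0 x" "\<lambda>t x. - u t x" "\<lambda>t x. - G t x"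
      by (rule pme_solution_minus[OF sol])
    have mv: "v = mean_value ?\<nu> (\<lambda>x. - u\<^sub>0 x)" using mean vu by (simp add: mean_value_def)
    have fl: "\<bar>- a - v\<bar> = \<bar>a - ubar\<bar>" for a by (simp add: vu abs_minus_commute)
    have "AE x in ?\<nu>. \<bar>- u\<^sub>0 x - v\<bar> \<le> R * v" unfolding fl by (rule u0b)
    from neg.decay_positive_mean[OF assms(10,9,7,8) v mv this]
    show ?thesis unfolding fl c_def .
  qed
  then show "AE t in lborel. 0 < t \<longrightarrow>
       in_Lp r ?\<nu> (\<lambda>x. u t x - ubar) \<and>
       Lp_norm r ?\<nu> (\<lambda>x. u t x - ubar)
         \<le> exp (- (decay_const m r R M\<^sub>P / r) * \<bar>ubar\<bar> powr (m - 1) * t) * Lp_norm r ?\<nu> (\<lambda>x. u\<^sub>0 x - ubar)"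
  proof eventually_elim
    case (elim t)
    show ?case
    proof (intro impI conjI)
      assume t: "0 < t"
      have [measurable]: "u t \<in> borel_measurable ?\<nu>" by (rule slice_measurable[OF t])
      have b: "AE x in ?\<nu>. \<bar>u t x - ubar\<bar> \<le> R * v" using elim t by simp
      have "integrable ?\<nu> (\<lambda>x. \<bar>u t x - ubar\<bar> powr r)"
      proof (rule fnu.integrable_const_bound[of _ "(R * v) powr r"])
        show "AE x in ?\<nu>. norm (\<bar>u t x - ubar\<bar> powr r) \<le> (R * v) powr r"
          using b by eventually_elim (use assms(7) in \<open>auto intro!: powr_mono2\<close>)
      qed measurable
      then show "in_Lp r ?\<nu> (\<lambda>x. u t x - ubar)" by (simp add: in_Lp_def)
      have "0 \<le> (LINT x|?\<nu>. \<bar>u t x - ubar\<bar> powr r)" by (rule integral_nonneg_AE) auto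
      then have "(LINT x|?\<nu>. \<bar>u t x - ubar\<bar> powr r) powr (1 / r)
        \<le> (exp (- c * t) * (LINT x|?\<nu>. \<bar>u\<^sub>0 x - ubar\<bar> powr r)) powr (1 / r)"
        using elim t assms(7) by (intro powr_mono2) auto
      also have "\<dots> = exp (- c * t) powr (1 / r) * (LINT x|?\<nu>. \<bar>u\<^sub>0 x - ubar\<bar> powr r) powr (1 / r)"
        by (rule powr_mult)
      also have "exp (- c * t) powr (1 / r) = exp (- (decay_const m r R M\<^sub>P / r) * \<bar>ubar\<bar> powr (m - 1) * t)"
        by (simp add: exp_powr_real c_def v_def)
      finally show "Lp_norm r ?\<nu> (\<lambda>x. u t x - ubar)
         \<le> exp (- (decay_const m r R M\<^sub>P / r) * \<bar>ubar\<bar> powr (m - 1) * t) * Lp_norm r ?\<nu> (\<lambda>x. u\<^sub>0 x - ubar)"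
        by (simp add: Lp_norm_def)
    qed
  qed
qed

end
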